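(* Let $\varepsilon>0$ be any constant and let $\alpha\in(0,1)$. Assume D.1, D.2, D.3, D.4 hold, and let $\lambda$ satisfy $\lambda\ge\lambda_0:=\frac{c_0+3}{c_0-3}\Lambda(1-\alpha|X)$ and $$K\,W_{\mathcal U}\sqrt{n\log(n\vee p)}\le\lambda\le K'\,W_{\mathcal U}\sqrt{n\log(n\vee p)}$$ for some constants $K'\ge K\ge2K_\varepsilon\bar\phi_\varepsilon^{1/2}$. Then, for any $A>1$, with probability at least $1-\alpha-2\varepsilon-4\gamma-p^{-A^2}$, $$\hat s:=\sup_{u\in\mathcal U}\|\hat\beta(u)\|_0\le s\cdot\left[16\mu W_{\mathcal U}/(\underline f^{1/2}\kappa_0)\right]^2\left[(1+c_0)AK'/K\right]^2,$$ where $\mu:=\mu(n/\log(n\vee p))$, provided that $s$ obeys the growth condition $$2K'(1+c_0)A\,W_{\mathcal U}\sqrt{s\log(n\vee p)}<q\,\underline f^{1/2}\kappa_0\sqrt n.$$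
   Context: Notation: $a\vee b=\max\{a,b\}$, $a\wedge b=\min\{a,b\}$; $\|\cdot\|,\|\cdot\|_1,\|\cdot\|_0$ are the $\ell_2$-norm, $\ell_1$-norm and number of non-zero components; $\mathbb E_n f(Z_i)=\frac1n\sum_{i=1}^n f(Z_i)$. For $T\subset\{1,\dots,p\}$, $\delta_T$ has components $\delta_j$ for $j\in T$ and $0$ otherwise. $\mathcal U\subset(0,1)$ is a compact set of quantile indices; $W_{\mathcal U}=\max_{u\in\mathcal U}1/\sqrt{u(1-u)}$. Model: the $u$-th conditional quantile of $y_i$ given $x_i\in\mathbb R^p$ is $x_i'\beta(u)$ for all $u\in\mathcal U$; $T_u=\mathrm{support}(\beta(u))$, $|T_u|\le s\le n/\log(n\vee p)$. $J_u=\mathrm E[f_{y_i|x_i}(x_i'\beta(u)|x_i)x_ix_i']$. Estimator: for penalty level $\lambda$ (possibly depending on $X=[x_1,\dots,x_n]'$), $\hat\beta(u)$ minimizes over $\beta\in\mathbb R^p$ the function $\mathbb E_n[\rho_u(y_i-x_i'\beta)]+\frac{\lambda\sqrt{u(1-u)}}n\sum_{j=1}^p\hat\sigma_j|\beta_j|$, where $\rho_u(t)=(u-1\{t\le0\})t$ and $\hat\sigma_j^2=\mathbb E_n[x_{ij}^2]$; if the solution is not unique, $\hat\beta(u)$ is any optimal basic feasible solution of the equivalent linear program $\min \mathbb E_n[u\xi_i^++(1-u)\xi_i^-]+\frac{\lambda\sqrt{u(1-u)}}n\sum_j\hat\sigma_j(\beta_j^++\beta_j^-)$ subject to $\xi_i^+-\xi_i^-=y_i-x_i'(\beta^+-\beta^-)$,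 all variables nonnegative, with $\hat\beta=\beta^+-\beta^-$. $\Lambda=n\sup_{u\in\mathcal U}\max_{1\le j\le p}|\mathbb E_n[x_{ij}(u-1\{u_i\le u\})/(\hat\sigma_j\sqrt{u(1-u)})]|$ with $u_1,\dots,u_n$ i.i.d. uniform$(0,1)$ independent of $X$; $\Lambda(1-\alpha|X)$ is its $(1-\alpha)$-quantile conditional on $X$. D.1: $(y_i,x_i')'$, $i=1,\dots,n$, are i.i.d. with the $u$-th conditional quantile of $y_i$ given $x_i$ equal to $x_i'\beta(u)$ for each $u\in\mathcal U$, first component of $x_i$ equal to one, $n\wedge p\ge3$. For each $x$ in the support of $x_i$, $f_{y_i|x_i}(y|x)$ is continuously differentiable in $y$ at each $y\in\mathbb R$; $f_{y_i|x_i}(y|x)$ and $\frac{\partial}{\partial y}f_{y_i|x_i}(y|x)$ are bounded in absolute value by constants $\bar f$ and $\bar f'$ uniformly in $y\in\mathbb R$ and $x$ in the support; and $f_{y_i|x_i}(x'\beta(u)|x)>\underline f>0$ uniformly in $u\in\mathcal U$ and $x$ in the support. D.2: $\sup_{u\in\mathcal U}\|\beta(u)\|_0\le s$, $\|\beta(u)-\beta(u')\|\le L|u-u'|$ for all $u,u'\in\mathcal U$, with $s\ge1$ and $\log L\le C_L\log(p\vee n)$ for some constant $C_L$. D.3: $\mathrm E[x_{ij}^2]=1$ for all $j$, and $P(\max_{1\le j\le p}|\hat\sigma_j-1|\le1/2)\ge1-\gamma\to1$ as $n\to\infty$. D.4: with $A_u=\{\delta\in\mathbb R^p:\|\delta_{T_u^c}\|_1\le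 c_0\|\delta_{T_u}\|_1,\ \|\delta_{T_u^c}\|_0\le n\}$ and $\overline T_u(\delta,m)\subset T_u^c$ the support of the $m$ largest in absolute value components of $\delta$ outside $T_u$ (empty if $m=0$), for some constants $m\ge0$ and $c_0\ge9$, $$\kappa_m^2:=\inf_{u\in\mathcal U}\inf_{\delta\in A_u,\delta\ne0}\frac{\delta'\mathrm E[x_ix_i']\delta}{\|\delta_{T_u\cup\overline T_u(\delta,m)}\|^2}>0,$$ $\log(\underline f\kappa_0^2)\le C_f\log(n\vee p)$ for some constant $C_f$ ($\kappa_0$ is $\kappa_m$ with $m=0$), and $$q:=\frac38\frac{\underline f^{3/2}}{\bar f'}\inf_{u\in\mathcal U}\inf_{\delta\in A_u,\delta\ne0}\frac{\mathrm E[|x_i'\delta|^2]^{3/2}}{\mathrm E[|x_i'\delta|^3]}>0.$$ Sparse eigenvalues: $\varphi_{\max}(k)=\max_{\delta\ne0,\|\delta\|_0\le k}\frac{\mathrm E[(x_i'\delta)^2]}{\delta'\delta}$, $\phi(k)=\sup_{\delta\ne0,\|\delta\|_0\le k}\left\{\frac{\mathbb E_n[(x_i'\delta)^2]}{\delta'\delta}\vee\frac{\mathrm E[(x_i'\delta)^2]}{\delta'\delta}\right\}$, $\mu(k)=2\sqrt{\varphi_{\max}(k)}\,(1\vee2\bar f/\underline f^{1/2})$. Constants: $\bar\phi_\varepsilon$ is a constant such that $\phi(n/\log(n\vee p))\le\bar\phi_\varepsilon$ with probability $1-\varepsilon$. $K_\varepsilon\ge\sqrt2$ is a constant such that under D.1–D.4,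 with $r=\sup_{u\in\mathcal U}\|J_u^{1/2}(\hat\beta(u)-\beta(u))\|$, with probability at least $1-\varepsilon-\gamma$, $$\frac{\sqrt{\hat s}}{W_{\mathcal U}}\le\mu(\hat s)\frac n\lambda(r\wedge1)+\sqrt{\hat s}\,K_\varepsilon\frac{\sqrt{n\log(n\vee p)\phi(\hat s)}}{\lambda}$$ (the existence of such a constant for any $\varepsilon>0$ is a separate lemma). *)

theory Defs
  imports "HOL-Probability.Probability"
begin

text \<open>
  Vectors of dimension \<open>p\<close> are functions \<open>nat \<Rightarrow> real\<close> of which only the
  coordinates \<open>j < p\<close> matter (the first component is number 0), because the dimension varies with
  the sample size.
  Observations are numbered \<open>0, \<dots>, n - 1\<close>.
\<close>

definition dot :: "nat \<Rightarrow> (nat \<Rightarrow> real) \<Rightarrow> (nat \<Rightarrow> real) \<Rightarrow> real" where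
  "dot p a b = (\<Sum>j<p. a j * b j)"

definition supp :: "nat \<Rightarrow> (nat \<Rightarrow> real) \<Rightarrow> nat set" where
  "supp p b = {j. j < p \<and> b j \<noteq> 0}"

definition l0 :: "nat \<Rightarrow> (nat \<Rightarrow> real) \<Rightarrow> nat" where
  "l0 p b = card (supp p b)"

definition quad_form :: "nat \<Rightarrow> (nat \<Rightarrow> nat \<Rightarrow> real) \<Rightarrow> (nat \<Rightarrow> real) \<Rightarrow> real" where
  "quad_form p G d = (\<Sum>j<p. \<Sum>k<p. d j * G j k * d k)"

definition mat_vec :: "nat \<Rightarrow> (nat \<Rightarrow> nat \<Rightarrow> real) \<Rightarrow> (nat \<Rightarrow> real) \<Rightarrow> nat \<Rightarrow> real" where
  "mat_vec p S d j = (\<Sum>k<p. S j k * d k)"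

definition is_psd_sqrt :: "nat \<Rightarrow> (nat \<Rightarrow> nat \<Rightarrow> real) \<Rightarrow> (nat \<Rightarrow> nat \<Rightarrow> real) \<Rightarrow> bool" where
  "is_psd_sqrt p G S \<longleftrightarrow>
     (\<forall>j<p. \<forall>k<p. S j k = S k j) \<and>
     (\<forall>d. 0 \<le> quad_form p S d) \<and>
     (\<forall>j<p. \<forall>k<p. (\<Sum>l<p. S j l * S l k) = G j k)"

definition mat_sqrt :: "nat \<Rightarrow> (nat \<Rightarrow> nat \<Rightarrow> real) \<Rightarrow> nat \<Rightarrow> nat \<Rightarrow> real" where
  "mat_sqrt p G = (SOME S. is_psd_sqrt p G S)"

text \<open>
  ``With probability at least \<open>c\<close>'' in the sense of inner probability: estimators and suprema
  over uncountable sets need not be measurable.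
\<close>

definition with_prob_at_least :: "'w measure \<Rightarrow> real \<Rightarrow> ('w \<Rightarrow> bool) \<Rightarrow> bool" where
  "with_prob_at_least M c P \<longleftrightarrow>
     (\<exists>E\<in>sets M. (\<forall>\<omega>\<in>E. P \<omega>) \<and> c \<le> measure M E)"

definition quantile :: "real measure \<Rightarrow> real \<Rightarrow> real" where
  "quantile N t = Inf {v. t \<le> measure N {..v}}"

abbreviation Rp :: "nat \<Rightarrow> (nat \<Rightarrow> real) measure" where
  "Rp p \<equiv> Pi\<^sub>M {..<p} (\<lambda>_. borel)"

definition law_support :: "'w measure \<Rightarrow> nat \<Rightarrow> ('w \<Rightarrow> nat \<Rightarrow> real) \<Rightarrow> (nat \<Rightarrow> real) set" where
  "law_support M p X =
     {z \<in> space (Rp p). \<forall>e>0.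
        0 < measure M {\<omega> \<in> space M. L2_set (\<lambda>j. X \<omega> j - z j) {..<p} < e}}"

text \<open>\<open>cdens Q z v\<close> is the conditional density of the response at \<open>v\<close> given the covariate vector \<open>z\<close>.\<close>

record 'w qr_model =
  pspace :: "'w measure"
  nobs :: nat
  dim :: nat
  resp :: "nat \<Rightarrow> 'w \<Rightarrow> real"
  covar :: "nat \<Rightarrow> 'w \<Rightarrow> nat \<Rightarrow> real"
  cdens :: "(nat \<Rightarrow> real) \<Rightarrow> real \<Rightarrow> real"
  coef :: "real \<Rightarrow> nat \<Rightarrow> real"

definition is_cond_density ::
  "'w measure \<Rightarrow> nat \<Rightarrow> ('w \<Rightarrow> real) \<Rightarrow> ('w \<Rightarrow> nat \<Rightarrow> real) \<Rightarrow>
   ((nat \<Rightarrow> real) \<Rightarrow> real \<Rightarrow> real) \<Rightarrow> bool" where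
  "is_cond_density M p Y X f \<longleftrightarrow>
     (\<lambda>(z, v). f z v) \<in> borel_measurable (Rp p \<Otimes>\<^sub>M borel) \<and>
     (\<forall>z \<in> law_support M p X. (\<forall>v. 0 \<le> f z v) \<and> (\<integral>\<^sup>+v. ennreal (f z v) \<partial>lborel) = 1) \<and>
     (\<forall>C \<in> sets (Rp p). \<forall>B \<in> sets borel.
        emeasure M {\<omega> \<in> space M. X \<omega> \<in> C \<and> Y \<omega> \<in> B} =
        (\<integral>\<^sup>+\<omega>. indicator C (X \<omega>) * (\<integral>\<^sup>+v. ennreal (f (X \<omega>) v) * indicator B v \<partial>lborel) \<partial>M))"

definition lognp :: "'w qr_model \<Rightarrow> real" where
  "lognp Q = ln (real (max (nobs Q) (dim Q)))"

text \<open>Population moments are computed from observation 0; the observations are identically distributed.\<close>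

definition pop_gram :: "'w qr_model \<Rightarrow> nat \<Rightarrow> nat \<Rightarrow> real" where
  "pop_gram Q j k = (\<integral>\<omega>. covar Q 0 \<omega> j * covar Q 0 \<omega> k \<partial>pspace Q)"

definition pop_abs_moment :: "'w qr_model \<Rightarrow> nat \<Rightarrow> (nat \<Rightarrow> real) \<Rightarrow> real" where
  "pop_abs_moment Q r d = (\<integral>\<omega>. \<bar>dot (dim Q) (covar Q 0 \<omega>) d\<bar> ^ r \<partial>pspace Q)"

definition emp_second_moment :: "'w qr_model \<Rightarrow> 'w \<Rightarrow> (nat \<Rightarrow> real) \<Rightarrow> real" where
  "emp_second_moment Q \<omega> d = (\<Sum>i<nobs Q. (dot (dim Q) (covar Q i \<omega>) d)\<^sup>2) / real (nobs Q)"

definition Jmat :: "'w qr_model \<Rightarrow> real \<Rightarrow> nat \<Rightarrow> nat \<Rightarrow> real" where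
  "Jmat Q u j k =
     (\<integral>\<omega>. cdens Q (covar Q 0 \<omega>) (dot (dim Q) (covar Q 0 \<omega>) (coef Q u))
          * covar Q 0 \<omega> j * covar Q 0 \<omega> k \<partial>pspace Q)"

text \<open>The whole design matrix; it is extensional in both indices, so it carries no other information.\<close>

definition design :: "'w qr_model \<Rightarrow> 'w \<Rightarrow> nat \<Rightarrow> nat \<Rightarrow> real" where
  "design Q \<omega> = (\<lambda>i\<in>{..<nobs Q}. \<lambda>j\<in>{..<dim Q}. covar Q i \<omega> j)"

definition W_U :: "real set \<Rightarrow> real" where
  "W_U U = (SUP u\<in>U. 1 / sqrt (u * (1 - u)))"

definition sigma_hat :: "nat \<Rightarrow> (nat \<Rightarrow> nat \<Rightarrow> real) \<Rightarrow> nat \<Rightarrow> real" where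
  "sigma_hat n X j = sqrt ((\<Sum>i<n. (X i j)\<^sup>2) / real n)"

definition rho :: "real \<Rightarrow> real \<Rightarrow> real" where
  "rho u t = (u - of_bool (t \<le> 0)) * t"

definition penalized_obj ::
  "nat \<Rightarrow> nat \<Rightarrow> (nat \<Rightarrow> nat \<Rightarrow> real) \<Rightarrow> (nat \<Rightarrow> real) \<Rightarrow> real \<Rightarrow> real \<Rightarrow> (nat \<Rightarrow> real) \<Rightarrow> real" where
  "penalized_obj n p X y lam u b =
     (\<Sum>i<n. rho u (y i - dot p (X i) b)) / real n
     + lam * sqrt (u * (1 - u)) / real n * (\<Sum>j<p. sigma_hat n X j * \<bar>b j\<bar>)"

definition is_minimizer ::
  "nat \<Rightarrow> nat \<Rightarrow> (nat \<Rightarrow> nat \<Rightarrow> real) \<Rightarrow> (nat \<Rightarrow> real) \<Rightarrow> real \<Rightarrow> real \<Rightarrow> (nat \<Rightarrow> real) \<Rightarrow> bool" where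
  "is_minimizer n p X y lam u b \<longleftrightarrow>
     (\<forall>b'. penalized_obj n p X y lam u b \<le> penalized_obj n p X y lam u b')"

datatype lp_var = XiPos nat | XiNeg nat | BetaPos nat | BetaNeg nat

definition lp_vars :: "nat \<Rightarrow> nat \<Rightarrow> lp_var set" where
  "lp_vars n p = XiPos ` {..<n} \<union> XiNeg ` {..<n} \<union> BetaPos ` {..<p} \<union> BetaNeg ` {..<p}"

text \<open>Column of the constraint matrix belonging to a variable, for the constraints
  \<open>\<xi>\<^sub>i\<^sup>+ - \<xi>\<^sub>i\<^sup>- + x\<^sub>i' (\<beta>\<^sup>+ - \<beta>\<^sup>-) = y\<^sub>i\<close>.\<close>

fun lp_col :: "(nat \<Rightarrow> nat \<Rightarrow> real) \<Rightarrow> lp_var \<Rightarrow> nat \<Rightarrow> real" where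
  "lp_col X (XiPos k) i = of_bool (i = k)"
| "lp_col X (XiNeg k) i = - of_bool (i = k)"
| "lp_col X (BetaPos j) i = X i j"
| "lp_col X (BetaNeg j) i = - X i j"

definition lp_feasible ::
  "nat \<Rightarrow> nat \<Rightarrow> (nat \<Rightarrow> nat \<Rightarrow> real) \<Rightarrow> (nat \<Rightarrow> real) \<Rightarrow> (lp_var \<Rightarrow> real) \<Rightarrow> bool" where
  "lp_feasible n p X y z \<longleftrightarrow>
     (\<forall>v\<in>lp_vars n p. 0 \<le> z v) \<and>
     (\<forall>i<n. z (XiPos i) - z (XiNeg i) = y i - dot p (X i) (\<lambda>j. z (BetaPos j) - z (BetaNeg j)))"

definition lp_cost ::
  "nat \<Rightarrow> nat \<Rightarrow> (nat \<Rightarrow> nat \<Rightarrow> real) \<Rightarrow> real \<Rightarrow> real \<Rightarrow> (lp_var \<Rightarrow> real) \<Rightarrow> real" where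
  "lp_cost n p X lam u z =
     (\<Sum>i<n. u * z (XiPos i) + (1 - u) * z (XiNeg i)) / real n
     + lam * sqrt (u * (1 - u)) / real n
       * (\<Sum>j<p. sigma_hat n X j * (z (BetaPos j) + z (BetaNeg j)))"

text \<open>The constraint matrix has \<open>n\<close> rows and full row rank, so a basis consists of \<open>n\<close> linearly
  independent columns; the nonbasic variables vanish.\<close>

definition lp_basic :: "nat \<Rightarrow> nat \<Rightarrow> (nat \<Rightarrow> nat \<Rightarrow> real) \<Rightarrow> (lp_var \<Rightarrow> real) \<Rightarrow> bool" where
  "lp_basic n p X z \<longleftrightarrow>
     (\<exists>B \<subseteq> lp_vars n p. card B = n \<and>
        (\<forall>c. (\<forall>i<n. (\<Sum>v\<in>B. c v * lp_col X v i) = 0) \<longrightarrow> (\<forall>v\<in>B. c v = 0)) \<and>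
        (\<forall>v \<in> lp_vars n p - B. z v = 0))"

definition is_optimal_bfs ::
  "nat \<Rightarrow> nat \<Rightarrow> (nat \<Rightarrow> nat \<Rightarrow> real) \<Rightarrow> (nat \<Rightarrow> real) \<Rightarrow> real \<Rightarrow> real \<Rightarrow> (lp_var \<Rightarrow> real) \<Rightarrow> bool" where
  "is_optimal_bfs n p X y lam u z \<longleftrightarrow>
     lp_feasible n p X y z \<and> lp_basic n p X z \<and>
     (\<forall>z'. lp_feasible n p X y z' \<longrightarrow> lp_cost n p X lam u z \<le> lp_cost n p X lam u z')"

definition is_l1_qr ::
  "nat \<Rightarrow> nat \<Rightarrow> (nat \<Rightarrow> nat \<Rightarrow> real) \<Rightarrow> (nat \<Rightarrow> real) \<Rightarrow> real \<Rightarrow> real \<Rightarrow> (nat \<Rightarrow> real) \<Rightarrow> bool" where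
  "is_l1_qr n p X y lam u b \<longleftrightarrow>
     is_minimizer n p X y lam u b \<and>
     ((\<forall>b'. is_minimizer n p X y lam u b' \<longrightarrow> (\<forall>j<p. b' j = b j)) \<or>
      (\<exists>z. is_optimal_bfs n p X y lam u z \<and> (\<forall>j<p. b j = z (BetaPos j) - z (BetaNeg j))))"

definition Lam :: "real set \<Rightarrow> nat \<Rightarrow> nat \<Rightarrow> (nat \<Rightarrow> nat \<Rightarrow> real) \<Rightarrow> (nat \<Rightarrow> real) \<Rightarrow> real" where
  "Lam U n p X v =
     real n * (SUP u\<in>U. MAX j\<in>{..<p}.
       \<bar>(\<Sum>i<n. X i j * (u - of_bool (v i \<le> u)) / (sigma_hat n X j * sqrt (u * (1 - u)))) / real n\<bar>)"

text \<open>Since the uniform variables are independent of the design, their conditional law given the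
  design is the product of uniform laws.\<close>

definition Lam_quantile :: "real set \<Rightarrow> nat \<Rightarrow> nat \<Rightarrow> (nat \<Rightarrow> nat \<Rightarrow> real) \<Rightarrow> real \<Rightarrow> real" where
  "Lam_quantile U n p X t =
     quantile (distr (Pi\<^sub>M {..<n} (\<lambda>_. uniform_measure lborel {0<..<1})) borel (Lam U n p X)) t"

text \<open>\<open>flow\<close>, \<open>fbar\<close> and \<open>fbar'\<close> are the lower bound on the conditional density at the quantiles,
  the upper bound on the density and the upper bound on its derivative.  The conditional density is
  stated for observation 0 only, since the pairs are identically distributed.\<close>

definition cond_D1 :: "'w qr_model \<Rightarrow> real set \<Rightarrow> real \<Rightarrow> real \<Rightarrow> real \<Rightarrow> bool" where
  "cond_D1 Q U flow fbar fbar' \<longleftrightarrow>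
     (let M = pspace Q; n = nobs Q; p = dim Q; f = cdens Q; S = law_support M p (covar Q 0) in
      prob_space M \<and> 3 \<le> min n p \<and>
      (\<forall>i<n. resp Q i \<in> borel_measurable M \<and> covar Q i \<in> M \<rightarrow>\<^sub>M Rp p) \<and>
      prob_space.indep_vars M (\<lambda>_. borel \<Otimes>\<^sub>M Rp p) (\<lambda>i \<omega>. (resp Q i \<omega>, covar Q i \<omega>)) {..<n} \<and>
      (\<forall>i<n. distr M (borel \<Otimes>\<^sub>M Rp p) (\<lambda>\<omega>. (resp Q i \<omega>, covar Q i \<omega>))
           = distr M (borel \<Otimes>\<^sub>M Rp p) (\<lambda>\<omega>. (resp Q 0 \<omega>, covar Q 0 \<omega>))) \<and>
      (\<forall>i<n. \<forall>\<omega>\<in>space M. covar Q i \<omega> 0 = 1) \<and>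
      is_cond_density M p (resp Q 0) (covar Q 0) f \<and>
      (\<forall>u\<in>U. AE \<omega> in M. quantile (density lborel (\<lambda>v. ennreal (f (covar Q 0 \<omega>) v))) u
                          = dot p (covar Q 0 \<omega>) (coef Q u)) \<and>
      (\<forall>z\<in>S. (\<forall>v. f z differentiable at v) \<and> continuous_on UNIV (deriv (f z)) \<and>
              (\<forall>v. \<bar>f z v\<bar> \<le> fbar \<and> \<bar>deriv (f z) v\<bar> \<le> fbar')) \<and>
      0 < flow \<and> (\<forall>u\<in>U. \<forall>z\<in>S. flow < f z (dot p z (coef Q u))))"

definition cond_D2 :: "'w qr_model \<Rightarrow> real set \<Rightarrow> nat \<Rightarrow> real \<Rightarrow> real \<Rightarrow> bool" where
  "cond_D2 Q U s L C_L \<longleftrightarrow>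
     1 \<le> s \<and> (\<forall>u\<in>U. l0 (dim Q) (coef Q u) \<le> s) \<and>
     (\<forall>u\<in>U. \<forall>u'\<in>U. L2_set (\<lambda>j. coef Q u j - coef Q u' j) {..<dim Q} \<le> L * \<bar>u - u'\<bar>) \<and>
     0 < L \<and> ln L \<le> C_L * lognp Q"

definition cond_D3 :: "'w qr_model \<Rightarrow> real \<Rightarrow> bool" where
  "cond_D3 Q \<gamma> \<longleftrightarrow>
     (\<forall>j<dim Q. (\<integral>\<omega>. (covar Q 0 \<omega> j)\<^sup>2 \<partial>pspace Q) = 1) \<and>
     1 - \<gamma> \<le> measure (pspace Q) {\<omega> \<in> space (pspace Q).
        (MAX j\<in>{..<dim Q}. \<bar>sigma_hat (nobs Q) (design Q \<omega>) j - 1\<bar>) \<le> 1 / 2}"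

definition restricted_set :: "'w qr_model \<Rightarrow> real \<Rightarrow> real \<Rightarrow> (nat \<Rightarrow> real) set" where
  "restricted_set Q c0 u =
     (let T = supp (dim Q) (coef Q u) in
      {d. (\<Sum>j\<in>{..<dim Q} - T. \<bar>d j\<bar>) \<le> c0 * (\<Sum>j\<in>T. \<bar>d j\<bar>) \<and>
          card {j \<in> {..<dim Q} - T. d j \<noteq> 0} \<le> nobs Q})"

definition restricted_pairs :: "'w qr_model \<Rightarrow> real set \<Rightarrow> real \<Rightarrow> (real \<times> (nat \<Rightarrow> real)) set" where
  "restricted_pairs Q U c0 =
     {(u, d). u \<in> U \<and> d \<in> restricted_set Q c0 u \<and> supp (dim Q) d \<noteq> {}}"

text \<open>Positions of the \<open>m\<close> components of \<open>d\<close> outside \<open>T\<close> that are largest in absolute value,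
  ties being broken in favour of the smaller index.\<close>

definition largest_outside :: "nat \<Rightarrow> nat set \<Rightarrow> (nat \<Rightarrow> real) \<Rightarrow> nat \<Rightarrow> nat set" where
  "largest_outside p T d m =
     {j \<in> {..<p} - T.
        card {i \<in> {..<p} - T. \<bar>d j\<bar> < \<bar>d i\<bar> \<or> (\<bar>d i\<bar> = \<bar>d j\<bar> \<and> i < j)} < m}"

text \<open>The iterated infimum over \<open>u\<close> and then over the vectors is taken over pairs: for some \<open>u\<close>
  the set of nonzero restricted vectors may be empty.\<close>

definition kappa_sq :: "'w qr_model \<Rightarrow> real set \<Rightarrow> real \<Rightarrow> nat \<Rightarrow> real" where
  "kappa_sq Q U c0 m =
     (INF (u, d)\<in>restricted_pairs Q U c0.
        quad_form (dim Q) (pop_gram Q) d /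
        (L2_set d (supp (dim Q) (coef Q u)
                   \<union> largest_outside (dim Q) (supp (dim Q) (coef Q u)) d m))\<^sup>2)"

definition kappa :: "'w qr_model \<Rightarrow> real set \<Rightarrow> real \<Rightarrow> nat \<Rightarrow> real" where
  "kappa Q U c0 m = sqrt (kappa_sq Q U c0 m)"

definition nonlin_q :: "'w qr_model \<Rightarrow> real set \<Rightarrow> real \<Rightarrow> real \<Rightarrow> real \<Rightarrow> real" where
  "nonlin_q Q U c0 flow fbar' =
     3 / 8 * (flow powr (3 / 2) / fbar') *
     (INF (u, d)\<in>restricted_pairs Q U c0.
        pop_abs_moment Q 2 d powr (3 / 2) / pop_abs_moment Q 3 d)"

text \<open>The first conjunct is implicit in the bound on the logarithm: an infimum over the empty set
  would be \<open>\<infinity>\<close>.\<close>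

definition cond_D4 ::
  "'w qr_model \<Rightarrow> real set \<Rightarrow> real \<Rightarrow> real \<Rightarrow> nat \<Rightarrow> real \<Rightarrow> real \<Rightarrow> bool" where
  "cond_D4 Q U flow fbar' m c0 C_f \<longleftrightarrow>
     restricted_pairs Q U c0 \<noteq> {} \<and> 9 \<le> c0 \<and> 0 < kappa_sq Q U c0 m \<and>
     ln (flow * (kappa Q U c0 0)\<^sup>2) \<le> C_f * lognp Q \<and>
     0 < nonlin_q Q U c0 flow fbar'"

text \<open>The argument is real because it is instantiated with \<open>n / log (max n p)\<close>.
  All ratios are nonnegative; inserting 0 makes the supremum 0 when no nonzero vector is
  admissible, i.e. for \<open>k < 1\<close>.\<close>

definition varphi_max :: "'w qr_model \<Rightarrow> real \<Rightarrow> real" where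
  "varphi_max Q k =
     Sup (insert 0 ((\<lambda>d. pop_abs_moment Q 2 d / dot (dim Q) d d)
            ` {d. supp (dim Q) d \<noteq> {} \<and> real (l0 (dim Q) d) \<le> k}))"

definition phi :: "'w qr_model \<Rightarrow> 'w \<Rightarrow> real \<Rightarrow> real" where
  "phi Q \<omega> k =
     Sup (insert 0 ((\<lambda>d. max (emp_second_moment Q \<omega> d / dot (dim Q) d d)
                              (pop_abs_moment Q 2 d / dot (dim Q) d d))
            ` {d. supp (dim Q) d \<noteq> {} \<and> real (l0 (dim Q) d) \<le> k}))"

definition mu :: "'w qr_model \<Rightarrow> real \<Rightarrow> real \<Rightarrow> real \<Rightarrow> real" where
  "mu Q flow fbar k = 2 * sqrt (varphi_max Q k) * max 1 (2 * fbar / sqrt flow)"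

definition est_error :: "'w qr_model \<Rightarrow> real set \<Rightarrow> (real \<Rightarrow> nat \<Rightarrow> real) \<Rightarrow> real" where
  "est_error Q U b =
     (SUP u\<in>U. L2_set (mat_vec (dim Q) (mat_sqrt (dim Q) (Jmat Q u)) (\<lambda>j. b u j - coef Q u j)) {..<dim Q})"

definition s_hat :: "'w qr_model \<Rightarrow> real set \<Rightarrow> (real \<Rightarrow> nat \<Rightarrow> real) \<Rightarrow> nat" where
  "s_hat Q U b = (SUP u\<in>U. l0 (dim Q) (b u))"

definition sparsity_ineq ::
  "'w qr_model \<Rightarrow> real set \<Rightarrow> real \<Rightarrow> real \<Rightarrow> real \<Rightarrow> real \<Rightarrow> (real \<Rightarrow> nat \<Rightarrow> real) \<Rightarrow> 'w \<Rightarrow> bool" where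
  "sparsity_ineq Q U flow fbar K_eps lam b \<omega> \<longleftrightarrow>
     (let sh = real (s_hat Q U b); n = real (nobs Q) in
      sqrt sh / W_U U
        \<le> mu Q flow fbar sh * (n / lam) * min (est_error Q U b) 1
          + sqrt sh * K_eps * (sqrt (n * lognp Q * phi Q \<omega> sh) / lam))"

end

theory Submission
  imports Defs
begin

text \<open>
  On an event of the required probability the sparsity inequality turns a rate for
  \<open>r = sup u. norm (sqrt (J u) (bhat u - \<beta> u))\<close> into the claim, because its last term is at most half of its left
  side.  For the rate one needs no constant from empirical process theory: with
  \<open>t = 8 (1 + c0) A K' W sqrt (s log(n \<or> p) / n) / (sqrt flow \<kappa>)\<close>, an error of norm larger than \<open>t\<close> can be
  scaled down, by convexity, to an element of the restricted set of norm exactly \<open>t\<close>, where the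
  expected loss has grown by \<open>t\<^sup>2 / 4\<close>.  Penalty and empirical process cannot compensate this growth.

  The deviation of the empirical process over the \<open>\<ell>\<^sub>1\<close>-ball of radius
  \<open>R = (1 + c0) sqrt s t / (sqrt flow \<kappa>)\<close> is bounded for one \<open>u\<close> by symmetrization with a ghost sample, the
  contraction principle and Chernoff's bound.  The check function has Lipschitz constant
  \<open>c = max u (1 - u)\<close>, and \<open>c\<^sup>2 \<le> (27/256) W\<^sup>2\<close> together with \<open>K \<ge> 2 K_eps sqrt phibar \<ge> 2 sqrt 2\<close> makes the exponent
  large enough for a union bound over a grid of mesh \<open>1/n\<close> in \<open>u\<close>.  The grid suffices because the
  conditional quantile functions \<open>u \<mapsto> x'\<beta>(u)\<close> are Lipschitz with constant \<open>2 / flow\<close> at this scale.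
\<close>

section \<open>Rademacher sums\<close>

text \<open>A bound on \<open>s_hat\<close> is needed before the sparsity inequality can be
  exploited: \<open>mu\<close> and \<open>phi\<close> are evaluated at \<open>s_hat\<close>, and
  restricted vectors have at most n components off the support. It is drawn from optimality alone,
  by moving along a sign direction.

  Two constants are dictated by the claim. The 8 in t is half of the 16 there, because solving the
  sparsity inequality for sqrt \<open>s_hat\<close> costs a factor 2. The same 8 is four times the 2
  of the growth condition, which yields t \<le> 4 q, and this keeps the cubic error of the expected
  loss below half of its quadratic term. Penalty and deviation must then fit into n t^2 / 4 with
  explicit numbers; hence the care about constants.

  A second obstacle is measurability: U, the l1-balls and the support of the covariates enter
  through uncountable or not evidently measurable conditions, so countable dense families and
  measurable sets of full measure stand in for them.

  Finally, the claim is trivial unless its probability is positive, so \<gamma> \<le> 1/4 may be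
  assumed; this supplies well-behaved ghost samples.\<close>

definition rsign :: "nat set \<Rightarrow> nat \<Rightarrow> real" where
  "rsign S i = (if i \<in> S then 1 else -1)"

lemma sum_Pow_lessThan_Suc:
  fixes f :: "nat set \<Rightarrow> real"
  shows "(\<Sum>S\<in>Pow {..<Suc n}. f S) = (\<Sum>S\<in>Pow {..<n}. f S + f (insert n S))"
proof -
  have "Pow {..<Suc n} = Pow {..<n} \<union> insert n ` Pow {..<n}"
    by (simp add: lessThan_Suc Pow_insert)
  moreover have "Pow {..<n} \<inter> insert n ` Pow {..<n} = {}" by auto
  moreover have "inj_on (insert n) (Pow {..<n})"
  proof (rule inj_onI)
    fix A B assume "A \<in> Pow {..<n}" "B \<in> Pow {..<n}" "insert n A = insert n B"
    moreover from this have "n \<notin> A" "n \<notin> B" by auto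
    ultimately show "A = B" by (metis Diff_insert_absorb)
  qed
  ultimately show ?thesis
    by (simp add: sum.union_disjoint sum.reindex sum.distrib)
qed

lemma rsign_insert_sum:
  assumes "S \<subseteq> {..<n}"
  shows "(\<Sum>i<n. rsign (insert n S) i * a i) = (\<Sum>i<n. rsign S i * a i)"
  by (intro sum.cong) (auto simp: rsign_def)

lemma sum_rsign_Suc:
  assumes "S \<subseteq> {..<n}"
  shows "(\<Sum>i<Suc n. rsign S i * a i) = (\<Sum>i<n. rsign S i * a i) - a n"
    and "(\<Sum>i<Suc n. rsign (insert n S) i * a i) = (\<Sum>i<n. rsign S i * a i) + a n"
proof -
  have "n \<notin> S" using assms by auto
  then show "(\<Sum>i<Suc n. rsign S i * a i) = (\<Sum>i<n. rsign S i * a i) - a n"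
    by (simp add: rsign_def)
  show "(\<Sum>i<Suc n. rsign (insert n S) i * a i) = (\<Sum>i<n. rsign S i * a i) + a n"
    using rsign_insert_sum[OF assms] by (simp add: rsign_def)
qed

section \<open>Contraction of Rademacher maxima under the exponential\<close>

lemma exp_add_le_of_majorized:
  fixes a b c d :: real
  assumes "a \<le> max c d" "b \<le> max c d" "a + b \<le> c + d"
  shows "exp a + exp b \<le> exp c + exp d"
proof -
  have *: "exp a + exp b \<le> exp c + exp d"
    if "a \<le> c" "b \<le> c" "a + b \<le> c + d" for a b c d :: real
  proof -
    \<comment> \<open>Weak majorization of two points. For \<open>exp\<close> it is this product of
      nonnegative factors, which expands to exp a + exp b \<le> exp c + exp (a + b - c).\<close>
    have "0 \<le> (exp c - exp a) * (1 - exp (b - c))" using that by simp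
    also have "\<dots> = exp c - exp a - exp b + exp (a + b - c)"
      by (simp add: exp_diff exp_add right_diff_distrib left_diff_distrib diff_divide_distrib)
    also have "exp (a + b - c) \<le> exp d" using that by simp
    finally show ?thesis by simp
  qed
  show ?thesis
  proof (cases "d \<le> c")
    case True then show ?thesis using assms *[of a c b d] by simp
  next
    case False then show ?thesis using assms *[of a d b c] by simp
  qed
qed

text \<open>The maxima on the left are attained at some \<open>d\<close> and \<open>e\<close>. Their
  values are weakly majorized by the maxima on the right: each one because |a| \<le> |t|, and their
  sum because \<open>a e - a d\<close> is at most \<open>t e - t d\<close> or
  \<open>t d - t e\<close>, whichever is nonnegative.\<close>

lemma contraction_step:
  fixes A a t :: "'d \<Rightarrow> real"
  assumes F: "finite F" "F \<noteq> {}"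
    and lip: "\<And>d e. d \<in> F \<Longrightarrow> e \<in> F \<Longrightarrow> \<bar>a d - a e\<bar> \<le> \<bar>t d - t e\<bar>"
    and le: "\<And>d. d \<in> F \<Longrightarrow> \<bar>a d\<bar> \<le> \<bar>t d\<bar>"
  shows "exp (MAX d\<in>F. A d - a d) + exp (MAX d\<in>F. A d + a d)
    \<le> exp (MAX d\<in>F. A d - t d) + exp (MAX d\<in>F. A d + t d)"
proof -
  have "(MAX d\<in>F. A d - a d) \<in> (\<lambda>d. A d - a d) ` F" using F by (intro Max_in) auto
  then obtain d where d: "d \<in> F" "(MAX d\<in>F. A d - a d) = A d - a d" by auto
  have "(MAX d\<in>F. A d + a d) \<in> (\<lambda>d. A d + a d) ` F" using F by (intro Max_in) auto
  then obtain e where e: "e \<in> F" "(MAX d\<in>F. A d + a d) = A e + a e" by auto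
  have m: "A x - t x \<le> (MAX d\<in>F. A d - t d)" "A x + t x \<le> (MAX d\<in>F. A d + t d)" if "x \<in> F" for x
    using F that by (auto intro!: Max_ge)
  let ?C = "MAX d\<in>F. A d - t d" and ?D = "MAX d\<in>F. A d + t d"
  note facts = lip[OF d(1) e(1)] le[OF d(1)] le[OF e(1)] m[OF d(1)] m[OF e(1)]
  have "A d - a d \<le> max ?C ?D" "A e + a e \<le> max ?C ?D"
    unfolding le_max_iff_disj using facts by linarith+
  moreover have "(A d - a d) + (A e + a e) \<le> ?C + ?D" using facts by linarith
  ultimately show ?thesis unfolding d(2) e(2) by (rule exp_add_le_of_majorized)
qed

text \<open>The additive offset \<open>A\<close> lets the coordinates be contracted one at a time.\<close>

lemma sum_rsign_Suc_offset:
  assumes "S \<subseteq> {..<n}"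
  shows "exp (MAX d\<in>F. A d + (\<Sum>i<Suc n. rsign S i * a i d)) + exp (MAX d\<in>F. A d + (\<Sum>i<Suc n. rsign (insert n S) i * a i d))
    = exp (MAX d\<in>F. (A d - a n d) + (\<Sum>i<n. rsign S i * a i d)) + exp (MAX d\<in>F. (A d + a n d) + (\<Sum>i<n. rsign S i * a i d))"
proof -
  have "A d + (\<Sum>i<Suc n. rsign S i * a i d) = (A d - a n d) + (\<Sum>i<n. rsign S i * a i d)"
    "A d + (\<Sum>i<Suc n. rsign (insert n S) i * a i d) = (A d + a n d) + (\<Sum>i<n. rsign S i * a i d)" for d
    unfolding sum_rsign_Suc[OF assms] by simp_all
  then show ?thesis by presburger
qed

text \<open>The Ledoux-Talagrand comparison for \<open>exp\<close> of a signed maximum. The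
  induction hypothesis is used with the offsets \<open>A d - a n d\<close> and
  \<open>A d + a n d\<close>, so \<open>A\<close> has to be arbitrary; the last coordinate is
  contracted afterwards, the already contracted sum being part of the offset.\<close>

lemma contraction_principle:
  fixes A :: "'d \<Rightarrow> real" and a t :: "nat \<Rightarrow> 'd \<Rightarrow> real"
  assumes F: "finite F" "F \<noteq> {}"
    and lip: "\<And>i d e. i < n \<Longrightarrow> d \<in> F \<Longrightarrow> e \<in> F \<Longrightarrow> \<bar>a i d - a i e\<bar> \<le> \<bar>t i d - t i e\<bar>"
    and le: "\<And>i d. i < n \<Longrightarrow> d \<in> F \<Longrightarrow> \<bar>a i d\<bar> \<le> \<bar>t i d\<bar>"
  shows "(\<Sum>S\<in>Pow {..<n}. exp (MAX d\<in>F. A d + (\<Sum>i<n. rsign S i * a i d)))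
    \<le> (\<Sum>S\<in>Pow {..<n}. exp (MAX d\<in>F. A d + (\<Sum>i<n. rsign S i * t i d)))"
  using lip le
proof (induction n arbitrary: A)
  case 0 then show ?case by simp
next
  case (Suc n)
  let ?a = "\<lambda>S d. \<Sum>i<n. rsign S i * a i d" and ?t = "\<lambda>S d. \<Sum>i<n. rsign S i * t i d"
  have IH: "(\<Sum>S\<in>Pow {..<n}. exp (MAX d\<in>F. A d + ?a S d)) \<le> (\<Sum>S\<in>Pow {..<n}. exp (MAX d\<in>F. A d + ?t S d))"
    for A using Suc.prems by (intro Suc.IH) auto
  have "(\<Sum>S\<in>Pow {..<Suc n}. exp (MAX d\<in>F. A d + (\<Sum>i<Suc n. rsign S i * a i d)))
    = (\<Sum>S\<in>Pow {..<n}. exp (MAX d\<in>F. (A d - a n d) + ?a S d) + exp (MAX d\<in>F. (A d + a n d) + ?a S d))"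
    unfolding sum_Pow_lessThan_Suc
    by (intro sum.cong refl sum_rsign_Suc_offset) simp
  also have "\<dots> \<le> (\<Sum>S\<in>Pow {..<n}. exp (MAX d\<in>F. (A d - a n d) + ?t S d) + exp (MAX d\<in>F. (A d + a n d) + ?t S d))"
    unfolding sum.distrib by (intro add_mono IH)
  also have "\<dots> = (\<Sum>S\<in>Pow {..<n}. exp (MAX d\<in>F. (A d + ?t S d) - a n d) + exp (MAX d\<in>F. (A d + ?t S d) + a n d))"
    by (simp add: algebra_simps)
  also have "\<dots> \<le> (\<Sum>S\<in>Pow {..<n}. exp (MAX d\<in>F. (A d + ?t S d) - t n d) + exp (MAX d\<in>F. (A d + ?t S d) + t n d))"
    using Suc.prems by (intro sum_mono contraction_step F) auto
  also have "\<dots> = (\<Sum>S\<in>Pow {..<Suc n}. exp (MAX d\<in>F. A d + (\<Sum>i<Suc n. rsign S i * t i d)))"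
    unfolding sum_Pow_lessThan_Suc
  proof (intro sum.cong refl)
    fix S assume "S \<in> Pow {..<n}"
    then have S: "S \<subseteq> {..<n}" by simp
    have "A d + ?t S d - t n d = (A d - t n d) + ?t S d" "A d + ?t S d + t n d = (A d + t n d) + ?t S d" for d
      by simp_all
    then show "exp (MAX d\<in>F. A d + ?t S d - t n d) + exp (MAX d\<in>F. A d + ?t S d + t n d)
      = exp (MAX d\<in>F. A d + (\<Sum>i<Suc n. rsign S i * t i d)) + exp (MAX d\<in>F. A d + (\<Sum>i<Suc n. rsign (insert n S) i * t i d))"
      unfolding sum_rsign_Suc_offset[OF S] by presburger
  qed
  finally show ?case .
qed

section \<open>Sub-Gaussian bounds for Rademacher sums\<close>

lemma cosh_le_exp_half_square:
  fixes x :: real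
  shows "(exp x + exp (- x)) / 2 \<le> exp (x\<^sup>2 / 2)"
proof -
  have "(\<lambda>n. (x\<^sup>2 / 2) ^ n /\<^sub>R fact n) sums exp (x\<^sup>2 / 2)" by (rule exp_converges)
  moreover have "(x\<^sup>2 / 2) ^ n /\<^sub>R fact n = (x\<^sup>2 / 2) ^ n / fact n" for n
    by (simp only: real_scaleR_def divide_inverse mult.commute)
  ultimately have s1: "(\<lambda>n. (x\<^sup>2 / 2) ^ n / fact n) sums exp (x\<^sup>2 / 2)" by (simp only:)
  \<comment> \<open>The odd terms of the cosh series vanish; reindexing along 2n lets both series
    run over the same index.\<close>
  have "(\<lambda>n. (if even (2*n) then x ^ (2*n) /\<^sub>R fact (2*n) else 0)) sums cosh x \<longleftrightarrow>
       (\<lambda>n. if even n then x ^ n /\<^sub>R fact n else 0) sums cosh x"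
    by (rule sums_mono_reindex) (auto simp: strict_mono_def elim!: evenE)
  with cosh_converges[of x] have "(\<lambda>n. (if even (2*n) then x ^ (2*n) /\<^sub>R fact (2*n) else 0)) sums cosh x"
    by blast
  moreover have "(if even (2*n) then x ^ (2*n) /\<^sub>R fact (2*n) else 0) = x ^ (2*n) / fact (2*n)" for n
    by (simp only: real_scaleR_def divide_inverse mult.commute[of "x ^ (2*n)"]) simp
  ultimately have s2: "(\<lambda>n. x ^ (2*n) / fact (2*n)) sums cosh x" by (simp only:)
  \<comment> \<open>Termwise comparison, which rests on 2^n n! \<le> (2n)!.\<close>
  have le: "x ^ (2*n) / fact (2*n) \<le> (x\<^sup>2 / 2) ^ n / fact n" for n
  proof -
    have "2 ^ n * fact n \<le> (fact (2*n) :: real)"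
    proof (induction n)
      case (Suc n)
      have "2 ^ Suc n * fact (Suc n) = (2 * (real n + 1)) * (2 ^ n * fact n)" by simp
      also have "\<dots> \<le> ((2 * real n + 2) * (2 * real n + 1)) * fact (2*n)"
        using Suc by (intro mult_mono) auto
      also have "\<dots> = fact (2 * Suc n)" by (simp add: algebra_simps)
      finally show ?case .
    qed simp
    then have "(x\<^sup>2) ^ n / fact (2*n) \<le> (x\<^sup>2) ^ n / (2 ^ n * fact n)"
      by (intro divide_left_mono) auto
    then show ?thesis by (simp add: power_mult power_divide)
  qed
  have "cosh x \<le> exp (x\<^sup>2 / 2)" by (rule sums_le[OF le s2 s1])
  then show ?thesis by (simp add: cosh_field_def)
qed

text \<open>The sum over sign patterns is 2^n times an expectation over independent signs, hence it
  factors.\<close>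

lemma sum_exp_rsign:
  "(\<Sum>S\<in>Pow {..<n}. exp (c * (\<Sum>i<n. rsign S i * x i))) = (\<Prod>i<n. exp (c * x i) + exp (- (c * x i)))"
proof (induction n)
  case (Suc n)
  have "(\<Sum>S\<in>Pow {..<Suc n}. exp (c * (\<Sum>i<Suc n. rsign S i * x i)))
    = (\<Sum>S\<in>Pow {..<n}. exp (c * (\<Sum>i<n. rsign S i * x i)) * (exp (c * x n) + exp (- (c * x n))))"
    unfolding sum_Pow_lessThan_Suc
  proof (intro sum.cong refl)
    fix S assume "S \<in> Pow {..<n}"
    then have S: "S \<subseteq> {..<n}" by simp
    show "exp (c * (\<Sum>i<Suc n. rsign S i * x i)) + exp (c * (\<Sum>i<Suc n. rsign (insert n S) i * x i))
      = exp (c * (\<Sum>i<n. rsign S i * x i)) * (exp (c * x n) + exp (- (c * x n)))"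
      unfolding sum_rsign_Suc[OF S]
      by (simp add: right_diff_distrib distrib_left exp_add exp_diff exp_minus divide_inverse)
  qed
  then show ?case using Suc by (simp add: sum_distrib_right[symmetric])
qed simp

lemma rademacher_exp_bound:
  "(\<Sum>S\<in>Pow {..<n}. exp (c * (\<Sum>i<n. rsign S i * x i))) \<le> 2 ^ n * exp (c\<^sup>2 * (\<Sum>i<n. (x i)\<^sup>2) / 2)"
proof -
  have "(\<Prod>i<n. exp (c * x i) + exp (- (c * x i))) \<le> (\<Prod>i<n. 2 * exp ((c * x i)\<^sup>2 / 2))"
  proof (intro prod_mono conjI)
    fix i show "exp (c * x i) + exp (- (c * x i)) \<le> 2 * exp ((c * x i)\<^sup>2 / 2)"
      using cosh_le_exp_half_square[of "c * x i"] by simp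
  qed (simp add: add_nonneg_nonneg)
  also have "\<dots> = 2 ^ n * exp (\<Sum>i<n. (c * x i)\<^sup>2 / 2)" by (simp add: prod.distrib exp_sum)
  also have "(\<Sum>i<n. (c * x i)\<^sup>2 / 2) = c\<^sup>2 * (\<Sum>i<n. (x i)\<^sup>2) / 2"
    by (simp add: power_mult_distrib sum_distrib_left sum_divide_distrib)
  finally show ?thesis by (simp add: sum_exp_rsign)
qed

lemma abs_dot_le:
  assumes "\<And>j. j < p \<Longrightarrow> \<bar>a j\<bar> \<le> B"
  shows "\<bar>dot p a d\<bar> \<le> B * (\<Sum>j<p. \<bar>d j\<bar>)"
proof -
  have "\<bar>dot p a d\<bar> \<le> (\<Sum>j<p. \<bar>a j * d j\<bar>)" unfolding dot_def by (rule sum_abs)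
  also have "\<dots> \<le> (\<Sum>j<p. B * \<bar>d j\<bar>)"
    using assms by (intro sum_mono) (simp add: abs_mult mult_right_mono)
  finally show ?thesis by (simp add: sum_distrib_left)
qed

text \<open>By duality of the l1-norm and the maximum norm, a linear form on the ball is at most R
  times its largest coefficient in absolute value. The maximum over \<open>F\<close> therefore costs
  only 2p exponentials of signed coefficients, however many elements \<open>F\<close> has.\<close>

lemma rademacher_l1_ball_bound:
  fixes x :: "nat \<Rightarrow> nat \<Rightarrow> real"
  assumes F: "finite F" "F \<noteq> {}" and c: "0 \<le> c" and R: "0 \<le> R"
    and l1: "\<And>d. d \<in> F \<Longrightarrow> (\<Sum>j<p. \<bar>d j\<bar>) \<le> R" and p: "0 < p"
    and V: "\<And>j. j < p \<Longrightarrow> (\<Sum>i<n. (x i j)\<^sup>2) \<le> V"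
  shows "(\<Sum>S\<in>Pow {..<n}. exp (MAX d\<in>F. \<Sum>i<n. rsign S i * (c * dot p (x i) d)))
    \<le> 2 ^ n * (2 * real p * exp ((c * R)\<^sup>2 * V / 2))"
proof -
  let ?r = "\<lambda>S j. \<Sum>i<n. rsign S i * x i j"
  have 1: "exp (MAX d\<in>F. \<Sum>i<n. rsign S i * (c * dot p (x i) d))
     \<le> (\<Sum>j<p. exp (c * R * ?r S j) + exp ((- (c * R)) * ?r S j))" (is "_ \<le> ?rhs") for S
  proof -
    have "(MAX d\<in>F. \<Sum>i<n. rsign S i * (c * dot p (x i) d)) \<in> (\<lambda>d. \<Sum>i<n. rsign S i * (c * dot p (x i) d)) ` F"
      using F by (intro Max_in) auto
    then obtain d where d: "d \<in> F"
      "(MAX d\<in>F. \<Sum>i<n. rsign S i * (c * dot p (x i) d)) = (\<Sum>i<n. rsign S i * (c * dot p (x i) d))" by auto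
    have e: "(\<Sum>i<n. rsign S i * (c * dot p (x i) d)) = c * dot p (?r S) d"
      unfolding dot_def by (simp add: sum_distrib_left sum_distrib_right mult_ac) (rule sum.swap)
    define B where "B = (MAX j\<in>{..<p}. \<bar>?r S j\<bar>)"
    have "B \<in> (\<lambda>j. \<bar>?r S j\<bar>) ` {..<p}" unfolding B_def using p by (intro Max_in) auto
    then obtain j where j: "j < p" "B = \<bar>?r S j\<bar>" by auto
    have "\<bar>dot p (?r S) d\<bar> \<le> B * (\<Sum>j<p. \<bar>d j\<bar>)"
      by (rule abs_dot_le) (auto simp: B_def)
    also have "\<dots> \<le> B * R" using l1[OF d(1)] j by (intro mult_left_mono) auto
    finally have "c * dot p (?r S) d \<le> c * (B * R)" using c by (intro mult_left_mono) auto
    then have "exp (c * dot p (?r S) d) \<le> exp (c * R * \<bar>?r S j\<bar>)" using j by (simp add: mult_ac)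
    also have "\<dots> \<le> exp (c * R * ?r S j) + exp ((- (c * R)) * ?r S j)"
      by (cases "?r S j \<ge> 0") (auto simp: abs_if)
    also have "\<dots> \<le> ?rhs" using j(1) by (intro member_le_sum) (auto simp: add_nonneg_nonneg)
    finally show ?thesis unfolding d(2) e .
  qed
  have 2: "(\<Sum>S\<in>Pow {..<n}. exp (k * ?r S j)) \<le> 2 ^ n * exp ((c * R)\<^sup>2 * V / 2)"
    if "j < p" "k\<^sup>2 = (c * R)\<^sup>2" for j k
  proof -
    have "(\<Sum>S\<in>Pow {..<n}. exp (k * ?r S j)) \<le> 2 ^ n * exp (k\<^sup>2 * (\<Sum>i<n. (x i j)\<^sup>2) / 2)"
      by (rule rademacher_exp_bound)
    also have "\<dots> \<le> 2 ^ n * exp ((c * R)\<^sup>2 * V / 2)"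
      using V[OF that(1)] that(2) by (auto intro!: mult_left_mono)
    finally show ?thesis .
  qed
  have "(\<Sum>S\<in>Pow {..<n}. exp (MAX d\<in>F. \<Sum>i<n. rsign S i * (c * dot p (x i) d)))
    \<le> (\<Sum>S\<in>Pow {..<n}. \<Sum>j<p. exp (c * R * ?r S j) + exp ((- (c * R)) * ?r S j))"
    by (intro sum_mono 1)
  also have "\<dots> = (\<Sum>j<p. (\<Sum>S\<in>Pow {..<n}. exp (c * R * ?r S j)) + (\<Sum>S\<in>Pow {..<n}. exp ((- (c * R)) * ?r S j)))"
    unfolding sum.distrib[symmetric] by (rule sum.swap)
  also have "\<dots> \<le> (\<Sum>j<p. 2 ^ n * exp ((c * R)\<^sup>2 * V / 2) + 2 ^ n * exp ((c * R)\<^sup>2 * V / 2))"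
    by (intro sum_mono add_mono 2) auto
  finally show ?thesis by (simp add: mult_ac)
qed

section \<open>Square roots of positive semidefinite matrices\<close>

definition mmul :: "nat \<Rightarrow> (nat \<Rightarrow> nat \<Rightarrow> real) \<Rightarrow> (nat \<Rightarrow> nat \<Rightarrow> real) \<Rightarrow> nat \<Rightarrow> nat \<Rightarrow> real" where
  "mmul p A B j k = (\<Sum>l<p. A j l * B l k)"

text \<open>A bound for the operator norm, kept as a relation so that no supremum has to
  exist.\<close>

definition op_bound :: "nat \<Rightarrow> (nat \<Rightarrow> nat \<Rightarrow> real) \<Rightarrow> real \<Rightarrow> bool" where
  "op_bound p A c \<longleftrightarrow> (\<forall>d. L2_set (mat_vec p A d) {..<p} \<le> c * L2_set d {..<p})"

lemma op_boundD: "op_bound p A c \<Longrightarrow> L2_set (mat_vec p A d) {..<p} \<le> c * L2_set d {..<p}"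
  by (simp add: op_bound_def)

lemma mat_vec_mmul: "mat_vec p (mmul p A B) d j = mat_vec p A (mat_vec p B d) j"
  unfolding mat_vec_def mmul_def
  by (simp add: sum_distrib_left sum_distrib_right mult.assoc) (rule sum.swap)

lemma op_bound_mmul:
  assumes "op_bound p A a" "op_bound p B b" "0 \<le> a"
  shows "op_bound p (mmul p A B) (a * b)"
  unfolding op_bound_def
proof
  fix d
  have "L2_set (mat_vec p (mmul p A B) d) {..<p} = L2_set (mat_vec p A (mat_vec p B d)) {..<p}"
    by (intro arg_cong2[of _ _ _ _ L2_set] refl ext) (rule mat_vec_mmul)
  also have "\<dots> \<le> a * L2_set (mat_vec p B d) {..<p}" by (rule op_boundD[OF assms(1)])
  also have "\<dots> \<le> a * (b * L2_set d {..<p})"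
    by (intro mult_left_mono op_boundD[OF assms(2)] assms(3))
  finally show "L2_set (mat_vec p (mmul p A B) d) {..<p} \<le> a * b * L2_set d {..<p}" by (simp add: mult.assoc)
qed

lemma op_bound_add:
  assumes "op_bound p A a" "op_bound p B b"
  shows "op_bound p (\<lambda>j k. A j k + B j k) (a + b)"
  unfolding op_bound_def
proof
  fix d
  have "mat_vec p (\<lambda>j k. A j k + B j k) d = (\<lambda>j. mat_vec p A d j + mat_vec p B d j)"
    by (auto simp: mat_vec_def sum.distrib algebra_simps)
  then have "L2_set (mat_vec p (\<lambda>j k. A j k + B j k) d) {..<p}
    \<le> L2_set (mat_vec p A d) {..<p} + L2_set (mat_vec p B d) {..<p}"
    by (simp add: L2_set_triangle_ineq)
  also have "\<dots> \<le> (a + b) * L2_set d {..<p}"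
    using op_boundD[OF assms(1), of d] op_boundD[OF assms(2), of d] by (simp add: algebra_simps)
  finally show "L2_set (mat_vec p (\<lambda>j k. A j k + B j k) d) {..<p} \<le> (a + b) * L2_set d {..<p}" .
qed

lemma op_bound_scale:
  assumes "op_bound p A a" "0 \<le> c"
  shows "op_bound p (\<lambda>j k. c * A j k) (c * a)"
  unfolding op_bound_def
proof
  fix d
  have "mat_vec p (\<lambda>j k. c * A j k) d = (\<lambda>j. c * mat_vec p A d j)"
    by (auto simp: mat_vec_def sum_distrib_left mult.assoc)
  then have "L2_set (mat_vec p (\<lambda>j k. c * A j k) d) {..<p} = c * L2_set (mat_vec p A d) {..<p}"
    using assms(2) by (simp add: L2_set_right_distrib)
  also have "\<dots> \<le> c * (a * L2_set d {..<p})" by (intro mult_left_mono op_boundD assms)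
  finally show "L2_set (mat_vec p (\<lambda>j k. c * A j k) d) {..<p} \<le> c * a * L2_set d {..<p}" by (simp add: mult.assoc)
qed

text \<open>The k-th column is the image of a unit vector. This turns summable operator bounds into
  convergence of the entries.\<close>

lemma entry_le_op_bound:
  assumes "op_bound p A a" "j < p" "k < p"
  shows "\<bar>A j k\<bar> \<le> a"
proof -
  let ?e = "\<lambda>i. if i = k then 1 else (0::real)"
  have "(\<Sum>i<p. (?e i)\<^sup>2) = (\<Sum>i<p. if i = k then 1 else 0)" by (intro sum.cong) auto
  then have "L2_set ?e {..<p} = 1" using assms(3) by (simp add: L2_set_def)
  moreover have "mat_vec p A ?e = (\<lambda>j. A j k)"
    using assms(3) by (auto simp: mat_vec_def if_distrib cong: if_cong)
  ultimately have "L2_set (\<lambda>j. A j k) {..<p} \<le> a" using op_boundD[OF assms(1), of ?e] by simp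
  moreover have "\<bar>A j k\<bar> \<le> L2_set (\<lambda>j. \<bar>A j k\<bar>) {..<p}"
    using assms(2) by (intro member_le_L2_set) auto
  ultimately show ?thesis by (simp add: L2_set_def)
qed

text \<open>The iteration \<open>Y \<mapsto> (B + Y\<^sup>2) / 2\<close> is dominated in operator norm by the scalar iteration
  \<open>r \<mapsto> (1 + r\<^sup>2) / 2\<close>, whose increments telescope; its limit satisfies \<open>(1 - Y)\<^sup>2 = 1 - B\<close>.\<close>

fun sqrt_iter :: "nat \<Rightarrow> (nat \<Rightarrow> nat \<Rightarrow> real) \<Rightarrow> nat \<Rightarrow> nat \<Rightarrow> nat \<Rightarrow> real" where
  "sqrt_iter p B 0 = (\<lambda>j k. 0)"
| "sqrt_iter p B (Suc m) = (\<lambda>j k. (1/2) * (B j k + mmul p (sqrt_iter p B m) (sqrt_iter p B m) j k))"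

fun scalar_iter :: "nat \<Rightarrow> real" where
  "scalar_iter 0 = 0"
| "scalar_iter (Suc m) = (1/2) * (1 + scalar_iter m * scalar_iter m)"

lemma scalar_iter_bounds: "0 \<le> scalar_iter m \<and> scalar_iter m \<le> scalar_iter (Suc m) \<and> scalar_iter m \<le> 1"
proof (induction m)
  case (Suc m)
  let ?r = "scalar_iter m"
  have "?r * ?r \<le> scalar_iter (Suc m) * scalar_iter (Suc m)" using Suc by (intro mult_mono) auto
  moreover have "?r * ?r \<le> 1" using Suc by (simp add: mult_le_one)
  ultimately show ?case using Suc by (simp del: scalar_iter.simps(2) add: scalar_iter.simps(2)[of "Suc m"] scalar_iter.simps(2)[of m])
qed simp

lemma sqrt_iter_bound:
  assumes "op_bound p B 1"
  shows "op_bound p (sqrt_iter p B m) (scalar_iter m)"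
proof (induction m)
  case 0 then show ?case by (simp add: op_bound_def mat_vec_def L2_set_def)
next
  case (Suc m)
  show ?case unfolding sqrt_iter.simps scalar_iter.simps
    by (intro op_bound_scale op_bound_add op_bound_mmul assms Suc) (use scalar_iter_bounds in auto)
qed

lemma mmul_square_diff:
  "mmul p Y Y j k - mmul p X X j k
    = mmul p Y (\<lambda>j k. Y j k - X j k) j k + mmul p (\<lambda>j k. Y j k - X j k) X j k"
  by (simp add: mmul_def algebra_simps sum_subtractf)

text \<open>Y^2 - X^2 = Y (Y - X) + (Y - X) X holds without commutativity, and the scalar iteration
  obeys the same identity; so scalar increments dominate matrix increments inductively.\<close>

lemma sqrt_iter_step_bound:
  assumes "op_bound p B 1"
  shows "op_bound p (\<lambda>j k. sqrt_iter p B (Suc m) j k - sqrt_iter p B m j k) (scalar_iter (Suc m) - scalar_iter m)"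
proof (induction m)
  case 0
  have "op_bound p (\<lambda>j k. (1/2) * B j k) ((1/2) * 1)" by (intro op_bound_scale assms) auto
  then show ?case by (simp add: mmul_def)
next
  case (Suc m)
  let ?Y = "sqrt_iter p B (Suc m)" and ?X = "sqrt_iter p B m"
  let ?D = "\<lambda>j k. ?Y j k - ?X j k"
  have "(\<lambda>j k. sqrt_iter p B (Suc (Suc m)) j k - ?Y j k) = (\<lambda>j k. (1/2) * (mmul p ?Y ?D j k + mmul p ?D ?X j k))"
  proof (intro ext)
    fix j k
    have "sqrt_iter p B (Suc (Suc m)) j k = (1/2) * (B j k + mmul p ?Y ?Y j k)"
      "?Y j k = (1/2) * (B j k + mmul p ?X ?X j k)" by (simp_all only: sqrt_iter.simps)
    then show "sqrt_iter p B (Suc (Suc m)) j k - ?Y j k = (1/2) * (mmul p ?Y ?D j k + mmul p ?D ?X j k)"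
      unfolding mmul_square_diff[of p ?Y j k ?X, symmetric] by (simp only: right_diff_distrib distrib_left)
  qed
  moreover have "op_bound p (\<lambda>j k. (1/2) * (mmul p ?Y ?D j k + mmul p ?D ?X j k))
     ((1/2) * (scalar_iter (Suc m) * (scalar_iter (Suc m) - scalar_iter m) + (scalar_iter (Suc m) - scalar_iter m) * scalar_iter m))"
    by (intro op_bound_scale op_bound_add op_bound_mmul sqrt_iter_bound assms Suc)
      (use scalar_iter_bounds in \<open>auto simp del: scalar_iter.simps\<close>)
  moreover have "(1/2) * (scalar_iter (Suc m) * (scalar_iter (Suc m) - scalar_iter m) + (scalar_iter (Suc m) - scalar_iter m) * scalar_iter m)
     = scalar_iter (Suc (Suc m)) - scalar_iter (Suc m)"
    by (subst scalar_iter.simps(2)[of "Suc m"], subst (6) scalar_iter.simps(2))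
      (simp add: algebra_simps del: scalar_iter.simps)
  ultimately show ?case by (simp only:)
qed

lemma sqrt_iter_convergent:
  assumes "op_bound p B 1" "j < p" "k < p"
  shows "convergent (\<lambda>m. sqrt_iter p B m j k)"
proof -
  have "incseq scalar_iter" using scalar_iter_bounds by (intro incseq_SucI) auto
  then have "convergent scalar_iter"
    using scalar_iter_bounds by (intro Bseq_mono_convergent BseqI'[of _ 1]) (auto simp: incseq_def)
  then have "summable (\<lambda>m. scalar_iter (Suc m) - scalar_iter m)"
    by (simp add: telescope_summable convergent_LIMSEQ_iff del: scalar_iter.simps)
  then have "summable (\<lambda>m. sqrt_iter p B (Suc m) j k - sqrt_iter p B m j k)"
    by (rule summable_comparison_test[rotated])
      (use entry_le_op_bound[OF sqrt_iter_step_bound[OF assms(1)] assms(2,3)] in auto)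
  then have "convergent (\<lambda>m. \<Sum>i<m. sqrt_iter p B (Suc i) j k - sqrt_iter p B i j k)"
    by (simp add: summable_iff_convergent)
  moreover have "(\<Sum>i<m. sqrt_iter p B (Suc i) j k - sqrt_iter p B i j k) = sqrt_iter p B m j k" for m
    using sum_lessThan_telescope[of "\<lambda>m. sqrt_iter p B m j k" m] by (simp only: sqrt_iter.simps(1) diff_zero)
  ultimately show ?thesis by (simp only:)
qed

lemma quad_form_eq_mat_vec: "quad_form p G d = (\<Sum>j<p. d j * mat_vec p G d j)"
  by (simp add: quad_form_def mat_vec_def sum_distrib_left mult.assoc)

lemma op_bound_quad_form:
  assumes "op_bound p A a"
  shows "\<bar>quad_form p A d\<bar> \<le> a * (\<Sum>j<p. (d j)\<^sup>2)"
proof -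
  have "\<bar>quad_form p A d\<bar> \<le> L2_set d {..<p} * L2_set (mat_vec p A d) {..<p}"
    unfolding quad_form_eq_mat_vec
    by (rule order_trans[OF sum_abs]) (simp add: abs_mult L2_set_mult_ineq)
  also have "\<dots> \<le> L2_set d {..<p} * (a * L2_set d {..<p})"
    by (intro mult_left_mono op_boundD assms L2_set_nonneg)
  also have "\<dots> = a * (L2_set d {..<p})\<^sup>2" by (simp add: power2_eq_square)
  finally show ?thesis by (simp add: L2_set_def sum_nonneg)
qed

text \<open>The root is 1 - Y with Y the limit of the iteration. Symmetry passes to the limit, and 1
  - Y is positive semidefinite because the scalar iterates stay below 1.\<close>

lemma psd_sqrt_one_minus:
  assumes B: "op_bound p B 1" and sym: "\<And>j k. j < p \<Longrightarrow> k < p \<Longrightarrow> B j k = B k j"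
  shows "\<exists>S. is_psd_sqrt p (\<lambda>j k. of_bool (j = k) - B j k) S"
proof -
  let ?Y = "sqrt_iter p B"
  define Y where "Y j k = lim (\<lambda>m. ?Y m j k)" for j k
  have lim: "(\<lambda>m. ?Y m j k) \<longlonglongrightarrow> Y j k" if "j < p" "k < p" for j k
    using sqrt_iter_convergent[OF B that] by (simp add: Y_def convergent_LIMSEQ_iff)
  have symI: "?Y m j k = ?Y m k j" if "j < p" "k < p" for m j k
    using that
  proof (induction m arbitrary: j k)
    case (Suc m)
    have "mmul p (?Y m) (?Y m) j k = mmul p (?Y m) (?Y m) k j"
      unfolding mmul_def using Suc by (intro sum.cong refl) (simp add: mult.commute)
    then show ?case using sym Suc.prems by simp
  qed simp
  have Ysym: "Y j k = Y k j" if "j < p" "k < p" for j k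
    unfolding Y_def using symI[OF that] by simp
  have fix_eq: "Y j k = (1/2) * (B j k + mmul p Y Y j k)" if "j < p" "k < p" for j k
  proof -
    have l1: "(\<lambda>m. (1/2) * (B j k + mmul p (?Y m) (?Y m) j k)) \<longlonglongrightarrow> (1/2) * (B j k + mmul p Y Y j k)"
      unfolding mmul_def using that by (intro tendsto_intros lim) auto
    have "(\<lambda>m. ?Y (Suc m) j k) \<longlonglongrightarrow> Y j k" by (rule LIMSEQ_Suc[OF lim[OF that]])
    then have "(\<lambda>m. (1/2) * (B j k + mmul p (?Y m) (?Y m) j k)) \<longlonglongrightarrow> Y j k" by (simp only: sqrt_iter.simps)
    then show ?thesis by (rule LIMSEQ_unique[OF _ l1])
  qed
  have Yq: "quad_form p Y d \<le> (\<Sum>j<p. (d j)\<^sup>2)" for d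
  proof (rule LIMSEQ_le_const2)
    show "(\<lambda>m. quad_form p (?Y m) d) \<longlonglongrightarrow> quad_form p Y d"
      unfolding quad_form_def by (intro tendsto_intros lim) auto
    have "quad_form p (?Y m) d \<le> (\<Sum>j<p. (d j)\<^sup>2)" for m
    proof -
      have "quad_form p (?Y m) d \<le> scalar_iter m * (\<Sum>j<p. (d j)\<^sup>2)"
        using op_bound_quad_form[OF sqrt_iter_bound[OF B, of m], of d] by simp
      also have "\<dots> \<le> 1 * (\<Sum>j<p. (d j)\<^sup>2)"
        using scalar_iter_bounds by (intro mult_right_mono) (auto intro: sum_nonneg)
      finally show ?thesis by simp
    qed
    then show "\<exists>N. \<forall>m\<ge>N. quad_form p (?Y m) d \<le> (\<Sum>j<p. (d j)\<^sup>2)" by auto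
  qed
  let ?S = "\<lambda>j k. of_bool (j = k) - Y j k"
  have "quad_form p ?S d = (\<Sum>j<p. (d j)\<^sup>2) - quad_form p Y d" for d
  proof -
    have "quad_form p ?S d = (\<Sum>j<p. (\<Sum>k<p. d j * of_bool (j = k) * d k) - (\<Sum>k<p. d j * Y j k * d k))"
      unfolding quad_form_def sum_subtractf[symmetric] by (simp only: right_diff_distrib left_diff_distrib)
    also have "\<dots> = (\<Sum>j<p. (d j)\<^sup>2 - (\<Sum>k<p. d j * Y j k * d k))"
    proof (intro sum.cong refl arg_cong2[of _ _ _ _ "(-)"])
      fix j assume "j \<in> {..<p}"
      have "(\<Sum>k<p. d j * of_bool (j = k) * d k) = (\<Sum>k<p. if j = k then d j * d k else 0)"
        by (intro sum.cong) auto
      then show "(\<Sum>k<p. d j * of_bool (j = k) * d k) = (d j)\<^sup>2"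
        using \<open>j \<in> _\<close> by (simp add: power2_eq_square)
    qed
    finally show ?thesis by (simp add: quad_form_def sum_subtractf)
  qed
  moreover have "(\<Sum>l<p. ?S j l * ?S l k) = of_bool (j = k) - B j k" if jk: "j < p" "k < p" for j k
  proof -
    have "(\<Sum>l<p. ?S j l * ?S l k) = (\<Sum>l<p. (if j = l then of_bool (l = k) else 0) - (if j = l then Y l k else 0)
        - (if l = k then Y j l else 0) + Y j l * Y l k)"
      by (intro sum.cong) (auto simp: algebra_simps)
    also have "\<dots> = of_bool (j = k) - Y j k - Y j k + mmul p Y Y j k"
      using jk by (simp add: sum.distrib sum_subtractf mmul_def)
    also have "\<dots> = of_bool (j = k) - B j k" using fix_eq[OF jk] by simp
    finally show ?thesis .
  qed
  ultimately show ?thesis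
    unfolding is_psd_sqrt_def using Ysym Yq by (intro exI[of _ ?S] conjI allI impI) auto
qed

lemma psd_cauchy_schwarz:
  assumes sym: "\<And>j k. j < p \<Longrightarrow> k < p \<Longrightarrow> G j k = G k j"
    and psd: "\<And>d. 0 \<le> quad_form p G d"
  shows "(\<Sum>j<p. x j * mat_vec p G y j)\<^sup>2 \<le> quad_form p G x * quad_form p G y"
proof -
  let ?b = "\<lambda>x y. \<Sum>j<p. x j * mat_vec p G y j"
  have b: "?b x y = ?b y x"
  proof -
    have "?b x y = (\<Sum>j<p. \<Sum>k<p. x j * G j k * y k)" by (simp add: mat_vec_def sum_distrib_left mult.assoc)
    also have "\<dots> = (\<Sum>k<p. \<Sum>j<p. y k * G k j * x j)"
      by (subst sum.swap) (intro sum.cong refl, auto simp: sym mult_ac)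
    also have "\<dots> = ?b y x" by (simp add: mat_vec_def sum_distrib_left mult.assoc)
    finally show ?thesis .
  qed
  have q: "quad_form p G (\<lambda>j. s * x j + t * y j) = s\<^sup>2 * quad_form p G x + 2 * s * t * ?b x y + t\<^sup>2 * quad_form p G y" for s t
  proof -
    have "mat_vec p G (\<lambda>j. s * x j + t * y j) = (\<lambda>j. s * mat_vec p G x j + t * mat_vec p G y j)"
      by (auto simp: mat_vec_def algebra_simps sum.distrib sum_distrib_left)
    then have "quad_form p G (\<lambda>j. s * x j + t * y j)
        = (\<Sum>j<p. s\<^sup>2 * (x j * mat_vec p G x j) + s * t * (x j * mat_vec p G y j)
            + s * t * (y j * mat_vec p G x j) + t\<^sup>2 * (y j * mat_vec p G y j))"
      unfolding quad_form_eq_mat_vec by (intro sum.cong refl) (simp only:, simp add: algebra_simps power2_eq_square)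
    also have "\<dots> = s\<^sup>2 * ?b x x + s * t * ?b x y + s * t * ?b y x + t\<^sup>2 * ?b y y"
      by (simp only: sum.distrib sum_distrib_left)
    finally have "quad_form p G (\<lambda>j. s * x j + t * y j)
        = s\<^sup>2 * ?b x x + s * t * ?b x y + s * t * ?b y x + t\<^sup>2 * ?b y y" .
    then show ?thesis using b by (simp add: quad_form_eq_mat_vec)
  qed
  define P where "P = quad_form p G x"
  define R where "R = quad_form p G y"
  define c where "c = ?b x y"
  have P: "0 \<le> P" and R: "0 \<le> R" using psd by (simp_all add: P_def R_def)
  have all: "0 \<le> s\<^sup>2 * P + 2 * s * t * c + t\<^sup>2 * R" for s t
    using psd[of "\<lambda>j. s * x j + t * y j"] unfolding q P_def R_def c_def .
  have "c\<^sup>2 \<le> P * R"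
  proof (cases "R = 0")
    case True
    then have "0 \<le> s\<^sup>2 * P + 2 * s * t * c" for s t using all[of s t] by simp
    show ?thesis
    proof (cases "c = 0")
      case False
      \<comment> \<open>With R = 0 the form is affine in t; at s = 1 this t would give it the value
        -1.\<close>
      have "2 * 1 * (- (P + 1) / (2 * c)) * c = - (P + 1)" using False by simp
      with \<open>\<And>s t. 0 \<le> s\<^sup>2 * P + 2 * s * t * c\<close>[of 1 "- (P + 1) / (2 * c)"] have "0 \<le> P - (P + 1)"
        by simp
      then show ?thesis using P by simp
    qed (use P R in simp)
  next
    case False
    then have "0 < R" using R by simp
    \<comment> \<open>The choice s = R, t = -c is the minimizing direction, scaled to avoid a
      division.\<close>
    have "0 \<le> R * (R * P - c\<^sup>2)" using all[of R "-c"] by (simp add: power2_eq_square algebra_simps)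
    then have "0 \<le> R * P - c\<^sup>2" using \<open>0 < R\<close> by (simp add: zero_le_mult_iff)
    then show ?thesis by (simp add: mult.commute)
  qed
  then show ?thesis by (simp add: P_def R_def c_def)
qed

text \<open>\<open>mat_sqrt\<close> is a choice, so it has its defining property only once some root
  exists. For large \<open>c\<close> the matrix 1 - G / c has operator norm at most 1, which yields
  a root of G / c; it is rescaled by sqrt c.\<close>

theorem psd_sqrt_exists:
  assumes sym: "\<And>j k. j < p \<Longrightarrow> k < p \<Longrightarrow> G j k = G k j"
    and psd: "\<And>d. 0 \<le> quad_form p G d"
  shows "is_psd_sqrt p G (mat_sqrt p G)"
proof -
  \<comment> \<open>The sum of all entries in absolute value dominates the quadratic form; the 1
    keeps \<open>c\<close> positive for the zero matrix.\<close>
  define c where "c = (\<Sum>j<p. \<Sum>k<p. \<bar>G j k\<bar>) + 1"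
  have c: "0 < c" unfolding c_def by (intro add_nonneg_pos sum_nonneg) auto
  have qc: "quad_form p G d \<le> c * (\<Sum>j<p. (d j)\<^sup>2)" for d
  proof -
    have m: "\<bar>d j\<bar> \<le> L2_set d {..<p}" if "j < p" for j
      using member_le_L2_set[of "{..<p}" "j" "\<lambda>j. \<bar>d j\<bar>"] that by (simp add: L2_set_def)
    have "quad_form p G d \<le> (\<Sum>j<p. \<Sum>k<p. \<bar>G j k\<bar> * (L2_set d {..<p})\<^sup>2)"
      unfolding quad_form_def
    proof (intro sum_mono)
      fix j k assume "j \<in> {..<p}" "k \<in> {..<p}"
      have "d j * G j k * d k \<le> \<bar>G j k\<bar> * (\<bar>d j\<bar> * \<bar>d k\<bar>)"
        by (metis abs_ge_self abs_mult mult.assoc mult.commute)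
      also have "\<dots> \<le> \<bar>G j k\<bar> * (L2_set d {..<p} * L2_set d {..<p})"
        using m \<open>j \<in> _\<close> \<open>k \<in> _\<close> by (intro mult_left_mono mult_mono) auto
      finally show "d j * G j k * d k \<le> \<bar>G j k\<bar> * (L2_set d {..<p})\<^sup>2" by (simp add: power2_eq_square)
    qed
    also have "\<dots> = (c - 1) * (L2_set d {..<p})\<^sup>2" by (simp add: c_def sum_distrib_right)
    also have "\<dots> \<le> c * (L2_set d {..<p})\<^sup>2" by (intro mult_right_mono) auto
    finally show ?thesis by (simp add: L2_set_def sum_nonneg)
  qed
  let ?B = "\<lambda>j k. of_bool (j = k) - G j k / c"
  \<comment> \<open>Cauchy-Schwarz for the form of G at the vectors G d and d: |G d|^4 \<le> (c |G
    d|^2) (d' G d).\<close>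
  have Gd: "(\<Sum>j<p. (mat_vec p G d j)\<^sup>2) \<le> c * quad_form p G d" for d
  proof -
    define N where "N = (\<Sum>j<p. (mat_vec p G d j)\<^sup>2)"
    have N: "0 \<le> N" by (simp add: N_def sum_nonneg)
    have "N\<^sup>2 = (\<Sum>j<p. mat_vec p G d j * mat_vec p G d j)\<^sup>2" by (simp add: N_def power2_eq_square)
    also have "\<dots> \<le> quad_form p G (mat_vec p G d) * quad_form p G d" by (rule psd_cauchy_schwarz[OF sym psd])
    also have "\<dots> \<le> (c * N) * quad_form p G d" unfolding N_def by (intro mult_right_mono qc psd)
    finally have "N * N \<le> N * (c * quad_form p G d)" by (simp add: power2_eq_square mult_ac)
    then show ?thesis unfolding N_def[symmetric]
      using N c psd[of d] by (cases "N = 0") auto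
  qed
  have "op_bound p ?B 1" unfolding op_bound_def
  proof
    fix d
    have mv: "mat_vec p ?B d j = d j - mat_vec p G d j / c" if "j < p" for j
    proof -
      have "mat_vec p ?B d j = (\<Sum>k<p. (if j = k then d k else 0) - G j k * d k / c)"
        unfolding mat_vec_def by (intro sum.cong) (auto simp: algebra_simps)
      then show ?thesis using that by (simp add: sum_subtractf mat_vec_def sum_divide_distrib)
    qed
    have "(\<Sum>j<p. (mat_vec p ?B d j)\<^sup>2) = (\<Sum>j<p. (d j)\<^sup>2 - 2 / c * (d j * mat_vec p G d j) + (mat_vec p G d j)\<^sup>2 / c\<^sup>2)"
      by (intro sum.cong) (auto simp: mv power2_diff power_divide)
    also have "\<dots> = (\<Sum>j<p. (d j)\<^sup>2) - 2 / c * quad_form p G d + (\<Sum>j<p. (mat_vec p G d j)\<^sup>2) / c\<^sup>2"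
      by (simp add: sum.distrib sum_subtractf quad_form_eq_mat_vec sum_distrib_left sum_divide_distrib)
    also have "\<dots> \<le> (\<Sum>j<p. (d j)\<^sup>2) - 2 / c * quad_form p G d + (c * quad_form p G d) / c\<^sup>2"
      using Gd by (intro add_left_mono divide_right_mono) auto
    also have "\<dots> = (\<Sum>j<p. (d j)\<^sup>2) - quad_form p G d / c" using c by (simp add: field_simps power2_eq_square)
    also have "\<dots> \<le> (\<Sum>j<p. (d j)\<^sup>2)" using psd[of d] c by simp
    finally show "L2_set (mat_vec p ?B d) {..<p} \<le> 1 * L2_set d {..<p}" by (simp add: L2_set_def)
  qed
  moreover have "?B j k = ?B k j" if "j < p" "k < p" for j k using sym[OF that] by auto
  ultimately obtain S where S: "is_psd_sqrt p (\<lambda>j k. of_bool (j = k) - ?B j k) S"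
    using psd_sqrt_one_minus[of p ?B] by blast
  have "is_psd_sqrt p G (\<lambda>j k. sqrt c * S j k)"
    unfolding is_psd_sqrt_def
  proof (intro conjI allI impI)
    fix d
    have "quad_form p (\<lambda>j k. sqrt c * S j k) d = sqrt c * quad_form p S d"
      by (simp add: quad_form_def sum_distrib_left mult_ac)
    then show "0 \<le> quad_form p (\<lambda>j k. sqrt c * S j k) d" using S c by (simp add: is_psd_sqrt_def)
  next
    fix j k assume "j < p" "k < p"
    then show "sqrt c * S j k = sqrt c * S k j" using S by (simp add: is_psd_sqrt_def)
    have "(\<Sum>l<p. sqrt c * S j l * (sqrt c * S l k)) = (sqrt c * sqrt c) * (\<Sum>l<p. S j l * S l k)"
      unfolding sum_distrib_left by (intro sum.cong refl) (simp only: mult_ac)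
    also have "(\<Sum>l<p. S j l * S l k) = G j k / c"
      using conjunct2[OF conjunct2[OF S[unfolded is_psd_sqrt_def]], rule_format, OF \<open>j < p\<close> \<open>k < p\<close>]
      by (simp only:)
    finally show "(\<Sum>l<p. sqrt c * S j l * (sqrt c * S l k)) = G j k" using c by simp
  qed
  then show ?thesis unfolding mat_sqrt_def by (rule someI[of "is_psd_sqrt p G"])
qed

text \<open>For a symmetric root S, |S d|^2 = d' S S d = d' G d. In this way
  \<open>est_error\<close> becomes a statement about the quadratic form of
  \<open>Jmat\<close>.\<close>

lemma L2_set_mat_sqrt:
  assumes sym: "\<And>j k. j < p \<Longrightarrow> k < p \<Longrightarrow> G j k = G k j"
    and psd: "\<And>d. 0 \<le> quad_form p G d"
  shows "L2_set (mat_vec p (mat_sqrt p G) d) {..<p} = sqrt (quad_form p G d)"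
proof -
  let ?S = "mat_sqrt p G"
  have sq: "is_psd_sqrt p G ?S" by (rule psd_sqrt_exists[OF sym psd])
  have S: "?S j k = ?S k j" "(\<Sum>l<p. ?S j l * ?S l k) = G j k" if "j < p" "k < p" for j k
    using sq[unfolded is_psd_sqrt_def] that by blast+
  have "(\<Sum>l<p. (mat_vec p ?S d l)\<^sup>2) = (\<Sum>l<p. \<Sum>j<p. \<Sum>k<p. d j * (?S j l * ?S l k) * d k)"
  proof (intro sum.cong refl)
    fix l assume l: "l \<in> {..<p}"
    have "mat_vec p ?S d l = (\<Sum>j<p. d j * ?S j l)"
      unfolding mat_vec_def using l by (intro sum.cong refl) (simp add: S(1)[of _ l] mult.commute)
    moreover have "mat_vec p ?S d l = (\<Sum>k<p. ?S l k * d k)" by (simp add: mat_vec_def)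
    ultimately have "(mat_vec p ?S d l)\<^sup>2 = (\<Sum>j<p. d j * ?S j l) * (\<Sum>k<p. ?S l k * d k)"
      by (simp add: power2_eq_square)
    then show "(mat_vec p ?S d l)\<^sup>2 = (\<Sum>j<p. \<Sum>k<p. d j * (?S j l * ?S l k) * d k)"
      by (simp only: sum_product mult.assoc)
  qed
  also have "\<dots> = (\<Sum>j<p. \<Sum>l<p. \<Sum>k<p. d j * (?S j l * ?S l k) * d k)" by (rule sum.swap)
  also have "\<dots> = (\<Sum>j<p. \<Sum>k<p. \<Sum>l<p. d j * (?S j l * ?S l k) * d k)"
    by (rule sum.cong[OF refl], rule sum.swap)
  also have "\<dots> = (\<Sum>j<p. \<Sum>k<p. d j * (\<Sum>l<p. ?S j l * ?S l k) * d k)"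
    by (simp only: sum_distrib_left[of "d _"] sum_distrib_right[of _ _ "d _"])
  also have "\<dots> = (\<Sum>j<p. \<Sum>k<p. d j * G j k * d k)"
  proof (intro sum.cong refl)
    fix j k assume "j \<in> {..<p}" "k \<in> {..<p}"
    then have "(\<Sum>l<p. ?S j l * ?S l k) = G j k" by (intro S(2)) simp_all
    then show "d j * (\<Sum>l<p. ?S j l * ?S l k) * d k = d j * G j k * d k" by (simp only:)
  qed
  also have "\<dots> = quad_form p G d" by (simp only: quad_form_def)
  finally show ?thesis by (simp add: L2_set_def)
qed

section \<open>The check function and penalized minimizers\<close>

text \<open>As a maximum of two linear functions the check function is visibly convex and Lipschitz,
  and lies above its supporting lines.\<close>

lemma rho_eq_max: "rho u t = max (u * t) ((u - 1) * t)"
  by (cases "t \<le> 0") (auto simp: rho_def max_def algebra_simps)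

lemma rho_borel_measurable [measurable]: "rho u \<in> borel_measurable borel"
  unfolding rho_def by simp

lemma rho_lipschitz:
  assumes "0 \<le> u" "u \<le> 1"
  shows "\<bar>rho u a - rho u b\<bar> \<le> max u (1 - u) * \<bar>a - b\<bar>"
proof -
  have *: "rho u a - rho u b \<le> max u (1 - u) * \<bar>a - b\<bar>" for a b
  proof -
    have "u * a - u * b \<le> max u (1 - u) * \<bar>a - b\<bar>"
    proof -
      have "u * a - u * b = u * (a - b)" by (simp add: algebra_simps)
      also have "\<dots> \<le> u * \<bar>a - b\<bar>" using assms by (intro mult_left_mono) auto
      also have "\<dots> \<le> max u (1 - u) * \<bar>a - b\<bar>" by (intro mult_right_mono) auto
      finally show ?thesis .
    qed
    moreover have "(u - 1) * a - (u - 1) * b \<le> max u (1 - u) * \<bar>a - b\<bar>"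
    proof -
      have "(u - 1) * a - (u - 1) * b = (1 - u) * (b - a)" by (simp add: algebra_simps)
      also have "\<dots> \<le> (1 - u) * \<bar>a - b\<bar>" using assms by (intro mult_left_mono) auto
      also have "\<dots> \<le> max u (1 - u) * \<bar>a - b\<bar>" by (intro mult_right_mono) auto
      finally show ?thesis .
    qed
    ultimately show ?thesis unfolding rho_eq_max by (auto simp: max_def split: if_splits)
  qed
  have "rho u b - rho u a \<le> max u (1 - u) * \<bar>b - a\<bar>" by (rule *)
  then have "rho u b - rho u a \<le> max u (1 - u) * \<bar>a - b\<bar>" by (simp only: abs_minus_commute)
  then show ?thesis using *[of a b] by linarith
qed

lemma rho_lipschitz1:
  assumes "0 \<le> u" "u \<le> 1"
  shows "\<bar>rho u a - rho u b\<bar> \<le> \<bar>a - b\<bar>"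
proof -
  have "max u (1 - u) * \<bar>a - b\<bar> \<le> 1 * \<bar>a - b\<bar>" using assms by (intro mult_right_mono) auto
  then show ?thesis using rho_lipschitz[OF assms, of a b] by simp
qed

lemma rho_subgradient: "rho u (w - a) - rho u w \<ge> - ((u - of_bool (w \<le> 0)) * a)"
proof -
  have "rho u (w - a) \<ge> u * (w - a)" "rho u (w - a) \<ge> (u - 1) * (w - a)"
    unfolding rho_eq_max by auto
  then show ?thesis by (cases "w \<le> 0") (auto simp: rho_def[of u w] algebra_simps)
qed

lemma rho_diff_index: "rho u t - rho v t = (u - v) * t"
  by (simp add: rho_def algebra_simps)

lemma rho_convex:
  assumes "0 \<le> \<theta>" "\<theta> \<le> 1"
  shows "rho u ((1 - \<theta>) * a + \<theta> * b) \<le> (1 - \<theta>) * rho u a + \<theta> * rho u b"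
proof -
  have "(1 - \<theta>) * (c * a) + \<theta> * (c * b) \<le> (1 - \<theta>) * rho u a + \<theta> * rho u b"
    if "c = u \<or> c = u - 1" for c
    using assms that unfolding rho_eq_max by (intro add_mono mult_left_mono) auto
  from this[of u] this[of "u - 1"] show ?thesis
    unfolding rho_eq_max[of u "(1 - \<theta>) * a + \<theta> * b"] by (simp add: algebra_simps)
qed

lemma dot_diff: "dot p a (\<lambda>j. b j - c j) = dot p a b - dot p a c"
  by (simp add: dot_def algebra_simps sum_subtractf)

lemma dot_scale: "dot p a (\<lambda>j. c * b j) = c * dot p a b"
  by (simp add: dot_def sum_distrib_left mult_ac)

lemma supp_subset: "supp p b \<subseteq> {..<p}" by (auto simp: supp_def)

lemma finite_supp [simp]: "finite (supp p b)" by (rule finite_subset[OF supp_subset]) simp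

lemma sigma_hat_nonneg [simp]: "0 \<le> sigma_hat n X j"
  by (simp add: sigma_hat_def sum_nonneg)

text \<open>Optimality in the direction that shrinks some of the active coordinates at unit rate.\<close>

lemma minimizer_sign_direction:
  assumes min: "is_minimizer n p X y lam u b" and u: "0 < u" "u < 1" and n: "0 < n" and lam: "0 \<le> lam"
    and sig: "\<And>j. j < p \<Longrightarrow> 1/2 \<le> sigma_hat n X j"
    and S: "S \<subseteq> supp p b" "S \<noteq> {}"
  shows "lam * sqrt (u * (1 - u)) * (real (card S) / 2)
     \<le> (\<Sum>i<n. \<bar>dot p (X i) (\<lambda>j. if j \<in> S then sgn (b j) else 0)\<bar>)"
proof -
  let ?d = "\<lambda>j. if j \<in> S then sgn (b j) else 0"
  have finS: "finite S" by (rule finite_subset[OF S(1)]) simp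
  \<comment> \<open>The step is the smallest active modulus: no coordinate in \<open>S\<close>
    changes sign, so the weighted l1-norm falls exactly linearly.\<close>
  define h where "h = (MIN j\<in>S. \<bar>b j\<bar>)"
  have h: "0 < h" unfolding h_def using S finS by (subst Min_gr_iff) (auto simp: supp_def)
  have hle: "h \<le> \<bar>b j\<bar>" if "j \<in> S" for j unfolding h_def using that finS by (intro Min_le) auto
  let ?b = "\<lambda>j. b j - h * ?d j"
  have abs: "\<bar>?b j\<bar> = \<bar>b j\<bar> - (if j \<in> S then h else 0)" for j
    using hle[of j] h by (cases "j \<in> S") (auto simp: sgn_if abs_if split: if_splits)
  have "(\<Sum>j<p. sigma_hat n X j * \<bar>?b j\<bar>)
      = (\<Sum>j<p. sigma_hat n X j * \<bar>b j\<bar>) - h * (\<Sum>j\<in>S. sigma_hat n X j)"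
  proof -
    have "(\<Sum>j<p. sigma_hat n X j * (if j \<in> S then h else 0)) = (\<Sum>j\<in>S. sigma_hat n X j * h)"
      using S(1) supp_subset[of p b] by (intro sum.mono_neutral_cong_right) auto
    then show ?thesis unfolding abs by (simp add: right_diff_distrib sum_subtractf sum_distrib_left mult.commute)
  qed
  moreover have "(\<Sum>j\<in>S. 1/2) \<le> (\<Sum>j\<in>S. sigma_hat n X j)"
    using S(1) supp_subset[of p b] by (intro sum_mono sig) auto
  ultimately have pen: "(\<Sum>j<p. sigma_hat n X j * \<bar>?b j\<bar>)
      \<le> (\<Sum>j<p. sigma_hat n X j * \<bar>b j\<bar>) - h * (real (card S) / 2)"
    using h by (simp add: mult_left_mono)
  have loss: "(\<Sum>i<n. rho u (y i - dot p (X i) ?b)) \<le> (\<Sum>i<n. rho u (y i - dot p (X i) b)) + h * (\<Sum>i<n. \<bar>dot p (X i) ?d\<bar>)"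
    unfolding sum_distrib_left sum.distrib[symmetric]
  proof (intro sum_mono)
    fix i
    have "dot p (X i) ?b = dot p (X i) b - h * dot p (X i) ?d" unfolding dot_diff dot_scale ..
    then show "rho u (y i - dot p (X i) ?b) \<le> rho u (y i - dot p (X i) b) + h * \<bar>dot p (X i) ?d\<bar>"
      using rho_lipschitz1[of u "y i - dot p (X i) ?b" "y i - dot p (X i) b"] u h by (simp add: abs_mult)
  qed
  let ?l = "lam * sqrt (u * (1 - u))"
  have l: "0 \<le> ?l" using lam u by simp
  define O1 where "O1 = (\<Sum>i<n. rho u (y i - dot p (X i) b))"
  define O2 where "O2 = (\<Sum>i<n. rho u (y i - dot p (X i) ?b))"
  define P1 where "P1 = (\<Sum>j<p. sigma_hat n X j * \<bar>b j\<bar>)"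
  define P2 where "P2 = (\<Sum>j<p. sigma_hat n X j * \<bar>?b j\<bar>)"
  have "(O1 + ?l * P1) / real n \<le> (O2 + ?l * P2) / real n"
    using min unfolding is_minimizer_def penalized_obj_def O1_def O2_def P1_def P2_def
    by (simp add: add_divide_distrib)
  then have "O1 + ?l * P1 \<le> O2 + ?l * P2" using n by (simp add: divide_le_cancel)
  moreover have "?l * P2 \<le> ?l * (P1 - h * (real (card S) / 2))"
    using l pen unfolding P1_def P2_def by (intro mult_left_mono)
  ultimately have "h * (?l * (real (card S) / 2)) \<le> h * (\<Sum>i<n. \<bar>dot p (X i) ?d\<bar>)"
    using loss unfolding O1_def O2_def by (simp add: right_diff_distrib mult_ac)
  then show ?thesis using h by simp
qed

text \<open>By convexity the penalized objective on the segment from \<beta> to the minimizer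
  nowhere exceeds its value at \<beta>. The basic inequality thus survives scaling the error down,
  and the factor \<theta> can be chosen to suit.\<close>

lemma minimizer_scaled_inequality:
  assumes min: "is_minimizer n p X y lam u b" and n: "0 < n"
    and u: "0 < u" "u < 1" and lam: "0 \<le> lam" and \<theta>: "0 \<le> \<theta>" "\<theta> \<le> 1"
    and d: "d = (\<lambda>j. \<theta> * (b j - \<beta> j))"
  shows "(\<Sum>i<n. rho u (y i - dot p (X i) \<beta> - dot p (X i) d) - rho u (y i - dot p (X i) \<beta>))
    + lam * sqrt (u * (1 - u)) * (\<Sum>j<p. sigma_hat n X j * (\<bar>\<beta> j + d j\<bar> - \<bar>\<beta> j\<bar>)) \<le> 0"
proof -
  let ?l = "lam * sqrt (u * (1 - u))"
  have l: "0 \<le> ?l" using lam u by simp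
  let ?O = "\<lambda>b. (\<Sum>i<n. rho u (y i - dot p (X i) b)) + ?l * (\<Sum>j<p. sigma_hat n X j * \<bar>b j\<bar>)"
  have "?O b / real n \<le> ?O \<beta> / real n"
    using min unfolding is_minimizer_def penalized_obj_def by (simp add: add_divide_distrib)
  then have m: "?O b \<le> ?O \<beta>" using n by (simp add: divide_le_cancel)
  have dd: "dot p (X i) d = \<theta> * (dot p (X i) b - dot p (X i) \<beta>)" for i
    unfolding d dot_scale dot_diff ..
  have loss: "(\<Sum>i<n. rho u (y i - dot p (X i) \<beta> - dot p (X i) d))
    \<le> (1 - \<theta>) * (\<Sum>i<n. rho u (y i - dot p (X i) \<beta>)) + \<theta> * (\<Sum>i<n. rho u (y i - dot p (X i) b))"
    unfolding sum_distrib_left sum.distrib[symmetric]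
  proof (intro sum_mono)
    fix i
    have "y i - dot p (X i) \<beta> - dot p (X i) d = (1 - \<theta>) * (y i - dot p (X i) \<beta>) + \<theta> * (y i - dot p (X i) b)"
      by (simp add: dd algebra_simps)
    then show "rho u (y i - dot p (X i) \<beta> - dot p (X i) d)
       \<le> (1 - \<theta>) * rho u (y i - dot p (X i) \<beta>) + \<theta> * rho u (y i - dot p (X i) b)"
      using rho_convex[OF \<theta>, of u "y i - dot p (X i) \<beta>" "y i - dot p (X i) b"] by simp
  qed
  have pen: "(\<Sum>j<p. sigma_hat n X j * \<bar>\<beta> j + d j\<bar>)
     \<le> (1 - \<theta>) * (\<Sum>j<p. sigma_hat n X j * \<bar>\<beta> j\<bar>) + \<theta> * (\<Sum>j<p. sigma_hat n X j * \<bar>b j\<bar>)"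
    unfolding sum_distrib_left sum.distrib[symmetric]
  proof (intro sum_mono)
    fix j
    have "\<beta> j + d j = (1 - \<theta>) * \<beta> j + \<theta> * b j" by (simp add: d algebra_simps)
    then have "\<bar>\<beta> j + d j\<bar> \<le> \<bar>(1 - \<theta>) * \<beta> j\<bar> + \<bar>\<theta> * b j\<bar>" by (simp add: abs_triangle_ineq)
    also have "\<dots> = (1 - \<theta>) * \<bar>\<beta> j\<bar> + \<theta> * \<bar>b j\<bar>" using \<theta> by (simp add: abs_mult)
    finally have "sigma_hat n X j * \<bar>\<beta> j + d j\<bar> \<le> sigma_hat n X j * ((1 - \<theta>) * \<bar>\<beta> j\<bar> + \<theta> * \<bar>b j\<bar>)"
      by (intro mult_left_mono) auto
    then show "sigma_hat n X j * \<bar>\<beta> j + d j\<bar>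
       \<le> (1 - \<theta>) * (sigma_hat n X j * \<bar>\<beta> j\<bar>) + \<theta> * (sigma_hat n X j * \<bar>b j\<bar>)"
      by (simp add: algebra_simps)
  qed
  define A1 where "A1 = (\<Sum>i<n. rho u (y i - dot p (X i) \<beta>))"
  define A2 where "A2 = (\<Sum>i<n. rho u (y i - dot p (X i) b))"
  define B1 where "B1 = (\<Sum>j<p. sigma_hat n X j * \<bar>\<beta> j\<bar>)"
  define B2 where "B2 = (\<Sum>j<p. sigma_hat n X j * \<bar>b j\<bar>)"
  have "?l * (\<Sum>j<p. sigma_hat n X j * \<bar>\<beta> j + d j\<bar>) \<le> ?l * ((1 - \<theta>) * B1 + \<theta> * B2)"
    using l pen unfolding B1_def B2_def by (intro mult_left_mono)
  moreover have "\<theta> * (A2 + ?l * B2) \<le> \<theta> * (A1 + ?l * B1)"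
    using m \<theta> unfolding A1_def A2_def B1_def B2_def by (intro mult_left_mono)
  moreover have "?l * (\<Sum>j<p. sigma_hat n X j * (\<bar>\<beta> j + d j\<bar> - \<bar>\<beta> j\<bar>)) = ?l * (\<Sum>j<p. sigma_hat n X j * \<bar>\<beta> j + d j\<bar>) - ?l * B1"
    unfolding B1_def by (simp only: right_diff_distrib sum_subtractf)
  moreover have "\<theta> * (A2 + ?l * B2) = \<theta> * A2 + ?l * (\<theta> * B2)" "\<theta> * (A1 + ?l * B1) = \<theta> * A1 + ?l * (\<theta> * B1)"
    "?l * ((1 - \<theta>) * B1 + \<theta> * B2) = ?l * B1 - ?l * (\<theta> * B1) + ?l * (\<theta> * B2)" "(1 - \<theta>) * A1 = A1 - \<theta> * A1"
    by (simp_all add: algebra_simps)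
  ultimately show ?thesis using loss unfolding A1_def[symmetric] A2_def[symmetric] sum_subtractf
    by linarith
qed

lemma sum_lessThan_split_supp:
  "(\<Sum>j<p. f j) = (\<Sum>j\<in>supp p \<beta>. f j) + (\<Sum>j\<in>{..<p} - supp p \<beta>. (f j :: real))"
  using sum.subset_diff[OF supp_subset[of p \<beta>], of f] by simp

text \<open>Off the support \<beta> vanishes and the change of the penalty is exact; on the support
  the triangle inequality is used.\<close>

lemma penalty_lower_bound:
  "(\<Sum>j<p. sigma_hat n X j * (\<bar>\<beta> j + d j\<bar> - \<bar>\<beta> j\<bar>))
    \<ge> (\<Sum>j\<in>{..<p} - supp p \<beta>. sigma_hat n X j * \<bar>d j\<bar>) - (\<Sum>j\<in>supp p \<beta>. sigma_hat n X j * \<bar>d j\<bar>)"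
proof -
  have "(\<Sum>j\<in>supp p \<beta>. sigma_hat n X j * (\<bar>\<beta> j + d j\<bar> - \<bar>\<beta> j\<bar>)) \<ge> (\<Sum>j\<in>supp p \<beta>. - (sigma_hat n X j * \<bar>d j\<bar>))"
  proof (intro sum_mono)
    fix j
    have "- \<bar>d j\<bar> \<le> \<bar>\<beta> j + d j\<bar> - \<bar>\<beta> j\<bar>" by linarith
    then have "sigma_hat n X j * (- \<bar>d j\<bar>) \<le> sigma_hat n X j * (\<bar>\<beta> j + d j\<bar> - \<bar>\<beta> j\<bar>)"
      by (intro mult_left_mono) auto
    then show "- (sigma_hat n X j * \<bar>d j\<bar>) \<le> sigma_hat n X j * (\<bar>\<beta> j + d j\<bar> - \<bar>\<beta> j\<bar>)" by simp
  qed
  moreover have "(\<Sum>j\<in>{..<p} - supp p \<beta>. sigma_hat n X j * (\<bar>\<beta> j + d j\<bar> - \<bar>\<beta> j\<bar>))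
      = (\<Sum>j\<in>{..<p} - supp p \<beta>. sigma_hat n X j * \<bar>d j\<bar>)"
    by (intro sum.cong) (auto simp: supp_def)
  ultimately show ?thesis unfolding sum_lessThan_split_supp[of _ p \<beta>] by (simp add: sum_negf)
qed

text \<open>The penalty off the support is nonnegative and dropped. What remains carries the factor
  1/2 * 3/2 = 3/4, from sqrt (u (1 - u)) \<le> 1/2 and \<open>sigma_hat\<close> \<le> 3/2.\<close>

lemma scaled_error_loss_bound:
  assumes min: "is_minimizer n p X y lam u b" and n: "0 < n"
    and u: "0 < u" "u < 1" and lam: "0 \<le> lam" and \<theta>: "0 \<le> \<theta>" "\<theta> \<le> 1"
    and d: "d = (\<lambda>j. \<theta> * (b j - \<beta> j))"
    and sig: "\<And>j. j < p \<Longrightarrow> 1/2 \<le> sigma_hat n X j \<and> sigma_hat n X j \<le> 3/2"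
  shows "(\<Sum>i<n. rho u (y i - dot p (X i) \<beta> - dot p (X i) d) - rho u (y i - dot p (X i) \<beta>))
    \<le> 3/4 * lam * (\<Sum>j\<in>supp p \<beta>. \<bar>d j\<bar>)"
proof -
  let ?l = "lam * sqrt (u * (1 - u))"
  have l: "0 \<le> ?l" using lam u by simp
  have "sqrt (u * (1 - u)) \<le> 1/2"
  proof (rule real_le_lsqrt)
    have "0 \<le> (1/2 - u)\<^sup>2" by simp
    then show "u * (1 - u) \<le> (1/2)\<^sup>2" by (simp add: power2_eq_square algebra_simps)
  qed (use u in auto)
  then have l2: "?l \<le> lam * (1/2)" using lam by (intro mult_left_mono)
  have "(\<Sum>j\<in>supp p \<beta>. sigma_hat n X j * \<bar>d j\<bar>) \<le> (\<Sum>j\<in>supp p \<beta>. 3/2 * \<bar>d j\<bar>)"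
    using sig supp_subset[of p \<beta>] by (intro sum_mono mult_right_mono) auto
  also have "\<dots> = 3/2 * (\<Sum>j\<in>supp p \<beta>. \<bar>d j\<bar>)" by (simp add: sum_distrib_left)
  finally have a: "(\<Sum>j\<in>supp p \<beta>. sigma_hat n X j * \<bar>d j\<bar>) \<le> 3/2 * (\<Sum>j\<in>supp p \<beta>. \<bar>d j\<bar>)" .
  have b: "0 \<le> (\<Sum>j\<in>{..<p} - supp p \<beta>. sigma_hat n X j * \<bar>d j\<bar>)" by (intro sum_nonneg) auto
  have "- (3/2 * (\<Sum>j\<in>supp p \<beta>. \<bar>d j\<bar>)) \<le> (\<Sum>j<p. sigma_hat n X j * (\<bar>\<beta> j + d j\<bar> - \<bar>\<beta> j\<bar>))"
    using penalty_lower_bound[where p = p and \<beta> = \<beta> and n = n and X = X and d = d] a b by linarith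
  then have "?l * (- (3/2 * (\<Sum>j\<in>supp p \<beta>. \<bar>d j\<bar>))) \<le> ?l * (\<Sum>j<p. sigma_hat n X j * (\<bar>\<beta> j + d j\<bar> - \<bar>\<beta> j\<bar>))"
    using l by (intro mult_left_mono)
  moreover have "?l * (3/2 * (\<Sum>j\<in>supp p \<beta>. \<bar>d j\<bar>)) \<le> (lam * (1/2)) * (3/2 * (\<Sum>j\<in>supp p \<beta>. \<bar>d j\<bar>))"
    using l2 by (intro mult_right_mono) (auto intro: sum_nonneg)
  ultimately show ?thesis using minimizer_scaled_inequality[OF min n u lam \<theta> d] by simp
qed

text \<open>The subgradient of the loss at \<beta>, paired with the error, is at most \<Lambda>
  times the weighted l1-norm of the error. The ratio (c0 + 3) / (c0 - 3) is made for the outcome 3 e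
  \<le> c0 a in weighted norms; the 3 is then spent on the weights, which lie between 1/2 and
  3/2.\<close>

lemma error_in_cone:
  assumes min: "is_minimizer n p X y lam u b" and n: "0 < n"
    and u: "0 < u" "u < 1" and c0: "9 \<le> c0"
    and sig: "\<And>j. j < p \<Longrightarrow> 1/2 \<le> sigma_hat n X j \<and> sigma_hat n X j \<le> 3/2"
    and score: "\<And>j. j < p \<Longrightarrow> \<bar>\<Sum>i<n. X i j * (u - of_bool (y i \<le> dot p (X i) \<beta>))\<bar>
        \<le> \<Lambda> * (sigma_hat n X j * sqrt (u * (1 - u)))"
    and lam: "(c0 + 3) / (c0 - 3) * \<Lambda> \<le> lam" "0 < lam"
  shows "(\<Sum>j\<in>{..<p} - supp p \<beta>. \<bar>b j - \<beta> j\<bar>) \<le> c0 * (\<Sum>j\<in>supp p \<beta>. \<bar>b j - \<beta> j\<bar>)"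
proof -
  let ?d = "\<lambda>j. b j - \<beta> j"
  let ?q = "sqrt (u * (1 - u))"
  have q: "0 < ?q" using u by simp
  have main: "(\<Sum>i<n. rho u (y i - dot p (X i) \<beta> - dot p (X i) ?d) - rho u (y i - dot p (X i) \<beta>))
    + lam * ?q * (\<Sum>j<p. sigma_hat n X j * (\<bar>\<beta> j + ?d j\<bar> - \<bar>\<beta> j\<bar>)) \<le> 0"
    using lam by (intro minimizer_scaled_inequality[OF min n u, of 1]) auto
  define S where "S = (\<Sum>i<n. rho u (y i - dot p (X i) \<beta> - dot p (X i) ?d) - rho u (y i - dot p (X i) \<beta>))"
  have "- (\<Lambda> * ?q * (\<Sum>j<p. sigma_hat n X j * \<bar>?d j\<bar>)) = - (\<Sum>j<p. (\<Lambda> * (sigma_hat n X j * ?q)) * \<bar>?d j\<bar>)"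
    unfolding sum_distrib_left by (intro arg_cong[of _ _ uminus] sum.cong refl) (simp only: mult_ac)
  also have "\<dots> \<le> - (\<Sum>j<p. (\<Sum>i<n. X i j * (u - of_bool (y i \<le> dot p (X i) \<beta>))) * ?d j)"
    unfolding neg_le_iff_le
  proof (intro sum_mono)
    fix j assume "j \<in> {..<p}"
    have "(\<Sum>i<n. X i j * (u - of_bool (y i \<le> dot p (X i) \<beta>))) * ?d j
      \<le> \<bar>\<Sum>i<n. X i j * (u - of_bool (y i \<le> dot p (X i) \<beta>))\<bar> * \<bar>?d j\<bar>"
      unfolding abs_mult[symmetric] by (rule abs_ge_self)
    also have "\<dots> \<le> (\<Lambda> * (sigma_hat n X j * ?q)) * \<bar>?d j\<bar>"
      using \<open>j \<in> _\<close> by (intro mult_right_mono score) auto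
    finally show "(\<Sum>i<n. X i j * (u - of_bool (y i \<le> dot p (X i) \<beta>))) * ?d j
      \<le> (\<Lambda> * (sigma_hat n X j * ?q)) * \<bar>?d j\<bar>" .
  qed
  also have "\<dots> = - (\<Sum>i<n. \<Sum>j<p. (X i j * (u - of_bool (y i \<le> dot p (X i) \<beta>))) * ?d j)"
    unfolding sum_distrib_right by (subst sum.swap) (rule refl)
  also have "\<dots> = (\<Sum>i<n. - ((u - of_bool (y i - dot p (X i) \<beta> \<le> 0)) * dot p (X i) ?d))"
    unfolding sum_negf[symmetric]
    by (intro sum.cong refl) (simp add: dot_def sum_distrib_left sum_negf mult_ac)
  also have "\<dots> \<le> S"
    unfolding S_def by (intro sum_mono rho_subgradient)
  finally have low: "S \<ge> - (\<Lambda> * ?q * (\<Sum>j<p. sigma_hat n X j * \<bar>?d j\<bar>))" .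
  define a where "a = (\<Sum>j\<in>supp p \<beta>. sigma_hat n X j * \<bar>?d j\<bar>)"
  define e where "e = (\<Sum>j\<in>{..<p} - supp p \<beta>. sigma_hat n X j * \<bar>?d j\<bar>)"
  have ae: "0 \<le> a" "0 \<le> e" unfolding a_def e_def by (auto intro!: sum_nonneg)
  have "lam * ?q * (e - a) \<le> lam * ?q * (\<Sum>j<p. sigma_hat n X j * (\<bar>\<beta> j + ?d j\<bar> - \<bar>\<beta> j\<bar>))"
    using penalty_lower_bound[where p = p and \<beta> = \<beta> and n = n and X = X and d = ?d] lam q unfolding a_def e_def
    by (intro mult_left_mono) auto
  moreover have "(\<Sum>j<p. sigma_hat n X j * \<bar>?d j\<bar>) = a + e"
    unfolding a_def e_def by (rule sum_lessThan_split_supp)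
  ultimately have "lam * ?q * (e - a) \<le> \<Lambda> * ?q * (a + e)" using main low unfolding S_def[symmetric] by simp
  then have "?q * (lam * (e - a)) \<le> ?q * (\<Lambda> * (a + e))" by (simp add: mult_ac)
  then have 1: "lam * (e - a) \<le> \<Lambda> * (a + e)" using q by simp
  have "(c0 + 3) / (c0 - 3) * \<Lambda> * (c0 - 3) \<le> lam * (c0 - 3)" using lam(1) c0 by (intro mult_right_mono) auto
  then have "\<Lambda> * (c0 + 3) \<le> lam * (c0 - 3)" using c0 by (simp add: mult.commute)
  then have "(\<Lambda> * (c0 + 3)) * (a + e) \<le> (lam * (c0 - 3)) * (a + e)"
    using ae by (intro mult_right_mono) auto
  moreover have "(c0 + 3) * (lam * (e - a)) \<le> (c0 + 3) * (\<Lambda> * (a + e))"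
    using 1 c0 by (intro mult_left_mono) auto
  ultimately have "lam * ((c0 + 3) * (e - a)) \<le> lam * ((c0 - 3) * (a + e))" by (simp add: mult_ac)
  then have "(c0 + 3) * (e - a) \<le> (c0 - 3) * (a + e)" using lam by simp
  then have 2: "3 * e \<le> c0 * a" by (simp add: algebra_simps)
  have "(\<Sum>j\<in>{..<p} - supp p \<beta>. 1/2 * \<bar>?d j\<bar>) \<le> e"
    unfolding e_def using sig by (intro sum_mono mult_right_mono) auto
  moreover have "a \<le> (\<Sum>j\<in>supp p \<beta>. 3/2 * \<bar>?d j\<bar>)"
    unfolding a_def using sig supp_subset[of p \<beta>] by (intro sum_mono mult_right_mono) auto
  moreover from this have "c0 * a \<le> c0 * (\<Sum>j\<in>supp p \<beta>. 3/2 * \<bar>?d j\<bar>)"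
    using c0 by (intro mult_left_mono) auto
  ultimately show ?thesis using 2 unfolding sum_distrib_left[symmetric] by linarith
qed

section \<open>Densities with bounded derivative\<close>

locale smooth_density =
  fixes f :: "real \<Rightarrow> real" and B :: real
  assumes f_measurable [measurable]: "f \<in> borel_measurable borel"
    and f_nonneg: "\<And>v. 0 \<le> f v"
    and f_mass: "(\<integral>\<^sup>+v. ennreal (f v) \<partial>lborel) = 1"
    and f_diff: "\<And>v. f differentiable at v"
    and f_deriv: "\<And>v. \<bar>deriv f v\<bar> \<le> B"
begin

definition N :: "real measure" where "N = density lborel (\<lambda>v. ennreal (f v))"

definition F :: "real \<Rightarrow> real" where "F v = measure N {..v}"

lemma sets_N [measurable_cong, simp]: "sets N = sets borel" and space_N [simp]: "space N = UNIV"
  by (simp_all add: N_def)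

sublocale N: real_distribution N
proof -
  have "prob_space N"
    by (rule prob_spaceI) (simp add: N_def emeasure_density f_mass)
  then show "real_distribution N" by (simp add: real_distribution_def real_distribution_axioms_def)
qed

lemma F_eq_cdf: "F = cdf N" by (auto simp: F_def cdf_def)

lemma emeasure_N: "A \<in> sets borel \<Longrightarrow> emeasure N A = (\<integral>\<^sup>+v. ennreal (f v) * indicator A v \<partial>lborel)"
  by (simp add: N_def emeasure_density)

lemma N_singleton: "measure N {v} = 0"
proof -
  have "absolutely_continuous lborel N" unfolding N_def by (rule absolutely_continuousI_density) simp
  moreover have "{v} \<in> null_sets lborel" by (rule null_setsI) auto
  ultimately have "emeasure N {v} = 0" unfolding absolutely_continuous_def by auto
  then show ?thesis by (simp add: measure_def)
qed

lemma F_isCont: "isCont F v"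
  unfolding F_eq_cdf N.isCont_cdf by (rule N_singleton)

lemma F_mono: "a \<le> b \<Longrightarrow> F a \<le> F b"
  unfolding F_eq_cdf by (rule N.cdf_nondecreasing)

lemma F_bounds: "0 \<le> F v" "F v \<le> 1"
  by (simp_all add: F_def)

lemma F_measurable [measurable]: "F \<in> borel_measurable borel"
  using F_isCont by (intro borel_measurable_continuous_onI continuous_at_imp_continuous_on) auto

text \<open>Continuity of \<open>F\<close> makes the infimum an exact solution: closedness of {u
  \<le> F} gives one inequality, the limit from the left the other.\<close>

lemma F_quantile:
  assumes "0 < u" "u < 1"
  shows "F (quantile N u) = u"
proof -
  let ?S = "{v. u \<le> F v}"
  have "\<forall>\<^sub>F v in at_top. F v > u"
    unfolding F_eq_cdf using N.cdf_lim_at_top_prob assms by (intro order_tendstoD(1)) auto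
  then have "\<exists>v. F v > u" by (auto simp: eventually_at_top_linorder)
  then have ne: "?S \<noteq> {}" by (auto intro: less_imp_le)
  have "\<forall>\<^sub>F v in at_bot. F v < u"
    unfolding F_eq_cdf using N.cdf_lim_at_bot assms by (intro order_tendstoD(2)) auto
  then obtain l where l: "F l < u" by (auto simp: eventually_at_bot_linorder)
  have lb: "l \<le> v" if "v \<in> ?S" for v
  proof (rule ccontr)
    assume "\<not> l \<le> v" then have "F v \<le> F l" by (intro F_mono) auto
    then show False using that l by auto
  qed
  then have bb: "bdd_below ?S" by (rule bdd_belowI)
  have cl: "closed ?S"
    by (intro closed_Collect_le continuous_intros continuous_at_imp_continuous_on ballI F_isCont)
  have q: "quantile N u = Inf ?S" by (simp add: quantile_def F_def)
  have "Inf ?S \<in> ?S" by (rule closed_contains_Inf[OF ne bb cl])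
  then have ge: "u \<le> F (Inf ?S)" by simp
  have "F (Inf ?S) \<le> u"
  proof (rule tendsto_upperbound)
    show "(F \<longlongrightarrow> F (Inf ?S)) (at_left (Inf ?S))"
      using F_isCont[of "Inf ?S"] unfolding isCont_def by (rule filterlim_mono[OF _ order_refl]) (simp add: at_le)
    show "\<forall>\<^sub>F v in at_left (Inf ?S). F v \<le> u"
    proof (rule eventually_at_leftI[of "Inf ?S - 1"])
      fix v assume "v \<in> {Inf ?S - 1<..<Inf ?S}"
      then have "v \<notin> ?S" using cInf_lower[OF _ bb, of v] by auto
      then show "F v \<le> u" by simp
    qed simp
  qed simp
  with ge q show ?thesis by simp
qed

lemma f_lower: "f v \<ge> f q - B * \<bar>v - q\<bar>"
proof -
  have "\<bar>f v - f q\<bar> \<le> B * \<bar>v - q\<bar>"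
  proof (rule field_differentiable_bound[of UNIV f "deriv f", simplified, unfolded real_norm_def])
    fix z show "DERIV f z :> deriv f z" using f_diff[of z] by (simp add: DERIV_deriv_iff_real_differentiable)
  qed (rule f_deriv)
  then show ?thesis by linarith
qed

lemma B_nonneg: "0 \<le> B" using f_deriv[of 0] by linarith

lemma F_increment_lower:
  assumes "0 \<le> h" "0 \<le> c" "\<And>v. q < v \<Longrightarrow> v \<le> q + h \<Longrightarrow> c \<le> f v"
  shows "c * h \<le> F (q + h) - F q"
proof -
  have "ennreal (c * h) = (\<integral>\<^sup>+v. ennreal c * indicator {q<..q+h} v \<partial>lborel)"
    using assms by (simp add: nn_integral_cmult_indicator ennreal_mult)
  also have "\<dots> \<le> (\<integral>\<^sup>+v. ennreal (f v) * indicator {q<..q+h} v \<partial>lborel)"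
    using assms(3) by (intro nn_integral_mono) (auto simp: indicator_def intro!: ennreal_leI)
  also have "\<dots> = ennreal (measure N {q<..q+h})"
    by (simp add: emeasure_N[symmetric] N.emeasure_eq_measure)
  finally have "c * h \<le> measure N {q<..q+h}" by simp
  also have "\<dots> = F (q + h) - F q"
    unfolding F_eq_cdf using assms(1)
    by (cases "h = 0") (auto simp: N.cdf_diff_eq)
  finally show ?thesis .
qed

text \<open>With derivative bounded by B the density falls from c to c/2 only over a distance of at
  least c / (2B), and this stretch carries mass at least c^2 / (4B). A smaller increment of
  \<open>F\<close> keeps b inside the stretch, where the density is at least c/2.\<close>

lemma quantile_increment_le:
  assumes c: "0 < c" "c < f a" and B: "0 < B" and Fab: "F b - F a < c\<^sup>2 / (4 * B)"
  shows "b - a \<le> 2 * (F b - F a) / c \<or> b < a"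
proof (cases "b < a")
  case False
  define h where "h = min (b - a) (c / (2 * B))"
  have h: "0 \<le> h" using False c B by (simp add: h_def)
  have low: "c / 2 \<le> f v" if "a < v" "v \<le> a + h" for v
  proof -
    have "B * \<bar>v - a\<bar> \<le> B * (c / (2 * B))" using that B by (intro mult_left_mono) (auto simp: h_def)
    then show ?thesis using f_lower[of a v] c B by simp
  qed
  have 1: "c / 2 * h \<le> F (a + h) - F a" using c h low by (intro F_increment_lower) auto
  have 2: "F (a + h) \<le> F b" by (intro F_mono) (simp add: h_def)
  have "h \<noteq> c / (2 * B)"
  proof
    assume "h = c / (2 * B)"
    then have "c\<^sup>2 / (4 * B) \<le> F b - F a" using 1 2 B by (simp add: power2_eq_square)
    then show False using Fab by simp
  qed
  then have "h = b - a" by (auto simp: h_def min_def split: if_splits)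
  then have "c / 2 * (b - a) \<le> F b - F a" using 1 2 by simp
  then show ?thesis using c by (simp add: field_simps)
qed simp

text \<open>\<open>F\<close> may be flat elsewhere, but it increases strictly just to the right of a
  point of positive density.\<close>

lemma le_iff_F_le:
  assumes "0 < f q"
  shows "v \<le> q \<longleftrightarrow> F v \<le> F q"
proof (cases "v \<le> q")
  case False
  \<comment> \<open>\<open>B + 1\<close> rather than \<open>B\<close> in the denominator, since the
    derivative bound may be 0.\<close>
  define h where "h = min (v - q) (f q / (2 * (B + 1)))"
  have h: "0 < h" using False assms B_nonneg by (simp add: h_def)
  have low: "f q / 2 \<le> f w" if "q < w" "w \<le> q + h" for w
  proof -
    have "B * \<bar>w - q\<bar> \<le> (B + 1) * \<bar>w - q\<bar>" by (intro mult_right_mono) auto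
    also have "\<dots> \<le> (B + 1) * (f q / (2 * (B + 1)))"
      using that B_nonneg by (intro mult_left_mono) (auto simp: h_def)
    also have "\<dots> = f q / 2"
    proof -
      have "x * (y / (2 * x)) = y / 2" if "x \<noteq> 0" for x y :: real using that by simp
      then show ?thesis using B_nonneg by (metis add_nonneg_pos less_irrefl zero_less_one)
    qed
    finally show ?thesis using f_lower[of q w] by simp
  qed
  have "f q / 2 * h \<le> F (q + h) - F q" using assms h low by (intro F_increment_lower) auto
  moreover have "0 < f q / 2 * h" using assms h by simp
  moreover have "F (q + h) \<le> F v" by (intro F_mono) (simp add: h_def)
  ultimately show ?thesis using False by linarith
qed (simp add: F_mono)

text \<open>The probability integral transform for a continuous, possibly not injective
  \<open>F\<close>: for c strictly between 0 and 1 the sublevel set of \<open>F\<close> at c is a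
  closed half-line, and \<open>F\<close> equals c at its end point.\<close>

lemma distr_F_uniform: "distr N borel F = uniform_measure lborel {0<..<1}"
proof (rule cdf_unique)
  show "real_distribution (distr N borel F)"
    by (intro real_distribution.intro N.prob_space_distr real_distribution_axioms.intro) simp_all
  have pu: "prob_space (uniform_measure lborel {0<..<1::real})"
    by (rule prob_space_uniform_measure) auto
  then show "real_distribution (uniform_measure lborel {0<..<1})"
    by (intro real_distribution.intro real_distribution_axioms.intro) simp_all
  interpret U: prob_space "uniform_measure lborel {0<..<1::real}" by (rule pu)
  have mid: "measure N {v. F v \<le> c} = c" if c: "0 < c" "c < 1" for c
  proof -
    let ?S = "{v. F v \<le> c}"
    define m where "m = quantile N c"
    have Fm: "F m = c" unfolding m_def by (rule F_quantile[OF c])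
    have "\<forall>\<^sub>F v in at_top. F v > c"
      unfolding F_eq_cdf using N.cdf_lim_at_top_prob c by (intro order_tendstoD(1)) auto
    then obtain r where r: "F r > c" by (auto simp: eventually_at_top_linorder)
    have "v \<le> r" if "v \<in> ?S" for v using that r F_mono[of r v] by (cases "v \<le> r") auto
    then have bb: "bdd_above ?S" by (rule bdd_aboveI)
    have ne: "?S \<noteq> {}" using Fm by auto
    have "closed ?S"
      by (intro closed_Collect_le continuous_intros continuous_at_imp_continuous_on ballI F_isCont)
    then have in_S: "Sup ?S \<in> ?S" by (rule closed_contains_Sup[OF ne bb])
    have "?S = {..Sup ?S}"
    proof
      show "?S \<subseteq> {..Sup ?S}" using cSup_upper[OF _ bb] by auto
      show "{..Sup ?S} \<subseteq> ?S" using in_S by (auto dest: F_mono)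
    qed
    then have "measure N ?S = F (Sup ?S)" by (simp add: F_def)
    moreover have "m \<le> Sup ?S" using Fm by (intro cSup_upper bb) auto
    then have "c \<le> F (Sup ?S)" using F_mono Fm by auto
    ultimately show ?thesis using in_S by simp
  qed
  show "cdf (distr N borel F) = cdf (uniform_measure lborel {0<..<1})"
  proof
    fix c :: real
    have l: "cdf (distr N borel F) c = measure N {v. F v \<le> c}"
      unfolding cdf_def by (subst measure_distr) (auto simp: vimage_def)
    have r: "cdf (uniform_measure lborel {0<..<1}) c = measure lborel ({0<..<1} \<inter> {..c})"
      unfolding cdf_def by (subst measure_uniform_measure) auto
    consider "c \<le> 0" | "0 < c" "c < 1" | "1 \<le> c" by linarith
    then show "cdf (distr N borel F) c = cdf (uniform_measure lborel {0<..<1}) c"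
    proof cases
      case 1
      \<comment> \<open>There is no quantile to use at level 0 or below; the value is squeezed by
        small positive levels e.\<close>
      have "measure N {v. F v \<le> c} \<le> e" if "0 < e" "e < 1" for e
      proof -
        have "measure N {v. F v \<le> c} \<le> measure N {v. F v \<le> e}"
          using 1 that by (intro N.finite_measure_mono) auto
        then show ?thesis using mid[OF that] by simp
      qed
      then have "measure N {v. F v \<le> c} \<le> 0" by (intro dense_ge_bounded[of 0 1]) auto
      moreover have "{0<..<1} \<inter> {..c} = {}" using 1 by auto
      ultimately show ?thesis unfolding l r by (simp add: measure_le_0_iff)
    next
      case 2
      then have "{0<..<1} \<inter> {..c} = {0<..c}" by auto
      then show ?thesis unfolding l r using mid 2 by simp
    next
      case 3
      then have "{v. F v \<le> c} = space N" using F_bounds(2) order_trans by auto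
      moreover have "{0<..<1} \<inter> {..c} = {0<..<1}" using 3 by auto
      ultimately show ?thesis unfolding l r by (simp add: N.prob_space del: space_N)
    qed
  qed
qed

definition hat :: "real \<Rightarrow> real \<Rightarrow> real" where
  "hat a w = (if 0 \<le> a then (a - w) * indicator {0<..a} w else (w - a) * indicator {a<..0} w)"

text \<open>Knight's identity. The remainder \<open>hat a w\<close> is the integral of 1{w \<le> s}
  - 1{w \<le> 0} over s from 0 to a, written out so that its nonnegativity is visible.\<close>

lemma rho_knight: "rho u (w - a) - rho u w = - (a * (u - of_bool (w \<le> 0))) + hat a w"
  by (auto simp: rho_def hat_def indicator_def algebra_simps)

lemma hat_bounds: "0 \<le> hat a w" "hat a w \<le> \<bar>a\<bar>"
  by (auto simp: hat_def indicator_def)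

lemma hat_measurable [measurable]: "hat a \<in> borel_measurable borel"
  unfolding hat_def by (cases "0 \<le> a") simp_all

text \<open>The remainder integrated against the tent c - B |v - q| that minorizes a density with
  value c at q: the integrals of \<open>hat a w\<close> and |w| \<open>hat a w\<close> are a^2 / 2
  and |a|^3 / 6.\<close>

lemma hat_integral_lower:
  "c * a\<^sup>2 / 2 - B * \<bar>a\<bar> ^ 3 / 6 = (\<integral>v. (c - B * \<bar>v - q\<bar>) * hat a (v - q) \<partial>lborel)"
  "integrable lborel (\<lambda>v. (c - B * \<bar>v - q\<bar>) * hat a (v - q))"
proof -
  have "has_bochner_integral lborel (\<lambda>v. (c - B * \<bar>v - q\<bar>) * hat a (v - q)) (c * a\<^sup>2 / 2 - B * \<bar>a\<bar> ^ 3 / 6)"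
  proof (cases "0 \<le> a")
    case True
    \<comment> \<open>\<open>e1\<close> and \<open>e2\<close> are coefficients of the cubic
      primitive of (c - B w) (a - w) in w = v - q.\<close>
    define e1 where "e1 = (c + B * a) / 2"
    define e2 where "e2 = B / 3"
    have e: "2 * e1 = c + B * a" "3 * e2 = B" by (simp_all add: e1_def e2_def)
    let ?G = "\<lambda>v. c * a * (v - q) - e1 * (v - q)\<^sup>2 + e2 * (v - q) ^ 3"
    let ?g = "\<lambda>v. (c - B * (v - q)) * (a - (v - q))"
    have "has_bochner_integral lborel (\<lambda>v. ?g v * indicator {q..q+a} v) (?G (q + a) - ?G q)"
    proof (rule has_bochner_integral_FTC_Icc_real)
      fix v
      have "DERIV ?G v :> c * a - 2 * e1 * (v - q) + 3 * e2 * (v - q)\<^sup>2"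
        by (auto intro!: derivative_eq_intros simp: algebra_simps power2_eq_square)
      moreover have "c * a - 2 * e1 * (v - q) + 3 * e2 * (v - q)\<^sup>2 = ?g v"
        unfolding e by (simp add: algebra_simps power2_eq_square)
      ultimately show "DERIV ?G v :> ?g v" by simp
    qed (use True in \<open>auto intro!: continuous_intros\<close>)
    moreover have "?G (q + a) - ?G q = c * a\<^sup>2 / 2 - B * \<bar>a\<bar> ^ 3 / 6"
      using True by (simp add: e1_def e2_def power2_eq_square power3_eq_cube field_simps)
    moreover have "AE v in lborel. ?g v * indicator {q..q+a} v = (c - B * \<bar>v - q\<bar>) * hat a (v - q)"
      using AE_lborel_singleton[of q] by eventually_elim (use True in \<open>auto simp: hat_def indicator_def\<close>)
    ultimately show ?thesis
      by (subst has_bochner_integral_cong_AE[symmetric]) auto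
  next
    case False
    define e1 where "e1 = (c - B * a) / 2"
    define e2 where "e2 = B / 3"
    have e: "2 * e1 = c - B * a" "3 * e2 = B" by (simp_all add: e1_def e2_def)
    let ?G = "\<lambda>v. - (c * a * (v - q)) + e1 * (v - q)\<^sup>2 + e2 * (v - q) ^ 3"
    let ?g = "\<lambda>v. (c - B * (q - v)) * ((v - q) - a)"
    have "has_bochner_integral lborel (\<lambda>v. ?g v * indicator {q+a..q} v) (?G q - ?G (q + a))"
    proof (rule has_bochner_integral_FTC_Icc_real)
      fix v
      have "DERIV ?G v :> - (c * a) + 2 * e1 * (v - q) + 3 * e2 * (v - q)\<^sup>2"
        by (auto intro!: derivative_eq_intros simp: algebra_simps power2_eq_square)
      moreover have "- (c * a) + 2 * e1 * (v - q) + 3 * e2 * (v - q)\<^sup>2 = ?g v"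
        unfolding e by (simp add: algebra_simps power2_eq_square)
      ultimately show "DERIV ?G v :> ?g v" by simp
    qed (use False in \<open>auto intro!: continuous_intros\<close>)
    moreover have "?G q - ?G (q + a) = c * a\<^sup>2 / 2 - B * \<bar>a\<bar> ^ 3 / 6"
      using False by (simp add: e1_def e2_def power2_eq_square power3_eq_cube field_simps)
    moreover have "AE v in lborel. ?g v * indicator {q+a..q} v = (c - B * \<bar>v - q\<bar>) * hat a (v - q)"
      using AE_lborel_singleton[of "q + a"]
      by eventually_elim (use False in \<open>auto simp: hat_def indicator_def\<close>)
    ultimately show ?thesis
      by (subst has_bochner_integral_cong_AE[symmetric]) auto
  qed
  then show "c * a\<^sup>2 / 2 - B * \<bar>a\<bar> ^ 3 / 6 = (\<integral>v. (c - B * \<bar>v - q\<bar>) * hat a (v - q) \<partial>lborel)"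
    "integrable lborel (\<lambda>v. (c - B * \<bar>v - q\<bar>) * hat a (v - q))"
    by (auto simp: has_bochner_integral_iff)
qed

text \<open>The linear term of Knight's identity has mean zero exactly because F q = u. In the
  remainder the density is replaced by its tent minorant, which may be negative; multiplication by
  \<open>hat\<close> \<ge> 0 still preserves the inequality.\<close>

lemma check_excess_lower:
  assumes q: "F q = u"
  shows "(\<integral>v. rho u (v - q - a) - rho u (v - q) \<partial>N) \<ge> f q * a\<^sup>2 / 2 - B * \<bar>a\<bar> ^ 3 / 6"
proof -
  have i1: "integrable N (\<lambda>v. indicator {..q} v :: real)" by (rule N.integrable_const_bound[of _ 1]) auto
  have ih: "integrable N (\<lambda>v. hat a (v - q))"
    using hat_bounds by (intro N.integrable_const_bound[of _ "\<bar>a\<bar>"]) auto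
  have "(\<integral>v. rho u (v - q - a) - rho u (v - q) \<partial>N) = (\<integral>v. - (a * (u - indicator {..q} v)) + hat a (v - q) \<partial>N)"
    unfolding rho_knight by (intro Bochner_Integration.integral_cong) (auto simp: indicator_def)
  also have "\<dots> = - (a * (u - measure N {..q})) + (\<integral>v. hat a (v - q) \<partial>N)"
    using i1 ih by (simp add: N.prob_space[simplified])
  also have "\<dots> = (\<integral>v. hat a (v - q) \<partial>N)" using q by (simp add: F_def)
  also have "\<dots> = (\<integral>v. f v * hat a (v - q) \<partial>lborel)"
    unfolding N_def using f_nonneg by (subst integral_density) (auto simp: AE_I2)
  also have "\<dots> \<ge> (\<integral>v. (f q - B * \<bar>v - q\<bar>) * hat a (v - q) \<partial>lborel)"
  proof (rule integral_mono)
    show "integrable lborel (\<lambda>v. f v * hat a (v - q))"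
      using ih unfolding N_def using f_nonneg by (subst (asm) integrable_density) (auto simp: AE_I2)
    show "(f q - B * \<bar>v - q\<bar>) * hat a (v - q) \<le> f v * hat a (v - q)" for v
      using f_lower[of q v] hat_bounds(1) by (intro mult_right_mono) auto
  qed (rule hat_integral_lower)
  finally show ?thesis unfolding hat_integral_lower(1)[symmetric] by simp
qed

end

section \<open>Symmetrization with a ghost sample\<close>

text \<open>The double sample is fixed here and only the signs vary. Convexity of \<open>exp\<close>
  separates the two samples at the price of doubling the exponent in each; contraction then replaces
  the increments by linear forms, and the l1-ball bound applies to each sample.\<close>

lemma symmetrized_count_bound:
  fixes x x' :: "nat \<Rightarrow> nat \<Rightarrow> real" and G G' :: "nat \<Rightarrow> (nat \<Rightarrow> real) \<Rightarrow> real"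
  assumes F: "finite F" "F \<noteq> {}" and c: "0 < c" and R: "0 < R" and a: "0 < a" and V: "0 < V" and p: "0 < p"
    and l1: "\<And>d. d \<in> F \<Longrightarrow> (\<Sum>j<p. \<bar>d j\<bar>) \<le> R"
    and x: "\<And>j. j < p \<Longrightarrow> (\<Sum>i<n. (x i j)\<^sup>2) \<le> V" and x': "\<And>j. j < p \<Longrightarrow> (\<Sum>i<n. (x' i j)\<^sup>2) \<le> V"
    and G: "\<And>i d e. i < n \<Longrightarrow> \<bar>G i d - G i e\<bar> \<le> c * \<bar>dot p (x i) d - dot p (x i) e\<bar>"
      "\<And>i d. i < n \<Longrightarrow> \<bar>G i d\<bar> \<le> c * \<bar>dot p (x i) d\<bar>"
    and G': "\<And>i d e. i < n \<Longrightarrow> \<bar>G' i d - G' i e\<bar> \<le> c * \<bar>dot p (x' i) d - dot p (x' i) e\<bar>"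
      "\<And>i d. i < n \<Longrightarrow> \<bar>G' i d\<bar> \<le> c * \<bar>dot p (x' i) d\<bar>"
  shows "real (card {S \<in> Pow {..<n}. \<exists>d\<in>F. a < (\<Sum>i<n. rsign S i * (G' i d - G i d))})
    \<le> 2 ^ n * (2 * real p * exp (- (a\<^sup>2 / (8 * c\<^sup>2 * R\<^sup>2 * V))))"
proof -
  \<comment> \<open>Minimizer of 2 \<tau>^2 c^2 R^2 V - \<tau> a, the exponent left by Markov's
    inequality.\<close>
  define \<tau> where "\<tau> = a / (4 * c\<^sup>2 * R\<^sup>2 * V)"
  have \<tau>: "0 < \<tau>" using a c R V by (simp add: \<tau>_def)
  let ?m = "\<lambda>H S. MAX d\<in>F. \<Sum>i<n. rsign S i * (2 * \<tau> * H i d)"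
  have half: "(\<Sum>S\<in>Pow {..<n}. exp (?m H S)) \<le> 2 ^ n * (2 * real p * exp ((2 * \<tau> * c * R)\<^sup>2 * V / 2))"
    if H: "\<And>i d e. i < n \<Longrightarrow> \<bar>H i d - H i e\<bar> \<le> c * \<bar>dot p (z i) d - dot p (z i) e\<bar>"
      "\<And>i d. i < n \<Longrightarrow> \<bar>H i d\<bar> \<le> c * \<bar>dot p (z i) d\<bar>"
      and z: "\<And>j. j < p \<Longrightarrow> (\<Sum>i<n. (z i j)\<^sup>2) \<le> V" for H z
  proof -
    have "(\<Sum>S\<in>Pow {..<n}. exp (MAX d\<in>F. 0 + (\<Sum>i<n. rsign S i * (2 * \<tau> * H i d))))
       \<le> (\<Sum>S\<in>Pow {..<n}. exp (MAX d\<in>F. 0 + (\<Sum>i<n. rsign S i * (2 * \<tau> * c * dot p (z i) d))))"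
    proof (rule contraction_principle[OF F])
      fix i d e assume i: "i < n"
      have "\<bar>2 * \<tau> * H i d - 2 * \<tau> * H i e\<bar> = 2 * \<tau> * \<bar>H i d - H i e\<bar>"
        using \<tau> by (simp add: abs_mult right_diff_distrib[symmetric])
      also have "\<dots> \<le> 2 * \<tau> * (c * \<bar>dot p (z i) d - dot p (z i) e\<bar>)"
        using \<tau> H(1)[OF i] by (intro mult_left_mono) auto
      also have "\<dots> = \<bar>2 * \<tau> * c * dot p (z i) d - 2 * \<tau> * c * dot p (z i) e\<bar>"
        using \<tau> c by (simp add: abs_mult right_diff_distrib[symmetric])
      finally show "\<bar>2 * \<tau> * H i d - 2 * \<tau> * H i e\<bar> \<le> \<bar>2 * \<tau> * c * dot p (z i) d - 2 * \<tau> * c * dot p (z i) e\<bar>" .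
    next
      fix i d assume i: "i < n"
      have "2 * \<tau> * \<bar>H i d\<bar> \<le> 2 * \<tau> * (c * \<bar>dot p (z i) d\<bar>)"
        using \<tau> H(2)[OF i] by (intro mult_left_mono) auto
      then show "\<bar>2 * \<tau> * H i d\<bar> \<le> \<bar>2 * \<tau> * c * dot p (z i) d\<bar>" using \<tau> c by (simp add: abs_mult)
    qed
    also have "\<dots> \<le> 2 ^ n * (2 * real p * exp ((2 * \<tau> * c * R)\<^sup>2 * V / 2))"
      using rademacher_l1_ball_bound[OF F _ _ l1 p z, of "2 * \<tau> * c"] \<tau> c R by simp
    finally show ?thesis by simp
  qed
  have 1: "(\<Sum>S\<in>Pow {..<n}. exp (?m G' S)) \<le> 2 ^ n * (2 * real p * exp ((2 * \<tau> * c * R)\<^sup>2 * V / 2))"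
    by (rule half[OF G' x'])
  have 2: "(\<Sum>S\<in>Pow {..<n}. exp (?m (\<lambda>i d. - G i d) S)) \<le> 2 ^ n * (2 * real p * exp ((2 * \<tau> * c * R)\<^sup>2 * V / 2))"
  proof (rule half[OF _ _ x])
    fix i d e assume "i < n"
    then show "\<bar>- G i d - - G i e\<bar> \<le> c * \<bar>dot p (x i) d - dot p (x i) e\<bar>"
      using G(1)[of i e d] by (simp add: abs_minus_commute)
  qed (simp add: G(2))
  let ?A = "{S \<in> Pow {..<n}. \<exists>d\<in>F. a < (\<Sum>i<n. rsign S i * (G' i d - G i d))}"
  \<comment> \<open>Markov's inequality for the counting measure on sign patterns, in pointwise
    form.\<close>
  have 3: "exp (\<tau> * a) * of_bool (S \<in> ?A) \<le> (exp (?m G' S) + exp (?m (\<lambda>i d. - G i d) S)) / 2" if "S \<in> Pow {..<n}" for S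
  proof (cases "S \<in> ?A")
    case True
    then obtain d where d: "d \<in> F" "a < (\<Sum>i<n. rsign S i * (G' i d - G i d))" by auto
    have m: "(\<Sum>i<n. rsign S i * (2 * \<tau> * H i d)) \<le> ?m H S" for H
      using F d(1) by (intro Max_ge) auto
    have e: "(\<Sum>i<n. rsign S i * (2 * \<tau> * G' i d)) + (\<Sum>i<n. rsign S i * (2 * \<tau> * (- G i d)))
       = 2 * (\<tau> * (\<Sum>i<n. rsign S i * (G' i d - G i d)))"
      unfolding sum.distrib[symmetric] sum_distrib_left by (intro sum.cong refl) (simp add: algebra_simps)
    have "\<tau> * a \<le> \<tau> * (\<Sum>i<n. rsign S i * (G' i d - G i d))" using \<tau> d(2) by (intro mult_left_mono) auto
    then have "2 * (\<tau> * a) \<le> ?m G' S + ?m (\<lambda>i d. - G i d) S" using m[of G'] m[of "\<lambda>i d. - G i d"] e by linarith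
    then have "exp (\<tau> * a) + exp (\<tau> * a) \<le> exp (?m G' S) + exp (?m (\<lambda>i d. - G i d) S)"
      by (intro exp_add_le_of_majorized) (auto simp: max_def)
    then show ?thesis using True by simp
  next
    case False
    then have "of_bool (S \<in> ?A) = (0::real)" by (simp only: of_bool_eq)
    moreover have "0 \<le> exp (?m G' S) + exp (?m (\<lambda>i d. - G i d) S)" by (intro add_nonneg_nonneg exp_ge_zero)
    ultimately show ?thesis by (simp only: mult_zero_right zero_le_divide_iff) simp
  qed
  have "exp (\<tau> * a) * real (card ?A) = (\<Sum>S\<in>Pow {..<n}. exp (\<tau> * a) * of_bool (S \<in> ?A))"
    by (simp add: sum_distrib_left[symmetric] Int_def cong: conj_cong)
  also have "\<dots> \<le> (\<Sum>S\<in>Pow {..<n}. (exp (?m G' S) + exp (?m (\<lambda>i d. - G i d) S)) / 2)"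
    by (intro sum_mono 3)
  also have "\<dots> = ((\<Sum>S\<in>Pow {..<n}. exp (?m G' S)) + (\<Sum>S\<in>Pow {..<n}. exp (?m (\<lambda>i d. - G i d) S))) / 2"
    by (simp only: sum.distrib sum_divide_distrib[symmetric])
  also have "\<dots> \<le> 2 ^ n * (2 * real p * exp ((2 * \<tau> * c * R)\<^sup>2 * V / 2))"
  proof -
    have "(X + Y) / 2 \<le> Z" if "X \<le> Z" "Y \<le> Z" for X Y Z :: real using that by simp
    from this[OF 1 2] show ?thesis .
  qed
  finally have "exp (\<tau> * a) * real (card ?A) \<le> 2 ^ n * (2 * real p * exp ((2 * \<tau> * c * R)\<^sup>2 * V / 2))" .
  then have "exp (- (\<tau> * a)) * (exp (\<tau> * a) * real (card ?A))
     \<le> exp (- (\<tau> * a)) * (2 ^ n * (2 * real p * exp ((2 * \<tau> * c * R)\<^sup>2 * V / 2)))"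
    by (intro mult_left_mono) auto
  moreover have "exp (- (\<tau> * a)) * (exp (\<tau> * a) * real (card ?A)) = real (card ?A)"
    by (simp add: mult.assoc[symmetric] exp_add[symmetric])
  moreover have "exp (- (\<tau> * a)) * (2 ^ n * (2 * real p * exp ((2 * \<tau> * c * R)\<^sup>2 * V / 2)))
     = 2 ^ n * (2 * real p * exp ((2 * \<tau> * c * R)\<^sup>2 * V / 2 - \<tau> * a))"
    by (simp add: exp_diff exp_minus field_simps)
  moreover have "(2 * \<tau> * c * R)\<^sup>2 * V / 2 - \<tau> * a = - (a\<^sup>2 / (8 * c\<^sup>2 * R\<^sup>2 * V))"
    using c R V by (simp add: \<tau>_def power_mult_distrib power_divide power2_eq_square divide_simps)
  ultimately show ?thesis by (simp only:)
qed

text \<open>\<open>P\<close> is the law of one observation, and samples are points of its product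
  space. Each increment \<open>g d\<close> is dominated by the linear form in \<open>d\<close>, as
  are its differences; this is what contraction requires.\<close>

locale iid_process = P: prob_space P for P :: "'a measure" +
  fixes x :: "'a \<Rightarrow> nat \<Rightarrow> real" and g :: "(nat \<Rightarrow> real) \<Rightarrow> 'a \<Rightarrow> real" and p n :: nat and c :: real
  assumes x_meas: "\<And>j. j < p \<Longrightarrow> (\<lambda>z. x z j) \<in> borel_measurable P"
    and g_meas [measurable]: "\<And>d. g d \<in> borel_measurable P"
    and g_lip: "\<And>z d e. \<bar>g d z - g e z\<bar> \<le> c * \<bar>dot p (x z) d - dot p (x z) e\<bar>"
    and g_le: "\<And>z d. \<bar>g d z\<bar> \<le> c * \<bar>dot p (x z) d\<bar>"
    and c_pos: "0 < c" and p_pos: "0 < p" and n_pos: "0 < n"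
begin

abbreviation PiP :: "nat set \<Rightarrow> (nat \<Rightarrow> 'a) measure" where "PiP I \<equiv> Pi\<^sub>M I (\<lambda>_. P)"

lemma prob_space_PiP: "prob_space (PiP I)" by (intro prob_space_PiM) (rule P.prob_space_axioms)

sublocale PS: product_sigma_finite "\<lambda>_::nat. P"
  by (simp add: product_sigma_finite_def P.sigma_finite_measure_axioms)

lemma sum_component_measurable [measurable]:
  assumes "I \<subseteq> J" "h \<in> borel_measurable P"
  shows "(\<lambda>Z. \<Sum>i\<in>I. h (Z i) :: real) \<in> borel_measurable (PiP J)"
  using assms by (intro borel_measurable_sum measurable_compose[OF measurable_component_singleton]) auto

lemma centered_sum_second_moment:
  assumes h: "integrable P h" "integrable P (\<lambda>z. (h z)\<^sup>2)" "P.expectation h = 0"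
  shows "integrable (PiP {..<n}) (\<lambda>Z. (\<Sum>i<n. h (Z i))\<^sup>2)"
    and "(\<integral>Z. (\<Sum>i<n. h (Z i))\<^sup>2 \<partial>PiP {..<n}) = real n * (\<integral>z. (h z)\<^sup>2 \<partial>P)"
proof -
  have hm [measurable]: "h \<in> borel_measurable P" using h(1) by auto
  \<comment> \<open>h (Z i) h (Z k) as a product with one factor per coordinate, so that diagonal
    and off-diagonal terms follow from the same product formula.\<close>
  let ?f = "\<lambda>i k l z. (if l = i then h z else 1) * (if l = k then h z else 1)"
  have eq: "(\<Prod>l<n. ?f i k l (Z l)) = h (Z i) * h (Z k)" if "i < n" "k < n" for i k Z
    using that by (simp add: prod.distrib)
  have int: "integrable P (?f i k l)" for i k l
    using h by (cases "l = i"; cases "l = k") (simp_all add: power2_eq_square)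
  have 1: "integrable (PiP {..<n}) (\<lambda>Z. h (Z i) * h (Z k))" if "i < n" "k < n" for i k
    using PS.product_integrable_prod[OF finite_lessThan, of n "?f i k", OF int] by (simp only: eq[OF that])
  have 2: "(\<integral>Z. h (Z i) * h (Z k) \<partial>PiP {..<n}) = (if i = k then (\<integral>z. (h z)\<^sup>2 \<partial>P) else 0)"
    if "i < n" "k < n" for i k
  proof -
    have "(\<integral>Z. h (Z i) * h (Z k) \<partial>PiP {..<n}) = (\<Prod>l<n. \<integral>z. ?f i k l z \<partial>P)"
      using PS.product_integral_prod[OF finite_lessThan, of n "?f i k", OF int] by (simp only: eq[OF that])
    also have "\<dots> = (if i = k then (\<integral>z. (h z)\<^sup>2 \<partial>P) else 0)"
    proof (cases "i = k")
      case True
      have "(\<Prod>l<n. \<integral>z. ?f i k l z \<partial>P) = (\<Prod>l<n. if l = i then (\<integral>z. (h z)\<^sup>2 \<partial>P) else 1)"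
        using True by (intro prod.cong) (auto simp: power2_eq_square P.prob_space)
      then show ?thesis using True that by simp
    next
      case False
      have "(\<integral>z. ?f i k i z \<partial>P) = 0" using False h(3) by simp
      then have "\<exists>l\<in>{..<n}. (\<integral>z. ?f i k l z \<partial>P) = 0" using that by blast
      then have "(\<Prod>l<n. \<integral>z. ?f i k l z \<partial>P) = 0" by (intro prod_zero) auto
      then show ?thesis using False by simp
    qed
    finally show ?thesis .
  qed
  have sq: "(\<Sum>i<n. h (Z i))\<^sup>2 = (\<Sum>i<n. \<Sum>k<n. h (Z i) * h (Z k))" for Z
    by (simp add: power2_eq_square sum_product)
  show "integrable (PiP {..<n}) (\<lambda>Z. (\<Sum>i<n. h (Z i))\<^sup>2)"
    unfolding sq by (intro Bochner_Integration.integrable_sum 1) auto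
  have "(\<integral>Z. (\<Sum>i<n. h (Z i))\<^sup>2 \<partial>PiP {..<n}) = (\<Sum>i<n. \<integral>Z. (\<Sum>k<n. h (Z i) * h (Z k)) \<partial>PiP {..<n})"
    unfolding sq by (rule Bochner_Integration.integral_sum) (auto intro!: Bochner_Integration.integrable_sum 1)
  also have "\<dots> = (\<Sum>i<n. \<Sum>k<n. \<integral>Z. h (Z i) * h (Z k) \<partial>PiP {..<n})"
    by (intro sum.cong refl Bochner_Integration.integral_sum 1) auto
  also have "\<dots> = (\<Sum>i<n. \<Sum>k<n. if i = k then (\<integral>z. (h z)\<^sup>2 \<partial>P) else 0)"
    by (intro sum.cong refl 2) auto
  also have "\<dots> = real n * (\<integral>z. (h z)\<^sup>2 \<partial>P)" by simp
  finally show "(\<integral>Z. (\<Sum>i<n. h (Z i))\<^sup>2 \<partial>PiP {..<n}) = real n * (\<integral>z. (h z)\<^sup>2 \<partial>P)" .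
qed

lemma chebyshev_sum:
  assumes g2: "integrable P (\<lambda>z. (g d z)\<^sup>2)" "(\<integral>z. (g d z)\<^sup>2 \<partial>P) \<le> v"
    and a: "0 < a" "4 * (real n * v) \<le> a\<^sup>2"
  shows "measure (PiP {..<n}) {Z \<in> space (PiP {..<n}). a \<le> \<bar>\<Sum>i<n. g d (Z i) - P.expectation (g d)\<bar>} \<le> 1/4"
proof -
  interpret Pn: prob_space "PiP {..<n}" by (rule prob_space_PiP)
  let ?h = "\<lambda>z. g d z - P.expectation (g d)"
  have g1: "integrable P (g d)" using g2(1) by (rule P.square_integrable_imp_integrable[rotated]) simp
  have h: "integrable P ?h" "integrable P (\<lambda>z. (?h z)\<^sup>2)" "P.expectation ?h = 0"
    using g1 g2(1) by (auto simp: power2_diff P.prob_space)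
  have "(\<integral>z. (?h z)\<^sup>2 \<partial>P) = (\<integral>z. (g d z)\<^sup>2 \<partial>P) - (P.expectation (g d))\<^sup>2"
    using P.variance_eq[OF g1 g2(1)] .
  then have hv: "(\<integral>z. (?h z)\<^sup>2 \<partial>P) \<le> v" using g2(2) by (smt (verit) zero_le_power2)
  have "measure (PiP {..<n}) {Z \<in> space (PiP {..<n}). a \<le> \<bar>\<Sum>i<n. ?h (Z i)\<bar>}
     \<le> (\<integral>Z. (\<Sum>i<n. ?h (Z i))\<^sup>2 \<partial>PiP {..<n}) / a\<^sup>2"
    by (rule Pn.second_moment_method) (use h centered_sum_second_moment[OF h] a in \<open>auto intro!: sum_component_measurable\<close>)
  also have "\<dots> = real n * (\<integral>z. (?h z)\<^sup>2 \<partial>P) / a\<^sup>2" unfolding centered_sum_second_moment[OF h] ..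
  also have "\<dots> \<le> real n * v / a\<^sup>2" using hv by (intro divide_right_mono mult_left_mono) auto
  also have "\<dots> \<le> 1/4" using a by (simp add: field_simps)
  finally show ?thesis .
qed

text \<open>The event on which the Rademacher sums of all coordinates have variance proxy at most
  V.\<close>

definition good :: "real \<Rightarrow> (nat \<Rightarrow> 'a) \<Rightarrow> bool" where
  "good V Z \<longleftrightarrow> (\<forall>j<p. (\<Sum>i<n. (x (Z i) j)\<^sup>2) \<le> V)"

lemma good_sets: "{Z \<in> space (PiP {..<n}). good V Z} \<in> sets (PiP {..<n})"
proof -
  have m: "(\<lambda>Z. \<Sum>i<n. (x (Z i) j)\<^sup>2) \<in> borel_measurable (PiP {..<n})" if "j < p" for j
    using x_meas[OF that] by (intro sum_component_measurable[of _ _ "\<lambda>z. (x z j)\<^sup>2"]) auto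
  have "{Z \<in> space (PiP {..<n}). good V Z} = {Z \<in> space (PiP {..<n}). \<forall>j\<in>{..<p}. (\<Sum>i<n. (x (Z i) j)\<^sup>2) \<le> V}"
    by (auto simp: good_def)
  also have "\<dots> \<in> sets (PiP {..<n})"
  proof (intro sets.sets_Collect_finite_All')
    fix j assume "j \<in> {..<p}"
    then have [measurable]: "(\<lambda>Z. \<Sum>i<n. (x (Z i) j)\<^sup>2) \<in> borel_measurable (PiP {..<n})" by (intro m) simp
    show "{Z \<in> space (PiP {..<n}). (\<Sum>i<n. (x (Z i) j)\<^sup>2) \<le> V} \<in> sets (PiP {..<n})"
      by measurable
  qed (use p_pos in auto)
  finally show ?thesis .
qed

text \<open>The double sample is indexed by \<open>{..<2 * n}\<close>, the ghost copy of observation \<open>i\<close> being \<open>n + i\<close>.\<close>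

definition swap_index :: "nat set \<Rightarrow> nat \<Rightarrow> nat" where
  "swap_index S i = (if i < n then (if i \<in> S then i else n + i)
     else if i < 2 * n \<and> i - n \<notin> S then i - n else i)"

lemma swap_preserves:
  assumes "A \<in> sets (PiP {..<2 * n})"
  shows "{Z \<in> space (PiP {..<2 * n}). (\<lambda>i\<in>{..<2 * n}. Z (swap_index S i)) \<in> A} \<in> sets (PiP {..<2 * n})"
    and "measure (PiP {..<2 * n}) {Z \<in> space (PiP {..<2 * n}). (\<lambda>i\<in>{..<2 * n}. Z (swap_index S i)) \<in> A} = measure (PiP {..<2 * n}) A"
proof -
  let ?I = "{..<2 * n}"
  have r: "swap_index S \<in> ?I \<rightarrow> ?I" by (auto simp: swap_index_def)
  have inj: "inj_on (swap_index S) ?I" by (rule inj_onI) (auto simp: swap_index_def split: if_splits)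
  have m: "(\<lambda>Z. \<lambda>i\<in>?I. Z (swap_index S i)) \<in> PiP ?I \<rightarrow>\<^sub>M PiP ?I"
    using r by (intro measurable_restrict measurable_component_singleton) auto
  have d: "distr (PiP ?I) (PiP ?I) (\<lambda>Z. \<lambda>i\<in>?I. Z (swap_index S i)) = PiP ?I"
    by (rule distr_PiM_reindex[of _ "\<lambda>_. P"]) (use r inj P.prob_space_axioms in auto)
  have "measure (PiP ?I) A = measure (distr (PiP ?I) (PiP ?I) (\<lambda>Z. \<lambda>i\<in>?I. Z (swap_index S i))) A"
    unfolding d ..
  also have "\<dots> = measure (PiP ?I) ((\<lambda>Z. \<lambda>i\<in>?I. Z (swap_index S i)) -` A \<inter> space (PiP ?I))"
    by (rule measure_distr[OF m assms])
  also have "(\<lambda>Z. \<lambda>i\<in>?I. Z (swap_index S i)) -` A \<inter> space (PiP ?I) = {Z \<in> space (PiP ?I). (\<lambda>i\<in>?I. Z (swap_index S i)) \<in> A}" by auto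
  finally show "measure (PiP ?I) {Z \<in> space (PiP ?I). (\<lambda>i\<in>?I. Z (swap_index S i)) \<in> A} = measure (PiP ?I) A" ..
  have "(\<lambda>Z. \<lambda>i\<in>?I. Z (swap_index S i)) -` A \<inter> space (PiP ?I) \<in> sets (PiP ?I)" by (rule measurable_sets[OF m assms])
  then show "{Z \<in> space (PiP ?I). (\<lambda>i\<in>?I. Z (swap_index S i)) \<in> A} \<in> sets (PiP ?I)"
    by (simp add: vimage_def Int_def conj_commute)
qed

text \<open>The sums of squares are bounded over both samples together, since only this constraint
  is invariant under swaps.\<close>

definition sym_event :: "(nat \<Rightarrow> real) set \<Rightarrow> real \<Rightarrow> real \<Rightarrow> (nat \<Rightarrow> 'a) set" where
  "sym_event D a V = {Z \<in> space (PiP {..<2 * n}).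
     (\<forall>j\<in>{..<p}. (\<Sum>i<n. (x (Z i) j)\<^sup>2 + (x (Z (n + i)) j)\<^sup>2) \<le> V) \<and>
     (\<exists>d\<in>D. a < (\<Sum>i<n. g d (Z (n + i)) - g d (Z i)))}"

lemma component_measurable2:
  assumes "h \<in> borel_measurable P" "i < 2 * n"
  shows "(\<lambda>Z. h (Z i) :: real) \<in> borel_measurable (PiP {..<2 * n})"
  using assms by (intro measurable_compose[OF measurable_component_singleton]) auto

lemma sym_event_sets: "finite D \<Longrightarrow> sym_event D a V \<in> sets (PiP {..<2 * n})"
proof -
  assume D: "finite D"
  have m1: "(\<lambda>Z. \<Sum>i<n. (x (Z i) j)\<^sup>2 + (x (Z (n + i)) j)\<^sup>2) \<in> borel_measurable (PiP {..<2 * n})" if "j < p" for j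
    using x_meas[OF that]
    by (intro borel_measurable_sum borel_measurable_add component_measurable2[of "\<lambda>z. (x z j)\<^sup>2"]) auto
  have m2: "(\<lambda>Z. \<Sum>i<n. g d (Z (n + i)) - g d (Z i)) \<in> borel_measurable (PiP {..<2 * n})" for d
    by (intro borel_measurable_sum borel_measurable_diff component_measurable2) auto
  show ?thesis unfolding sym_event_def
  proof (intro sets.sets_Collect_conj sets.sets_Collect_finite_All' sets.sets_Collect_finite_Ex)
    fix j assume "j \<in> {..<p}"
    then have [measurable]: "(\<lambda>Z. \<Sum>i<n. (x (Z i) j)\<^sup>2 + (x (Z (n + i)) j)\<^sup>2) \<in> borel_measurable (PiP {..<2 * n})"
      by (intro m1) simp
    show "{Z \<in> space (PiP {..<2 * n}). (\<Sum>i<n. (x (Z i) j)\<^sup>2 + (x (Z (n + i)) j)\<^sup>2) \<le> V} \<in> sets (PiP {..<2 * n})"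
      by measurable
  next
    fix d show "{Z \<in> space (PiP {..<2 * n}). a < (\<Sum>i<n. g d (Z (n + i)) - g d (Z i))} \<in> sets (PiP {..<2 * n})"
      using m2[of d] by measurable
  qed (use D p_pos in auto)
qed

text \<open>All 2^n swaps preserve the law of the double sample. The probability is thus the mean,
  over double samples, of a proportion of sign patterns, and that proportion obeys the counting
  bound pointwise.\<close>

lemma sym_event_prob:
  assumes D: "finite D" "D \<noteq> {}" and R: "0 < R" and a: "0 < a" and V: "0 < V"
    and l1: "\<And>d. d \<in> D \<Longrightarrow> (\<Sum>j<p. \<bar>d j\<bar>) \<le> R"
  shows "measure (PiP {..<2 * n}) (sym_event D a V) \<le> 2 * real p * exp (- (a\<^sup>2 / (8 * c\<^sup>2 * R\<^sup>2 * V)))"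
    (is "?m \<le> ?b")
proof -
  let ?I = "{..<2 * n}"
  interpret Q: prob_space "PiP ?I" by (rule prob_space_PiP)
  let ?A = "\<lambda>S. {Z \<in> space (PiP ?I). (\<lambda>i\<in>?I. Z (swap_index S i)) \<in> sym_event D a V}"
  have A: "?A S \<in> sets (PiP ?I)" "measure (PiP ?I) (?A S) = ?m" for S
    using swap_preserves[OF sym_event_sets[OF D(1)]] by auto
  have count: "(\<Sum>S\<in>Pow {..<n}. indicator (?A S) Z) \<le> 2 ^ n * ?b" if Z: "Z \<in> space (PiP ?I)" for Z
  proof (cases "\<forall>j<p. (\<Sum>i<n. (x (Z i) j)\<^sup>2 + (x (Z (n + i)) j)\<^sup>2) \<le> V")
    case False
    have "Z \<notin> ?A S" for S
    proof
      assume "Z \<in> ?A S"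
      moreover have "(x ((\<lambda>i\<in>?I. Z (swap_index S i)) i) j)\<^sup>2 + (x ((\<lambda>i\<in>?I. Z (swap_index S i)) (n + i)) j)\<^sup>2
        = (x (Z i) j)\<^sup>2 + (x (Z (n + i)) j)\<^sup>2" if "i < n" for i j
        using that by (auto simp: swap_index_def)
      ultimately show False using False by (auto simp: sym_event_def)
    qed
    then have "(\<Sum>S\<in>Pow {..<n}. indicator (?A S) Z) = (0::real)" by (intro sum.neutral) auto
    then show ?thesis by simp
  next
    case True
    have le: "(\<Sum>i<n. (x (Z i) j)\<^sup>2) \<le> V" "(\<Sum>i<n. (x (Z (n + i)) j)\<^sup>2) \<le> V" if "j < p" for j
    proof -
      have "(\<Sum>i<n. (x (Z i) j)\<^sup>2) + (\<Sum>i<n. (x (Z (n + i)) j)\<^sup>2) \<le> V" using True that by (simp add: sum.distrib)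
      moreover have "0 \<le> (\<Sum>i<n. (x (Z i) j)\<^sup>2)" "0 \<le> (\<Sum>i<n. (x (Z (n + i)) j)\<^sup>2)" by (auto intro: sum_nonneg)
      ultimately show "(\<Sum>i<n. (x (Z i) j)\<^sup>2) \<le> V" "(\<Sum>i<n. (x (Z (n + i)) j)\<^sup>2) \<le> V" by linarith+
    qed
    let ?C = "{S \<in> Pow {..<n}. \<exists>d\<in>D. a < (\<Sum>i<n. rsign S i * (g d (Z (n + i)) - g d (Z i)))}"
    have sub: "indicator (?A S) Z \<le> (indicator ?C S :: real)" if S: "S \<in> Pow {..<n}" for S
    proof (cases "Z \<in> ?A S")
      case True
      then obtain d where d: "d \<in> D"
        "a < (\<Sum>i<n. g d ((\<lambda>i\<in>?I. Z (swap_index S i)) (n + i)) - g d ((\<lambda>i\<in>?I. Z (swap_index S i)) i))"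
        by (auto simp: sym_event_def)
      \<comment> \<open>\<open>S\<close> collects the pairs left in place, which get sign 1; a
        swapped pair changes the sign of its difference.\<close>
      have "(\<Sum>i<n. g d ((\<lambda>i\<in>?I. Z (swap_index S i)) (n + i)) - g d ((\<lambda>i\<in>?I. Z (swap_index S i)) i))
        = (\<Sum>i<n. rsign S i * (g d (Z (n + i)) - g d (Z i)))"
        by (intro sum.cong) (auto simp: swap_index_def rsign_def)
      then have "S \<in> ?C" using d S by auto
      then show ?thesis by simp
    qed simp
    have "(\<Sum>S\<in>Pow {..<n}. indicator (?A S) Z) \<le> (\<Sum>S\<in>Pow {..<n}. indicator ?C S :: real)"
      by (intro sum_mono sub)
    also have "\<dots> = real (card ?C)"
      by (simp add: indicator_def sum.If_cases Int_def cong: conj_cong)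
    also have "\<dots> \<le> 2 ^ n * ?b"
      by (rule symmetrized_count_bound[OF D c_pos R a V p_pos l1, where x = "\<lambda>i. x (Z i)" and x' = "\<lambda>i. x (Z (n + i))"])
        (auto intro: g_lip g_le le)
    finally show ?thesis .
  qed
  have "2 ^ n * ?m = (\<Sum>S\<in>Pow {..<n}. measure (PiP ?I) (?A S))" by (simp add: A card_Pow)
  also have "\<dots> = (\<integral>Z. (\<Sum>S\<in>Pow {..<n}. indicator (?A S) Z) \<partial>PiP ?I)"
    using A(1) by (subst Bochner_Integration.integral_sum) (auto intro!: integrable_real_indicator Q.emeasure_finite simp: less_top[symmetric])
  also have "\<dots> \<le> (\<integral>Z. 2 ^ n * ?b \<partial>PiP ?I)"
    using A(1) by (intro integral_mono count Bochner_Integration.integrable_sum integrable_real_indicator)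
      (auto simp: less_top[symmetric] Q.emeasure_finite)
  also have "\<dots> = 2 ^ n * ?b" by (simp add: Q.prob_space)
  finally show ?thesis by simp
qed

text \<open>One-sided: only an empirical loss below its mean could compensate the growth of the
  expected loss.\<close>

definition bad_event :: "(nat \<Rightarrow> real) set \<Rightarrow> real \<Rightarrow> real \<Rightarrow> (nat \<Rightarrow> 'a) set" where
  "bad_event D a V = {Z \<in> space (PiP {..<n}). good V Z \<and> (\<exists>d\<in>D. a < (\<Sum>i<n. P.expectation (g d) - g d (Z i)))}"

lemma bad_event_sets:
  assumes D: "countable D"
  shows "bad_event D a V \<in> sets (PiP {..<n})"
proof -
  have [measurable]: "(\<lambda>Z. \<Sum>i<n. P.expectation (g d) - g d (Z i)) \<in> borel_measurable (PiP {..<n})" for d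
    by (intro sum_component_measurable) auto
  show ?thesis unfolding bad_event_def
    by (intro sets.sets_Collect_conj good_sets sets.sets_Collect_countable_Ex' D) measurable
qed

text \<open>Chebyshev at the single index \<open>d\<close> excludes probability 1/4, the moment
  event another 1/4, so 1/2 remains. No uniformity in \<open>d\<close> is asked of the ghost
  sample.\<close>

lemma ghost_prob:
  assumes good: "3/4 \<le> measure (PiP {..<n}) {Z \<in> space (PiP {..<n}). good V Z}"
    and g2: "integrable P (\<lambda>z. (g d z)\<^sup>2)" "(\<integral>z. (g d z)\<^sup>2 \<partial>P) \<le> v"
    and a: "0 < a" "4 * (real n * v) \<le> a\<^sup>2"
  shows "1/2 \<le> measure (PiP {n..<2 * n}) {Z \<in> space (PiP {n..<2 * n}). good V (\<lambda>i. Z (n + i)) \<and>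
     (\<Sum>i<n. P.expectation (g d) - g d (Z (n + i))) < a}"
proof -
  interpret Pn: prob_space "PiP {..<n}" by (rule prob_space_PiP)
  let ?C = "{Z \<in> space (PiP {..<n}). a \<le> \<bar>\<Sum>i<n. g d (Z i) - P.expectation (g d)\<bar>}"
  let ?G = "{Z \<in> space (PiP {..<n}). good V Z}"
  let ?H = "{Z \<in> space (PiP {..<n}). good V Z \<and> (\<Sum>i<n. P.expectation (g d) - g d (Z i)) < a}"
  have [measurable]: "(\<lambda>Z. \<Sum>i<n. P.expectation (g d) - g d (Z i)) \<in> borel_measurable (PiP {..<n})"
    "(\<lambda>Z. \<Sum>i<n. g d (Z i) - P.expectation (g d)) \<in> borel_measurable (PiP {..<n})"
    by (auto intro!: sum_component_measurable)
  have C: "?C \<in> sets (PiP {..<n})" by measurable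
  have H: "?H \<in> sets (PiP {..<n})" by (intro sets.sets_Collect_conj good_sets) measurable
  have "?G \<subseteq> ?H \<union> ?C"
  proof
    fix Z assume Z: "Z \<in> ?G"
    have "(\<Sum>i<n. P.expectation (g d) - g d (Z i)) = - (\<Sum>i<n. g d (Z i) - P.expectation (g d))"
      by (simp add: sum_subtractf)
    then show "Z \<in> ?H \<union> ?C" using Z by auto
  qed
  then have "measure (PiP {..<n}) ?G \<le> measure (PiP {..<n}) (?H \<union> ?C)"
    using C H by (intro Pn.finite_measure_mono) auto
  also have "\<dots> \<le> measure (PiP {..<n}) ?H + measure (PiP {..<n}) ?C" by (rule measure_Un_le[OF H C])
  finally have "1/2 \<le> measure (PiP {..<n}) ?H" using good chebyshev_sum[OF g2 a] by linarith
  also have "measure (PiP {..<n}) ?H = measure (distr (PiP {n..<2 * n}) (PiP {..<n}) (\<lambda>Z. \<lambda>i\<in>{..<n}. Z (n + i))) ?H"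
    by (subst distr_PiM_reindex[of "{n..<2 * n}" "\<lambda>_. P" "\<lambda>i. n + i" "{..<n}"]) (auto simp: P.prob_space_axioms inj_on_def)
  also have "\<dots> = measure (PiP {n..<2 * n}) ((\<lambda>Z. \<lambda>i\<in>{..<n}. Z (n + i)) -` ?H \<inter> space (PiP {n..<2 * n}))"
    by (rule measure_distr[OF _ H]) (auto intro!: measurable_restrict measurable_component_singleton)
  also have "(\<lambda>Z. \<lambda>i\<in>{..<n}. Z (n + i)) -` ?H \<inter> space (PiP {n..<2 * n}) = {Z \<in> space (PiP {n..<2 * n}). good V (\<lambda>i. Z (n + i)) \<and>
     (\<Sum>i<n. P.expectation (g d) - g d (Z (n + i))) < a}"
    by (auto simp: good_def space_PiM PiE_iff extensional_def)
  finally show ?thesis .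
qed

text \<open>On the bad event an index \<open>d\<close> is determined by the first sample. An
  independent ghost sample is well behaved at this \<open>d\<close> with probability at least 1/2,
  and then the double sample lies in \<open>sym_event\<close> at level \<open>a\<close> with moment
  bound 2V. Fubini doubles the factor 2p, and 2V doubles the 8 in the exponent.\<close>

lemma finite_bad_event_prob:
  assumes D: "finite D" "D \<noteq> {}" and R: "0 < R" and V: "0 < V"
    and l1: "\<And>d. d \<in> D \<Longrightarrow> (\<Sum>j<p. \<bar>d j\<bar>) \<le> R"
    and good: "3/4 \<le> measure (PiP {..<n}) {Z \<in> space (PiP {..<n}). good V Z}"
    and g2: "\<And>d. d \<in> D \<Longrightarrow> integrable P (\<lambda>z. (g d z)\<^sup>2)" "\<And>d. d \<in> D \<Longrightarrow> (\<integral>z. (g d z)\<^sup>2 \<partial>P) \<le> v"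
    and a: "0 < a" "0 < a'" "4 * (real n * v) \<le> a'\<^sup>2"
  shows "measure (PiP {..<n}) (bad_event D (a + a') V) \<le> 4 * real p * exp (- (a\<^sup>2 / (16 * c\<^sup>2 * R\<^sup>2 * V)))"
proof -
  let ?I = "{..<n}" and ?J = "{n..<2 * n}"
  interpret I: prob_space "PiP ?I" by (rule prob_space_PiP)
  interpret J: prob_space "PiP ?J" by (rule prob_space_PiP)
  interpret IJ: pair_prob_space "PiP ?I" "PiP ?J" ..
  interpret Q: prob_space "PiP {..<2 * n}" by (rule prob_space_PiP)
  have un: "?I \<union> ?J = {..<2 * n}" by auto
  let ?H = "sym_event D a (2 * V)"
  have H: "?H \<in> sets (PiP {..<2 * n})" by (rule sym_event_sets[OF D(1)])
  have mm: "merge ?I ?J \<in> PiP ?I \<Otimes>\<^sub>M PiP ?J \<rightarrow>\<^sub>M PiP {..<2 * n}" using measurable_merge[of ?I ?J "\<lambda>_. P"] unfolding un .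
  let ?B = "bad_event D (a + a') V"
  have B: "?B \<in> sets (PiP ?I)" by (rule bad_event_sets) (simp add: D countable_finite)
  define K where "K = merge ?I ?J -` ?H \<inter> space (PiP ?I \<Otimes>\<^sub>M PiP ?J)"
  have K: "K \<in> sets (PiP ?I \<Otimes>\<^sub>M PiP ?J)" unfolding K_def by (rule measurable_sets[OF mm H])
  have slice: "ennreal (1/2) * indicator ?B Z \<le> emeasure (PiP ?J) (Pair Z -` K)" if Z: "Z \<in> space (PiP ?I)" for Z
  proof (cases "Z \<in> ?B")
    case True
    then obtain d where d: "d \<in> D" "a + a' < (\<Sum>i<n. P.expectation (g d) - g d (Z i))" and gZ: "good V Z"
      by (auto simp: bad_event_def)
    let ?G = "{Z \<in> space (PiP ?J). good V (\<lambda>i. Z (n + i)) \<and> (\<Sum>i<n. P.expectation (g d) - g d (Z (n + i))) < a'}"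
    have "?G \<subseteq> Pair Z -` K"
    proof
      fix Z' assume Z': "Z' \<in> ?G"
      let ?M = "merge ?I ?J (Z, Z')"
      have M: "?M i = Z i" "?M (n + i) = Z' (n + i)" if "i < n" for i using that by (auto simp: merge_def)
      have sp: "(Z, Z') \<in> space (PiP ?I \<Otimes>\<^sub>M PiP ?J)" using Z Z' by (simp add: space_pair_measure)
      then have "?M \<in> space (PiP {..<2 * n})" by (rule measurable_space[OF mm])
      moreover have "(\<Sum>i<n. (x (?M i) j)\<^sup>2 + (x (?M (n + i)) j)\<^sup>2) \<le> 2 * V" if "j < p" for j
      proof -
        have "(\<Sum>i<n. (x (?M i) j)\<^sup>2 + (x (?M (n + i)) j)\<^sup>2) = (\<Sum>i<n. (x (Z i) j)\<^sup>2) + (\<Sum>i<n. (x (Z' (n + i)) j)\<^sup>2)"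
          unfolding sum.distrib by (simp add: M)
        then show ?thesis using gZ Z' that unfolding good_def by fastforce
      qed
      moreover have "a < (\<Sum>i<n. g d (?M (n + i)) - g d (?M i))"
      proof -
        have "(\<Sum>i<n. g d (?M (n + i)) - g d (?M i))
          = (\<Sum>i<n. P.expectation (g d) - g d (Z i)) - (\<Sum>i<n. P.expectation (g d) - g d (Z' (n + i)))"
          unfolding sum_subtractf[symmetric] by (intro sum.cong) (auto simp: M)
        then show ?thesis using d Z' by auto
      qed
      ultimately have "?M \<in> ?H" using d(1) unfolding sym_event_def by blast
      then show "Z' \<in> Pair Z -` K" using sp by (simp add: K_def)
    qed
    then have "emeasure (PiP ?J) ?G \<le> emeasure (PiP ?J) (Pair Z -` K)"
      using sets_Pair1[OF K] by (rule emeasure_mono)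
    moreover have "ennreal (1/2) \<le> emeasure (PiP ?J) ?G"
      unfolding J.emeasure_eq_measure
      by (intro ennreal_leI ghost_prob[OF good g2(1)[OF d(1)] g2(2)[OF d(1)] a(2,3)])
    ultimately show ?thesis using True by (auto intro: order_trans)
  qed simp
  have "ennreal (1/2) * emeasure (PiP ?I) ?B = (\<integral>\<^sup>+Z. ennreal (1/2) * indicator ?B Z \<partial>PiP ?I)"
    using B by (simp add: nn_integral_cmult_indicator)
  also have "\<dots> \<le> (\<integral>\<^sup>+Z. emeasure (PiP ?J) (Pair Z -` K) \<partial>PiP ?I)"
    by (intro nn_integral_mono slice)
  also have "\<dots> = emeasure (PiP ?I \<Otimes>\<^sub>M PiP ?J) K" by (rule J.emeasure_pair_measure_alt[OF K, symmetric])
  also have "\<dots> = emeasure (distr (PiP ?I \<Otimes>\<^sub>M PiP ?J) (PiP {..<2 * n}) (merge ?I ?J)) ?H"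
    unfolding K_def by (rule emeasure_distr[OF mm H, symmetric])
  also have "distr (PiP ?I \<Otimes>\<^sub>M PiP ?J) (PiP {..<2 * n}) (merge ?I ?J) = PiP {..<2 * n}"
  proof -
    have "?I \<inter> ?J = {}" by auto
    from PS.distr_merge[OF this] show ?thesis unfolding un by simp
  qed
  finally have "1/2 * measure (PiP ?I) ?B \<le> measure (PiP {..<2 * n}) ?H"
    by (simp add: I.emeasure_eq_measure Q.emeasure_eq_measure ennreal_mult[symmetric] del: ennreal_half)
  also have "\<dots> \<le> 2 * real p * exp (- (a\<^sup>2 / (8 * c\<^sup>2 * R\<^sup>2 * (2 * V))))"
    using V by (intro sym_event_prob D R a l1) auto
  finally show ?thesis by (simp add: mult.assoc[symmetric])
qed

text \<open>The bound does not depend on the number of indices, so it passes to an increasing union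
  of finite sets.\<close>

lemma bad_event_prob:
  assumes D: "countable D" and R: "0 < R" and V: "0 < V"
    and l1: "\<And>d. d \<in> D \<Longrightarrow> (\<Sum>j<p. \<bar>d j\<bar>) \<le> R"
    and good: "3/4 \<le> measure (PiP {..<n}) {Z \<in> space (PiP {..<n}). good V Z}"
    and g2: "\<And>d. d \<in> D \<Longrightarrow> integrable P (\<lambda>z. (g d z)\<^sup>2)" "\<And>d. d \<in> D \<Longrightarrow> (\<integral>z. (g d z)\<^sup>2 \<partial>P) \<le> v"
    and a: "0 < a" "0 < a'" "4 * (real n * v) \<le> a'\<^sup>2"
  shows "measure (PiP {..<n}) (bad_event D (a + a') V) \<le> 4 * real p * exp (- (a\<^sup>2 / (16 * c\<^sup>2 * R\<^sup>2 * V)))"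
proof (cases "D = {}")
  case True then show ?thesis by (simp add: bad_event_def)
next
  case False
  interpret I: prob_space "PiP {..<n}" by (rule prob_space_PiP)
  let ?D = "\<lambda>k. from_nat_into D ` {..k::nat}"
  have sub: "?D k \<subseteq> D" for k using False by (auto intro: from_nat_into)
  have un: "bad_event D (a + a') V = (\<Union>k. bad_event (?D k) (a + a') V)"
  proof -
    have "D \<subseteq> (\<Union>k. ?D k)"
    proof
      fix d assume "d \<in> D"
      then obtain k where "d = from_nat_into D k" using range_from_nat_into[OF False D] by auto
      then show "d \<in> (\<Union>k. ?D k)" by auto
    qed
    then have "D = (\<Union>k. ?D k)" using sub by blast
    then have "(\<exists>d\<in>D. Q d) \<longleftrightarrow> (\<exists>k. \<exists>d\<in>?D k. Q d)" for Q by (metis UN_iff UNIV_I)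
    then show ?thesis unfolding bad_event_def by blast
  qed
  have lim: "(\<lambda>k. measure (PiP {..<n}) (bad_event (?D k) (a + a') V)) \<longlonglongrightarrow> measure (PiP {..<n}) (bad_event D (a + a') V)"
    unfolding un
  proof (rule I.finite_Lim_measure_incseq)
    show "range (\<lambda>k. bad_event (?D k) (a + a') V) \<subseteq> sets (PiP {..<n})"
      by (auto intro!: bad_event_sets countable_finite)
    show "incseq (\<lambda>k. bad_event (?D k) (a + a') V)"
      by (rule incseq_SucI) (auto simp: bad_event_def atMost_Suc)
  qed
  show ?thesis
  proof (rule LIMSEQ_le_const2[OF lim], intro exI allI impI)
    fix k show "measure (PiP {..<n}) (bad_event (?D k) (a + a') V) \<le> 4 * real p * exp (- (a\<^sup>2 / (16 * c\<^sup>2 * R\<^sup>2 * V)))"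
      using sub[of k] by (intro finite_bad_event_prob[OF _ _ R V _ good _ _ a]) (auto intro!: l1 g2)
  qed
qed

end

section \<open>The pivotal quantity\<close>

context
  fixes U :: "real set"
  assumes U: "compact U" "U \<noteq> {}" "U \<subseteq> {0<..<1}"
begin

lemma bdd_above_W: "bdd_above ((\<lambda>u. 1 / sqrt (u * (1 - u))) ` U)"
proof -
  have "continuous_on U (\<lambda>u. 1 / sqrt (u * (1 - u)))"
    using U(3) by (intro continuous_intros) auto
  then have "compact ((\<lambda>u. 1 / sqrt (u * (1 - u))) ` U)" using U(1) by (rule compact_continuous_image)
  then show ?thesis by (intro bounded_imp_bdd_above compact_imp_bounded)
qed

lemma W_upper: "u \<in> U \<Longrightarrow> 1 / sqrt (u * (1 - u)) \<le> W_U U"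
  unfolding W_U_def by (rule cSUP_upper[OF _ bdd_above_W])

lemma W_ge: "2 \<le> W_U U"
proof -
  obtain u where u: "u \<in> U" using U by auto
  then have u01: "0 < u" "u < 1" using U by auto
  have "sqrt (u * (1 - u)) \<le> 1/2"
  proof (rule real_le_lsqrt)
    have "0 \<le> (1/2 - u)\<^sup>2" by simp
    then show "u * (1 - u) \<le> (1/2)\<^sup>2" by (simp add: power2_eq_square algebra_simps)
  qed (use u01 in auto)
  then have "2 \<le> 1 / sqrt (u * (1 - u))" using u01 by (simp add: field_simps)
  then show ?thesis using W_upper[OF u] by simp
qed

text \<open>A countable subset that approximates every point of \<open>U\<close> from the right.\<close>

definition right_dense :: "real set" where
  "right_dense = (\<lambda>b. Sup (U \<inter> {..b})) ` {b \<in> \<rat>. U \<inter> {..b} \<noteq> {}}"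

lemma countable_right_dense: "countable right_dense"
  unfolding right_dense_def by (intro countable_image countable_subset[OF _ countable_rat]) auto

lemma right_dense_subset: "right_dense \<subseteq> U"
proof
  fix d assume "d \<in> right_dense"
  then obtain b where b: "U \<inter> {..b} \<noteq> {}" "d = Sup (U \<inter> {..b})" by (auto simp: right_dense_def)
  have "Sup (U \<inter> {..b}) \<in> U \<inter> {..b}"
  proof (rule closed_contains_Sup)
    show "bdd_above (U \<inter> {..b})" by (rule bdd_aboveI[of _ b]) auto
    show "closed (U \<inter> {..b})" using U(1) by (intro closed_Int compact_imp_closed) auto
  qed (rule b)
  then show "d \<in> U" using b by simp
qed

lemma right_dense_ex:
  assumes "u \<in> U" "0 < e"
  shows "\<exists>d\<in>right_dense. u \<le> d \<and> d < u + e"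
proof -
  obtain b where b: "b \<in> \<rat>" "u < b" "b < u + e" using Rats_dense_in_real[of u "u + e"] assms by auto
  have ne: "u \<in> U \<inter> {..b}" using assms b by auto
  have "bdd_above (U \<inter> {..b})" by (rule bdd_aboveI[of _ b]) auto
  then have "u \<le> Sup (U \<inter> {..b})" using ne by (intro cSup_upper)
  moreover have "Sup (U \<inter> {..b}) \<le> b" using ne by (intro cSup_least) auto
  moreover have "Sup (U \<inter> {..b}) \<in> right_dense" unfolding right_dense_def using b ne by blast
  ultimately show ?thesis using b by (intro bexI[of _ "Sup (U \<inter> {..b})"]) auto
qed

lemma right_continuous_le:
  fixes h :: "real \<Rightarrow> real"
  assumes "u \<in> U" and h: "(h \<longlongrightarrow> h u) (at_right u)" and le: "\<And>d. d \<in> right_dense \<Longrightarrow> h d \<le> c"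
  shows "h u \<le> c"
proof (rule ccontr)
  assume "\<not> h u \<le> c"
  then have "\<forall>\<^sub>F y in at_right u. c < h y" using order_tendstoD(1)[OF h, of c] by simp
  then obtain b where b: "u < b" "\<And>y. u < y \<Longrightarrow> y < b \<Longrightarrow> c < h y"
    unfolding eventually_at_right_field by auto
  obtain d where d: "d \<in> right_dense" "u \<le> d" "d < b" using right_dense_ex[OF assms(1), of "b - u"] b(1) by auto
  then show False using le[OF d(1)] b(2)[of d] \<open>\<not> h u \<le> c\<close> by (cases "d = u") auto
qed

definition score_term :: "nat \<Rightarrow> (nat \<Rightarrow> nat \<Rightarrow> real) \<Rightarrow> (nat \<Rightarrow> real) \<Rightarrow> nat \<Rightarrow> real \<Rightarrow> real" where
  "score_term n X v j u =
     \<bar>(\<Sum>i<n. X i j * (u - of_bool (v i \<le> u)) / (sigma_hat n X j * sqrt (u * (1 - u)))) / real n\<bar>"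

text \<open>The indicator of v i \<le> u already has its new value at the jump point u = v i. This
  is why \<open>right_dense\<close> approximates from the right.\<close>

lemma score_term_right_cont:
  assumes "u \<in> U"
  shows "(score_term n X v j \<longlongrightarrow> score_term n X v j u) (at_right u)"
proof -
  have u: "0 < u" "u < 1" using assms U by auto
  have b: "((\<lambda>w. of_bool (y \<le> w) :: real) \<longlongrightarrow> of_bool (y \<le> u)) (at_right u)" for y
  proof (rule tendsto_eventually)
    show "\<forall>\<^sub>F w in at_right u. (of_bool (y \<le> w) :: real) = of_bool (y \<le> u)"
    proof (cases "y \<le> u")
      case True
      have "\<forall>\<^sub>F w in at_right u. u < w" by (rule eventually_at_right_less)
      then show ?thesis by eventually_elim (use True in auto)
    next
      case False
      then have "\<forall>\<^sub>F w in at_right u. w < y" by (intro eventually_at_right_field[THEN iffD2] exI[of _ y]) auto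
      then show ?thesis by eventually_elim (use False in auto)
    qed
  qed
  have eq: "score_term n X v j = (\<lambda>w. \<bar>(\<Sum>i<n. (X i j / sigma_hat n X j) * ((w - of_bool (v i \<le> w)) / sqrt (w * (1 - w)))) / real n\<bar>)"
    by (auto simp: score_term_def fun_eq_iff)
  show ?thesis
  proof (cases "n = 0")
    case True then show ?thesis unfolding score_term_def by simp
  next
    case False
    then show ?thesis unfolding eq using u by (intro tendsto_intros b) auto
  qed
qed

lemma Lam_eq_score: "Lam U n p X v = real n * (SUP u\<in>U. MAX j\<in>{..<p}. score_term n X v j u)"
  by (simp add: Lam_def score_term_def)

text \<open>Crude, but it makes the supremum in \<open>Lam\<close> that of a bounded set, below
  which the value is meaningful.\<close>

lemma score_term_bound:
  assumes "u \<in> U"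
  shows "score_term n X v j u \<le> (\<Sum>i<n. \<bar>X i j / sigma_hat n X j\<bar> * W_U U)"
proof -
  have u: "0 < u" "u < 1" using assms U by auto
  have "\<bar>\<Sum>i<n. X i j * (u - of_bool (v i \<le> u)) / (sigma_hat n X j * sqrt (u * (1 - u)))\<bar>
    \<le> (\<Sum>i<n. \<bar>X i j / sigma_hat n X j\<bar> * W_U U)"
  proof (rule order_trans[OF sum_abs sum_mono])
    fix i
    have "\<bar>X i j * (u - of_bool (v i \<le> u)) / (sigma_hat n X j * sqrt (u * (1 - u)))\<bar>
      = \<bar>X i j / sigma_hat n X j\<bar> * (\<bar>u - of_bool (v i \<le> u)\<bar> * (1 / sqrt (u * (1 - u))))"
      using u by (simp add: abs_mult)
    also have "\<dots> \<le> \<bar>X i j / sigma_hat n X j\<bar> * (1 * W_U U)"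
      using u W_upper[OF assms] by (intro mult_left_mono mult_mono) auto
    finally show "\<bar>X i j * (u - of_bool (v i \<le> u)) / (sigma_hat n X j * sqrt (u * (1 - u)))\<bar>
      \<le> \<bar>X i j / sigma_hat n X j\<bar> * W_U U" by simp
  qed
  then have "score_term n X v j u \<le> (\<Sum>i<n. \<bar>X i j / sigma_hat n X j\<bar> * W_U U) / real n"
    unfolding score_term_def abs_divide by (simp add: divide_right_mono)
  also have "\<dots> \<le> (\<Sum>i<n. \<bar>X i j / sigma_hat n X j\<bar> * W_U U)"
  proof -
    have "0 \<le> (\<Sum>i<n. \<bar>X i j / sigma_hat n X j\<bar> * W_U U)" using W_ge by (intro sum_nonneg) auto
    then show ?thesis by (cases "n = 0") (auto simp: divide_le_eq mult_le_cancel_left1 mult_left_le intro: order_trans[OF _ mult_left_mono[of 1 "real n"]])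
  qed
  finally show ?thesis .
qed

context
  fixes n p :: nat assumes p: "0 < p" and n: "0 < n"
begin

lemma bdd_above_score: "bdd_above ((\<lambda>u. MAX j\<in>{..<p}. score_term n X v j u) ` U)"
proof (rule bdd_aboveI2)
  fix u assume u: "u \<in> U"
  show "(MAX j\<in>{..<p}. score_term n X v j u) \<le> (\<Sum>k<p. \<Sum>i<n. \<bar>X i k / sigma_hat n X k\<bar> * W_U U)"
  proof (rule Max.boundedI)
    fix a assume "a \<in> (\<lambda>j. score_term n X v j u) ` {..<p}"
    then obtain j where j: "j < p" "a = score_term n X v j u" by auto
    have "a \<le> (\<Sum>i<n. \<bar>X i j / sigma_hat n X j\<bar> * W_U U)" unfolding j(2) by (rule score_term_bound[OF u])
    also have "\<dots> \<le> (\<Sum>k<p. \<Sum>i<n. \<bar>X i k / sigma_hat n X k\<bar> * W_U U)"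
      using j W_ge by (intro member_le_sum) (auto intro!: sum_nonneg)
    finally show "a \<le> (\<Sum>k<p. \<Sum>i<n. \<bar>X i k / sigma_hat n X k\<bar> * W_U U)" .
  qed (use p in auto)
qed

text \<open>Reduces the supremum over U to countably many indices, from which joint measurability in
  the design and the uniform variables follows.\<close>

lemma Lam_countable: "Lam U n p X v = real n * (SUP u\<in>right_dense. MAX j\<in>{..<p}. score_term n X v j u)"
proof -
  have rd: "right_dense \<noteq> {}" using right_dense_ex[of _ 1] U(2) by auto
  have bd: "bdd_above ((\<lambda>u. MAX j\<in>{..<p}. score_term n X v j u) ` right_dense)"
    by (rule bdd_above_mono[OF bdd_above_score]) (use right_dense_subset in auto)
  have "(SUP u\<in>U. MAX j\<in>{..<p}. score_term n X v j u) = (SUP u\<in>right_dense. MAX j\<in>{..<p}. score_term n X v j u)"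
  proof (rule antisym)
    show "(SUP u\<in>U. MAX j\<in>{..<p}. score_term n X v j u) \<le> (SUP u\<in>right_dense. MAX j\<in>{..<p}. score_term n X v j u)"
    proof (rule cSUP_least[OF U(2)], rule Max.boundedI)
      fix u a assume u: "u \<in> U" and "a \<in> (\<lambda>j. score_term n X v j u) ` {..<p}"
      then obtain j where j: "j < p" "a = score_term n X v j u" by auto
      show "a \<le> (SUP u\<in>right_dense. MAX j\<in>{..<p}. score_term n X v j u)"
        unfolding j(2)
      proof (rule right_continuous_le[OF u score_term_right_cont[OF u]])
        fix d assume d: "d \<in> right_dense"
        have "score_term n X v j d \<le> (MAX j\<in>{..<p}. score_term n X v j d)" using j by (intro Max_ge) auto
        also have "\<dots> \<le> (SUP u\<in>right_dense. MAX j\<in>{..<p}. score_term n X v j u)"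
          by (rule cSUP_upper[OF d bd])
        finally show "score_term n X v j d \<le> (SUP u\<in>right_dense. MAX j\<in>{..<p}. score_term n X v j u)" .
      qed
    qed (use p in auto)
    show "(SUP u\<in>right_dense. MAX j\<in>{..<p}. score_term n X v j u) \<le> (SUP u\<in>U. MAX j\<in>{..<p}. score_term n X v j u)"
      by (rule cSUP_subset_mono[OF rd bdd_above_score right_dense_subset]) simp
  qed
  then show ?thesis by (simp add: Lam_eq_score)
qed

lemma score_le_Lam:
  assumes "u \<in> U" "j < p" "0 < sigma_hat n X j"
  shows "\<bar>\<Sum>i<n. X i j * (u - of_bool (v i \<le> u))\<bar> \<le> Lam U n p X v * (sigma_hat n X j * sqrt (u * (1 - u)))"
proof -
  have u: "0 < u" "u < 1" using assms U by auto
  let ?s = "sigma_hat n X j * sqrt (u * (1 - u))"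
  have s: "0 < ?s" using u assms by simp
  have "score_term n X v j u \<le> (MAX j\<in>{..<p}. score_term n X v j u)" using assms by (intro Max_ge) auto
  also have "\<dots> \<le> (SUP u\<in>U. MAX j\<in>{..<p}. score_term n X v j u)" by (rule cSUP_upper[OF assms(1) bdd_above_score])
  finally have "real n * score_term n X v j u \<le> Lam U n p X v" by (simp add: Lam_eq_score mult_left_mono)
  moreover have "real n * score_term n X v j u = \<bar>\<Sum>i<n. X i j * (u - of_bool (v i \<le> u))\<bar> / ?s"
    unfolding score_term_def sum_divide_distrib[symmetric] abs_divide using n s by simp
  ultimately show ?thesis using s by (simp add: divide_le_eq)
qed

lemma Lam_measurable: "(\<lambda>(X, v). Lam U n p X v) \<in> borel_measurable (Pi\<^sub>M {..<n} (\<lambda>_. Rp p) \<Otimes>\<^sub>M Pi\<^sub>M {..<n} (\<lambda>_. borel :: real measure))"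
proof -
  have X: "(\<lambda>z. fst z i j) \<in> borel_measurable (Pi\<^sub>M {..<n} (\<lambda>_. Rp p) \<Otimes>\<^sub>M Pi\<^sub>M {..<n} (\<lambda>_. borel :: real measure))" if "i < n" "j < p" for i j
  proof -
    have "(\<lambda>z. fst z i) \<in> Pi\<^sub>M {..<n} (\<lambda>_. Rp p) \<Otimes>\<^sub>M Pi\<^sub>M {..<n} (\<lambda>_. borel :: real measure) \<rightarrow>\<^sub>M Rp p"
      using that by (intro measurable_compose[OF measurable_fst] measurable_component_singleton) auto
    then show ?thesis by (rule measurable_compose) (use that in \<open>auto intro!: measurable_component_singleton\<close>)
  qed
  have v: "(\<lambda>z. snd z i) \<in> borel_measurable (Pi\<^sub>M {..<n} (\<lambda>_. Rp p) \<Otimes>\<^sub>M Pi\<^sub>M {..<n} (\<lambda>_. borel :: real measure))" if "i < n" for i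
    using that by (intro measurable_compose[OF measurable_snd] measurable_component_singleton) auto
  have s: "(\<lambda>z. sigma_hat n (fst z) j) \<in> borel_measurable (Pi\<^sub>M {..<n} (\<lambda>_. Rp p) \<Otimes>\<^sub>M Pi\<^sub>M {..<n} (\<lambda>_. borel :: real measure))" if "j < p" for j
  proof -
    have [measurable]: "(\<lambda>z. \<Sum>i<n. (fst z i j)\<^sup>2) \<in> borel_measurable (Pi\<^sub>M {..<n} (\<lambda>_. Rp p) \<Otimes>\<^sub>M Pi\<^sub>M {..<n} (\<lambda>_. borel :: real measure))"
      using that by (intro borel_measurable_sum borel_measurable_power X) auto
    show ?thesis unfolding sigma_hat_def by measurable
  qed
  have b: "(\<lambda>z. of_bool (snd z i \<le> u) :: real) \<in> borel_measurable (Pi\<^sub>M {..<n} (\<lambda>_. Rp p) \<Otimes>\<^sub>M Pi\<^sub>M {..<n} (\<lambda>_. borel :: real measure))" if "i < n" for i u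
  proof -
    have [measurable]: "(\<lambda>z. snd z i) \<in> borel_measurable (Pi\<^sub>M {..<n} (\<lambda>_. Rp p) \<Otimes>\<^sub>M Pi\<^sub>M {..<n} (\<lambda>_. borel :: real measure))" by (rule v[OF that])
    show ?thesis by measurable
  qed
  have t: "(\<lambda>z. score_term n (fst z) (snd z) j u) \<in> borel_measurable (Pi\<^sub>M {..<n} (\<lambda>_. Rp p) \<Otimes>\<^sub>M Pi\<^sub>M {..<n} (\<lambda>_. borel :: real measure))" if "j < p" for j u
    unfolding score_term_def using that
    by (intro borel_measurable_abs borel_measurable_divide borel_measurable_sum borel_measurable_times
        borel_measurable_diff X b s borel_measurable_const) auto
  have "(\<lambda>z. real n * (SUP u\<in>right_dense. MAX j\<in>{..<p}. score_term n (fst z) (snd z) j u)) \<in> borel_measurable (Pi\<^sub>M {..<n} (\<lambda>_. Rp p) \<Otimes>\<^sub>M Pi\<^sub>M {..<n} (\<lambda>_. borel :: real measure))"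
  proof (intro borel_measurable_times borel_measurable_const borel_measurable_cSUP countable_right_dense)
    fix u show "(\<lambda>z. MAX j\<in>{..<p}. score_term n (fst z) (snd z) j u) \<in> borel_measurable (Pi\<^sub>M {..<n} (\<lambda>_. Rp p) \<Otimes>\<^sub>M Pi\<^sub>M {..<n} (\<lambda>_. borel :: real measure))"
      using t by (intro borel_measurable_Max) auto
  next
    fix z show "bdd_above ((\<lambda>u. MAX j\<in>{..<p}. score_term n (fst z) (snd z) j u) ` right_dense)"
      by (rule bdd_above_mono[OF bdd_above_score]) (use right_dense_subset in auto)
  qed
  then show ?thesis by (simp add: Lam_countable case_prod_beta)
qed

end

end

section \<open>Quantiles of conditional laws and products of pairs\<close>

lemma quantile_le_iff:
  assumes "real_distribution N" "0 < t" "t < 1"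
  shows "quantile N t \<le> c \<longleftrightarrow> t \<le> measure N {..c}"
proof -
  interpret N: real_distribution N by fact
  let ?S = "{v. t \<le> measure N {..v}}"
  have S: "?S = {v. t \<le> cdf N v}" by (simp add: cdf_def)
  have "\<forall>\<^sub>F v in at_top. cdf N v > t"
    using N.cdf_lim_at_top_prob assms by (intro order_tendstoD(1)) auto
  then have ne: "?S \<noteq> {}" unfolding S by (auto simp: eventually_at_top_linorder intro: less_imp_le)
  have "\<forall>\<^sub>F v in at_bot. cdf N v < t"
    using N.cdf_lim_at_bot assms by (intro order_tendstoD(2)) auto
  then obtain l where l: "cdf N l < t" by (auto simp: eventually_at_bot_linorder)
  have lb: "l \<le> v" if "v \<in> ?S" for v
    using that l N.cdf_nondecreasing[of v l] unfolding S by (cases "l \<le> v") auto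
  then have bb: "bdd_below ?S" by (rule bdd_belowI)
  \<comment> \<open>Right continuity of the distribution function makes the infimum attained; the
    forward implication depends on this.\<close>
  have in_S: "Inf ?S \<in> ?S"
  proof -
    have "t \<le> cdf N (Inf ?S)"
    proof (rule tendsto_lowerbound)
      show "(cdf N \<longlongrightarrow> cdf N (Inf ?S)) (at_right (Inf ?S))"
        using N.cdf_is_right_cont[of "Inf ?S"] by (simp add: continuous_within)
      show "\<forall>\<^sub>F v in at_right (Inf ?S). t \<le> cdf N v"
      proof (rule eventually_at_rightI[of _ "Inf ?S + 1"])
        fix v assume "v \<in> {Inf ?S<..<Inf ?S + 1}"
        then obtain w where "w \<in> ?S" "w < v" using cInf_less_iff[OF ne bb, of v] by auto
        then show "t \<le> cdf N v" using N.cdf_nondecreasing[of w v] unfolding S by auto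
      qed simp
    qed simp
    then show ?thesis by (simp add: S)
  qed
  show ?thesis
  proof
    assume "quantile N t \<le> c"
    then have "cdf N (Inf ?S) \<le> cdf N c" unfolding quantile_def by (rule N.cdf_nondecreasing)
    then show "t \<le> measure N {..c}" using in_S by (simp add: cdf_def)
  next
    assume "t \<le> measure N {..c}"
    then show "quantile N t \<le> c" unfolding quantile_def by (intro cInf_lower bb) simp
  qed
qed

text \<open>For each first coordinate the section has probability at least t by definition of the
  quantile, and Fubini integrates this. That the quantile is measurable in the first coordinate
  follows from \<open>quantile_le_iff\<close>, which expresses its sublevel sets through measures of
  sections.\<close>

lemma quantile_event:
  fixes L :: "'a \<times> 'b \<Rightarrow> real"
  assumes "prob_space MA" "prob_space MB" and L: "L \<in> borel_measurable (MA \<Otimes>\<^sub>M MB)" and t: "0 < t" "t < 1"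
  shows "{z \<in> space (MA \<Otimes>\<^sub>M MB). L z \<le> quantile (distr MB borel (\<lambda>b. L (fst z, b))) t} \<in> sets (MA \<Otimes>\<^sub>M MB)" (is "?E \<in> _")
    and "t \<le> measure (MA \<Otimes>\<^sub>M MB) {z \<in> space (MA \<Otimes>\<^sub>M MB). L z \<le> quantile (distr MB borel (\<lambda>b. L (fst z, b))) t}"
proof -
  interpret A: prob_space MA by fact
  interpret B: prob_space MB by fact
  interpret AB: pair_prob_space MA MB ..
  let ?q = "\<lambda>a. quantile (distr MB borel (\<lambda>b. L (a, b))) t"
  have La: "(\<lambda>b. L (a, b)) \<in> borel_measurable MB" if "a \<in> space MA" for a
    using L that by (rule measurable_Pair2)
  have rd: "real_distribution (distr MB borel (\<lambda>b. L (a, b)))" if "a \<in> space MA" for a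
    using La[OF that] by (intro real_distribution.intro B.prob_space_distr real_distribution_axioms.intro) simp_all
  have md: "measure (distr MB borel (\<lambda>b. L (a, b))) {..c} = measure MB {b \<in> space MB. L (a, b) \<le> c}" if "a \<in> space MA" for a c
    by (subst measure_distr[OF La[OF that]]) (auto simp: vimage_def Int_def conj_commute)
  have q: "?q \<in> borel_measurable MA"
  proof (rule borel_measurableI_le)
    fix c
    have C: "{z \<in> space (MA \<Otimes>\<^sub>M MB). L z \<le> c} \<in> sets (MA \<Otimes>\<^sub>M MB)" using L by measurable
    have "{a \<in> space MA. ?q a \<le> c} = {a \<in> space MA. ennreal t \<le> emeasure MB (Pair a -` {z \<in> space (MA \<Otimes>\<^sub>M MB). L z \<le> c})}"
    proof (intro Collect_cong conj_cong refl)
      fix a assume a: "a \<in> space MA"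
      have "Pair a -` {z \<in> space (MA \<Otimes>\<^sub>M MB). L z \<le> c} = {b \<in> space MB. L (a, b) \<le> c}"
        using a by (auto simp: space_pair_measure)
      then show "?q a \<le> c \<longleftrightarrow> ennreal t \<le> emeasure MB (Pair a -` {z \<in> space (MA \<Otimes>\<^sub>M MB). L z \<le> c})"
        unfolding quantile_le_iff[OF rd[OF a] t] md[OF a] by (simp add: B.emeasure_eq_measure)
    qed
    also have "\<dots> \<in> sets MA" using B.measurable_emeasure_Pair[OF C] by measurable
    finally show "{a \<in> space MA. ?q a \<le> c} \<in> sets MA" .
  qed
  have q': "(\<lambda>z. ?q (fst z)) \<in> borel_measurable (MA \<Otimes>\<^sub>M MB)" by (rule measurable_compose[OF measurable_fst q])
  show E: "?E \<in> sets (MA \<Otimes>\<^sub>M MB)" using q' L by measurable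
  have "ennreal t = (\<integral>\<^sup>+a. ennreal t \<partial>MA)" by (simp add: A.emeasure_space_1)
  also have "\<dots> \<le> (\<integral>\<^sup>+a. emeasure MB (Pair a -` ?E) \<partial>MA)"
  proof (rule nn_integral_mono)
    fix a assume a: "a \<in> space MA"
    have "Pair a -` ?E = {b \<in> space MB. L (a, b) \<le> ?q a}" using a by (auto simp: space_pair_measure)
    moreover have "t \<le> measure MB {b \<in> space MB. L (a, b) \<le> ?q a}"
      using quantile_le_iff[OF rd[OF a] t, of "?q a"] unfolding md[OF a] by simp
    ultimately show "ennreal t \<le> emeasure MB (Pair a -` ?E)"
      by (simp add: B.emeasure_eq_measure)
  qed
  also have "\<dots> = emeasure (MA \<Otimes>\<^sub>M MB) ?E" by (rule B.emeasure_pair_measure_alt[OF E, symmetric])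
  finally show "t \<le> measure (MA \<Otimes>\<^sub>M MB) ?E" using t by (simp add: AB.emeasure_eq_measure)
qed

text \<open>The sample is a product of independent pairs, whereas the conditional quantile treats
  design and ranks as two separate factors; this regrouping mediates between them.\<close>

lemma distr_zip_PiM:
  assumes "prob_space A" "prob_space B" "finite I"
  shows "distr (Pi\<^sub>M I (\<lambda>_. A) \<Otimes>\<^sub>M Pi\<^sub>M I (\<lambda>_. B)) (Pi\<^sub>M I (\<lambda>_. A \<Otimes>\<^sub>M B)) (\<lambda>(a, b). \<lambda>i\<in>I. (a i, b i))
    = Pi\<^sub>M I (\<lambda>_. A \<Otimes>\<^sub>M B)"
proof -
  interpret A: prob_space A by fact
  interpret B: prob_space B by fact
  interpret AB: pair_prob_space A B ..
  interpret PA: product_sigma_finite "\<lambda>_. A" by (simp add: product_sigma_finite_def A.sigma_finite_measure_axioms)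
  interpret PB: product_sigma_finite "\<lambda>_. B" by (simp add: product_sigma_finite_def B.sigma_finite_measure_axioms)
  interpret PAB: product_sigma_finite "\<lambda>_. A \<Otimes>\<^sub>M B" by (simp add: product_sigma_finite_def AB.sigma_finite_measure_axioms)
  interpret QB: prob_space "Pi\<^sub>M I (\<lambda>_. B)" by (intro prob_space_PiM assms)
  let ?z = "\<lambda>(a, b). \<lambda>i\<in>I. (a i, b i)"
  have m: "?z \<in> Pi\<^sub>M I (\<lambda>_. A) \<Otimes>\<^sub>M Pi\<^sub>M I (\<lambda>_. B) \<rightarrow>\<^sub>M Pi\<^sub>M I (\<lambda>_. A \<Otimes>\<^sub>M B)"
    unfolding case_prod_beta
    by (intro measurable_restrict measurable_Pair measurable_compose[OF measurable_fst] measurable_compose[OF measurable_snd]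
        measurable_component_singleton)
  show ?thesis
  proof (rule PAB.PiM_eqI[OF assms(3)])
    fix S assume S: "\<And>i. i \<in> I \<Longrightarrow> S i \<in> sets (A \<Otimes>\<^sub>M B)"
    have PS: "Pi\<^sub>E I S \<in> sets (Pi\<^sub>M I (\<lambda>_. A \<Otimes>\<^sub>M B))" using S assms(3) by (intro sets_PiM_I_finite) auto
    define E where "E = ?z -` Pi\<^sub>E I S \<inter> space (Pi\<^sub>M I (\<lambda>_. A) \<Otimes>\<^sub>M Pi\<^sub>M I (\<lambda>_. B))"
    have E: "E \<in> sets (Pi\<^sub>M I (\<lambda>_. A) \<Otimes>\<^sub>M Pi\<^sub>M I (\<lambda>_. B))" unfolding E_def by (rule measurable_sets[OF m PS])
    have "emeasure (distr (Pi\<^sub>M I (\<lambda>_. A) \<Otimes>\<^sub>M Pi\<^sub>M I (\<lambda>_. B)) (Pi\<^sub>M I (\<lambda>_. A \<Otimes>\<^sub>M B)) ?z) (Pi\<^sub>E I S) = emeasure (Pi\<^sub>M I (\<lambda>_. A) \<Otimes>\<^sub>M Pi\<^sub>M I (\<lambda>_. B)) E"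
      unfolding E_def by (rule emeasure_distr[OF m PS])
    also have "\<dots> = (\<integral>\<^sup>+a. emeasure (Pi\<^sub>M I (\<lambda>_. B)) (Pair a -` E) \<partial>Pi\<^sub>M I (\<lambda>_. A))"
      by (rule QB.emeasure_pair_measure_alt[OF E])
    also have "\<dots> = (\<integral>\<^sup>+a. (\<Prod>i\<in>I. emeasure B (Pair (a i) -` S i)) \<partial>Pi\<^sub>M I (\<lambda>_. A))"
    proof (rule nn_integral_cong)
      fix a assume a: "a \<in> space (Pi\<^sub>M I (\<lambda>_. A))"
      have "Pair a -` E = Pi\<^sub>E I (\<lambda>i. Pair (a i) -` S i)"
      proof (intro set_eqI iffI)
        fix b assume "b \<in> Pair a -` E"
        then have "b \<in> space (Pi\<^sub>M I (\<lambda>_. B))" "(\<lambda>i\<in>I. (a i, b i)) \<in> Pi\<^sub>E I S"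
          using a by (auto simp: E_def space_pair_measure)
        then show "b \<in> Pi\<^sub>E I (\<lambda>i. Pair (a i) -` S i)" by (auto simp: space_PiM PiE_iff)
      next
        fix b assume b: "b \<in> Pi\<^sub>E I (\<lambda>i. Pair (a i) -` S i)"
        then have "b i \<in> space B" if "i \<in> I" for i
          using sets.sets_into_space[OF S[OF that]] that by (auto simp: PiE_iff space_pair_measure)
        then show "b \<in> Pair a -` E" using a b by (auto simp: E_def space_pair_measure space_PiM PiE_iff)
      qed
      then show "emeasure (Pi\<^sub>M I (\<lambda>_. B)) (Pair a -` E) = (\<Prod>i\<in>I. emeasure B (Pair (a i) -` S i))"
        using PB.emeasure_PiM[OF assms(3), of "\<lambda>i. Pair (a i) -` S i"] S by (simp add: sets_Pair1)
    qed
    also have "\<dots> = (\<Prod>i\<in>I. \<integral>\<^sup>+a. emeasure B (Pair a -` S i) \<partial>A)"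
      using S by (intro PA.product_nn_integral_prod assms(3) B.measurable_emeasure_Pair)
    also have "\<dots> = (\<Prod>i\<in>I. emeasure (A \<Otimes>\<^sub>M B) (S i))"
      using S by (intro prod.cong refl B.emeasure_pair_measure_alt[symmetric])
    finally show "emeasure (distr (Pi\<^sub>M I (\<lambda>_. A) \<Otimes>\<^sub>M Pi\<^sub>M I (\<lambda>_. B)) (Pi\<^sub>M I (\<lambda>_. A \<Otimes>\<^sub>M B)) ?z) (Pi\<^sub>E I S) = (\<Prod>i\<in>I. emeasure (A \<Otimes>\<^sub>M B) (S i))" .
  qed simp
qed

section \<open>The quantile regression model\<close>

lemma dot_measurable [measurable]: "(\<lambda>z. dot p z d) \<in> borel_measurable (Rp p)"
  unfolding dot_def by (intro borel_measurable_sum borel_measurable_times measurable_component_singleton) auto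

lemma dot_le_L2_set: "\<bar>dot p a b\<bar> \<le> L2_set a {..<p} * L2_set b {..<p}"
proof -
  have "\<bar>dot p a b\<bar> \<le> (\<Sum>j<p. \<bar>a j * b j\<bar>)" unfolding dot_def by (rule sum_abs)
  also have "\<dots> \<le> L2_set a {..<p} * L2_set b {..<p}" unfolding abs_mult by (rule L2_set_mult_ineq)
  finally show ?thesis .
qed

definition cond_cdf :: "((nat \<Rightarrow> real) \<Rightarrow> real \<Rightarrow> real) \<Rightarrow> (nat \<Rightarrow> real) \<Rightarrow> real \<Rightarrow> real" where
  "cond_cdf f z v = measure (density lborel (\<lambda>w. ennreal (f z w))) {..v}"

text \<open>Countably many null balls with rational centre and radius cover the complement of the
  support. A measurable null superset is enough, and avoids deciding whether the support is
  measurable.\<close>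

lemma law_support_null:
  assumes M: "prob_space M" and X: "X \<in> M \<rightarrow>\<^sub>M Rp p"
  obtains N where "N \<in> sets (Rp p)" "emeasure (distr M (Rp p) X) N = 0" "space (Rp p) - law_support M p X \<subseteq> N"
proof -
  interpret M: prob_space M by fact
  let ?B = "\<lambda>(c, r). {z \<in> space (Rp p). L2_set (\<lambda>j. z j - c j) {..<p} < r}"
  have Lm: "(\<lambda>z. L2_set (\<lambda>j. z j - c j) {..<p}) \<in> borel_measurable (Rp p)" for c
  proof -
    have [measurable]: "(\<lambda>z. \<Sum>j<p. (z j - c j)\<^sup>2) \<in> borel_measurable (Rp p)"
      by (intro borel_measurable_sum borel_measurable_power borel_measurable_diff measurable_component_singleton) auto
    show ?thesis unfolding L2_set_def by measurable
  qed
  have B: "?B cr \<in> sets (Rp p)" for cr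
    using Lm[of "fst cr"] by (cases cr) (simp, measurable)
  let ?I = "{cr \<in> PiE {..<p} (\<lambda>_. \<rat>) \<times> \<rat>. emeasure (distr M (Rp p) X) (?B cr) = 0}"
  have cI: "countable ?I"
  proof (rule countable_subset)
    show "countable (PiE {..<p} (\<lambda>_. \<rat> :: real set) \<times> (\<rat> :: real set))"
      by (intro countable_SIGMA countable_PiE countable_rat) auto
  qed auto
  define N where "N = (\<Union>cr\<in>?I. ?B cr)"
  have "N \<in> sets (Rp p)" unfolding N_def by (intro sets.countable_UN'' cI B)
  moreover have "emeasure (distr M (Rp p) X) N = 0"
  proof -
    have "N \<in> null_sets (distr M (Rp p) X)"
      unfolding N_def by (intro null_sets_UN' cI null_setsI) (use B in auto)
    then show ?thesis by auto
  qed
  moreover have "space (Rp p) - law_support M p X \<subseteq> N"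
  proof
    fix z assume z: "z \<in> space (Rp p) - law_support M p X"
    then obtain e where e: "0 < e" "\<not> 0 < measure M {\<omega> \<in> space M. L2_set (\<lambda>j. X \<omega> j - z j) {..<p} < e}"
      by (auto simp: law_support_def)
    have "\<exists>q\<in>\<rat>. \<bar>z j - q\<bar> < e / (2 * (real p + 1))" for j
    proof -
      have "z j - e / (2 * (real p + 1)) < z j" using e by simp
      then obtain q where "q \<in> \<rat>" "z j - e / (2 * (real p + 1)) < q" "q < z j" using Rats_dense_in_real by blast
      then show ?thesis by (intro bexI[of _ q]) auto
    qed
    then obtain q where q: "\<And>j. q j \<in> \<rat>" "\<And>j. \<bar>z j - q j\<bar> < e / (2 * (real p + 1))" by metis
    \<comment> \<open>The restriction makes the rational centre a member of a countable product
      set.\<close>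
    let ?c = "\<lambda>j\<in>{..<p}. q j"
    have "L2_set (\<lambda>j. z j - ?c j) {..<p} \<le> (\<Sum>j<p. \<bar>z j - ?c j\<bar>)" by (rule L2_set_le_sum_abs)
    also have "\<dots> \<le> (\<Sum>j<p. e / (2 * (real p + 1)))" using q(2) by (intro sum_mono) (auto intro: less_imp_le)
    also have "\<dots> = real p * (e / (2 * (real p + 1)))" by simp
    also have "\<dots> < (real p + 1) * (e / (2 * (real p + 1)))" using e by (intro mult_strict_right_mono) auto
    also have "\<dots> = e / 2"
    proof -
      have "x * (y / (2 * x)) = y / 2" if "x \<noteq> 0" for x y :: real using that by simp
      then show ?thesis by (metis add_nonneg_pos less_irrefl of_nat_0_le_iff zero_less_one)
    qed
    finally have zc: "L2_set (\<lambda>j. z j - ?c j) {..<p} < e / 2" .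
    \<comment> \<open>With a radius between the distance of the centre to z and e / 2, the ball
      contains z and lies inside the null ball around z.\<close>
    obtain r where r: "r \<in> \<rat>" "L2_set (\<lambda>j. z j - ?c j) {..<p} < r" "r < e / 2" using Rats_dense_in_real[OF zc] by auto
    have sub: "X -` ?B (?c, r) \<inter> space M \<subseteq> {\<omega> \<in> space M. L2_set (\<lambda>j. X \<omega> j - z j) {..<p} < e}"
    proof
      fix \<omega> assume w: "\<omega> \<in> X -` ?B (?c, r) \<inter> space M"
      have "L2_set (\<lambda>j. X \<omega> j - z j) {..<p} = L2_set (\<lambda>j. (X \<omega> j - ?c j) + (?c j - z j)) {..<p}" by simp
      also have "\<dots> \<le> L2_set (\<lambda>j. X \<omega> j - ?c j) {..<p} + L2_set (\<lambda>j. ?c j - z j) {..<p}" by (rule L2_set_triangle_ineq)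
      also have "L2_set (\<lambda>j. ?c j - z j) {..<p} = L2_set (\<lambda>j. z j - ?c j) {..<p}"
        by (simp add: L2_set_def power2_commute)
      finally show "\<omega> \<in> {\<omega> \<in> space M. L2_set (\<lambda>j. X \<omega> j - z j) {..<p} < e}" using w r zc by auto
    qed
    have "emeasure (distr M (Rp p) X) (?B (?c, r)) = emeasure M (X -` ?B (?c, r) \<inter> space M)"
      by (rule emeasure_distr[OF X B])
    also have "\<dots> \<le> emeasure M {\<omega> \<in> space M. L2_set (\<lambda>j. X \<omega> j - z j) {..<p} < e}"
      using measurable_compose[OF X Lm[of z]] by (intro emeasure_mono[OF sub]) measurable
    also have "\<dots> = 0" using e(2) by (simp add: M.emeasure_eq_measure measure_le_0_iff not_less)
    finally have "(?c, r) \<in> ?I" using r(1) q(1) by (auto simp: PiE_iff)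
    moreover have "z \<in> ?B (?c, r)" using z r by auto
    ultimately show "z \<in> N" unfolding N_def by blast
  qed
  ultimately show ?thesis by (rule that)
qed

section \<open>Disintegration along the conditional density\<close>

locale cond_density =
  fixes M :: "'w measure" and p :: nat and Y :: "'w \<Rightarrow> real" and X :: "'w \<Rightarrow> nat \<Rightarrow> real"
    and f :: "(nat \<Rightarrow> real) \<Rightarrow> real \<Rightarrow> real"
  assumes M: "prob_space M" and Y [measurable]: "Y \<in> borel_measurable M" and X [measurable]: "X \<in> M \<rightarrow>\<^sub>M Rp p"
    and dens: "is_cond_density M p Y X f"
begin

sublocale M: prob_space M by (rule M)

lemma f_joint [measurable]: "(\<lambda>(z, v). f z v) \<in> borel_measurable (Rp p \<Otimes>\<^sub>M borel)"
  using dens by (simp add: is_cond_density_def)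

lemma f_slice: "z \<in> space (Rp p) \<Longrightarrow> f z \<in> borel_measurable borel"
  using measurable_Pair2[OF f_joint, of z] by simp

definition Px where "Px = distr M (Rp p) X"

lemma sets_Px [measurable_cong, simp]: "sets Px = sets (Rp p)" and space_Px [simp]: "space Px = space (Rp p)"
  by (simp_all add: Px_def)

sublocale Px: prob_space Px unfolding Px_def by (rule M.prob_space_distr[OF X])

sublocale PL: pair_sigma_finite Px "lborel :: real measure" ..

lemma AE_support: "AE \<omega> in M. X \<omega> \<in> law_support M p X"
proof -
  obtain N where N: "N \<in> sets (Rp p)" "emeasure (distr M (Rp p) X) N = 0" "space (Rp p) - law_support M p X \<subseteq> N"
    using law_support_null[OF M X] .
  have "emeasure M (X -` N \<inter> space M) = 0" using N by (simp add: emeasure_distr)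
  then have "AE \<omega> in M. \<omega> \<notin> X -` N \<inter> space M"
    using N(1) by (intro AE_not_in null_setsI measurable_sets[OF X])
  then show ?thesis
    using AE_space by eventually_elim (use N(3) measurable_space[OF X] in blast)
qed

text \<open>The conditional density is specified on rectangles only; they form an
  intersection-stable generator and so determine the joint law.\<close>

lemma law_XY: "distr M (Rp p \<Otimes>\<^sub>M borel) (\<lambda>\<omega>. (X \<omega>, Y \<omega>)) = density (Px \<Otimes>\<^sub>M lborel) (\<lambda>(z, v). ennreal (f z v))"
  (is "?D = ?K")
proof (rule measure_eqI_generator_eq[OF Int_stable_pair_measure_generator[of "Rp p" "borel :: real measure"]])
  let ?E = "{a \<times> b |a b. a \<in> sets (Rp p) \<and> b \<in> sets (borel :: real measure)}"
  show "?E \<subseteq> Pow (space (Rp p) \<times> space borel)" by (rule pair_measure_closed)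
  show "sets ?D = sigma_sets (space (Rp p) \<times> space borel) ?E" by (simp add: sets_pair_measure)
  show "sets ?K = sigma_sets (space (Rp p) \<times> space borel) ?E"
  proof -
    have "sets ?K = sets (Rp p \<Otimes>\<^sub>M (borel :: real measure))" by (simp cong: sets_pair_measure_cong)
    then show ?thesis by (simp only: sets_pair_measure)
  qed
  have D: "emeasure ?D (A \<times> B) = emeasure M {\<omega> \<in> space M. X \<omega> \<in> A \<and> Y \<omega> \<in> B}" if "A \<in> sets (Rp p)" "B \<in> sets borel" for A B
    using that by (subst emeasure_distr) (auto intro!: arg_cong[of _ _ "emeasure M"])
  fix S assume "S \<in> ?E"
  then obtain A B where AB: "S = A \<times> B" "A \<in> sets (Rp p)" "B \<in> sets borel" by auto
  have AB2: "A \<times> B \<in> sets (Px \<Otimes>\<^sub>M lborel)" using AB by auto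
  have [measurable]: "A \<in> sets (Rp p)" "B \<in> sets borel" by fact+
  have "emeasure ?K (A \<times> B) = (\<integral>\<^sup>+z. (\<integral>\<^sup>+v. ennreal (f z v) * indicator (A \<times> B) (z, v) \<partial>lborel) \<partial>Px)"
    using AB2 by (subst emeasure_density) (auto simp: lborel.nn_integral_fst[symmetric] case_prod_beta)
  also have "\<dots> = (\<integral>\<^sup>+z. indicator A z * (\<integral>\<^sup>+v. ennreal (f z v) * indicator B v \<partial>lborel) \<partial>Px)"
    by (intro nn_integral_cong) (auto simp: indicator_times indicator_def split: if_splits)
  also have "\<dots> = (\<integral>\<^sup>+\<omega>. indicator A (X \<omega>) * (\<integral>\<^sup>+v. ennreal (f (X \<omega>) v) * indicator B v \<partial>lborel) \<partial>M)"
    unfolding Px_def by (subst nn_integral_distr) auto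
  also have "\<dots> = emeasure ?D (A \<times> B)" using dens AB by (simp add: D is_cond_density_def)
  finally show "emeasure ?D S = emeasure ?K S" using AB by simp
next
  let ?W = "\<lambda>i::nat. space (Rp p) \<times> space (borel :: real measure)"
  have "space (Rp p) \<in> sets (Rp p)" "space (borel :: real measure) \<in> sets borel" by (rule sets.top)+
  then show "range ?W \<subseteq> {a \<times> b |a b. a \<in> sets (Rp p) \<and> b \<in> sets (borel :: real measure)}" by blast
  show "(\<Union>i. ?W i) = space (Rp p) \<times> space borel" by auto
  interpret D: prob_space ?D by (rule M.prob_space_distr) measurable
  show "emeasure ?D (?W i) \<noteq> \<infinity>" for i :: nat using D.emeasure_finite[of "?W i"] by simp
qed

lemma nn_integral_XY:
  assumes [measurable]: "h \<in> borel_measurable (Rp p \<Otimes>\<^sub>M borel)"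
  shows "(\<integral>\<^sup>+\<omega>. h (X \<omega>, Y \<omega>) \<partial>M) = (\<integral>\<^sup>+z. (\<integral>\<^sup>+v. ennreal (f z v) * h (z, v) \<partial>lborel) \<partial>Px)"
proof -
  have "(\<integral>\<^sup>+\<omega>. h (X \<omega>, Y \<omega>) \<partial>M) = (\<integral>\<^sup>+zv. h zv \<partial>distr M (Rp p \<Otimes>\<^sub>M borel) (\<lambda>\<omega>. (X \<omega>, Y \<omega>)))"
    by (subst nn_integral_distr) auto
  also have "\<dots> = (\<integral>\<^sup>+zv. (case zv of (z, v) \<Rightarrow> ennreal (f z v)) * h zv \<partial>(Px \<Otimes>\<^sub>M lborel))"
    unfolding law_XY by (subst nn_integral_density) auto
  also have "\<dots> = (\<integral>\<^sup>+z. (\<integral>\<^sup>+v. ennreal (f z v) * h (z, v) \<partial>lborel) \<partial>Px)"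
    by (subst lborel.nn_integral_fst[symmetric]) (auto simp: case_prod_beta)
  finally show ?thesis .
qed

lemma AE_Px_iff: "{z \<in> space (Rp p). P z} \<in> sets (Rp p) \<Longrightarrow> (AE z in Px. P z) \<longleftrightarrow> (AE \<omega> in M. P (X \<omega>))"
  unfolding Px_def by (rule AE_distr_iff[OF X])

lemma AE_Px_support: "AE z in Px. z \<in> law_support M p X"
proof -
  obtain N where N: "N \<in> sets (Rp p)" "emeasure (distr M (Rp p) X) N = 0" "space (Rp p) - law_support M p X \<subseteq> N"
    using law_support_null[OF M X] .
  have "AE z in Px. z \<notin> N" unfolding Px_def using N by (intro AE_not_in null_setsI) auto
  then show ?thesis using AE_space by eventually_elim (use N(3) in auto)
qed

lemma f_nonneg: "z \<in> law_support M p X \<Longrightarrow> 0 \<le> f z v"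
  using dens by (simp add: is_cond_density_def)

lemma support_space: "z \<in> law_support M p X \<Longrightarrow> z \<in> space (Rp p)"
  by (simp add: law_support_def)

lemma integral_XY:
  fixes h :: "(nat \<Rightarrow> real) \<times> real \<Rightarrow> real"
  assumes [measurable]: "h \<in> borel_measurable (Rp p \<Otimes>\<^sub>M borel)" and int: "integrable M (\<lambda>\<omega>. h (X \<omega>, Y \<omega>))"
  shows "integrable M (\<lambda>\<omega>. \<integral>v. h (X \<omega>, v) \<partial>density lborel (\<lambda>v. ennreal (f (X \<omega>) v)))"
    and "(\<integral>\<omega>. h (X \<omega>, Y \<omega>) \<partial>M) = (\<integral>\<omega>. (\<integral>v. h (X \<omega>, v) \<partial>density lborel (\<lambda>v. ennreal (f (X \<omega>) v))) \<partial>M)"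
proof -
  \<comment> \<open>Off the support \<open>f\<close> may be negative. \<open>ennreal\<close> cuts it
    off to 0 inside the measure, so a real-valued density has to do the same.\<close>
  let ?fp = "\<lambda>z v. max 0 (f z v)"
  let ?fq = "\<lambda>zv. ?fp (fst zv) (snd zv)"
  have [measurable]: "?fq \<in> borel_measurable (Rp p \<Otimes>\<^sub>M borel)"
    unfolding case_prod_beta using f_joint[unfolded case_prod_beta] by measurable
  have law: "distr M (Rp p \<Otimes>\<^sub>M borel) (\<lambda>\<omega>. (X \<omega>, Y \<omega>)) = density (Px \<Otimes>\<^sub>M lborel) (\<lambda>zv. ennreal (?fq zv))"
    unfolding law_XY by (intro arg_cong2[of _ _ _ _ density] refl ext) (auto simp: ennreal_neg max_def)
  have d: "density lborel (\<lambda>v. ennreal (f z v)) = density lborel (\<lambda>v. ennreal (?fp z v))" for z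
    by (intro arg_cong2[of _ _ _ _ density] refl ext) (auto simp: ennreal_neg max_def)
  have inner: "(\<integral>v. h (z, v) \<partial>density lborel (\<lambda>v. ennreal (f z v))) = (\<integral>v. ?fp z v * h (z, v) \<partial>lborel)"
    if z: "z \<in> space (Rp p)" for z
  proof -
    have [measurable]: "(\<lambda>v. h (z, v)) \<in> borel_measurable borel" "f z \<in> borel_measurable borel"
      using z f_slice[OF z] measurable_Pair2[OF assms(1) z] by auto
    show ?thesis unfolding d by (subst integral_density) auto
  qed
  have "integrable (distr M (Rp p \<Otimes>\<^sub>M borel) (\<lambda>\<omega>. (X \<omega>, Y \<omega>))) h"
    using int by (subst integrable_distr_eq) auto
  then have i2: "integrable (Px \<Otimes>\<^sub>M lborel) (\<lambda>zv. ?fq zv * h zv)"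
    unfolding law by (subst (asm) integrable_density) (auto simp: case_prod_beta)
  have i3: "integrable Px (\<lambda>z. \<integral>v. ?fp z v * h (z, v) \<partial>lborel)"
    using PL.integrable_fst'[OF i2] by simp
  have [measurable]: "(\<lambda>z. \<integral>v. ?fp z v * h (z, v) \<partial>lborel) \<in> borel_measurable (Rp p)" using i3 by auto
  have "integrable M (\<lambda>\<omega>. \<integral>v. ?fp (X \<omega>) v * h (X \<omega>, v) \<partial>lborel)"
    using i3 unfolding Px_def by (subst (asm) integrable_distr_eq) auto
  then show "integrable M (\<lambda>\<omega>. \<integral>v. h (X \<omega>, v) \<partial>density lborel (\<lambda>v. ennreal (f (X \<omega>) v)))"
    by (rule Bochner_Integration.integrable_cong[THEN iffD1, rotated -1]) (auto simp: inner[OF measurable_space[OF X]])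
  have "(\<integral>\<omega>. h (X \<omega>, Y \<omega>) \<partial>M) = (\<integral>zv. h zv \<partial>distr M (Rp p \<Otimes>\<^sub>M borel) (\<lambda>\<omega>. (X \<omega>, Y \<omega>)))"
    by (subst integral_distr) auto
  also have "\<dots> = (\<integral>zv. ?fq zv * h zv \<partial>(Px \<Otimes>\<^sub>M lborel))"
    unfolding law by (subst integral_density) (auto simp: case_prod_beta)
  also have "\<dots> = (\<integral>z. (\<integral>v. ?fp z v * h (z, v) \<partial>lborel) \<partial>Px)"
    using PL.integral_fst'[OF i2] by simp
  also have "\<dots> = (\<integral>\<omega>. (\<integral>v. ?fp (X \<omega>) v * h (X \<omega>, v) \<partial>lborel) \<partial>M)"
    unfolding Px_def by (subst integral_distr) auto
  also have "\<dots> = (\<integral>\<omega>. (\<integral>v. h (X \<omega>, v) \<partial>density lborel (\<lambda>v. ennreal (f (X \<omega>) v))) \<partial>M)"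
    by (rule Bochner_Integration.integral_cong[OF refl], rule inner[symmetric]) (rule measurable_space[OF X])
  finally show "(\<integral>\<omega>. h (X \<omega>, Y \<omega>) \<partial>M) = (\<integral>\<omega>. (\<integral>v. h (X \<omega>, v) \<partial>density lborel (\<lambda>v. ennreal (f (X \<omega>) v))) \<partial>M)" .
qed

lemma cond_cdf_eq:
  assumes "z \<in> space (Rp p)"
  shows "cond_cdf f z v = enn2real (\<integral>\<^sup>+w. ennreal (f z w) * indicator {..v} w \<partial>lborel)"
  using f_slice[OF assms] by (simp add: cond_cdf_def measure_def emeasure_density)

lemma cond_cdf_measurable [measurable]: "(\<lambda>(z, v). cond_cdf f z v) \<in> borel_measurable (Rp p \<Otimes>\<^sub>M borel)"
proof -
  have [measurable]: "(\<lambda>(zv, w). ennreal (f (fst zv) w) * indicator {..snd zv} w) \<in> borel_measurable ((Rp p \<Otimes>\<^sub>M borel) \<Otimes>\<^sub>M lborel)"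
  proof -
    have 1: "(\<lambda>y. f (fst (fst y)) (snd y)) \<in> borel_measurable ((Rp p \<Otimes>\<^sub>M borel) \<Otimes>\<^sub>M lborel)"
      using measurable_compose[of "\<lambda>y. (fst (fst y), snd y)" "(Rp p \<Otimes>\<^sub>M borel) \<Otimes>\<^sub>M lborel" "Rp p \<Otimes>\<^sub>M borel", OF _ f_joint]
      by (simp add: measurable_lborel1)
    have 2: "(\<lambda>y. indicator {..snd (fst y)} (snd y) :: ennreal) \<in> borel_measurable ((Rp p \<Otimes>\<^sub>M borel) \<Otimes>\<^sub>M (lborel :: real measure))"
    proof -
      have "(\<lambda>y. if snd y \<le> snd (fst y) then 1 else 0 :: ennreal) \<in> borel_measurable ((Rp p \<Otimes>\<^sub>M borel) \<Otimes>\<^sub>M (lborel :: real measure))"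
        by measurable
      then show ?thesis by (simp add: indicator_def)
    qed
    show ?thesis unfolding case_prod_beta using 1 2 by measurable
  qed
  have "(\<lambda>zv. enn2real (\<integral>\<^sup>+w. ennreal (f (fst zv) w) * indicator {..snd zv} w \<partial>lborel)) \<in> borel_measurable (Rp p \<Otimes>\<^sub>M borel)"
    by measurable
  then show ?thesis
    by (rule measurable_cong[THEN iffD1, rotated]) (auto simp: cond_cdf_eq space_pair_measure)
qed

end

locale qr_sample =
  fixes Q :: "'w qr_model" and U :: "real set" and s :: nat and flow L fbar fbar' C_L :: real
  assumes U: "compact U" "U \<noteq> {}" "U \<subseteq> {0<..<1}"
    and D1: "cond_D1 Q U flow fbar fbar'"
    and D2: "cond_D2 Q U s L C_L"
begin

abbreviation "M \<equiv> pspace Q"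
abbreviation "n \<equiv> nobs Q"
abbreviation "p \<equiv> dim Q"
abbreviation "x \<equiv> covar Q"
abbreviation "y \<equiv> resp Q"
abbreviation "f \<equiv> cdens Q"
abbreviation "\<beta> \<equiv> coef Q"
abbreviation "supp_x \<equiv> law_support (pspace Q) (dim Q) (covar Q 0)"
abbreviation "OZ \<equiv> (borel :: real measure) \<Otimes>\<^sub>M Rp (dim Q)"

lemma D1_basic:
  shows prob_M: "prob_space M" and n3: "3 \<le> n" and p3: "3 \<le> p"
    and y_meas: "\<And>i. i < n \<Longrightarrow> y i \<in> borel_measurable M"
    and x_meas: "\<And>i. i < n \<Longrightarrow> x i \<in> M \<rightarrow>\<^sub>M Rp p"
    and indep: "prob_space.indep_vars M (\<lambda>_. OZ) (\<lambda>i \<omega>. (y i \<omega>, x i \<omega>)) {..<n}"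
    and ident: "\<And>i. i < n \<Longrightarrow> distr M OZ (\<lambda>\<omega>. (y i \<omega>, x i \<omega>)) = distr M OZ (\<lambda>\<omega>. (y 0 \<omega>, x 0 \<omega>))"
    and dens: "is_cond_density M p (y 0) (x 0) f"
    and quant: "\<And>u. u \<in> U \<Longrightarrow> AE \<omega> in M. quantile (density lborel (\<lambda>v. ennreal (f (x 0 \<omega>) v))) u = dot p (x 0 \<omega>) (\<beta> u)"
    and f_diff: "\<And>z v. z \<in> supp_x \<Longrightarrow> f z differentiable at v"
    and f_bound: "\<And>z v. z \<in> supp_x \<Longrightarrow> \<bar>f z v\<bar> \<le> fbar"
    and f_deriv: "\<And>z v. z \<in> supp_x \<Longrightarrow> \<bar>deriv (f z) v\<bar> \<le> fbar'"
    and flow: "0 < flow" and f_low: "\<And>u z. u \<in> U \<Longrightarrow> z \<in> supp_x \<Longrightarrow> flow < f z (dot p z (\<beta> u))"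
proof -
  note D = D1[unfolded cond_D1_def Let_def]
  have "3 \<le> min n p" using D by blast
  then show "3 \<le> n" "3 \<le> p" by simp_all
qed (use D1[unfolded cond_D1_def Let_def] in blast)+

sublocale C: cond_density M p "y 0" "x 0" f
proof -
  have "0 < n" using n3 by linarith
  then show "cond_density M p (y 0) (x 0) f"
    by (intro cond_density.intro prob_M y_meas x_meas dens)
qed

lemma n_pos: "0 < n" and p_pos: "0 < p" using n3 p3 by auto

lemma U01: "u \<in> U \<Longrightarrow> 0 < u" "u \<in> U \<Longrightarrow> u < 1" using U by auto

lemma smooth: "z \<in> supp_x \<Longrightarrow> smooth_density (f z) fbar'"
proof -
  assume z: "z \<in> supp_x"
  have "(\<integral>\<^sup>+v. ennreal (f z v) \<partial>lborel) = 1" using dens z unfolding is_cond_density_def by blast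
  then show ?thesis
    by (intro smooth_density.intro C.f_slice[OF C.support_space[OF z]] C.f_nonneg[OF z] f_diff[OF z] f_deriv[OF z])
qed

lemma F_eq: "z \<in> supp_x \<Longrightarrow> smooth_density.F (f z) = cond_cdf f z"
  by (auto simp: fun_eq_iff smooth_density.F_def[OF smooth] smooth_density.N_def[OF smooth] cond_cdf_def)

lemma N_eq: "z \<in> supp_x \<Longrightarrow> smooth_density.N (f z) = density lborel (\<lambda>v. ennreal (f z v))"
  by (rule smooth_density.N_def[OF smooth])

lemma beta_lipschitz:
  assumes "u \<in> U" "u' \<in> U"
  shows "\<bar>dot p z (\<beta> u) - dot p z (\<beta> u')\<bar> \<le> L2_set z {..<p} * (L * \<bar>u - u'\<bar>)"
proof -
  have "\<bar>dot p z (\<beta> u) - dot p z (\<beta> u')\<bar> = \<bar>dot p z (\<lambda>j. \<beta> u j - \<beta> u' j)\<bar>" by (simp add: dot_diff)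
  also have "\<dots> \<le> L2_set z {..<p} * L2_set (\<lambda>j. \<beta> u j - \<beta> u' j) {..<p}" by (rule dot_le_L2_set)
  also have "\<dots> \<le> L2_set z {..<p} * (L * \<bar>u - u'\<bar>)"
    using D2 assms by (intro mult_left_mono L2_set_nonneg) (auto simp: cond_D2_def)
  finally show ?thesis .
qed

text \<open>\<open>cond_D1\<close> gives the quantile equation outside a null set that depends on u;
  these are the covariate values at which it holds for every u at once.\<close>

definition good_cov :: "(nat \<Rightarrow> real) set" where
  "good_cov = {z \<in> supp_x. \<forall>u\<in>U. cond_cdf f z (dot p z (\<beta> u)) = u}"

text \<open>The quantile restriction holds simultaneously for all \<open>u\<close>: first on a countable dense set,
  then everywhere by continuity of the coefficient process.\<close>

lemma quantile_extend:
  assumes z: "z \<in> supp_x" and d: "\<And>d. d \<in> right_dense U \<Longrightarrow> cond_cdf f z (dot p z (\<beta> d)) = d" and u: "u \<in> U"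
  shows "cond_cdf f z (dot p z (\<beta> u)) = u"
proof -
  interpret S: smooth_density "f z" fbar' by (rule smooth[OF z])
  have c: "isCont (cond_cdf f z) (dot p z (\<beta> u))" using S.F_isCont unfolding F_eq[OF z] .
  have L: "0 < L" using D2 by (simp add: cond_D2_def)
  let ?F = "cond_cdf f z" and ?q = "dot p z (\<beta> u)"
  have "\<bar>?F ?q - u\<bar> \<le> e" if e: "0 < e" for e
  proof -
    have "\<forall>r>0. \<exists>s>0. \<forall>w. dist w ?q < s \<longrightarrow> dist (?F w) (?F ?q) < r"
      using c unfolding continuous_at_eps_delta by (auto simp: dist_real_def)
    then obtain del where del: "0 < del" "\<And>w. \<bar>w - ?q\<bar> < del \<Longrightarrow> \<bar>?F w - ?F ?q\<bar> < e / 2"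
      using e by (metis half_gt_zero dist_real_def)
    let ?K = "L2_set z {..<p} * L + 1"
    have K: "0 < ?K" using L by (intro add_nonneg_pos mult_nonneg_nonneg L2_set_nonneg) auto
    obtain w where w: "w \<in> right_dense U" "u \<le> w" "w < u + min (e / 2) (del / ?K)"
      using right_dense_ex[OF U u, of "min (e / 2) (del / ?K)"] e del K by auto
    have wU: "w \<in> U" using right_dense_subset[OF U] w by auto
    have "\<bar>dot p z (\<beta> w) - ?q\<bar> \<le> L2_set z {..<p} * (L * \<bar>w - u\<bar>)" by (rule beta_lipschitz[OF wU u])
    also have "\<dots> \<le> ?K * \<bar>w - u\<bar>" by (simp add: algebra_simps)
    also have "\<dots> < ?K * (del / ?K)" using w K by (intro mult_strict_left_mono) auto
    also have "\<dots> = del" using K by simp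
    finally have "\<bar>?F (dot p z (\<beta> w)) - ?F ?q\<bar> < e / 2" by (rule del(2))
    moreover have "w < u + e / 2" using w(3) min.cobounded1[of "e / 2" "del / ?K"] by linarith
    ultimately show ?thesis using d[OF w(1)] w(2) by (auto simp: abs_if split: if_splits)
  qed
  then have "\<bar>?F ?q - u\<bar> \<le> 0" by (rule field_le_epsilon[of _ 0, simplified])
  then show ?thesis by simp
qed

text \<open>\<open>good_cov\<close> quantifies over uncountably many u. The equations on the
  countable set \<open>right_dense U\<close> cut out a measurable subset of it that still has full
  measure.\<close>

lemma good_cov_core:
  obtains G where "G \<in> sets (Rp p)" "G \<subseteq> good_cov" "AE z in C.Px. z \<in> G"
proof -
  obtain N where N: "N \<in> sets (Rp p)" "emeasure (distr M (Rp p) (x 0)) N = 0" "space (Rp p) - supp_x \<subseteq> N"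
    using law_support_null[OF C.M C.X] .
  define G where "G = {z \<in> space (Rp p). z \<notin> N \<and> (\<forall>d\<in>right_dense U. cond_cdf f z (dot p z (\<beta> d)) = d)}"
  have cm: "(\<lambda>z. cond_cdf f z (dot p z (\<beta> d))) \<in> borel_measurable (Rp p)" for d
  proof -
    have "(\<lambda>z. (z, dot p z (\<beta> d))) \<in> Rp p \<rightarrow>\<^sub>M Rp p \<Otimes>\<^sub>M borel" by measurable
    from measurable_compose[OF this C.cond_cdf_measurable] show ?thesis by simp
  qed
  have cs: "{z \<in> space (Rp p). cond_cdf f z (dot p z (\<beta> d)) = d} \<in> sets (Rp p)" for d
    using cm[of d] by measurable
  have cs2: "{z \<in> space (Rp p). \<forall>d\<in>right_dense U. cond_cdf f z (dot p z (\<beta> d)) = d} \<in> sets (Rp p)"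
    by (rule sets.sets_Collect_countable_All'[OF cs countable_right_dense[OF U]])
  have "G = {z \<in> space (Rp p). \<forall>d\<in>right_dense U. cond_cdf f z (dot p z (\<beta> d)) = d} - N" by (auto simp: G_def)
  then have G: "G \<in> sets (Rp p)" using cs2 N(1) by auto
  have supp: "z \<in> supp_x" if "z \<in> G" for z using that N(3) unfolding G_def by blast
  have "G \<subseteq> good_cov"
  proof
    fix z assume z: "z \<in> G"
    then have "cond_cdf f z (dot p z (\<beta> d)) = d" if "d \<in> right_dense U" for d using that unfolding G_def by blast
    then show "z \<in> good_cov" unfolding good_cov_def using supp[OF z] quantile_extend[OF supp[OF z]] by blast
  qed
  moreover have "AE z in C.Px. z \<in> G"
  proof -
    have "AE \<omega> in M. \<forall>d\<in>right_dense U. cond_cdf f (x 0 \<omega>) (dot p (x 0 \<omega>) (\<beta> d)) = d"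
    proof (subst AE_ball_countable[OF countable_right_dense[OF U]], intro ballI)
      fix d assume "d \<in> right_dense U"
      then have d: "d \<in> U" using right_dense_subset[OF U] by auto
      show "AE \<omega> in M. cond_cdf f (x 0 \<omega>) (dot p (x 0 \<omega>) (\<beta> d)) = d"
        using quant[OF d] C.AE_support
      proof eventually_elim
        case (elim \<omega>)
        interpret S: smooth_density "f (x 0 \<omega>)" fbar' by (rule smooth[OF elim(2)])
        show ?case using S.F_quantile[of d] U01[OF d] elim by (simp add: F_eq[OF elim(2)] N_eq[OF elim(2)])
      qed
    qed
    then have "AE z in C.Px. \<forall>d\<in>right_dense U. cond_cdf f z (dot p z (\<beta> d)) = d"
      by (subst C.AE_Px_iff[OF cs2])
    moreover have "AE z in C.Px. z \<notin> N" unfolding C.Px_def using N by (intro AE_not_in null_setsI) auto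
    ultimately show ?thesis using AE_space unfolding G_def by eventually_elim simp
  qed
  ultimately show ?thesis using G that by blast
qed

lemma yx_meas: "i < n \<Longrightarrow> (\<lambda>\<omega>. (y i \<omega>, x i \<omega>)) \<in> M \<rightarrow>\<^sub>M OZ"
  by (intro measurable_Pair y_meas x_meas)

lemma distr_x: "i < n \<Longrightarrow> distr M (Rp p) (x i) = C.Px"
proof -
  assume i: "i < n"
  have d: "distr M (Rp p) (x k) = distr (distr M OZ (\<lambda>\<omega>. (y k \<omega>, x k \<omega>))) (Rp p) snd" if "k < n" for k
    unfolding distr_distr[OF measurable_snd yx_meas[OF that]] by (simp add: comp_def)
  show ?thesis unfolding C.Px_def d[OF i] d[OF n_pos] ident[OF i] ..
qed

lemma AE_good_cov: "AE \<omega> in M. \<forall>i<n. x i \<omega> \<in> good_cov"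
proof -
  obtain G where G: "G \<in> sets (Rp p)" "G \<subseteq> good_cov" "AE z in C.Px. z \<in> G" by (rule good_cov_core)
  have "AE \<omega> in M. x i \<omega> \<in> G" if "i < n" for i
    using G(3) unfolding distr_x[OF that, symmetric]
    by (subst (asm) AE_distr_iff[OF x_meas[OF that]]) (use G(1) sets.sets_into_space[OF G(1)] in \<open>auto simp: Collect_conj_eq Int_absorb1\<close>)
  then have "AE \<omega> in M. \<forall>i\<in>{..<n}. x i \<omega> \<in> G" by (subst AE_ball_countable) auto
  then show ?thesis by eventually_elim (use G(2) in auto)
qed

text \<open>The signs of the residuals are read off the rank, simultaneously for all u; in this way
  the score at the true coefficients is dominated by the pivotal statistic.\<close>

lemma le_quantile_iff:
  assumes "z \<in> good_cov" "u \<in> U"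
  shows "v \<le> dot p z (\<beta> u) \<longleftrightarrow> cond_cdf f z v \<le> u"
proof -
  have z: "z \<in> supp_x" using assms by (simp add: good_cov_def)
  interpret S: smooth_density "f z" fbar' by (rule smooth[OF z])
  have "0 < f z (dot p z (\<beta> u))" using f_low[OF assms(2) z] flow by linarith
  from S.le_iff_F_le[OF this, of v] show ?thesis using assms by (simp add: F_eq[OF z] good_cov_def)
qed

section \<open>Uniform ranks and the pivotal event\<close>

abbreviation "unif \<equiv> uniform_measure lborel {0<..<1::real}"

lemma prob_unif: "prob_space unif" by (rule prob_space_uniform_measure) auto

text \<open>At every covariate value in the support the rank is uniform. As this conditional law
  does not depend on the value, the joint law is a product.\<close>

lemma distr_rank: "distr M (Rp p \<Otimes>\<^sub>M borel) (\<lambda>\<omega>. (x 0 \<omega>, cond_cdf f (x 0 \<omega>) (y 0 \<omega>))) = C.Px \<Otimes>\<^sub>M unif"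
proof (rule pair_measure_eqI[symmetric])
  interpret V: prob_space unif by (rule prob_unif)
  show "sigma_finite_measure C.Px" "sigma_finite_measure unif" by unfold_locales
  show "sets (C.Px \<Otimes>\<^sub>M unif) = sets (distr M (Rp p \<Otimes>\<^sub>M borel) (\<lambda>\<omega>. (x 0 \<omega>, cond_cdf f (x 0 \<omega>) (y 0 \<omega>))))"
    by (simp cong: sets_pair_measure_cong)
  have cc: "(\<lambda>\<omega>. cond_cdf f (x 0 \<omega>) (y 0 \<omega>)) \<in> borel_measurable M"
    using measurable_compose[of "\<lambda>\<omega>. (x 0 \<omega>, y 0 \<omega>)" M "Rp p \<Otimes>\<^sub>M borel", OF _ C.cond_cdf_measurable] by simp
  fix A B assume "A \<in> sets C.Px" "B \<in> sets unif"
  then have AB [measurable]: "A \<in> sets (Rp p)" "B \<in> sets borel" by auto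
  have ch: "(\<lambda>zv. indicator A (fst zv) * indicator B (cond_cdf f (fst zv) (snd zv)) :: ennreal) \<in> borel_measurable (Rp p \<Otimes>\<^sub>M borel)"
    using C.cond_cdf_measurable[unfolded case_prod_beta] by measurable
  have "emeasure (distr M (Rp p \<Otimes>\<^sub>M borel) (\<lambda>\<omega>. (x 0 \<omega>, cond_cdf f (x 0 \<omega>) (y 0 \<omega>)))) (A \<times> B)
    = (\<integral>\<^sup>+zv. indicator (A \<times> B) zv \<partial>distr M (Rp p \<Otimes>\<^sub>M borel) (\<lambda>\<omega>. (x 0 \<omega>, cond_cdf f (x 0 \<omega>) (y 0 \<omega>))))"
    using AB by simp
  also have "\<dots> = (\<integral>\<^sup>+\<omega>. indicator (A \<times> B) (x 0 \<omega>, cond_cdf f (x 0 \<omega>) (y 0 \<omega>)) \<partial>M)"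
    using AB cc by (subst nn_integral_distr) auto
  also have "\<dots> = (\<integral>\<^sup>+\<omega>. (\<lambda>zv. indicator A (fst zv) * indicator B (cond_cdf f (fst zv) (snd zv))) (x 0 \<omega>, y 0 \<omega>) \<partial>M)"
    by (intro nn_integral_cong) (auto simp: indicator_def)
  also have "\<dots> = (\<integral>\<^sup>+z. (\<integral>\<^sup>+v. ennreal (f z v) * (indicator A z * indicator B (cond_cdf f z v)) \<partial>lborel) \<partial>C.Px)"
    by (subst C.nn_integral_XY[OF ch]) simp
  also have "\<dots> = (\<integral>\<^sup>+z. emeasure unif B * indicator A z \<partial>C.Px)"
  proof (rule nn_integral_cong_AE)
    show "AE z in C.Px. (\<integral>\<^sup>+v. ennreal (f z v) * (indicator A z * indicator B (cond_cdf f z v)) \<partial>lborel) = emeasure unif B * indicator A z"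
      using C.AE_Px_support
    proof eventually_elim
      case (elim z)
      interpret S: smooth_density "f z" fbar' by (rule smooth[OF elim])
      have "emeasure unif B = emeasure (distr S.N borel S.F) B" by (simp add: S.distr_F_uniform)
      also have "\<dots> = emeasure S.N {v. S.F v \<in> B}"
        using AB by (subst emeasure_distr) (auto simp: vimage_def)
      also have "\<dots> = emeasure S.N {v. cond_cdf f z v \<in> B}" by (simp only: F_eq[OF elim])
      also have "\<dots> = (\<integral>\<^sup>+v. ennreal (f z v) * indicator {v. cond_cdf f z v \<in> B} v \<partial>lborel)"
      proof (rule S.emeasure_N)
        have "S.F -` B \<inter> space borel \<in> sets borel" by (rule measurable_sets[OF S.F_measurable AB(2)])
        then show "{v. cond_cdf f z v \<in> B} \<in> sets borel" by (simp add: F_eq[OF elim] vimage_def)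
      qed
      finally have e: "emeasure unif B = (\<integral>\<^sup>+v. ennreal (f z v) * indicator B (cond_cdf f z v) \<partial>lborel)"
        by (simp add: indicator_def)
      show ?case unfolding e by (cases "z \<in> A") auto
    qed
  qed
  also have "\<dots> = emeasure unif B * emeasure C.Px A"
    using AB by (subst nn_integral_cmult_indicator) auto
  finally show "emeasure C.Px A * emeasure unif B = emeasure (distr M (Rp p \<Otimes>\<^sub>M borel) (\<lambda>\<omega>. (x 0 \<omega>, cond_cdf f (x 0 \<omega>) (y 0 \<omega>)))) (A \<times> B)"
    by (simp add: mult.commute)
qed

lemma distr_sample: "distr M (Pi\<^sub>M {..<n} (\<lambda>_. OZ)) (\<lambda>\<omega>. \<lambda>i\<in>{..<n}. (y i \<omega>, x i \<omega>))
   = Pi\<^sub>M {..<n} (\<lambda>_. distr M OZ (\<lambda>\<omega>. (y 0 \<omega>, x 0 \<omega>)))"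
proof -
  have "distr M (Pi\<^sub>M {..<n} (\<lambda>_. OZ)) (\<lambda>\<omega>. \<lambda>i\<in>{..<n}. (y i \<omega>, x i \<omega>))
    = Pi\<^sub>M {..<n} (\<lambda>i. distr M OZ (\<lambda>\<omega>. (y i \<omega>, x i \<omega>)))"
    using indep y_meas x_meas n_pos
    by (subst (asm) C.M.indep_vars_iff_distr_eq_PiM') (auto simp: lessThan_empty_iff)
  also have "\<dots> = Pi\<^sub>M {..<n} (\<lambda>_. distr M OZ (\<lambda>\<omega>. (y 0 \<omega>, x 0 \<omega>)))"
    by (rule PiM_cong) (auto intro: ident)
  finally show ?thesis .
qed

definition ranks :: "'w \<Rightarrow> nat \<Rightarrow> real" where
  "ranks \<omega> = (\<lambda>i\<in>{..<n}. cond_cdf f (x i \<omega>) (y i \<omega>))"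

lemma rank_map_measurable: "(\<lambda>(v, z). (z, cond_cdf f z v)) \<in> OZ \<rightarrow>\<^sub>M Rp p \<Otimes>\<^sub>M borel"
proof -
  have "(\<lambda>w. cond_cdf f (snd w) (fst w)) \<in> borel_measurable OZ"
    using measurable_compose[of "\<lambda>w. (snd w, fst w)" OZ "Rp p \<Otimes>\<^sub>M borel", OF _ C.cond_cdf_measurable] by simp
  then show ?thesis unfolding case_prod_beta by measurable
qed

lemma distr_ranks_pairs: "distr M (Pi\<^sub>M {..<n} (\<lambda>_. Rp p \<Otimes>\<^sub>M borel)) (\<lambda>\<omega>. \<lambda>i\<in>{..<n}. (x i \<omega>, ranks \<omega> i))
   = Pi\<^sub>M {..<n} (\<lambda>_. C.Px \<Otimes>\<^sub>M unif)"
proof -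
  let ?W = "\<lambda>i \<omega>. (\<lambda>(v, z). (z, cond_cdf f z v)) (y i \<omega>, x i \<omega>)"
  have W: "C.M.random_variable (Rp p \<Otimes>\<^sub>M borel) (?W i)" if "i < n" for i
    using measurable_compose[of "\<lambda>\<omega>. (y i \<omega>, x i \<omega>)" M OZ, OF yx_meas[OF that] rank_map_measurable] .
  have "C.M.indep_vars (\<lambda>_. Rp p \<Otimes>\<^sub>M borel) ?W {..<n}"
    by (rule C.M.indep_vars_compose2[OF indep]) (rule rank_map_measurable)
  then have "distr M (Pi\<^sub>M {..<n} (\<lambda>_. Rp p \<Otimes>\<^sub>M borel)) (\<lambda>\<omega>. \<lambda>i\<in>{..<n}. ?W i \<omega>)
    = Pi\<^sub>M {..<n} (\<lambda>i. distr M (Rp p \<Otimes>\<^sub>M borel) (?W i))"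
    using W n_pos by (subst (asm) C.M.indep_vars_iff_distr_eq_PiM') (auto simp: lessThan_empty_iff)
  also have "(\<lambda>\<omega>. \<lambda>i\<in>{..<n}. ?W i \<omega>) = (\<lambda>\<omega>. \<lambda>i\<in>{..<n}. (x i \<omega>, ranks \<omega> i))"
    by (auto simp: ranks_def fun_eq_iff)
  also have "Pi\<^sub>M {..<n} (\<lambda>i. distr M (Rp p \<Otimes>\<^sub>M borel) (?W i)) = Pi\<^sub>M {..<n} (\<lambda>_. C.Px \<Otimes>\<^sub>M unif)"
  proof (rule PiM_cong[OF refl])
    fix i assume "i \<in> {..<n}"
    then have i: "i < n" by simp
    have dd: "distr M (Rp p \<Otimes>\<^sub>M borel) (?W k) = distr (distr M OZ (\<lambda>\<omega>. (y k \<omega>, x k \<omega>))) (Rp p \<Otimes>\<^sub>M borel) (\<lambda>(v, z). (z, cond_cdf f z v))"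
      if "k < n" for k
      unfolding distr_distr[OF rank_map_measurable yx_meas[OF that]] by (simp only: comp_def)
    show "distr M (Rp p \<Otimes>\<^sub>M borel) (?W i) = C.Px \<Otimes>\<^sub>M unif"
      unfolding dd[OF i] ident[OF i] dd[OF n_pos, symmetric] using distr_rank by simp
  qed
  finally show ?thesis .
qed

lemma design_eq: "\<omega> \<in> space M \<Longrightarrow> design Q \<omega> = (\<lambda>i\<in>{..<n}. x i \<omega>)"
proof -
  assume w: "\<omega> \<in> space M"
  have "(\<lambda>j\<in>{..<p}. x i \<omega> j) = x i \<omega>" if "i < n" for i
    using measurable_space[OF x_meas[OF that] w] by (auto simp: space_PiM PiE_iff extensional_restrict)
  then show ?thesis by (auto simp: design_def)
qed

text \<open>Design and ranks together have the product law for which the conditional quantile event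
  was evaluated. The event is pulled back to the sample through the regrouping into pairs.\<close>

lemma pivotal_event:
  assumes t: "0 < t" "t < 1"
  obtains E where "E \<in> sets M" "t \<le> measure M E"
    "\<And>\<omega>. \<omega> \<in> E \<Longrightarrow> Lam U n p (design Q \<omega>) (ranks \<omega>) \<le> Lam_quantile U n p (design Q \<omega>) t"
proof -
  let ?I = "{..<n}"
  let ?PX = "Pi\<^sub>M ?I (\<lambda>_. C.Px)" and ?PV = "Pi\<^sub>M ?I (\<lambda>_. unif)"
  interpret V: prob_space unif by (rule prob_unif)
  have pX: "prob_space ?PX" by (intro prob_space_PiM C.Px.prob_space_axioms)
  have pV: "prob_space ?PV" by (intro prob_space_PiM prob_unif)
  have sX: "sets ?PX = sets (Pi\<^sub>M ?I (\<lambda>_. Rp p))" by (intro sets_PiM_cong) auto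
  have sV: "sets ?PV = sets (Pi\<^sub>M ?I (\<lambda>_. borel))" by (intro sets_PiM_cong) auto
  let ?L = "\<lambda>(X, v). Lam U n p X v"
  have Lm: "?L \<in> borel_measurable (?PX \<Otimes>\<^sub>M ?PV)"
    using Lam_measurable[OF U p_pos n_pos] by (subst measurable_cong_sets[OF sets_pair_measure_cong[OF sX sV] refl])
  define E0 where "E0 = {z \<in> space (?PX \<Otimes>\<^sub>M ?PV). ?L z \<le> quantile (distr ?PV borel (\<lambda>b. ?L (fst z, b))) t}"
  have E0: "E0 \<in> sets (?PX \<Otimes>\<^sub>M ?PV)" "t \<le> measure (?PX \<Otimes>\<^sub>M ?PV) E0"
    unfolding E0_def by (rule quantile_event[OF pX pV Lm t])+
  let ?zip = "\<lambda>(a, b). \<lambda>i\<in>?I. (a i, b i)"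
  let ?unzip = "\<lambda>w. (\<lambda>i\<in>?I. fst (w i :: (nat \<Rightarrow> real) \<times> real), \<lambda>i\<in>?I. snd (w i))"
  let ?K = "Pi\<^sub>M ?I (\<lambda>_. C.Px \<Otimes>\<^sub>M unif)"
  have um: "?unzip \<in> ?K \<rightarrow>\<^sub>M ?PX \<Otimes>\<^sub>M ?PV"
  proof (intro measurable_Pair measurable_restrict)
    fix i assume i: "i \<in> ?I"
    have c: "(\<lambda>w. w i) \<in> ?K \<rightarrow>\<^sub>M C.Px \<Otimes>\<^sub>M unif" using i by (rule measurable_component_singleton)
    show "(\<lambda>w. fst (w i)) \<in> ?K \<rightarrow>\<^sub>M C.Px" "(\<lambda>w. snd (w i)) \<in> ?K \<rightarrow>\<^sub>M unif"
      using measurable_compose[OF c measurable_fst] measurable_compose[OF c measurable_snd] by simp_all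
  qed
  have zm: "?zip \<in> ?PX \<Otimes>\<^sub>M ?PV \<rightarrow>\<^sub>M ?K"
    unfolding case_prod_beta
    by (intro measurable_restrict measurable_Pair measurable_compose[OF measurable_fst] measurable_compose[OF measurable_snd]
        measurable_component_singleton)
  have dz: "distr (?PX \<Otimes>\<^sub>M ?PV) ?K ?zip = ?K" by (rule distr_zip_PiM[OF C.Px.prob_space_axioms prob_unif]) simp
  have sK: "sets ?K = sets (Pi\<^sub>M ?I (\<lambda>_. Rp p \<Otimes>\<^sub>M borel))" by (intro sets_PiM_cong refl sets_pair_measure_cong) auto
  let ?R = "\<lambda>\<omega>. \<lambda>i\<in>?I. (x i \<omega>, ranks \<omega> i)"
  have dR: "distr M ?K ?R = ?K" using distr_ranks_pairs by (simp add: distr_cong[OF refl sK refl])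
  have rm: "?R \<in> M \<rightarrow>\<^sub>M ?K"
  proof (intro measurable_restrict)
    fix i assume "i \<in> ?I"
    then have i: "i < n" by simp
    have "(\<lambda>\<omega>. (\<lambda>(v, z). (z, cond_cdf f z v)) (y i \<omega>, x i \<omega>)) \<in> M \<rightarrow>\<^sub>M Rp p \<Otimes>\<^sub>M borel"
      using measurable_compose[of "\<lambda>\<omega>. (y i \<omega>, x i \<omega>)" M OZ, OF yx_meas[OF i] rank_map_measurable] .
    then have "(\<lambda>\<omega>. (x i \<omega>, ranks \<omega> i)) \<in> M \<rightarrow>\<^sub>M Rp p \<Otimes>\<^sub>M borel" using i by (simp add: ranks_def)
    then show "(\<lambda>\<omega>. (x i \<omega>, ranks \<omega> i)) \<in> M \<rightarrow>\<^sub>M C.Px \<Otimes>\<^sub>M unif"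
      by (subst measurable_cong_sets[OF refl sets_pair_measure_cong]) auto
  qed
  define E1 where "E1 = ?unzip -` E0 \<inter> space ?K"
  have E1: "E1 \<in> sets ?K" unfolding E1_def by (rule measurable_sets[OF um E0(1)])
  define E where "E = ?R -` E1 \<inter> space M"
  have "E \<in> sets M" unfolding E_def by (rule measurable_sets[OF rm E1])
  moreover have "t \<le> measure M E"
  proof -
    have "measure M E = measure (distr M ?K ?R) E1" unfolding E_def by (rule measure_distr[OF rm E1, symmetric])
    also have "\<dots> = measure (distr (?PX \<Otimes>\<^sub>M ?PV) ?K ?zip) E1" unfolding dR dz ..
    also have "\<dots> = measure (?PX \<Otimes>\<^sub>M ?PV) (?zip -` E1 \<inter> space (?PX \<Otimes>\<^sub>M ?PV))" by (rule measure_distr[OF zm E1])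
    also have "?zip -` E1 \<inter> space (?PX \<Otimes>\<^sub>M ?PV) = E0"
    proof (intro set_eqI)
      fix ab :: "(nat \<Rightarrow> nat \<Rightarrow> real) \<times> (nat \<Rightarrow> real)"
      show "ab \<in> ?zip -` E1 \<inter> space (?PX \<Otimes>\<^sub>M ?PV) \<longleftrightarrow> ab \<in> E0"
      proof (cases "ab \<in> space (?PX \<Otimes>\<^sub>M ?PV)")
        case True
        have "?unzip (?zip ab) = ab" using True by (cases ab) (auto simp: space_pair_measure space_PiM PiE_iff extensional_def fun_eq_iff)
        then show ?thesis using True measurable_space[OF zm True] by (simp add: E1_def)
      qed (simp add: E0_def)
    qed
    finally show ?thesis using E0(2) by simp
  qed
  moreover have "Lam U n p (design Q \<omega>) (ranks \<omega>) \<le> Lam_quantile U n p (design Q \<omega>) t" if w: "\<omega> \<in> E" for \<omega>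
  proof -
    have sp: "\<omega> \<in> space M" using w by (simp add: E_def)
    have "?unzip (?R \<omega>) \<in> E0" using w by (simp add: E_def E1_def)
    moreover have "?unzip (?R \<omega>) = (design Q \<omega>, ranks \<omega>)"
      by (auto simp: design_eq[OF sp] ranks_def fun_eq_iff)
    ultimately show ?thesis by (simp add: E0_def Lam_quantile_def)
  qed
  ultimately show ?thesis by (rule that)
qed

end

section \<open>Population moments\<close>

locale qr_conditions = qr_sample Q U s flow L fbar fbar' C_L
  for Q :: "'w qr_model" and U s flow L fbar fbar' C_L +
  fixes \<gamma> c0 C_f :: real and m :: nat
  assumes D3: "cond_D3 Q \<gamma>" and D4: "cond_D4 Q U flow fbar' m c0 C_f"
begin

lemma x0_comp_meas [measurable]: "j < p \<Longrightarrow> (\<lambda>\<omega>. x 0 \<omega> j) \<in> borel_measurable M"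
  by (rule measurable_compose[OF C.X measurable_component_singleton]) simp

lemma dot_x0_meas [measurable]: "(\<lambda>\<omega>. dot p (x 0 \<omega>) d) \<in> borel_measurable M"
  by (rule measurable_compose[OF C.X dot_measurable])

lemma second_moment_one: "j < p \<Longrightarrow> (\<integral>\<omega>. (x 0 \<omega> j)\<^sup>2 \<partial>M) = 1"
  using D3 by (simp add: cond_D3_def)

text \<open>A non-integrable function would have integral 0 by convention, not 1.\<close>

lemma integrable_x_square: "j < p \<Longrightarrow> integrable M (\<lambda>\<omega>. (x 0 \<omega> j)\<^sup>2)"
  using second_moment_one[of j] not_integrable_integral_eq by fastforce

lemma integrable_x_prod:
  assumes "j < p" "k < p"
  shows "integrable M (\<lambda>\<omega>. x 0 \<omega> j * x 0 \<omega> k)"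
proof (rule Bochner_Integration.integrable_bound[where f = "\<lambda>\<omega>. (x 0 \<omega> j)\<^sup>2 + (x 0 \<omega> k)\<^sup>2"])
  show "integrable M (\<lambda>\<omega>. (x 0 \<omega> j)\<^sup>2 + (x 0 \<omega> k)\<^sup>2)"
    by (intro Bochner_Integration.integrable_add integrable_x_square assms)
  show "(\<lambda>\<omega>. x 0 \<omega> j * x 0 \<omega> k) \<in> borel_measurable M"
    by (intro borel_measurable_times x0_comp_meas assms)
  have "\<bar>a * b\<bar> \<le> a\<^sup>2 + b\<^sup>2" for a b :: real
  proof -
    have "0 \<le> (\<bar>a\<bar> - \<bar>b\<bar>)\<^sup>2" by simp
    then have "2 * (\<bar>a\<bar> * \<bar>b\<bar>) \<le> a\<^sup>2 + b\<^sup>2" by (simp add: power2_eq_square algebra_simps)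
    moreover have "0 \<le> \<bar>a\<bar> * \<bar>b\<bar>" by simp
    ultimately show ?thesis unfolding abs_mult by linarith
  qed
  then show "AE \<omega> in M. norm (x 0 \<omega> j * x 0 \<omega> k) \<le> norm ((x 0 \<omega> j)\<^sup>2 + (x 0 \<omega> k)\<^sup>2)" by simp
qed

lemma dot_square: "(dot p a d)\<^sup>2 = (\<Sum>j<p. \<Sum>k<p. d j * (a j * a k) * d k)"
  by (simp add: dot_def power2_eq_square sum_product mult_ac)

lemma integrable_dot_square: "integrable M (\<lambda>\<omega>. (dot p (x 0 \<omega>) d)\<^sup>2)"
  unfolding dot_square by (intro Bochner_Integration.integrable_sum integrable_mult_left integrable_mult_right integrable_x_prod) auto

abbreviation "E2 \<equiv> pop_abs_moment Q 2"
abbreviation "E3 \<equiv> pop_abs_moment Q 3"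

lemma E2_eq: "E2 d = (\<integral>\<omega>. (dot p (x 0 \<omega>) d)\<^sup>2 \<partial>M)"
  by (simp add: pop_abs_moment_def)

lemma E2_nonneg: "0 \<le> E2 d" unfolding E2_eq by (intro integral_nonneg_AE) auto

lemma E3_nonneg: "0 \<le> E3 d" unfolding pop_abs_moment_def by (intro integral_nonneg_AE) auto

lemma quad_gram: "quad_form p (pop_gram Q) d = E2 d"
proof -
  have "E2 d = (\<Sum>j<p. \<integral>\<omega>. (\<Sum>k<p. d j * (x 0 \<omega> j * x 0 \<omega> k) * d k) \<partial>M)"
    unfolding E2_eq dot_square
    by (intro Bochner_Integration.integral_sum Bochner_Integration.integrable_sum integrable_mult_left integrable_mult_right integrable_x_prod) auto
  also have "\<dots> = (\<Sum>j<p. \<Sum>k<p. \<integral>\<omega>. d j * (x 0 \<omega> j * x 0 \<omega> k) * d k \<partial>M)"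
    by (intro sum.cong refl Bochner_Integration.integral_sum integrable_mult_left integrable_mult_right integrable_x_prod) auto
  also have "\<dots> = quad_form p (pop_gram Q) d"
    unfolding quad_form_def pop_gram_def by (intro sum.cong refl) simp
  finally show ?thesis by simp
qed

lemma integrable_abs_x: "j < p \<Longrightarrow> integrable M (\<lambda>\<omega>. \<bar>x 0 \<omega> j\<bar>)"
  by (rule integrable_abs[OF C.M.square_integrable_imp_integrable[OF x0_comp_meas integrable_x_square]])

lemma expectation_abs_x_le: "j < p \<Longrightarrow> (\<integral>\<omega>. \<bar>x 0 \<omega> j\<bar> \<partial>M) \<le> 1"
proof -
  assume j: "j < p"
  have "(\<integral>\<omega>. \<bar>x 0 \<omega> j\<bar> \<partial>M) \<le> (\<integral>\<omega>. 1/2 + 1/2 * (x 0 \<omega> j)\<^sup>2 \<partial>M)"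
  proof (rule integral_mono[OF integrable_abs_x[OF j]])
    show "integrable M (\<lambda>\<omega>. 1/2 + 1/2 * (x 0 \<omega> j)\<^sup>2)" using integrable_x_square[OF j] by simp
    have "\<bar>a\<bar> \<le> 1/2 + 1/2 * a\<^sup>2" for a :: real
    proof -
      have "0 \<le> (\<bar>a\<bar> - 1)\<^sup>2" by simp
      then show ?thesis by (simp add: power2_eq_square algebra_simps)
    qed
    then show "\<bar>x 0 \<omega> j\<bar> \<le> 1/2 + 1/2 * (x 0 \<omega> j)\<^sup>2" for \<omega> .
  qed
  also have "\<dots> = 1" using integrable_x_square[OF j] second_moment_one[OF j] by (simp add: C.M.prob_space)
  finally show ?thesis .
qed

lemma integrable_dot: "integrable M (\<lambda>\<omega>. dot p (x 0 \<omega>) d)"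
  by (rule C.M.square_integrable_imp_integrable[OF dot_x0_meas integrable_dot_square])

lemma expectation_abs_dot_le: "(\<integral>\<omega>. \<bar>dot p (x 0 \<omega>) d\<bar> \<partial>M) \<le> (\<Sum>j<p. \<bar>d j\<bar>)"
proof -
  have "(\<integral>\<omega>. \<bar>dot p (x 0 \<omega>) d\<bar> \<partial>M) \<le> (\<integral>\<omega>. (\<Sum>j<p. \<bar>x 0 \<omega> j\<bar> * \<bar>d j\<bar>) \<partial>M)"
  proof (rule integral_mono)
    show "integrable M (\<lambda>\<omega>. \<bar>dot p (x 0 \<omega>) d\<bar>)" by (rule integrable_abs[OF integrable_dot])
    show "integrable M (\<lambda>\<omega>. \<Sum>j<p. \<bar>x 0 \<omega> j\<bar> * \<bar>d j\<bar>)"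
      by (intro Bochner_Integration.integrable_sum integrable_mult_left integrable_abs_x) auto
    show "\<bar>dot p (x 0 \<omega>) d\<bar> \<le> (\<Sum>j<p. \<bar>x 0 \<omega> j\<bar> * \<bar>d j\<bar>)" for \<omega>
      unfolding dot_def abs_mult[symmetric] by (rule sum_abs)
  qed
  also have "\<dots> = (\<Sum>j<p. (\<integral>\<omega>. \<bar>x 0 \<omega> j\<bar> \<partial>M) * \<bar>d j\<bar>)"
    by (subst Bochner_Integration.integral_sum) (auto intro!: integrable_mult_left integrable_abs_x)
  also have "\<dots> \<le> (\<Sum>j<p. 1 * \<bar>d j\<bar>)"
    by (intro sum_mono mult_right_mono expectation_abs_x_le) auto
  finally show ?thesis by simp
qed

text \<open>The increment of the loss at one observation when \<beta>(u) is displaced by d; as a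
  process in d it is what the deviation bound controls.\<close>

definition qexcess :: "real \<Rightarrow> (nat \<Rightarrow> real) \<Rightarrow> real \<times> (nat \<Rightarrow> real) \<Rightarrow> real" where
  "qexcess u d = (\<lambda>(v, z). rho u (v - dot p z (\<beta> u) - dot p z d) - rho u (v - dot p z (\<beta> u)))"

lemma qexcess_meas [measurable]: "qexcess u d \<in> borel_measurable OZ"
  unfolding qexcess_def case_prod_beta by measurable

lemma qexcess_lip:
  assumes "u \<in> U"
  shows "\<bar>qexcess u d w - qexcess u e w\<bar> \<le> max u (1 - u) * \<bar>dot p (snd w) d - dot p (snd w) e\<bar>"
  using rho_lipschitz[of u "fst w - dot p (snd w) (\<beta> u) - dot p (snd w) d" "fst w - dot p (snd w) (\<beta> u) - dot p (snd w) e"] U01[OF assms]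
  by (simp add: qexcess_def case_prod_beta abs_minus_commute)

lemma qexcess_le:
  assumes "u \<in> U"
  shows "\<bar>qexcess u d w\<bar> \<le> max u (1 - u) * \<bar>dot p (snd w) d\<bar>"
  using rho_lipschitz[of u "fst w - dot p (snd w) (\<beta> u) - dot p (snd w) d" "fst w - dot p (snd w) (\<beta> u)"] U01[OF assms]
  by (simp add: qexcess_def case_prod_beta)

lemma qexcess_le1:
  assumes "u \<in> U"
  shows "\<bar>qexcess u d w\<bar> \<le> \<bar>dot p (snd w) d\<bar>"
  using rho_lipschitz1[of u "fst w - dot p (snd w) (\<beta> u) - dot p (snd w) d" "fst w - dot p (snd w) (\<beta> u)"] U01[OF assms]
  by (simp add: qexcess_def case_prod_beta)

abbreviation "PZ \<equiv> distr (pspace Q) (borel \<Otimes>\<^sub>M Rp (dim Q)) (\<lambda>\<omega>. (resp Q 0 \<omega>, covar Q 0 \<omega>))"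

lemma yx0: "(\<lambda>\<omega>. (y 0 \<omega>, x 0 \<omega>)) \<in> M \<rightarrow>\<^sub>M OZ" by (rule yx_meas[OF n_pos])

lemma qexcess_meas_M: "(\<lambda>\<omega>. qexcess u d (y 0 \<omega>, x 0 \<omega>)) \<in> borel_measurable M"
  by (rule measurable_compose[OF yx0 qexcess_meas])

lemma integrable_qexcess: "u \<in> U \<Longrightarrow> integrable M (\<lambda>\<omega>. qexcess u d (y 0 \<omega>, x 0 \<omega>))"
proof -
  assume u: "u \<in> U"
  show ?thesis
  proof (rule Bochner_Integration.integrable_bound[OF integrable_dot[of d] qexcess_meas_M])
    show "AE \<omega> in M. norm (qexcess u d (y 0 \<omega>, x 0 \<omega>)) \<le> norm (dot p (x 0 \<omega>) d)"
      using qexcess_le1[OF u, of d "(y 0 _, x 0 _)"] by simp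
  qed
qed

lemma expectation_qexcess: "(\<integral>w. qexcess u d w \<partial>PZ) = (\<integral>\<omega>. qexcess u d (y 0 \<omega>, x 0 \<omega>) \<partial>M)"
  by (rule integral_distr[OF yx0 qexcess_meas])

lemma qexcess_square:
  assumes u: "u \<in> U"
  shows "integrable PZ (\<lambda>w. (qexcess u d w)\<^sup>2)" and "(\<integral>w. (qexcess u d w)\<^sup>2 \<partial>PZ) \<le> E2 d"
proof -
  have le: "(qexcess u d (y 0 \<omega>, x 0 \<omega>))\<^sup>2 \<le> (dot p (x 0 \<omega>) d)\<^sup>2" for \<omega>
    using qexcess_le1[OF u, of d "(y 0 \<omega>, x 0 \<omega>)"] by (simp add: abs_le_square_iff)
  have i: "integrable M (\<lambda>\<omega>. (qexcess u d (y 0 \<omega>, x 0 \<omega>))\<^sup>2)"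
    by (rule Bochner_Integration.integrable_bound[OF integrable_dot_square[of d] borel_measurable_power[OF qexcess_meas_M]])
      (use le in auto)
  have m: "(\<lambda>w. (qexcess u d w)\<^sup>2) \<in> borel_measurable OZ" by (intro borel_measurable_power qexcess_meas)
  show "integrable PZ (\<lambda>w. (qexcess u d w)\<^sup>2)" using i by (subst integrable_distr_eq[OF yx0 m])
  have "(\<integral>w. (qexcess u d w)\<^sup>2 \<partial>PZ) = (\<integral>\<omega>. (qexcess u d (y 0 \<omega>, x 0 \<omega>))\<^sup>2 \<partial>M)" by (rule integral_distr[OF yx0 m])
  also have "\<dots> \<le> E2 d" unfolding E2_eq by (intro integral_mono i integrable_dot_square le)
  finally show "(\<integral>w. (qexcess u d w)\<^sup>2 \<partial>PZ) \<le> E2 d" .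
qed

section \<open>The density-weighted Gram matrix\<close>

definition wt :: "real \<Rightarrow> 'w \<Rightarrow> real" where "wt u \<omega> = f (x 0 \<omega>) (dot p (x 0 \<omega>) (\<beta> u))"

lemma wt_meas [measurable]: "wt u \<in> borel_measurable M"
proof -
  have "(\<lambda>\<omega>. (x 0 \<omega>, dot p (x 0 \<omega>) (\<beta> u))) \<in> M \<rightarrow>\<^sub>M Rp p \<Otimes>\<^sub>M borel"
    by (intro measurable_Pair C.X dot_x0_meas)
  moreover have "wt u = (\<lambda>\<omega>. (\<lambda>(z, v). f z v) (x 0 \<omega>, dot p (x 0 \<omega>) (\<beta> u)))" by (rule ext) (simp add: wt_def)
  ultimately show ?thesis using measurable_compose[OF _ C.f_joint] by (simp only:)
qed

lemma AE_wt: "u \<in> U \<Longrightarrow> AE \<omega> in M. flow \<le> wt u \<omega> \<and> \<bar>wt u \<omega>\<bar> \<le> fbar"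
  using C.AE_support by eventually_elim (use f_low f_bound in \<open>auto simp: wt_def intro: less_imp_le\<close>)

lemma integrable_wt:
  assumes u: "u \<in> U" and h: "integrable M h"
  shows "integrable M (\<lambda>\<omega>. wt u \<omega> * h \<omega>)"
proof (rule Bochner_Integration.integrable_bound[where f = "\<lambda>\<omega>. fbar * h \<omega>"])
  show "integrable M (\<lambda>\<omega>. fbar * h \<omega>)" using h by simp
  show "(\<lambda>\<omega>. wt u \<omega> * h \<omega>) \<in> borel_measurable M" using h by (intro borel_measurable_times wt_meas) auto
  show "AE \<omega> in M. norm (wt u \<omega> * h \<omega>) \<le> norm (fbar * h \<omega>)"
    using AE_wt[OF u] by eventually_elim (auto simp: abs_mult intro!: mult_right_mono)
qed

lemma Jmat_eq: "Jmat Q u j k = (\<integral>\<omega>. wt u \<omega> * (x 0 \<omega> j * x 0 \<omega> k) \<partial>M)"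
  by (simp add: Jmat_def wt_def mult.assoc)

lemma quad_J:
  assumes u: "u \<in> U"
  shows "quad_form p (Jmat Q u) d = (\<integral>\<omega>. wt u \<omega> * (dot p (x 0 \<omega>) d)\<^sup>2 \<partial>M)"
proof -
  have i: "integrable M (\<lambda>\<omega>. d j * (wt u \<omega> * (x 0 \<omega> j * x 0 \<omega> k)) * d k)" if "j < p" "k < p" for j k
    by (intro integrable_mult_left integrable_mult_right integrable_wt u integrable_x_prod that)
  have "(\<integral>\<omega>. wt u \<omega> * (dot p (x 0 \<omega>) d)\<^sup>2 \<partial>M) = (\<integral>\<omega>. (\<Sum>j<p. \<Sum>k<p. d j * (wt u \<omega> * (x 0 \<omega> j * x 0 \<omega> k)) * d k) \<partial>M)"
    unfolding dot_square sum_distrib_left by (simp add: mult_ac)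
  also have "\<dots> = (\<Sum>j<p. \<integral>\<omega>. (\<Sum>k<p. d j * (wt u \<omega> * (x 0 \<omega> j * x 0 \<omega> k)) * d k) \<partial>M)"
    by (intro Bochner_Integration.integral_sum Bochner_Integration.integrable_sum i) auto
  also have "\<dots> = (\<Sum>j<p. \<Sum>k<p. \<integral>\<omega>. d j * (wt u \<omega> * (x 0 \<omega> j * x 0 \<omega> k)) * d k \<partial>M)"
    by (intro sum.cong refl Bochner_Integration.integral_sum i) auto
  also have "\<dots> = quad_form p (Jmat Q u) d"
    unfolding quad_form_def Jmat_eq by (intro sum.cong refl) simp
  finally show ?thesis by simp
qed

lemma J_ge:
  assumes u: "u \<in> U"
  shows "flow * E2 d \<le> quad_form p (Jmat Q u) d"
proof -
  have "flow * E2 d = (\<integral>\<omega>. flow * (dot p (x 0 \<omega>) d)\<^sup>2 \<partial>M)" unfolding E2_eq by simp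
  also have "\<dots> \<le> (\<integral>\<omega>. wt u \<omega> * (dot p (x 0 \<omega>) d)\<^sup>2 \<partial>M)"
  proof (rule integral_mono_AE)
    show "AE \<omega> in M. flow * (dot p (x 0 \<omega>) d)\<^sup>2 \<le> wt u \<omega> * (dot p (x 0 \<omega>) d)\<^sup>2"
      using AE_wt[OF u] by eventually_elim (auto intro: mult_right_mono)
  qed (intro integrable_mult_right integrable_wt u integrable_dot_square)+
  finally show ?thesis unfolding quad_J[OF u] .
qed

lemma J_sym: "Jmat Q u j k = Jmat Q u k j" unfolding Jmat_eq by (simp add: mult_ac)

lemma J_psd: "u \<in> U \<Longrightarrow> 0 \<le> quad_form p (Jmat Q u) d"
  using J_ge[of u d] flow E2_nonneg[of d] by (meson less_imp_le mult_nonneg_nonneg order_trans)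

lemma J_norm: "u \<in> U \<Longrightarrow> L2_set (mat_vec p (mat_sqrt p (Jmat Q u)) d) {..<p} = sqrt (quad_form p (Jmat Q u) d)"
  by (rule L2_set_mat_sqrt[OF J_sym J_psd])

text \<open>The bound for a single density is applied at each covariate value x with shift x'd and
  then integrated; the weight f(x'\<beta>(u)|x) turns the quadratic term into the form of
  \<open>Jmat\<close>.\<close>

lemma excess_minorization:
  assumes u: "u \<in> U" and i3: "integrable M (\<lambda>\<omega>. \<bar>dot p (x 0 \<omega>) d\<bar> ^ 3)"
  shows "(\<integral>w. qexcess u d w \<partial>PZ) \<ge> quad_form p (Jmat Q u) d / 2 - fbar' * E3 d / 6"
proof -
  let ?h = "\<lambda>(z, v). qexcess u d (v, z)"
  have hm: "?h \<in> borel_measurable (Rp p \<Otimes>\<^sub>M borel)"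
    unfolding case_prod_beta by (rule measurable_compose[OF _ qexcess_meas]) measurable
  have hi: "integrable M (\<lambda>\<omega>. ?h (x 0 \<omega>, y 0 \<omega>))" using integrable_qexcess[OF u] by simp
  note D = C.integral_XY[OF hm hi]
  have "quad_form p (Jmat Q u) d / 2 - fbar' * E3 d / 6
    = (\<integral>\<omega>. wt u \<omega> * (dot p (x 0 \<omega>) d)\<^sup>2 / 2 - fbar' * \<bar>dot p (x 0 \<omega>) d\<bar> ^ 3 / 6 \<partial>M)"
    unfolding quad_J[OF u] pop_abs_moment_def using i3 integrable_wt[OF u integrable_dot_square] by simp
  also have "\<dots> \<le> (\<integral>\<omega>. (\<integral>v. ?h (x 0 \<omega>, v) \<partial>density lborel (\<lambda>v. ennreal (f (x 0 \<omega>) v))) \<partial>M)"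
  proof (rule integral_mono_AE[OF _ D(1)])
    show "integrable M (\<lambda>\<omega>. wt u \<omega> * (dot p (x 0 \<omega>) d)\<^sup>2 / 2 - fbar' * \<bar>dot p (x 0 \<omega>) d\<bar> ^ 3 / 6)"
      using i3 integrable_wt[OF u integrable_dot_square] by simp
    have "AE \<omega> in M. x 0 \<omega> \<in> good_cov" using AE_good_cov by eventually_elim (use n_pos in auto)
    then show "AE \<omega> in M. wt u \<omega> * (dot p (x 0 \<omega>) d)\<^sup>2 / 2 - fbar' * \<bar>dot p (x 0 \<omega>) d\<bar> ^ 3 / 6
       \<le> (\<integral>v. ?h (x 0 \<omega>, v) \<partial>density lborel (\<lambda>v. ennreal (f (x 0 \<omega>) v)))"
    proof eventually_elim
      case (elim \<omega>)
      then have z: "x 0 \<omega> \<in> supp_x" by (simp add: good_cov_def)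
      interpret S: smooth_density "f (x 0 \<omega>)" fbar' by (rule smooth[OF z])
      have "S.F (dot p (x 0 \<omega>) (\<beta> u)) = u" using elim u by (simp add: F_eq[OF z] good_cov_def)
      from S.check_excess_lower[OF this, of "dot p (x 0 \<omega>) d"]
      show ?case by (simp add: N_eq[OF z] qexcess_def wt_def)
    qed
  qed
  also have "\<dots> = (\<integral>\<omega>. ?h (x 0 \<omega>, y 0 \<omega>) \<partial>M)" by (rule D(2)[symmetric])
  also have "\<dots> = (\<integral>w. qexcess u d w \<partial>PZ)" unfolding expectation_qexcess by simp
  finally show ?thesis .
qed

section \<open>Restricted infima\<close>

lemma c0_ge: "9 \<le> c0" and pairs_ne: "restricted_pairs Q U c0 \<noteq> {}" and q_pos: "0 < nonlin_q Q U c0 flow fbar'"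
  using D4 by (simp_all add: cond_D4_def)

text \<open>Positivity of q excludes all default values: with \<open>fbar'\<close> = 0 the quotient
  in front would be 0, and a non-integrable cube would give \<open>E3 d\<close> = 0 and again the
  ratio 0. So the infimum is a genuine bound at each restricted pair.\<close>

lemma nonlin_q_facts:
  assumes ud: "(u, d) \<in> restricted_pairs Q U c0"
  shows "0 < fbar'" "integrable M (\<lambda>\<omega>. \<bar>dot p (x 0 \<omega>) d\<bar> ^ 3)" "0 < E2 d" "0 < E3 d"
    "nonlin_q Q U c0 flow fbar' * E3 d \<le> 3/8 * (flow powr (3/2) / fbar') * E2 d powr (3/2)"
proof -
  let ?r = "\<lambda>(u, d). E2 d powr (3/2) / E3 d"
  let ?c = "3/8 * (flow powr (3/2) / fbar')"
  \<comment> \<open>The sign is read off at a point of the support, which is nonempty because the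
    covariate lies in it almost surely.\<close>
  have fb: "0 \<le> fbar'"
  proof -
    have "law_support M p (x 0) \<noteq> {}"
    proof
      assume "law_support M p (x 0) = {}"
      then have "AE \<omega> in M. False" using C.AE_support by simp
      then show False by (simp add: C.M.AE_False)
    qed
    then obtain z where "z \<in> supp_x" by auto
    from f_deriv[OF this, of 0] show ?thesis by linarith
  qed
  have r0: "0 \<le> ?r w" for w by (cases w) (simp add: E3_nonneg)
  have I0: "0 \<le> (INF w\<in>restricted_pairs Q U c0. ?r w)" using pairs_ne r0 by (intro cINF_greatest)
  have q: "nonlin_q Q U c0 flow fbar' = ?c * (INF w\<in>restricted_pairs Q U c0. ?r w)" by (simp add: nonlin_q_def)
  have c0: "0 \<le> ?c" using fb by simp
  have Ipos: "0 < (INF w\<in>restricted_pairs Q U c0. ?r w)" and cpos: "0 < ?c"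
  proof -
    have "0 < a \<and> 0 < b" if "0 < b * a" "0 \<le> a" "0 \<le> b" for a b :: real
      using that by (auto simp: zero_less_mult_iff)
    from this[OF q_pos[unfolded q] I0 c0]
    show "0 < (INF w\<in>restricted_pairs Q U c0. ?r w)" "0 < ?c" by blast+
  qed
  show "0 < fbar'" using cpos fb by (cases "fbar' = 0") auto
  have le: "(INF w\<in>restricted_pairs Q U c0. ?r w) \<le> ?r (u, d)"
    using r0 by (intro cINF_lower ud bdd_belowI2[of _ 0])
  then have rp: "0 < E2 d powr (3/2) / E3 d" using Ipos by simp
  then have "E3 d \<noteq> 0" by auto
  then show e3: "0 < E3 d" using E3_nonneg[of d] by simp
  show "integrable M (\<lambda>\<omega>. \<bar>dot p (x 0 \<omega>) d\<bar> ^ 3)"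
    using \<open>E3 d \<noteq> 0\<close> not_integrable_integral_eq unfolding pop_abs_moment_def by blast
  have "E2 d \<noteq> 0" using rp by auto
  then show "0 < E2 d" using E2_nonneg[of d] by simp
  have "nonlin_q Q U c0 flow fbar' \<le> ?c * (E2 d powr (3/2) / E3 d)"
    unfolding q using le c0 by (intro mult_left_mono) auto
  then have "nonlin_q Q U c0 flow fbar' * E3 d \<le> ?c * (E2 d powr (3/2) / E3 d) * E3 d"
    using e3 by (intro mult_right_mono) auto
  then show "nonlin_q Q U c0 flow fbar' * E3 d \<le> ?c * E2 d powr (3/2)" using e3 by simp
qed

lemma largest_outside_0 [simp]: "largest_outside p T d 0 = {}"
  by (simp add: largest_outside_def)

lemma kappa_sq_bounds:
  assumes ud: "(u, d) \<in> restricted_pairs Q U c0"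
  shows "0 \<le> kappa_sq Q U c0 0" "kappa_sq Q U c0 0 * (L2_set d (supp p (\<beta> u)))\<^sup>2 \<le> E2 d"
proof -
  let ?r = "\<lambda>(u, d). quad_form p (pop_gram Q) d / (L2_set d (supp p (\<beta> u)))\<^sup>2"
  have k: "kappa_sq Q U c0 0 = (INF w\<in>restricted_pairs Q U c0. ?r w)" by (simp add: kappa_sq_def)
  have r0: "0 \<le> ?r w" for w by (cases w) (simp add: quad_gram E2_nonneg)
  show "0 \<le> kappa_sq Q U c0 0" unfolding k using pairs_ne r0 by (intro cINF_greatest)
  have "kappa_sq Q U c0 0 \<le> ?r (u, d)" unfolding k using r0 by (intro cINF_lower ud bdd_belowI2[of _ 0])
  then have le: "kappa_sq Q U c0 0 \<le> E2 d / (L2_set d (supp p (\<beta> u)))\<^sup>2" by (simp add: quad_gram)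
  show "kappa_sq Q U c0 0 * (L2_set d (supp p (\<beta> u)))\<^sup>2 \<le> E2 d"
  \<comment> \<open>A vanishing denominator makes the ratio 0 by convention, but then the product on
    the left vanishes as well.\<close>
  proof (cases "L2_set d (supp p (\<beta> u)) = 0")
    case True then show ?thesis using E2_nonneg by simp
  next
    case False
    then have "0 < (L2_set d (supp p (\<beta> u)))\<^sup>2" by simp
    with le show ?thesis by (simp add: pos_le_divide_eq)
  qed
qed

text \<open>A coordinate vector in the support of some \<open>\<beta>(u)\<close> normalizes both restricted infima.\<close>

lemma unit_restricted:
  obtains u j where "u \<in> U" "j \<in> supp p (\<beta> u)" "(u, \<lambda>k. of_bool (k = j)) \<in> restricted_pairs Q U c0"
proof -
  obtain u d where ud: "u \<in> U" "d \<in> restricted_set Q c0 u" "supp p d \<noteq> {}"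
    using pairs_ne unfolding restricted_pairs_def by auto
  have cone: "(\<Sum>j\<in>{..<p} - supp p (\<beta> u). \<bar>d j\<bar>) \<le> c0 * (\<Sum>j\<in>supp p (\<beta> u). \<bar>d j\<bar>)"
    using ud(2) by (simp add: restricted_set_def Let_def)
  have "supp p (\<beta> u) \<noteq> {}"
  proof
    assume e: "supp p (\<beta> u) = {}"
    then have "(\<Sum>j<p. \<bar>d j\<bar>) \<le> 0" using cone by simp
    moreover have "0 \<le> (\<Sum>j<p. \<bar>d j\<bar>)" by (intro sum_nonneg) auto
    ultimately have "(\<Sum>j<p. \<bar>d j\<bar>) = 0" by simp
    then have "\<forall>j<p. d j = 0" by (subst (asm) sum_nonneg_eq_0_iff) auto
    then show False using ud(3) by (auto simp: supp_def)
  qed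
  then obtain j where j: "j \<in> supp p (\<beta> u)" by auto
  let ?e = "\<lambda>k. of_bool (k = j) :: real"
  have out: "?e k = 0" if "k \<in> {..<p} - supp p (\<beta> u)" for k using that j by auto
  have "(\<Sum>k\<in>{..<p} - supp p (\<beta> u). \<bar>?e k\<bar>) = 0" using out by (intro sum.neutral) auto
  moreover have "0 \<le> c0 * (\<Sum>k\<in>supp p (\<beta> u). \<bar>?e k\<bar>)" using c0_ge by (intro mult_nonneg_nonneg sum_nonneg) auto
  moreover have "{k \<in> {..<p} - supp p (\<beta> u). ?e k \<noteq> 0} = {}" using out by auto
  ultimately have "(\<Sum>k\<in>{..<p} - supp p (\<beta> u). \<bar>?e k\<bar>) \<le> c0 * (\<Sum>k\<in>supp p (\<beta> u). \<bar>?e k\<bar>) \<and>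
      card {k \<in> {..<p} - supp p (\<beta> u). ?e k \<noteq> 0} \<le> n" by (simp only: card.empty) simp
  then have "?e \<in> restricted_set Q c0 u" unfolding restricted_set_def Let_def mem_Collect_eq .
  moreover have "supp p ?e \<noteq> {}" using j by (auto simp: supp_def)
  ultimately show ?thesis using that[OF ud(1) j] ud(1) by (simp add: restricted_pairs_def)
qed

lemma dot_unit: "j < p \<Longrightarrow> dot p z (\<lambda>k. of_bool (k = j)) = z j"
  by (simp add: dot_def if_distrib of_bool_def cong: if_cong)

text \<open>The coordinate vector has ratio 1. Dividing by kappa then only enlarges t, which frees
  the later numerical estimates from kappa.\<close>

lemma kappa_sq_le_1: "kappa_sq Q U c0 0 \<le> 1"
proof -
  obtain u j where uj: "u \<in> U" "j \<in> supp p (\<beta> u)" "(u, \<lambda>k. of_bool (k = j)) \<in> restricted_pairs Q U c0"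
    by (rule unit_restricted)
  let ?e = "\<lambda>k. of_bool (k = j) :: real"
  have jp: "j < p" using uj(2) by (simp add: supp_def)
  have "(\<Sum>k\<in>supp p (\<beta> u). (?e k)\<^sup>2) = (\<Sum>k\<in>supp p (\<beta> u). if k = j then 1 else 0)" by (intro sum.cong) auto
  then have "(L2_set ?e (supp p (\<beta> u)))\<^sup>2 = 1" using uj(2) by (simp add: L2_set_def)
  moreover have "E2 ?e = 1" unfolding E2_eq using jp by (simp add: dot_unit second_moment_one)
  ultimately show ?thesis using kappa_sq_bounds(2)[OF uj(3)] by simp
qed

text \<open>The coordinate vector has second moment 1 and third absolute moment at least 1. This
  ties q sqrt flow to flow^2 / fbar', the scale on which the quantile curves are Lipschitz.\<close>

lemma nonlin_q_le: "nonlin_q Q U c0 flow fbar' \<le> 3/8 * (flow powr (3/2) / fbar')" and fbar'_pos: "0 < fbar'"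
proof -
  obtain u j where uj: "u \<in> U" "j \<in> supp p (\<beta> u)" "(u, \<lambda>k. of_bool (k = j)) \<in> restricted_pairs Q U c0"
    by (rule unit_restricted)
  let ?e = "\<lambda>k. of_bool (k = j) :: real"
  have jp: "j < p" using uj(2) by (simp add: supp_def)
  note q = nonlin_q_facts[OF uj(3)]
  show "0 < fbar'" by (rule q(1))
  have e2: "E2 ?e = 1" unfolding E2_eq using jp by (simp add: dot_unit second_moment_one)
  have i3: "integrable M (\<lambda>\<omega>. \<bar>x 0 \<omega> j\<bar> ^ 3)" using q(2) jp by (simp add: dot_unit)
  have "1 = (\<integral>\<omega>. (3/2) * (x 0 \<omega> j)\<^sup>2 - 1/2 \<partial>M)"
    using integrable_x_square[OF jp] second_moment_one[OF jp] by (simp add: C.M.prob_space)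
  also have "\<dots> \<le> (\<integral>\<omega>. \<bar>x 0 \<omega> j\<bar> ^ 3 \<partial>M)"
  proof (rule integral_mono[OF _ i3])
    show "integrable M (\<lambda>\<omega>. (3/2) * (x 0 \<omega> j)\<^sup>2 - 1/2)" using integrable_x_square[OF jp] by simp
    \<comment> \<open>A pointwise substitute for Jensen's inequality: at second moment 1 the left
      side has mean 1.\<close>
    have "(3/2) * a\<^sup>2 - 1/2 \<le> \<bar>a\<bar> ^ 3" for a :: real
    proof -
      have "0 \<le> (\<bar>a\<bar> - 1)\<^sup>2 * (2 * \<bar>a\<bar> + 1)" by simp
      also have "\<dots> = 2 * \<bar>a\<bar> ^ 3 - 3 * \<bar>a\<bar>\<^sup>2 + 1" by (simp add: power2_eq_square power3_eq_cube algebra_simps)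
      finally show ?thesis by simp
    qed
    then show "(3/2) * (x 0 \<omega> j)\<^sup>2 - 1/2 \<le> \<bar>x 0 \<omega> j\<bar> ^ 3" for \<omega> .
  qed
  also have "\<dots> = E3 ?e" using jp by (simp add: pop_abs_moment_def dot_unit)
  finally have "1 \<le> E3 ?e" .
  then have "nonlin_q Q U c0 flow fbar' * 1 \<le> nonlin_q Q U c0 flow fbar' * E3 ?e"
    using q_pos by (intro mult_left_mono) auto
  then show "nonlin_q Q U c0 flow fbar' \<le> 3/8 * (flow powr (3/2) / fbar')" using q(5) e2 by simp
qed

end

section \<open>The uniform deviation bound\<close>

text \<open>Separability, applied to an l1-ball in the product topology: it makes the supremum over
  displacements a countable one and its event measurable.\<close>

lemma countable_dense_subset:
  fixes S :: "'a::second_countable_topology set"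
  obtains D where "countable D" "D \<subseteq> S" "\<And>G x. open G \<Longrightarrow> x \<in> S \<Longrightarrow> x \<in> G \<Longrightarrow> \<exists>d\<in>D. d \<in> G"
proof -
  obtain B :: "'a set set" where B: "countable B \<and> topological_basis B"
    using ex_countable_basis[where 'a = 'a] by (rule exE)
  define pick where "pick b = (SOME x. x \<in> b \<inter> S)" for b
  have pick: "pick b \<in> b \<inter> S" if "b \<inter> S \<noteq> {}" for b
    unfolding pick_def some_in_eq by (rule that)
  show ?thesis
  proof (rule that)
    show "countable (pick ` {b \<in> B. b \<inter> S \<noteq> {}})" by (intro countable_image countable_subset[OF _ conjunct1[OF B]]) auto
    show "pick ` {b \<in> B. b \<inter> S \<noteq> {}} \<subseteq> S" using pick by auto
    fix G x assume "open G" "x \<in> S" "x \<in> G"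
    obtain b where "b \<in> B" "x \<in> b" "b \<subseteq> G" by (rule topological_basisE[OF conjunct2[OF B] \<open>open G\<close> \<open>x \<in> G\<close>]) blast
    then show "\<exists>d\<in>pick ` {b \<in> B. b \<inter> S \<noteq> {}}. d \<in> G" using pick[of b] \<open>x \<in> S\<close> \<open>b \<in> B\<close> by blast
  qed
qed

lemma open_coord_box: "open {e :: nat \<Rightarrow> real. \<forall>j<p. \<bar>e j - d j\<bar> < r}"
proof -
  have "open {e :: nat \<Rightarrow> real. \<bar>e j - d j\<bar> < r}" for j
    by (intro open_Collect_less continuous_intros continuous_on_product_coordinates)
  then have "open (\<Inter>j\<in>{..<p}. {e :: nat \<Rightarrow> real. \<bar>e j - d j\<bar> < r})" by (intro open_INT) auto
  moreover have "(\<Inter>j\<in>{..<p}. {e :: nat \<Rightarrow> real. \<bar>e j - d j\<bar> < r}) = {e. \<forall>j<p. \<bar>e j - d j\<bar> < r}" by auto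
  ultimately show ?thesis by simp
qed

lemma sum_abs_le_of_sum_squares:
  assumes "(\<Sum>i<n. (a i)\<^sup>2) \<le> 9/4 * real n"
  shows "(\<Sum>i<n. \<bar>a i\<bar>) \<le> 3/2 * real n"
proof -
  have "(\<Sum>i<n. \<bar>a i\<bar>) = (\<Sum>i<n. \<bar>a i\<bar> * \<bar>1\<bar>)" by simp
  also have "\<dots> \<le> L2_set a {..<n} * L2_set (\<lambda>_. 1) {..<n}" by (rule L2_set_mult_ineq)
  also have "\<dots> \<le> sqrt (9/4 * real n) * sqrt (real n)"
    using assms by (intro mult_mono) (auto simp: L2_set_def sum_nonneg)
  also have "\<dots> = sqrt ((3/2 * real n)\<^sup>2)" unfolding real_sqrt_mult[symmetric] by (simp add: power2_eq_square)
  also have "\<dots> = 3/2 * real n" by (subst real_sqrt_abs) simp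
  finally show ?thesis .
qed

text \<open>c^3 (1 - c) is largest at c = 3/4, with value 27/256. This improves on the 64/256 that c
  < 1 and W \<ge> 2 would give, and the gain enters the tail exponent.\<close>

lemma max_square_le_W:
  fixes u :: real
  assumes "0 < u" "u < 1" "1 / sqrt (u * (1 - u)) \<le> W"
  shows "(max u (1 - u))\<^sup>2 \<le> 27/256 * W\<^sup>2"
proof -
  define c where "c = max u (1 - u)"
  have c: "0 < c" "c < 1" "u * (1 - u) = c * (1 - c)" using assms by (auto simp: c_def max_def)
  \<comment> \<open>Factorization of 27/256 - c^3 (1 - c): a double root at 3/4 times a quadratic
    that is positive on (0, 1).\<close>
  have "0 \<le> (c - 3/4)\<^sup>2 * (c\<^sup>2 + c / 2 + 3/16)" using c by (intro mult_nonneg_nonneg) auto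
  also have "\<dots> = 27/256 - c\<^sup>2 * (c * (1 - c))" by (simp add: power2_eq_square algebra_simps)
  finally have k: "c\<^sup>2 * (c * (1 - c)) \<le> 27/256" by simp
  have pos: "0 < c * (1 - c)" using c by simp
  have "(1 / sqrt (c * (1 - c)))\<^sup>2 \<le> W\<^sup>2" using assms(3) c pos by (intro power_mono) auto
  then have "1 / (c * (1 - c)) \<le> W\<^sup>2" using pos by (simp add: power_divide)
  moreover have "c\<^sup>2 \<le> 27/256 * (1 / (c * (1 - c)))" using k pos by (simp add: field_simps)
  ultimately show ?thesis unfolding c_def[symmetric] by linarith
qed

context qr_conditions
begin

text \<open>Monotonicity of the distribution function orders the two quantiles, and
  \<open>quantile_increment_le\<close> bounds their distance. The constant involves neither the
  dimension nor the size of z.\<close>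

lemma quantile_lipschitz:
  assumes z: "z \<in> good_cov" and u: "u \<in> U" "u' \<in> U" and close: "\<bar>u - u'\<bar> < flow\<^sup>2 / (4 * fbar')"
  shows "\<bar>dot p z (\<beta> u) - dot p z (\<beta> u')\<bar> \<le> 2 * \<bar>u - u'\<bar> / flow"
proof -
  have zs: "z \<in> supp_x" and Fz: "\<And>u. u \<in> U \<Longrightarrow> cond_cdf f z (dot p z (\<beta> u)) = u"
    using z by (auto simp: good_cov_def)
  interpret S: smooth_density "f z" fbar' by (rule smooth[OF zs])
  have FS: "\<And>u. u \<in> U \<Longrightarrow> S.F (dot p z (\<beta> u)) = u" using Fz by (simp add: F_eq[OF zs])
  have *: "\<bar>dot p z (\<beta> u) - dot p z (\<beta> u')\<bar> \<le> 2 * (u' - u) / flow"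
    if "u \<in> U" "u' \<in> U" "u < u'" "u' - u < flow\<^sup>2 / (4 * fbar')" for u u'
  proof -
    have "dot p z (\<beta> u) \<le> dot p z (\<beta> u')"
    proof (rule ccontr)
      assume "\<not> dot p z (\<beta> u) \<le> dot p z (\<beta> u')"
      then have "S.F (dot p z (\<beta> u')) \<le> S.F (dot p z (\<beta> u))" by (intro S.F_mono) auto
      then show False using FS that by simp
    qed
    then show ?thesis
      using S.quantile_increment_le[OF flow f_low[OF that(1) zs] fbar'_pos, of "dot p z (\<beta> u')"] FS that by auto
  qed
  consider "u < u'" | "u' < u" | "u = u'" by linarith
  then show ?thesis
  proof cases
    case 1 then show ?thesis using *[OF u(1) u(2)] close by auto
  next
    case 2 then show ?thesis using *[OF u(2) u(1)] close by (auto simp: abs_minus_commute)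
  qed auto
qed

text \<open>Changing u moves the quantile, which both loss terms feel through their Lipschitz
  property, and tilts the check function, which is affine in u. In the tilt the residual cancels
  between the two terms and only (u - u') x'd survives.\<close>

lemma qexcess_index_change:
  assumes z: "z \<in> good_cov" and u: "u \<in> U" "u' \<in> U" and close: "\<bar>u - u'\<bar> < flow\<^sup>2 / (4 * fbar')"
  shows "\<bar>qexcess u d (v, z) - qexcess u' d (v, z)\<bar> \<le> \<bar>u - u'\<bar> * (\<bar>dot p z d\<bar> + 4 / flow)"
proof -
  let ?w = "v - dot p z (\<beta> u)" and ?w' = "v - dot p z (\<beta> u')" and ?a = "dot p z d"
  have q: "\<bar>?w - ?w'\<bar> \<le> 2 * \<bar>u - u'\<bar> / flow"
    using quantile_lipschitz[OF assms] by (simp add: abs_minus_commute)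
  have 1: "\<bar>rho u (?w - ?a) - rho u (?w' - ?a)\<bar> \<le> \<bar>?w - ?w'\<bar>"
    using rho_lipschitz1[of u "?w - ?a" "?w' - ?a"] U01[OF u(1)] by simp
  have 2: "\<bar>rho u ?w - rho u ?w'\<bar> \<le> \<bar>?w - ?w'\<bar>"
    using rho_lipschitz1[of u ?w ?w'] U01[OF u(1)] by simp
  have 3: "(rho u (?w' - ?a) - rho u' (?w' - ?a)) - (rho u ?w' - rho u' ?w') = - ((u - u') * ?a)"
    unfolding rho_diff_index by (simp add: algebra_simps)
  have "qexcess u d (v, z) - qexcess u' d (v, z) = (rho u (?w - ?a) - rho u (?w' - ?a)) - (rho u ?w - rho u ?w') - (u - u') * ?a"
    using 3 by (simp add: qexcess_def)
  then have "\<bar>qexcess u d (v, z) - qexcess u' d (v, z)\<bar> \<le> \<bar>?w - ?w'\<bar> + \<bar>?w - ?w'\<bar> + \<bar>(u - u') * ?a\<bar>"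
    using 1 2 by linarith
  also have "\<dots> \<le> 2 * \<bar>u - u'\<bar> / flow + 2 * \<bar>u - u'\<bar> / flow + \<bar>u - u'\<bar> * \<bar>?a\<bar>"
    using q by (intro add_mono) (auto simp: abs_mult)
  also have "\<dots> = \<bar>u - u'\<bar> * (\<bar>dot p z d\<bar> + 4 / flow)" using flow by (simp add: field_simps)
  finally show ?thesis .
qed

lemma qexcess_mean_index_change:
  assumes u: "u \<in> U" "u' \<in> U" and close: "\<bar>u - u'\<bar> < flow\<^sup>2 / (4 * fbar')"
  shows "\<bar>(\<integral>w. qexcess u d w \<partial>PZ) - (\<integral>w. qexcess u' d w \<partial>PZ)\<bar> \<le> \<bar>u - u'\<bar> * ((\<Sum>j<p. \<bar>d j\<bar>) + 4 / flow)"
proof -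
  let ?g = "\<lambda>u \<omega>. qexcess u d (y 0 \<omega>, x 0 \<omega>)"
  have "\<bar>(\<integral>w. qexcess u d w \<partial>PZ) - (\<integral>w. qexcess u' d w \<partial>PZ)\<bar> = \<bar>\<integral>\<omega>. ?g u \<omega> - ?g u' \<omega> \<partial>M\<bar>"
    unfolding expectation_qexcess using integrable_qexcess u by simp
  also have "\<dots> \<le> (\<integral>\<omega>. \<bar>?g u \<omega> - ?g u' \<omega>\<bar> \<partial>M)" by (rule integral_abs_bound)
  also have "\<dots> \<le> (\<integral>\<omega>. \<bar>u - u'\<bar> * (\<bar>dot p (x 0 \<omega>) d\<bar> + 4 / flow) \<partial>M)"
  proof (rule integral_mono_AE)
    show "integrable M (\<lambda>\<omega>. \<bar>?g u \<omega> - ?g u' \<omega>\<bar>)" using integrable_qexcess u by simp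
    show "integrable M (\<lambda>\<omega>. \<bar>u - u'\<bar> * (\<bar>dot p (x 0 \<omega>) d\<bar> + 4 / flow))" using integrable_dot by simp
    show "AE \<omega> in M. \<bar>?g u \<omega> - ?g u' \<omega>\<bar> \<le> \<bar>u - u'\<bar> * (\<bar>dot p (x 0 \<omega>) d\<bar> + 4 / flow)"
      using AE_good_cov by eventually_elim (use n_pos qexcess_index_change[OF _ assms] in auto)
  qed
  also have "\<dots> = \<bar>u - u'\<bar> * ((\<integral>\<omega>. \<bar>dot p (x 0 \<omega>) d\<bar> \<partial>M) + 4 / flow)"
    using integrable_dot by (simp add: C.M.prob_space)
  also have "\<dots> \<le> \<bar>u - u'\<bar> * ((\<Sum>j<p. \<bar>d j\<bar>) + 4 / flow)"
    by (intro mult_left_mono add_right_mono expectation_abs_dot_le) auto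
  finally show ?thesis .
qed

text \<open>The constant max u (1 - u), not just 1, is kept for the sake of the tail
  exponent.\<close>

lemma process: "u \<in> U \<Longrightarrow> iid_process PZ snd (qexcess u) p n (max u (1 - u))"
proof (intro iid_process.intro iid_process_axioms.intro)
  assume u: "u \<in> U"
  show "prob_space PZ" by (rule C.M.prob_space_distr[OF yx0])
  show "(\<lambda>w. snd w j) \<in> borel_measurable PZ" if "j < p" for j
    unfolding measurable_distr_eq1 by (rule measurable_compose[OF measurable_snd measurable_component_singleton]) (simp add: that)
  show "qexcess u d \<in> borel_measurable PZ" for d unfolding measurable_distr_eq1 by (rule qexcess_meas)
  show "\<bar>qexcess u d w - qexcess u e w\<bar> \<le> max u (1 - u) * \<bar>dot p (snd w) d - dot p (snd w) e\<bar>" for w d e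
    by (rule qexcess_lip[OF u])
  show "\<bar>qexcess u d w\<bar> \<le> max u (1 - u) * \<bar>dot p (snd w) d\<bar>" for w d by (rule qexcess_le[OF u])
  show "0 < max u (1 - u)" using U01[OF u] by simp
qed (rule p_pos n_pos)+

definition sample :: "'w \<Rightarrow> nat \<Rightarrow> real \<times> (nat \<Rightarrow> real)" where
  "sample \<omega> = (\<lambda>i\<in>{..<n}. (y i \<omega>, x i \<omega>))"

lemma sample_meas: "sample \<in> M \<rightarrow>\<^sub>M Pi\<^sub>M {..<n} (\<lambda>_. PZ)"
proof -
  have "(\<lambda>\<omega>. \<lambda>i\<in>{..<n}. (y i \<omega>, x i \<omega>)) \<in> M \<rightarrow>\<^sub>M Pi\<^sub>M {..<n} (\<lambda>_. PZ)"
    by (rule measurable_restrict) (simp add: measurable_distr_eq2 yx_meas)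
  then show ?thesis by (simp only: sample_def[abs_def])
qed

lemma distr_sample': "distr M (Pi\<^sub>M {..<n} (\<lambda>_. PZ)) sample = Pi\<^sub>M {..<n} (\<lambda>_. PZ)"
proof -
  have s: "sets (Pi\<^sub>M {..<n} (\<lambda>_. PZ)) = sets (Pi\<^sub>M {..<n} (\<lambda>_. OZ))" by (intro sets_PiM_cong) auto
  have "distr M (Pi\<^sub>M {..<n} (\<lambda>_. PZ)) sample = distr M (Pi\<^sub>M {..<n} (\<lambda>_. OZ)) sample"
    by (rule distr_cong[OF refl s refl])
  then show ?thesis using distr_sample by (simp only: sample_def[abs_def])
qed

lemma measure_sample:
  "A \<in> sets (Pi\<^sub>M {..<n} (\<lambda>_. PZ)) \<Longrightarrow> measure M (sample -` A \<inter> space M) = measure (Pi\<^sub>M {..<n} (\<lambda>_. PZ)) A"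
  using measure_distr[OF sample_meas, of A] unfolding distr_sample' by simp

definition scale_event :: "'w set" where
  "scale_event = {\<omega> \<in> space M. (MAX j\<in>{..<p}. \<bar>sigma_hat n (design Q \<omega>) j - 1\<bar>) \<le> 1/2}"

lemma scale_event_prob: "1 - \<gamma> \<le> measure M scale_event"
  using D3 by (simp add: cond_D3_def scale_event_def)

lemma scale_eventD:
  assumes "\<omega> \<in> scale_event" "j < p"
  shows "1/2 \<le> sigma_hat n (design Q \<omega>) j \<and> sigma_hat n (design Q \<omega>) j \<le> 3/2"
proof -
  have "\<bar>sigma_hat n (design Q \<omega>) j - 1\<bar> \<le> (MAX j\<in>{..<p}. \<bar>sigma_hat n (design Q \<omega>) j - 1\<bar>)"
    using assms(2) by (intro Max_ge) auto
  then have "\<bar>sigma_hat n (design Q \<omega>) j - 1\<bar> \<le> 1/2" using assms(1) by (simp add: scale_event_def)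
  then show ?thesis by linarith
qed

lemma sum_squares_le:
  assumes "\<omega> \<in> space M" "j < p" "sigma_hat n (design Q \<omega>) j \<le> 3/2"
  shows "(\<Sum>i<n. (x i \<omega> j)\<^sup>2) \<le> 9/4 * real n"
proof -
  have e: "(\<Sum>i<n. (design Q \<omega> i j)\<^sup>2) = (\<Sum>i<n. (x i \<omega> j)\<^sup>2)"
    using assms(1) by (intro sum.cong) (auto simp: design_eq)
  have "sqrt ((\<Sum>i<n. (x i \<omega> j)\<^sup>2) / real n) \<le> 3/2" using assms(3) unfolding sigma_hat_def e .
  then have "(\<Sum>i<n. (x i \<omega> j)\<^sup>2) / real n \<le> (3/2)\<^sup>2" by (rule sqrt_le_D)
  then show ?thesis using n_pos by (simp add: power2_eq_square divide_le_eq)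
qed

text \<open>A grid takes care of u and a countable dense set of d. The terms \<open>a + a'\<close>
  come from the bad event at a node. Moving u to its node costs at most R + 4 / flow in the means
  and 3/2 R + 4 / flow in the sample, summed over all observations.\<close>

lemma deviation_event:
  assumes R: "0 < R" and a: "0 < a" "0 < a'" "4 * (real n * v) \<le> a'\<^sup>2" and \<gamma>: "\<gamma> \<le> 1/4"
    and fine: "1 / real n < flow\<^sup>2 / (4 * fbar')"
  obtains E where "E \<in> sets M" "1 - real n * (4 * real p * exp (- (64 * a\<^sup>2 / (243 * real n * (W_U U)\<^sup>2 * R\<^sup>2)))) \<le> measure M E"
    "\<And>\<omega>. \<omega> \<in> E \<Longrightarrow> \<omega> \<in> space M \<and> (\<forall>i<n. x i \<omega> \<in> good_cov)"
    "\<And>\<omega> u d. \<omega> \<in> E \<Longrightarrow> \<omega> \<in> scale_event \<Longrightarrow> u \<in> U \<Longrightarrow> (\<Sum>j<p. \<bar>d j\<bar>) \<le> R \<Longrightarrow> E2 d \<le> v \<Longrightarrow>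
      (\<Sum>i<n. (\<integral>w. qexcess u d w \<partial>PZ) - qexcess u d (y i \<omega>, x i \<omega>)) \<le> a + a' + 5/2 * R + 8 / flow"
proof -
  let ?PP = "Pi\<^sub>M {..<n} (\<lambda>_. PZ)"
  interpret PP: prob_space ?PP by (intro prob_space_PiM C.M.prob_space_distr[OF yx0])
  \<comment> \<open>The bound (3/2)^2 n for the columns' sums of squares that
    \<open>scale_event\<close> provides.\<close>
  define V where "V = 9/4 * real n"
  have V: "0 < V" using n_pos by (simp add: V_def)
  define Cset where "Cset = {d :: nat \<Rightarrow> real. (\<Sum>j<p. \<bar>d j\<bar>) \<le> R \<and> E2 d \<le> v}"
  obtain D where D: "countable D" "D \<subseteq> Cset" "\<And>G d. open G \<Longrightarrow> d \<in> Cset \<Longrightarrow> d \<in> G \<Longrightarrow> \<exists>e\<in>D. e \<in> G"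
    by (rule countable_dense_subset[of Cset]) blast
  \<comment> \<open>U may miss the grid points, so each nonempty cell of length 1/n is represented
    by a point of U inside it.\<close>
  let ?cell = "\<lambda>k. {u \<in> U. real k / real n \<le> u \<and> u < real (Suc k) / real n}"
  let ?node = "\<lambda>k. SOME u. u \<in> ?cell k"
  have node: "?node k \<in> ?cell k" if "?cell k \<noteq> {}" for k unfolding some_in_eq by (rule that)
  let ?B = "\<lambda>k. iid_process.bad_event PZ snd (qexcess (?node k)) p n D (a + a') V"
  let ?K = "{k \<in> {..<n}. ?cell k \<noteq> {}}"
  let ?b = "4 * real p * exp (- (64 * a\<^sup>2 / (243 * real n * (W_U U)\<^sup>2 * R\<^sup>2)))"
  \<comment> \<open>\<open>scale_event\<close> has probability at least 1 - \<gamma> \<ge> 3/4 and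
    implies the moment bound for the sample.\<close>
  have goodprob: "3/4 \<le> measure ?PP {Z \<in> space ?PP. \<forall>j<p. (\<Sum>i<n. (snd (Z i) j)\<^sup>2) \<le> V}"
  proof -
    obtain u where u: "u \<in> U" using U(2) by auto
    interpret I: iid_process PZ snd "qexcess u" p n "max u (1 - u)" by (rule process[OF u])
    have gs: "{Z \<in> space ?PP. \<forall>j<p. (\<Sum>i<n. (snd (Z i) j)\<^sup>2) \<le> V} \<in> sets ?PP"
      using I.good_sets[of V] unfolding I.good_def .
    have "3/4 \<le> measure M scale_event" using scale_event_prob \<gamma> by linarith
    also have "\<dots> \<le> measure M (sample -` {Z \<in> space ?PP. \<forall>j<p. (\<Sum>i<n. (snd (Z i) j)\<^sup>2) \<le> V} \<inter> space M)"
    proof (rule C.M.finite_measure_mono)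
      show "scale_event \<subseteq> sample -` {Z \<in> space ?PP. \<forall>j<p. (\<Sum>i<n. (snd (Z i) j)\<^sup>2) \<le> V} \<inter> space M"
      proof
        fix \<omega> assume w: "\<omega> \<in> scale_event"
        then have sp: "\<omega> \<in> space M" by (simp add: scale_event_def)
        have "(\<Sum>i<n. (snd (sample \<omega> i) j)\<^sup>2) \<le> V" if j: "j < p" for j
          using sum_squares_le[OF sp j] scale_eventD[OF w j] by (simp add: sample_def V_def)
        then show "\<omega> \<in> sample -` {Z \<in> space ?PP. \<forall>j<p. (\<Sum>i<n. (snd (Z i) j)\<^sup>2) \<le> V} \<inter> space M"
          using sp measurable_space[OF sample_meas sp] by simp
      qed
      show "sample -` {Z \<in> space ?PP. \<forall>j<p. (\<Sum>i<n. (snd (Z i) j)\<^sup>2) \<le> V} \<inter> space M \<in> sets M"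
        by (rule measurable_sets[OF sample_meas gs])
    qed
    also have "\<dots> = measure ?PP {Z \<in> space ?PP. \<forall>j<p. (\<Sum>i<n. (snd (Z i) j)\<^sup>2) \<le> V}" by (rule measure_sample[OF gs])
    finally show ?thesis .
  qed
  have Bk: "?B k \<in> sets ?PP" "measure ?PP (?B k) \<le> ?b" if k: "k \<in> ?K" for k
  proof -
    define u where "u = ?node k"
    have u: "u \<in> U" using node[of k] k by (simp add: u_def)
    interpret I: iid_process PZ snd "qexcess u" p n "max u (1 - u)" by (rule process[OF u])
    show "?B k \<in> sets ?PP" unfolding u_def[symmetric] by (rule I.bad_event_sets[OF D(1)])
    have "measure ?PP (I.bad_event D (a + a') V) \<le> 4 * real p * exp (- (a\<^sup>2 / (16 * (max u (1 - u))\<^sup>2 * R\<^sup>2 * V)))"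
    proof (rule I.bad_event_prob[OF D(1) R V])
      show "(\<Sum>j<p. \<bar>d j\<bar>) \<le> R" if "d \<in> D" for d using that D(2) by (auto simp: Cset_def)
      show "3/4 \<le> measure ?PP {Z \<in> space ?PP. I.good V Z}" unfolding I.good_def by (rule goodprob)
      show "integrable PZ (\<lambda>w. (qexcess u d w)\<^sup>2)" for d by (rule qexcess_square(1)[OF u])
      show "(\<integral>w. (qexcess u d w)\<^sup>2 \<partial>PZ) \<le> v" if "d \<in> D" for d
        using qexcess_square(2)[OF u, of d] that D(2) by (auto simp: Cset_def)
    qed (rule a)+
    also have "\<dots> \<le> ?b"
    proof -
      have c: "0 < max u (1 - u)" using U01[OF u] by simp
      \<comment> \<open>16 * 27/256 * 9/4 = 243/64 is the origin of the 64 and the 243.\<close>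
      have "16 * (max u (1 - u))\<^sup>2 * R\<^sup>2 * V \<le> 16 * (27/256 * (W_U U)\<^sup>2) * R\<^sup>2 * V"
        using V by (intro mult_right_mono mult_left_mono max_square_le_W U01 u W_upper[OF U u]) auto
      also have "\<dots> = 243/64 * real n * (W_U U)\<^sup>2 * R\<^sup>2" by (simp add: V_def)
      finally have den: "16 * (max u (1 - u))\<^sup>2 * R\<^sup>2 * V \<le> 243/64 * real n * (W_U U)\<^sup>2 * R\<^sup>2" .
      have den0: "0 < 16 * (max u (1 - u))\<^sup>2 * R\<^sup>2 * V" using c R V by simp
      have "64 * a\<^sup>2 / (243 * real n * (W_U U)\<^sup>2 * R\<^sup>2) = a\<^sup>2 / (243/64 * real n * (W_U U)\<^sup>2 * R\<^sup>2)" by simp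
      also have "\<dots> \<le> a\<^sup>2 / (16 * (max u (1 - u))\<^sup>2 * R\<^sup>2 * V)"
      proof (rule divide_left_mono[OF den])
        have "0 < 243/64 * real n * (W_U U)\<^sup>2 * R\<^sup>2" using den den0 by linarith
        then show "0 < 243/64 * real n * (W_U U)\<^sup>2 * R\<^sup>2 * (16 * (max u (1 - u))\<^sup>2 * R\<^sup>2 * V)"
          using den0 by (rule mult_pos_pos)
      qed simp
      finally show ?thesis by (intro mult_left_mono) auto
    qed
    finally show "measure ?PP (?B k) \<le> ?b" unfolding u_def .
  qed
  define BB where "BB = (\<Union>k\<in>?K. ?B k)"
  have BB: "BB \<in> sets ?PP" unfolding BB_def using Bk by (intro sets.finite_UN) auto
  have "measure ?PP BB \<le> (\<Sum>k\<in>?K. measure ?PP (?B k))"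
    unfolding BB_def using Bk by (intro PP.finite_measure_subadditive_finite) auto
  also have "\<dots> \<le> (\<Sum>k\<in>?K. ?b)" by (intro sum_mono Bk)
  also have "\<dots> = real (card ?K) * ?b" by simp
  also have "\<dots> \<le> real n * ?b"
  proof (intro mult_right_mono)
    have "card ?K \<le> card {..<n}" by (intro card_mono) auto
    then show "real (card ?K) \<le> real n" by simp
  qed auto
  finally have BBp: "measure ?PP BB \<le> real n * ?b" .
  obtain N where N: "{\<omega> \<in> space M. \<not> (\<forall>i<n. x i \<omega> \<in> good_cov)} \<subseteq> N" "emeasure M N = 0" "N \<in> sets M"
    using AE_E[OF AE_good_cov] by blast
  define E where "E = space M - (sample -` BB \<inter> space M) - N"
  have SB: "sample -` BB \<inter> space M \<in> sets M" by (rule measurable_sets[OF sample_meas BB])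
  show ?thesis
  proof (rule that[of E])
    show E: "E \<in> sets M" unfolding E_def using SB N(3) by auto
    have "N \<in> null_sets M" using N by auto
    then have "measure M E = measure M (space M - (sample -` BB \<inter> space M))"
      unfolding E_def using SB by (intro measure_Diff_null_set) auto
    also have "\<dots> = 1 - measure M (sample -` BB \<inter> space M)" using SB by (rule C.M.prob_compl)
    also have "\<dots> = 1 - measure ?PP BB" by (simp add: measure_sample[OF BB])
    finally show "1 - real n * ?b \<le> measure M E" using BBp by linarith
    show EG: "\<omega> \<in> space M \<and> (\<forall>i<n. x i \<omega> \<in> good_cov)" if "\<omega> \<in> E" for \<omega> using that N(1) unfolding E_def by blast
    fix \<omega> u d
    assume w: "\<omega> \<in> E" "\<omega> \<in> scale_event" and u: "u \<in> U" and d: "(\<Sum>j<p. \<bar>d j\<bar>) \<le> R" "E2 d \<le> v"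
    have sp: "\<omega> \<in> space M" and gc: "\<And>i. i < n \<Longrightarrow> x i \<omega> \<in> good_cov" using EG[OF w(1)] by auto
    have xs: "(\<Sum>i<n. (x i \<omega> j)\<^sup>2) \<le> 9/4 * real n" if j: "j < p" for j
      using sum_squares_le[OF sp j] scale_eventD[OF w(2) j] by simp
    have xa: "(\<Sum>i<n. \<bar>dot p (x i \<omega>) e\<bar>) \<le> 3/2 * real n * (\<Sum>j<p. \<bar>e j\<bar>)" for e
    proof -
      have "(\<Sum>i<n. \<bar>dot p (x i \<omega>) e\<bar>) \<le> (\<Sum>i<n. \<Sum>j<p. \<bar>x i \<omega> j\<bar> * \<bar>e j\<bar>)"
        unfolding dot_def abs_mult[symmetric] by (intro sum_mono sum_abs)
      also have "\<dots> = (\<Sum>j<p. (\<Sum>i<n. \<bar>x i \<omega> j\<bar>) * \<bar>e j\<bar>)" unfolding sum_distrib_right by (rule sum.swap)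
      also have "\<dots> \<le> (\<Sum>j<p. (3/2 * real n) * \<bar>e j\<bar>)"
        by (intro sum_mono mult_right_mono sum_abs_le_of_sum_squares xs) auto
      finally show ?thesis by (simp add: sum_distrib_left)
    qed
    define k where "k = nat \<lfloor>real n * u\<rfloor>"
    have u01: "0 < u" "u < 1" using U01[OF u] by auto
    have "real k = of_int \<lfloor>real n * u\<rfloor>" unfolding k_def using u01 by simp
    then have k1: "real k \<le> real n * u" "real n * u < real (Suc k)" by linarith+
    have "real k < real n"
    proof -
      have "real n * u < real n * 1" using u01 n_pos by (intro mult_strict_left_mono) auto
      then show ?thesis using k1 by linarith
    qed
    then have kn: "k < n" by simp
    have ucell: "u \<in> ?cell k" using k1 u n_pos by (simp add: field_simps)
    then have kK: "k \<in> ?K" using kn by auto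
    define u' where "u' = ?node k"
    have u'cell: "u' \<in> ?cell k" unfolding u'_def using node[of k] kK by blast
    then have u': "u' \<in> U" by simp
    have uu: "\<bar>u - u'\<bar> \<le> 1 / real n"
    proof -
      have "real (Suc k) / real n = real k / real n + 1 / real n" by (simp add: add_divide_distrib)
      then show ?thesis using ucell u'cell by auto
    qed
    then have close: "\<bar>u - u'\<bar> < flow\<^sup>2 / (4 * fbar')" using fine by linarith
    interpret I: iid_process PZ snd "qexcess u'" p n "max u' (1 - u')" by (rule process[OF u'])
    let ?S = "\<lambda>u e. \<Sum>i<n. (\<integral>w. qexcess u e w \<partial>PZ) - qexcess u e (y i \<omega>, x i \<omega>)"
    have notbad: "sample \<omega> \<notin> I.bad_event D (a + a') V"
      using w(1) sp kK unfolding E_def BB_def u'_def by blast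
    have gd: "I.good V (sample \<omega>)" unfolding I.good_def using xs by (simp add: sample_def V_def)
    have SD: "?S u' e \<le> a + a'" if "e \<in> D" for e
    proof -
      have "\<not> a + a' < (\<Sum>i<n. (\<integral>w. qexcess u' e w \<partial>PZ) - qexcess u' e (sample \<omega> i))"
        using notbad gd that measurable_space[OF sample_meas sp] unfolding I.bad_event_def by blast
      then show ?thesis by (simp add: sample_def)
    qed
    \<comment> \<open>On \<open>scale_event\<close> the mean part is Lipschitz in the l1-norm with
      constant n and the empirical part with constant 3/2 n. This carries the bound from the dense
      set to every d.\<close>
    have Slip: "?S u' d \<le> ?S u' e + 5/2 * real n * (\<Sum>j<p. \<bar>d j - e j\<bar>)" for e
    proof -
      let ?de = "\<lambda>j. d j - e j"
      have "(\<integral>w. qexcess u' d w \<partial>PZ) - (\<integral>w. qexcess u' e w \<partial>PZ) \<le> (\<Sum>j<p. \<bar>?de j\<bar>)"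
      proof -
        have "(\<integral>w. qexcess u' d w \<partial>PZ) - (\<integral>w. qexcess u' e w \<partial>PZ)
            = (\<integral>\<omega>. qexcess u' d (y 0 \<omega>, x 0 \<omega>) - qexcess u' e (y 0 \<omega>, x 0 \<omega>) \<partial>M)"
          unfolding expectation_qexcess using integrable_qexcess[OF u'] by simp
        also have "\<dots> \<le> (\<integral>\<omega>. \<bar>dot p (x 0 \<omega>) ?de\<bar> \<partial>M)"
        proof (rule integral_mono)
          show "integrable M (\<lambda>\<omega>. qexcess u' d (y 0 \<omega>, x 0 \<omega>) - qexcess u' e (y 0 \<omega>, x 0 \<omega>))"
            using integrable_qexcess[OF u'] by simp
          show "integrable M (\<lambda>\<omega>. \<bar>dot p (x 0 \<omega>) ?de\<bar>)" by (rule integrable_abs[OF integrable_dot])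
          fix \<omega>
          have "max u' (1 - u') * \<bar>dot p (x 0 \<omega>) ?de\<bar> \<le> 1 * \<bar>dot p (x 0 \<omega>) ?de\<bar>"
            using U01[OF u'] by (intro mult_right_mono) auto
          then show "qexcess u' d (y 0 \<omega>, x 0 \<omega>) - qexcess u' e (y 0 \<omega>, x 0 \<omega>) \<le> \<bar>dot p (x 0 \<omega>) ?de\<bar>"
            using qexcess_lip[OF u', of d "(y 0 \<omega>, x 0 \<omega>)" e] by (simp add: dot_diff)
        qed
        also have "\<dots> \<le> (\<Sum>j<p. \<bar>?de j\<bar>)" by (rule expectation_abs_dot_le)
        finally show ?thesis .
      qed
      then have 1: "(\<Sum>i<n. (\<integral>w. qexcess u' d w \<partial>PZ) - (\<integral>w. qexcess u' e w \<partial>PZ)) \<le> (\<Sum>i<n. \<Sum>j<p. \<bar>?de j\<bar>)"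
        by (intro sum_mono)
      have 2: "(\<Sum>i<n. qexcess u' e (y i \<omega>, x i \<omega>) - qexcess u' d (y i \<omega>, x i \<omega>)) \<le> (\<Sum>i<n. \<bar>dot p (x i \<omega>) ?de\<bar>)"
      proof (intro sum_mono)
        fix i
        have "max u' (1 - u') * \<bar>dot p (x i \<omega>) ?de\<bar> \<le> 1 * \<bar>dot p (x i \<omega>) ?de\<bar>"
          using U01[OF u'] by (intro mult_right_mono) auto
        then show "qexcess u' e (y i \<omega>, x i \<omega>) - qexcess u' d (y i \<omega>, x i \<omega>) \<le> \<bar>dot p (x i \<omega>) ?de\<bar>"
          using qexcess_lip[OF u', of e "(y i \<omega>, x i \<omega>)" d] by (simp add: dot_diff abs_minus_commute)
      qed
      have "?S u' d - ?S u' e = (\<Sum>i<n. (\<integral>w. qexcess u' d w \<partial>PZ) - (\<integral>w. qexcess u' e w \<partial>PZ))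
         + (\<Sum>i<n. qexcess u' e (y i \<omega>, x i \<omega>) - qexcess u' d (y i \<omega>, x i \<omega>))"
        unfolding sum_subtractf by simp
      also have "\<dots> \<le> real n * (\<Sum>j<p. \<bar>?de j\<bar>) + 3/2 * real n * (\<Sum>j<p. \<bar>?de j\<bar>)"
        using 1 2 xa[of ?de] by simp
      finally show ?thesis by (simp add: algebra_simps)
    qed
    have Sd: "?S u' d \<le> a + a'"
    proof (rule field_le_epsilon)
      fix r :: real assume r: "0 < r"
      define del where "del = r / (5/2 * real n * real p)"
      have del: "0 < del" using r n_pos p_pos by (simp add: del_def)
      have "d \<in> Cset" using d by (simp add: Cset_def)
      then obtain e where e: "e \<in> D" "\<forall>j<p. \<bar>e j - d j\<bar> < del"
        using D(3)[OF open_coord_box[of p d del], of d] del by auto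
      have "(\<Sum>j<p. \<bar>d j - e j\<bar>) \<le> (\<Sum>j<p. del)" using e(2) by (intro sum_mono) (auto simp: abs_minus_commute intro: less_imp_le)
      then have "5/2 * real n * (\<Sum>j<p. \<bar>d j - e j\<bar>) \<le> 5/2 * real n * (real p * del)"
        by (intro mult_left_mono) auto
      also have "\<dots> = r" using n_pos p_pos by (simp add: del_def)
      finally show "?S u' d \<le> a + a' + r" using Slip[of e] SD[OF e(1)] by linarith
    qed
    have "?S u d - ?S u' d = (\<Sum>i<n. (\<integral>w. qexcess u d w \<partial>PZ) - (\<integral>w. qexcess u' d w \<partial>PZ))
         + (\<Sum>i<n. qexcess u' d (y i \<omega>, x i \<omega>) - qexcess u d (y i \<omega>, x i \<omega>))"
      unfolding sum_subtractf by simp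
    also have "\<dots> \<le> (\<Sum>i<n. 1 / real n * (R + 4 / flow)) + (\<Sum>i<n. 1 / real n * (\<bar>dot p (x i \<omega>) d\<bar> + 4 / flow))"
    proof (intro add_mono sum_mono)
      have "(\<integral>w. qexcess u d w \<partial>PZ) - (\<integral>w. qexcess u' d w \<partial>PZ) \<le> \<bar>u - u'\<bar> * ((\<Sum>j<p. \<bar>d j\<bar>) + 4 / flow)"
        using qexcess_mean_index_change[OF u u' close, of d] by linarith
      also have "\<dots> \<le> 1 / real n * (R + 4 / flow)"
        using uu d flow by (intro mult_mono) (auto intro!: add_nonneg_nonneg sum_nonneg)
      finally show "(\<integral>w. qexcess u d w \<partial>PZ) - (\<integral>w. qexcess u' d w \<partial>PZ) \<le> 1 / real n * (R + 4 / flow)" .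
      fix i assume i: "i \<in> {..<n}"
      have "qexcess u' d (y i \<omega>, x i \<omega>) - qexcess u d (y i \<omega>, x i \<omega>) \<le> \<bar>u - u'\<bar> * (\<bar>dot p (x i \<omega>) d\<bar> + 4 / flow)"
        using qexcess_index_change[OF gc u u' close, of i d "y i \<omega>"] i by auto
      also have "\<dots> \<le> 1 / real n * (\<bar>dot p (x i \<omega>) d\<bar> + 4 / flow)"
        using uu flow by (intro mult_right_mono) auto
      finally show "qexcess u' d (y i \<omega>, x i \<omega>) - qexcess u d (y i \<omega>, x i \<omega>) \<le> 1 / real n * (\<bar>dot p (x i \<omega>) d\<bar> + 4 / flow)" .
    qed
    also have "\<dots> = R + 8 / flow + 1 / real n * (\<Sum>i<n. \<bar>dot p (x i \<omega>) d\<bar>)"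
      unfolding sum_distrib_left[symmetric] sum.distrib using n_pos by (simp add: field_simps)
    also have "\<dots> \<le> R + 8 / flow + 1 / real n * (3/2 * real n * R)"
    proof -
      have "3/2 * real n * (\<Sum>j<p. \<bar>d j\<bar>) \<le> 3/2 * real n * R" using d by (intro mult_left_mono) auto
      then have "(\<Sum>i<n. \<bar>dot p (x i \<omega>) d\<bar>) \<le> 3/2 * real n * R" using xa[of d] by linarith
      then show ?thesis by (intro add_left_mono mult_left_mono) auto
    qed
    also have "\<dots> = 5/2 * R + 8 / flow" using n_pos by simp
    finally show "?S u d \<le> a + a' + 5/2 * R + 8 / flow" using Sd by linarith
  qed
qed

end

section \<open>Sparse eigenvalues and the sparsity bound\<close>

context qr_conditions
begin

lemma lognp_ge_1: "1 \<le> lognp Q"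
proof -
  have "exp 1 \<le> real (max n p)" using exp_le n3 by linarith
  then have "ln (exp 1) \<le> ln (real (max n p))" by (subst ln_le_cancel_iff) (use n3 in auto)
  then show ?thesis by (simp add: lognp_def)
qed

lemma dot_self: "dot p d d = (L2_set d {..<p})\<^sup>2"
  by (simp add: dot_def L2_set_def sum_nonneg power2_eq_square)

lemma dot_self_pos: "supp p d \<noteq> {} \<Longrightarrow> 0 < dot p d d"
proof -
  assume "supp p d \<noteq> {}"
  then obtain j where j: "j < p" "d j \<noteq> 0" by (auto simp: supp_def)
  have "0 < d j * d j" using j(2) by (metis not_real_square_gt_zero)
  also have "\<dots> \<le> dot p d d" unfolding dot_def using j(1) by (intro member_le_sum) auto
  finally show ?thesis .
qed

lemma dot_square_le: "(dot p a d)\<^sup>2 \<le> dot p a a * dot p d d"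
proof -
  have "\<bar>dot p a d\<bar>\<^sup>2 \<le> (L2_set a {..<p} * L2_set d {..<p})\<^sup>2" by (intro power_mono dot_le_L2_set) auto
  then show ?thesis by (simp add: dot_self power_mult_distrib)
qed

lemma emp_ratio_le:
  assumes "supp p d \<noteq> {}"
  shows "emp_second_moment Q \<omega> d / dot p d d \<le> (\<Sum>i<n. dot p (x i \<omega>) (x i \<omega>)) / real n"
proof -
  have "(\<Sum>i<n. (dot p (x i \<omega>) d)\<^sup>2) \<le> (\<Sum>i<n. dot p (x i \<omega>) (x i \<omega>)) * dot p d d"
    unfolding sum_distrib_right by (intro sum_mono dot_square_le)
  then show ?thesis using dot_self_pos[OF assms] n_pos by (simp add: emp_second_moment_def field_simps)
qed

lemma pop_ratio_le:
  assumes "supp p d \<noteq> {}"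
  shows "E2 d / dot p d d \<le> real p"
proof -
  have sq: "dot p a a = (\<Sum>j<p. (a j)\<^sup>2)" for a by (simp add: dot_def power2_eq_square)
  have "E2 d \<le> (\<integral>\<omega>. (\<Sum>j<p. (x 0 \<omega> j)\<^sup>2) * dot p d d \<partial>M)"
    unfolding E2_eq
  proof (rule integral_mono[OF integrable_dot_square])
    show "integrable M (\<lambda>\<omega>. (\<Sum>j<p. (x 0 \<omega> j)\<^sup>2) * dot p d d)"
      by (intro integrable_mult_left Bochner_Integration.integrable_sum integrable_x_square) auto
    show "(dot p (x 0 \<omega>) d)\<^sup>2 \<le> (\<Sum>j<p. (x 0 \<omega> j)\<^sup>2) * dot p d d" for \<omega>
      using dot_square_le[of "x 0 \<omega>" d] by (simp add: sq[of "x 0 \<omega>"])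
  qed
  also have "\<dots> = (\<integral>\<omega>. (\<Sum>j<p. (x 0 \<omega> j)\<^sup>2) \<partial>M) * dot p d d" by simp
  also have "(\<integral>\<omega>. (\<Sum>j<p. (x 0 \<omega> j)\<^sup>2) \<partial>M) = (\<Sum>j<p. \<integral>\<omega>. (x 0 \<omega> j)\<^sup>2 \<partial>M)"
    by (intro Bochner_Integration.integral_sum integrable_x_square) auto
  also have "\<dots> = real p" by (simp add: second_moment_one)
  finally show ?thesis using dot_self_pos[OF assms] by (simp add: pos_divide_le_eq)
qed

text \<open>For each sample the ratios are bounded, so \<open>phi\<close> is a genuine supremum and
  monotone in k.\<close>

lemma phi_bdd: "bdd_above (insert 0 ((\<lambda>d. max (emp_second_moment Q \<omega> d / dot p d d) (E2 d / dot p d d))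
    ` {d. supp p d \<noteq> {} \<and> real (l0 p d) \<le> k}))"
  unfolding bdd_above_insert
proof (rule bdd_aboveI2)
  fix d assume "d \<in> {d. supp p d \<noteq> {} \<and> real (l0 p d) \<le> k}"
  then have "supp p d \<noteq> {}" by blast
  from max.mono[OF emp_ratio_le[OF this] pop_ratio_le[OF this]]
  show "max (emp_second_moment Q \<omega> d / dot p d d) (E2 d / dot p d d)
    \<le> max ((\<Sum>i<n. dot p (x i \<omega>) (x i \<omega>)) / real n) (real p)" .
qed

lemma varphi_bdd: "bdd_above (insert 0 ((\<lambda>d. E2 d / dot p d d) ` {d. supp p d \<noteq> {} \<and> real (l0 p d) \<le> k}))"
  unfolding bdd_above_insert
proof (rule bdd_aboveI2)
  fix d assume "d \<in> {d. supp p d \<noteq> {} \<and> real (l0 p d) \<le> k}"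
  then have "supp p d \<noteq> {}" by blast
  then show "E2 d / dot p d d \<le> real p" by (rule pop_ratio_le)
qed

lemma phi_upper:
  assumes "supp p d \<noteq> {}" "real (l0 p d) \<le> k"
  shows "emp_second_moment Q \<omega> d / dot p d d \<le> phi Q \<omega> k" "E2 d / dot p d d \<le> phi Q \<omega> k"
proof -
  have "max (emp_second_moment Q \<omega> d / dot p d d) (E2 d / dot p d d) \<le> phi Q \<omega> k"
    unfolding phi_def by (rule cSup_upper[OF _ phi_bdd]) (use assms in blast)
  then show "emp_second_moment Q \<omega> d / dot p d d \<le> phi Q \<omega> k" "E2 d / dot p d d \<le> phi Q \<omega> k" by auto
qed

lemma phi_mono: "k \<le> k' \<Longrightarrow> phi Q \<omega> k \<le> phi Q \<omega> k'"
  unfolding phi_def by (rule cSup_subset_mono[OF _ phi_bdd]) auto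

lemma mu_mono: "k \<le> k' \<Longrightarrow> mu Q flow fbar k \<le> mu Q flow fbar k'"
proof -
  assume "k \<le> k'"
  then have "varphi_max Q k \<le> varphi_max Q k'"
    unfolding varphi_max_def by (intro cSup_subset_mono varphi_bdd) auto
  then show ?thesis unfolding mu_def by (intro mult_right_mono mult_left_mono) auto
qed

lemma varphi_nonneg: "0 \<le> varphi_max Q k"
  unfolding varphi_max_def by (rule cSup_upper[OF _ varphi_bdd]) simp

lemma mu_nonneg: "0 \<le> mu Q flow fbar k"
  unfolding mu_def using varphi_nonneg[of k] by simp

text \<open>The first coordinate vector has unit second moment. Consequently phibar \<ge> 1, and K
  inherits the lower bound 2 sqrt 2.\<close>

lemma phi_ge_1:
  assumes "1 \<le> k"
  shows "1 \<le> phi Q \<omega> k"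
proof -
  let ?e = "\<lambda>j. of_bool (j = 0) :: real"
  have s: "supp p ?e = {0}" using p_pos by (auto simp: supp_def)
  have "E2 ?e = 1" unfolding E2_eq using p_pos by (simp add: dot_unit second_moment_one)
  moreover have "dot p ?e ?e = 1" using p_pos by (simp add: dot_unit)
  ultimately show ?thesis using phi_upper(2)[of ?e k \<omega>] s assms by (simp add: l0_def)
qed

lemma dot_design: "\<omega> \<in> space M \<Longrightarrow> i < n \<Longrightarrow> dot p (design Q \<omega> i) d = dot p (x i \<omega>) d"
  by (simp add: design_eq)

text \<open>If more than \<open>n / log (n \<or> p)\<close> coordinates were active, the sign direction on
  \<open>\<lfloor>n / log (n \<or> p)\<rfloor>\<close> of them would violate optimality.\<close>

lemma active_le:
  assumes min: "is_minimizer n p (design Q \<omega>) Y lam u b" and u: "u \<in> U" and w: "\<omega> \<in> scale_event"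
    and k: "1 \<le> k" and phi: "phi Q \<omega> k \<le> phibar"
    and lam: "2 * sqrt 2 * sqrt phibar * W_U U * sqrt (real n * (real n / k)) \<le> lam"
  shows "l0 p b \<le> nat \<lfloor>k\<rfloor>"
proof (rule ccontr)
  assume "\<not> l0 p b \<le> nat \<lfloor>k\<rfloor>"
  then have "nat \<lfloor>k\<rfloor> \<le> card (supp p b)" by (simp add: l0_def)
  \<comment> \<open>Exactly floor k active coordinates: few enough for \<open>phi\<close> at k to
    apply, and yet k < m' + 1.\<close>
  then obtain S where S: "S \<subseteq> supp p b" "card S = nat \<lfloor>k\<rfloor>" using obtain_subset_with_card_n by metis
  define m' where "m' = card S"
  have m1: "1 \<le> real m'" and mk: "real m' \<le> k" "k < real m' + 1" using S k by (auto simp: m'_def)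
  have Sne: "S \<noteq> {}" using m1 by (auto simp: m'_def)
  have sp: "\<omega> \<in> space M" using w by (simp add: scale_event_def)
  let ?d = "\<lambda>j. if j \<in> S then sgn (b j) else 0"
  have Sp: "S \<subseteq> {..<p}" using S supp_subset[of p b] by auto
  have bS: "j \<in> S \<Longrightarrow> b j \<noteq> 0" for j using S(1) by (auto simp: supp_def)
  have sd: "supp p ?d = S" using Sp bS by (auto simp: supp_def sgn_if)
  have dd: "dot p ?d ?d = real m'"
  proof -
    have "dot p ?d ?d = (\<Sum>j<p. if j \<in> S then 1 else 0)"
      unfolding dot_def using bS by (intro sum.cong) (auto simp: sgn_if)
    also have "\<dots> = real m'" using Sp by (simp add: sum.If_cases m'_def Int_absorb1)
    finally show ?thesis .
  qed
  have pb: "1 \<le> phibar" using phi_ge_1[OF k, of \<omega>] phi by linarith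
  have W: "2 \<le> W_U U" by (rule W_ge[OF U])
  have lam0: "0 < lam"
  proof -
    have "0 < 2 * sqrt 2 * sqrt phibar * W_U U * sqrt (real n * (real n / k))" using pb W n_pos k by simp
    then show ?thesis using lam by linarith
  qed
  have emp: "(\<Sum>i<n. (dot p (x i \<omega>) ?d)\<^sup>2) \<le> real n * (phibar * real m')"
  proof -
    have "emp_second_moment Q \<omega> ?d / dot p ?d ?d \<le> phibar"
      using phi_upper(1)[of ?d k \<omega>] sd Sne mk phi by (simp add: l0_def m'_def)
    then have "emp_second_moment Q \<omega> ?d \<le> phibar * real m'" unfolding dd using m1 by (simp add: pos_divide_le_eq)
    then show ?thesis using n_pos unfolding emp_second_moment_def by (simp add: divide_le_eq mult.commute)
  qed
  have "lam * sqrt (u * (1 - u)) * (real (card S) / 2) \<le> (\<Sum>i<n. \<bar>dot p (design Q \<omega> i) ?d\<bar>)"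
    using U01[OF u] n_pos lam0 scale_eventD[OF w] S(1) Sne
    by (intro minimizer_sign_direction[OF min]) auto
  \<comment> \<open>Cauchy-Schwarz over the observations, then \<open>phi\<close> for the sign
    vector, whose squared norm is m'.\<close>
  also have "\<dots> = (\<Sum>i<n. \<bar>dot p (x i \<omega>) ?d\<bar> * \<bar>1\<bar>)" using sp by (intro sum.cong) (auto simp: dot_design)
  also have "\<dots> \<le> L2_set (\<lambda>i. dot p (x i \<omega>) ?d) {..<n} * L2_set (\<lambda>_. 1) {..<n}" by (rule L2_set_mult_ineq)
  also have "\<dots> \<le> sqrt (real n * (phibar * real m')) * sqrt (real n)"
    using emp pb by (intro mult_mono) (auto simp: L2_set_def sum_nonneg)
  also have "\<dots> = real n * (sqrt phibar * sqrt (real m'))" by (simp add: real_sqrt_mult)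
  finally have 1: "lam * sqrt (u * (1 - u)) * (real m' / 2) \<le> real n * (sqrt phibar * sqrt (real m'))" by (simp add: m'_def)
  \<comment> \<open>The factor W in the penalty level compensates sqrt (u (1 - u)).\<close>
  have q: "1 \<le> W_U U * sqrt (u * (1 - u))"
    using W_upper[OF U u] U01[OF u] by (simp add: divide_le_eq)
  have "2 * sqrt 2 * sqrt phibar * sqrt (real n * (real n / k)) * (real m' / 2)
    \<le> (2 * sqrt 2 * sqrt phibar * sqrt (real n * (real n / k))) * (W_U U * sqrt (u * (1 - u))) * (real m' / 2)"
  proof (intro mult_right_mono)
    have "0 \<le> 2 * sqrt 2 * sqrt phibar * sqrt (real n * (real n / k))" using pb k by simp
    from mult_left_mono[OF q this]
    show "2 * sqrt 2 * sqrt phibar * sqrt (real n * (real n / k))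
      \<le> 2 * sqrt 2 * sqrt phibar * sqrt (real n * (real n / k)) * (W_U U * sqrt (u * (1 - u)))" by simp
  qed simp
  also have "\<dots> = (2 * sqrt 2 * sqrt phibar * W_U U * sqrt (real n * (real n / k))) * sqrt (u * (1 - u)) * (real m' / 2)"
    by (simp add: mult_ac)
  also have "\<dots> \<le> lam * sqrt (u * (1 - u)) * (real m' / 2)"
    using lam U01[OF u] by (intro mult_right_mono) auto
  finally have 2: "2 * sqrt 2 * sqrt phibar * sqrt (real n * (real n / k)) * (real m' / 2) \<le> real n * (sqrt phibar * sqrt (real m'))"
    using 1 by linarith
  have e: "sqrt (real n * (real n / k)) = real n / sqrt k" by (simp add: real_sqrt_mult real_sqrt_divide)
  have "(real n * sqrt phibar * sqrt (real m')) * (sqrt 2 * sqrt (real m') / sqrt k) \<le> (real n * sqrt phibar * sqrt (real m')) * 1"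
  proof -
    have mm: "sqrt (real m') * sqrt (real m') = real m'" by simp
    have "(real n * sqrt phibar * sqrt (real m')) * (sqrt 2 * sqrt (real m') / sqrt k)
      = sqrt 2 * sqrt phibar * (real n / sqrt k) * (sqrt (real m') * sqrt (real m'))" by (simp add: mult_ac)
    also have "\<dots> = 2 * sqrt 2 * sqrt phibar * sqrt (real n * (real n / k)) * (real m' / 2)" unfolding mm e by simp
    finally show ?thesis using 2 by (simp add: mult_ac)
  qed
  moreover have "0 < real n * sqrt phibar * sqrt (real m')" using n_pos pb m1 by simp
  ultimately have "sqrt 2 * sqrt (real m') / sqrt k \<le> 1" by (simp only: mult_le_cancel_left_pos)
  then have "sqrt (2 * real m') \<le> sqrt k" using k by (simp add: real_sqrt_mult divide_le_eq)
  \<comment> \<open>The sqrt 2 in the lower bound for \<open>lam\<close> produces this 2; with k <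
    m' + 1 it forces m' < 1.\<close>
  then have "2 * real m' \<le> k" by simp
  then show False using m1 mk by linarith
qed

lemma s_pos: "1 \<le> s" and supp_le_s: "u \<in> U \<Longrightarrow> card (supp p (\<beta> u)) \<le> s"
  using D2 by (auto simp: cond_D2_def l0_def)

lemma sum_abs_le_sqrt_card:
  assumes "finite T"
  shows "(\<Sum>j\<in>T. \<bar>d j\<bar>) \<le> sqrt (real (card T)) * L2_set d T"
proof -
  have "(\<Sum>j\<in>T. \<bar>d j\<bar>) = (\<Sum>j\<in>T. \<bar>1\<bar> * \<bar>d j\<bar>)" by simp
  also have "\<dots> \<le> L2_set (\<lambda>_. 1) T * L2_set d T" by (rule L2_set_mult_ineq)
  also have "L2_set (\<lambda>_. 1) T = sqrt (real (card T))" by (simp add: L2_set_def)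
  finally show ?thesis .
qed

text \<open>The rate of convergence in the intrinsic norm: at the error scaled down to norm \<open>t\<close>, the
  quadratic minorant of the population loss exceeds what penalty and deviation can compensate.\<close>

lemma error_rate:
  assumes min: "is_minimizer n p (design Q \<omega>) (\<lambda>i. y i \<omega>) lam u b" and u: "u \<in> U"
    and w: "\<omega> \<in> scale_event" "\<forall>i<n. x i \<omega> \<in> good_cov"
    and piv: "Lam U n p (design Q \<omega>) (ranks \<omega>) \<le> \<Lambda>" and lam: "(c0 + 3) / (c0 - 3) * \<Lambda> \<le> lam" "0 < lam"
    and act: "l0 p b \<le> n"
    and t: "0 < t" "t \<le> 4 * nonlin_q Q U c0 flow fbar'" and kap: "0 < kappa Q U c0 0"
    and R: "R = (1 + c0) * (sqrt (real s) * (t / (sqrt flow * kappa Q U c0 0)))"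
    and dev: "\<And>d. (\<Sum>j<p. \<bar>d j\<bar>) \<le> R \<Longrightarrow> E2 d \<le> t\<^sup>2 / flow \<Longrightarrow>
      (\<Sum>i<n. (\<integral>w. qexcess u d w \<partial>PZ) - qexcess u d (y i \<omega>, x i \<omega>)) \<le> \<Delta>"
    and big: "3/4 * lam * (R / (1 + c0)) + \<Delta> < real n * (t\<^sup>2 / 4)"
  shows "L2_set (mat_vec p (mat_sqrt p (Jmat Q u)) (\<lambda>j. b j - \<beta> u j)) {..<p} \<le> t"
proof (rule ccontr)
  let ?del = "\<lambda>j. b j - \<beta> u j"
  define r where "r = sqrt (quad_form p (Jmat Q u) ?del)"
  assume "\<not> L2_set (mat_vec p (mat_sqrt p (Jmat Q u)) ?del) {..<p} \<le> t"
  then have r: "t < r" unfolding J_norm[OF u] r_def by simp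
  have sp: "\<omega> \<in> space M" using w by (simp add: scale_event_def)
  have u01: "0 < u" "u < 1" using U01[OF u] by auto
  let ?T = "supp p (\<beta> u)"
  have sig: "1/2 \<le> sigma_hat n (design Q \<omega>) j \<and> sigma_hat n (design Q \<omega>) j \<le> 3/2" if "j < p" for j
    by (rule scale_eventD[OF w(1) that])
  \<comment> \<open>On good covariates rank and response fall on the same side, so the pivotal bound
    at the ranks is a bound for the score at \<beta>(u).\<close>
  have rank: "ranks \<omega> i \<le> u \<longleftrightarrow> y i \<omega> \<le> dot p (design Q \<omega> i) (\<beta> u)" if "i < n" for i
    using le_quantile_iff[of "x i \<omega>" u "y i \<omega>"] w(2) u that sp by (simp add: ranks_def dot_design)
  have cone: "(\<Sum>j\<in>{..<p} - ?T. \<bar>?del j\<bar>) \<le> c0 * (\<Sum>j\<in>?T. \<bar>?del j\<bar>)"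
  proof (rule error_in_cone[OF min n_pos u01 c0_ge sig _ lam])
    fix j assume j: "j < p"
    have "0 < sigma_hat n (design Q \<omega>) j" using sig[OF j] by linarith
    from score_le_Lam[OF U p_pos n_pos u j this, of "ranks \<omega>"]
    have "\<bar>\<Sum>i<n. design Q \<omega> i j * (u - of_bool (ranks \<omega> i \<le> u))\<bar>
      \<le> Lam U n p (design Q \<omega>) (ranks \<omega>) * (sigma_hat n (design Q \<omega>) j * sqrt (u * (1 - u)))" .
    also have "\<dots> \<le> \<Lambda> * (sigma_hat n (design Q \<omega>) j * sqrt (u * (1 - u)))"
      using piv u01 by (intro mult_right_mono) auto
    also have "(\<Sum>i<n. design Q \<omega> i j * (u - of_bool (ranks \<omega> i \<le> u)))
      = (\<Sum>i<n. design Q \<omega> i j * (u - of_bool (y i \<omega> \<le> dot p (design Q \<omega> i) (\<beta> u))))"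
      by (intro sum.cong) (auto simp: rank)
    finally show "\<bar>\<Sum>i<n. design Q \<omega> i j * (u - of_bool (y i \<omega> \<le> dot p (design Q \<omega> i) (\<beta> u)))\<bar>
      \<le> \<Lambda> * (sigma_hat n (design Q \<omega>) j * sqrt (u * (1 - u)))" .
  qed
  \<comment> \<open>Scaling preserves the cone and brings the norm from r > t down to exactly
    t.\<close>
  define \<theta> where "\<theta> = t / r"
  have \<theta>: "0 < \<theta>" "\<theta> \<le> 1" using t r by (auto simp: \<theta>_def)
  define d where "d = (\<lambda>j. \<theta> * ?del j)"
  have qd: "quad_form p (Jmat Q u) d = t\<^sup>2"
  proof -
    have "quad_form p (Jmat Q u) d = \<theta>\<^sup>2 * quad_form p (Jmat Q u) ?del"
      by (simp add: quad_form_def d_def sum_distrib_left power2_eq_square mult_ac)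
    also have "quad_form p (Jmat Q u) ?del = r\<^sup>2" unfolding r_def using J_psd[OF u] by simp
    finally show ?thesis using t r by (simp add: \<theta>_def power_divide)
  qed
  have dcone: "(\<Sum>j\<in>{..<p} - ?T. \<bar>d j\<bar>) \<le> c0 * (\<Sum>j\<in>?T. \<bar>d j\<bar>)"
  proof -
    have "\<theta> * (\<Sum>j\<in>{..<p} - ?T. \<bar>?del j\<bar>) \<le> \<theta> * (c0 * (\<Sum>j\<in>?T. \<bar>?del j\<bar>))" using cone \<theta> by (intro mult_left_mono) auto
    then show ?thesis using \<theta> by (simp add: d_def abs_mult sum_distrib_left mult_ac)
  qed
  \<comment> \<open>Off the support of \<beta>(u) the components of d are multiples of those of b,
    so at most n of them are nonzero.\<close>
  have pair: "(u, d) \<in> restricted_pairs Q U c0"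
  proof -
    have "{j \<in> {..<p} - ?T. d j \<noteq> 0} \<subseteq> supp p b" by (auto simp: d_def supp_def)
    then have "card {j \<in> {..<p} - ?T. d j \<noteq> 0} \<le> l0 p b" unfolding l0_def by (intro card_mono) auto
    then have "d \<in> restricted_set Q c0 u" using dcone act unfolding restricted_set_def Let_def by simp
    moreover have "supp p d \<noteq> {}"
    proof
      assume "supp p d = {}"
      then have "d j = 0" if "j < p" for j using that by (auto simp: supp_def)
      then have "quad_form p (Jmat Q u) d = 0" unfolding quad_form_def by (intro sum.neutral ballI) simp
      then show False using qd t by simp
    qed
    ultimately show ?thesis using u by (simp add: restricted_pairs_def)
  qed
  have e2: "E2 d \<le> t\<^sup>2 / flow" using J_ge[OF u, of d] flow unfolding qd by (simp add: field_simps)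
  define K0 where "K0 = kappa Q U c0 0"
  have K0: "0 < K0" "K0\<^sup>2 = kappa_sq Q U c0 0" using kap kappa_sq_bounds(1)[OF pair] by (auto simp: K0_def kappa_def)
  define R1 where "R1 = sqrt (real s) * (t / (sqrt flow * K0))"
  have L2T: "L2_set d ?T \<le> t / (sqrt flow * K0)"
  proof -
    have "(K0 * L2_set d ?T)\<^sup>2 \<le> t\<^sup>2 / flow"
      using kappa_sq_bounds(2)[OF pair] e2 K0 by (simp add: power_mult_distrib)
    also have "\<dots> = (t / sqrt flow)\<^sup>2" using flow by (simp add: power_divide)
    finally have "K0 * L2_set d ?T \<le> t / sqrt flow" by (rule power2_le_imp_le) (use t flow in auto)
    then show ?thesis using K0 flow by (simp add: field_simps)
  qed
  have dT: "(\<Sum>j\<in>?T. \<bar>d j\<bar>) \<le> R1"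
  proof -
    have "(\<Sum>j\<in>?T. \<bar>d j\<bar>) \<le> sqrt (real (card ?T)) * L2_set d ?T" by (rule sum_abs_le_sqrt_card) simp
    also have "\<dots> \<le> sqrt (real s) * (t / (sqrt flow * K0))"
      using supp_le_s[OF u] L2T by (intro mult_mono) auto
    finally show ?thesis unfolding R1_def .
  qed
  have RR: "R = (1 + c0) * R1" unfolding R R1_def K0_def ..
  have dR: "(\<Sum>j<p. \<bar>d j\<bar>) \<le> R"
  proof -
    have "(\<Sum>j<p. \<bar>d j\<bar>) \<le> (1 + c0) * (\<Sum>j\<in>?T. \<bar>d j\<bar>)"
      using dcone sum_lessThan_split_supp[of "\<lambda>j. \<bar>d j\<bar>" p "\<beta> u"] by (simp add: algebra_simps)
    also have "\<dots> \<le> R" unfolding RR using dT c0_ge by (intro mult_left_mono) auto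
    finally show ?thesis .
  qed
  note nq = nonlin_q_facts[OF pair]
  \<comment> \<open>The 3/8 in \<open>nonlin_q\<close> and t \<le> 4 q give fbar' E3 d \<le> 3/8 t^3
    / q \<le> 3/2 t^2; the cubic remainder uses up at most half of t^2 / 2.\<close>
  have cubic: "fbar' * E3 d / 6 \<le> t\<^sup>2 / 4"
  proof -
    define q where "q = nonlin_q Q U c0 flow fbar'"
    have q: "0 < q" "t \<le> 4 * q" using q_pos t by (auto simp: q_def)
    have "flow powr (3/2) * E2 d powr (3/2) = (flow * E2 d) powr (3/2)" using flow E2_nonneg by (simp add: powr_mult)
    also have "\<dots> \<le> (t\<^sup>2) powr (3/2)"
      using e2 flow E2_nonneg[of d] by (intro powr_mono2) (auto simp: field_simps)
    also have "\<dots> = t ^ 3"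
    proof -
      have "(t\<^sup>2) powr (3/2) = (t powr 2) powr (3/2)" using t by simp
      also have "\<dots> = t powr 3" by (simp add: powr_powr)
      also have "\<dots> = t ^ 3" using t by simp
      finally show ?thesis .
    qed
    finally have p3: "flow powr (3/2) * E2 d powr (3/2) \<le> t ^ 3" .
    have "fbar' * (q * E3 d) \<le> fbar' * (3/8 * (flow powr (3/2) / fbar') * E2 d powr (3/2))"
      using nq(1,5) unfolding q_def by (intro mult_left_mono) auto
    also have "\<dots> = 3/8 * (flow powr (3/2) * E2 d powr (3/2))" using nq(1) by simp
    also have "\<dots> \<le> 3/8 * t ^ 3" using p3 by simp
    also have "\<dots> = 3/8 * t\<^sup>2 * t" by (simp add: power2_eq_square power3_eq_cube)
    also have "\<dots> \<le> 3/8 * t\<^sup>2 * (4 * q)" using q by (intro mult_left_mono) auto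
    finally have "q * (fbar' * E3 d) \<le> q * (3/2 * t\<^sup>2)" by (simp add: mult_ac)
    then have "fbar' * E3 d \<le> 3/2 * t\<^sup>2" using q by (simp only: mult_le_cancel_left_pos)
    then show ?thesis by simp
  qed
  have low: "t\<^sup>2 / 4 \<le> (\<integral>w. qexcess u d w \<partial>PZ)"
    using excess_minorization[OF u nq(2)] cubic unfolding qd by simp
  have "(\<Sum>i<n. rho u (y i \<omega> - dot p (design Q \<omega> i) (\<beta> u) - dot p (design Q \<omega> i) d) - rho u (y i \<omega> - dot p (design Q \<omega> i) (\<beta> u)))
    \<le> 3/4 * lam * (\<Sum>j\<in>?T. \<bar>d j\<bar>)"
    using lam \<theta> sig by (intro scaled_error_loss_bound[OF min n_pos u01 _ _ _ d_def]) auto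
  also have "(\<Sum>i<n. rho u (y i \<omega> - dot p (design Q \<omega> i) (\<beta> u) - dot p (design Q \<omega> i) d) - rho u (y i \<omega> - dot p (design Q \<omega> i) (\<beta> u)))
    = (\<Sum>i<n. qexcess u d (y i \<omega>, x i \<omega>))"
    using sp by (intro sum.cong) (auto simp: qexcess_def dot_design)
  also have "3/4 * lam * (\<Sum>j\<in>?T. \<bar>d j\<bar>) \<le> 3/4 * lam * R1" using dT lam by (intro mult_left_mono) auto
  finally have emp: "(\<Sum>i<n. qexcess u d (y i \<omega>, x i \<omega>)) \<le> 3/4 * lam * R1" .
  \<comment> \<open>By optimality the empirical increment is at most the penalty on the support;
    adding the deviation bounds n t^2 / 4 from above, against \<open>big\<close>.\<close>
  have "real n * (t\<^sup>2 / 4) \<le> real n * (\<integral>w. qexcess u d w \<partial>PZ)" using low by (intro mult_left_mono) auto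
  also have "\<dots> \<le> \<Delta> + 3/4 * lam * R1" using dev[OF dR e2] emp by (simp add: sum_subtractf)
  finally show False using big c0_ge unfolding RR by simp
qed

section \<open>Assembling the events and the constants\<close>

lemma measure_Int_lower:
  assumes "A \<in> sets M" "B \<in> sets M" "1 - a \<le> measure M A" "1 - b \<le> measure M B"
  shows "1 - (a + b) \<le> measure M (A \<inter> B)"
proof -
  have "measure M (A \<union> B) \<le> 1" by simp
  moreover have "measure M (A \<union> B) = measure M A + measure M B - measure M (A \<inter> B)"
    using assms by (intro measure_Un3) (auto simp: fmeasurable_def C.M.emeasure_finite less_top[symmetric])
  ultimately show ?thesis using assms by linarith
qed

text \<open>Five events are intersected: the bound on \<open>phi\<close>, the sparsity inequality,
  the pivotal event, the scale event and the deviation event. They fail with probability at most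
  \<epsilon>, \<epsilon> + \<gamma>, \<alpha>, \<gamma> and p^(-A^2).\<close>

theorem sparsity_bound:
  fixes lam :: "(nat \<Rightarrow> nat \<Rightarrow> real) \<Rightarrow> real" and bhat :: "'w \<Rightarrow> real \<Rightarrow> nat \<Rightarrow> real"
    and \<epsilon> \<alpha> A K K' K_eps phibar :: real
  assumes s: "real s \<le> real n / lognp Q"
    and min: "\<And>\<omega> u. \<omega> \<in> space M \<Longrightarrow> u \<in> U \<Longrightarrow>
      is_minimizer n p (design Q \<omega>) (\<lambda>i. y i \<omega>) (lam (design Q \<omega>)) u (bhat \<omega> u)"
    and alpha: "0 < \<alpha>" "\<alpha> < 1" and eps: "0 < \<epsilon>"
    and phibar: "with_prob_at_least M (1 - \<epsilon>) (\<lambda>\<omega>. phi Q \<omega> (real n / lognp Q) \<le> phibar)"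
    and K_eps: "sqrt 2 \<le> K_eps"
      "with_prob_at_least M (1 - \<epsilon> - \<gamma>)
        (\<lambda>\<omega>. sparsity_ineq Q U flow fbar K_eps (lam (design Q \<omega>)) (bhat \<omega>) \<omega>)"
    and lam_ge: "\<And>\<omega>. \<omega> \<in> space M \<Longrightarrow>
      lam (design Q \<omega>) \<ge> (c0 + 3) / (c0 - 3) * Lam_quantile U n p (design Q \<omega>) (1 - \<alpha>)"
    and lam_bounds: "\<And>\<omega>. \<omega> \<in> space M \<Longrightarrow>
      K * W_U U * sqrt (real n * lognp Q) \<le> lam (design Q \<omega>) \<and>
      lam (design Q \<omega>) \<le> K' * W_U U * sqrt (real n * lognp Q)"
    and K: "K' \<ge> K" "K \<ge> 2 * K_eps * sqrt phibar" and A: "A > 1"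
    and growth: "2 * K' * (1 + c0) * A * W_U U * sqrt (real s * lognp Q)
      < nonlin_q Q U c0 flow fbar' * sqrt flow * kappa Q U c0 0 * sqrt (real n)"
  shows "with_prob_at_least M (1 - \<alpha> - 2 * \<epsilon> - 4 * \<gamma> - real p powr (- (A\<^sup>2)))
    (\<lambda>\<omega>. real (s_hat Q U (bhat \<omega>))
       \<le> real s * (16 * mu Q flow fbar (real n / lognp Q) * W_U U / (sqrt flow * kappa Q U c0 0))\<^sup>2
         * ((1 + c0) * A * K' / K)\<^sup>2)"
proof (cases "1 - \<alpha> - 2 * \<epsilon> - 4 * \<gamma> - real p powr (- (A\<^sup>2)) \<le> 0")
  \<comment> \<open>The empty event attains a nonpositive probability; in the other case 4 \<gamma>
    < 1, which the ghost sample relies on.\<close>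
  case True
  then show ?thesis unfolding with_prob_at_least_def by (intro bexI[of _ "{}"]) auto
next
  case False
  define \<pi> where "\<pi> = real p powr (- (A\<^sup>2))"
  have \<pi>: "0 \<le> \<pi>" by (simp add: \<pi>_def)
  have \<gamma>0: "0 \<le> \<gamma>" using scale_event_prob C.M.prob_le_1[of scale_event] by linarith
  have \<gamma>: "\<gamma> \<le> 1/4" and \<epsilon>1: "\<epsilon> < 1" using False alpha eps \<gamma>0 \<pi> unfolding \<pi>_def by linarith+
  define l where "l = lognp Q"
  define W where "W = W_U U"
  define k where "k = real n / l"
  define K0 where "K0 = kappa Q U c0 0"
  define q where "q = nonlin_q Q U c0 flow fbar'"
  define sf where "sf = sqrt flow"
  have l: "1 \<le> l" using lognp_ge_1 by (simp add: l_def)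
  have W: "2 \<le> W" using W_ge[OF U] by (simp add: W_def)
  have n1: "1 \<le> real n" using n3 by simp
  have s1: "1 \<le> real s" using s_pos by simp
  have k1: "1 \<le> k" using s s1 by (simp add: k_def l_def)
  have kn: "k \<le> real n" using l n1 by (simp add: k_def divide_le_eq)
  have sf: "0 < sf" "sf\<^sup>2 = flow" using flow by (simp_all add: sf_def)
  have q: "0 < q" using q_pos by (simp add: q_def)
  have c0: "9 \<le> c0" by (rule c0_ge)
  obtain Ephi where Ephi: "Ephi \<in> sets M" "\<And>\<omega>. \<omega> \<in> Ephi \<Longrightarrow> phi Q \<omega> k \<le> phibar" "1 - \<epsilon> \<le> measure M Ephi"
    using phibar unfolding with_prob_at_least_def k_def l_def by blast
  obtain EK where EK: "EK \<in> sets M" "\<And>\<omega>. \<omega> \<in> EK \<Longrightarrow> sparsity_ineq Q U flow fbar K_eps (lam (design Q \<omega>)) (bhat \<omega>) \<omega>"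
    "1 - \<epsilon> - \<gamma> \<le> measure M EK"
    using K_eps(2) unfolding with_prob_at_least_def by blast
  have "Ephi \<noteq> {}" using Ephi(3) \<epsilon>1 by auto
  then have pb: "1 \<le> phibar" using phi_ge_1[OF k1] Ephi(2) order_trans by blast
  have Ke: "0 < K_eps" using K_eps(1) by (smt (verit) real_sqrt_gt_zero)
  have K2: "2 * sqrt 2 * sqrt phibar \<le> K"
  proof -
    have "2 * sqrt 2 * sqrt phibar \<le> 2 * K_eps * sqrt phibar" using K_eps(1) pb by (intro mult_right_mono) auto
    then show ?thesis using K(2) by linarith
  qed
  have Kb: "2 * sqrt 2 \<le> K"
  proof -
    have "2 * sqrt 2 * 1 \<le> 2 * sqrt 2 * sqrt phibar" using pb by (intro mult_left_mono) auto
    then show ?thesis using K2 by linarith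
  qed
  \<comment> \<open>A rational lower bound for sqrt 2, so that all later comparisons are between
    rationals.\<close>
  have s2: "7/5 \<le> sqrt 2" by (rule real_le_rsqrt) (simp add: power2_eq_square)
  have K0': "0 < K" "0 < K'" "14/5 \<le> K'" using Kb K(1) s2 by linarith+
  define t where "t = 8 * (1 + c0) * A * K' * W * sqrt (real s * l / real n) / (sf * K0)"
  \<comment> \<open>\<open>cond_D4\<close> asserts positivity of the infimum at \<open>m\<close>; at
    0 it follows from the growth condition, whose right side would otherwise be at most 0.\<close>
  have kap: "0 < K0"
  proof (rule ccontr)
    assume "\<not> 0 < K0"
    then have "q * sf * K0 * sqrt (real n) \<le> 0"
      using q sf by (intro mult_nonpos_nonneg mult_nonneg_nonpos) auto
    moreover have "0 \<le> 2 * K' * (1 + c0) * A * W * sqrt (real s * l)" using K0' c0 A W l by simp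
    ultimately show False using growth unfolding q_def sf_def K0_def W_def l_def by linarith
  qed
  have K01: "K0 \<le> 1" using kappa_sq_le_1 by (simp add: K0_def kappa_def)
  have sln: "0 < sqrt (real s * l / real n)" using s1 l n1 by simp
  have t: "0 < t" unfolding t_def using c0 A K0' W sln sf kap by simp
  have snn: "sqrt (real s * l / real n) * sqrt (real n) = sqrt (real s * l)"
    using n1 by (simp add: real_sqrt_mult[symmetric])
  have t4q: "t \<le> 4 * q"
  proof -
    have "t * (sf * K0 * sqrt (real n)) = 8 * (1 + c0) * A * K' * W * (sqrt (real s * l / real n) * sqrt (real n))"
      using sf kap by (simp add: t_def)
    also have "\<dots> = 4 * (2 * K' * (1 + c0) * A * W * sqrt (real s * l))" unfolding snn by simp
    also have "\<dots> \<le> 4 * (q * sf * K0 * sqrt (real n))"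
      using growth unfolding q_def sf_def K0_def W_def l_def by linarith
    finally have "t * (sf * K0 * sqrt (real n)) \<le> (4 * q) * (sf * K0 * sqrt (real n))" by (simp add: mult_ac)
    moreover have "0 < sf * K0 * sqrt (real n)" using sf kap n1 by simp
    ultimately show ?thesis by (simp only: mult_le_cancel_right_pos)
  qed
  define R where "R = (1 + c0) * (sqrt (real s) * (t / (sf * K0)))"
  have R: "0 < R" unfolding R_def using c0 s1 t sf kap by simp
  \<comment> \<open>The unit of account: the gain n t^2 / 4 equals 2 b, and every loss is compared
    with b.\<close>
  define b where "b = real n * (t\<^sup>2 / 8)"
  \<comment> \<open>By the choice of t and R, the quotient b / R is free of s, kappa and flow, and
    therefore so is the tail exponent.\<close>
  have bR: "b = A * K' * W * sqrt (real n * l) * R"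
  proof -
    have e: "sqrt (real s * l / real n) * real n = sqrt (real n * l) * sqrt (real s)"
    proof -
      have "real n = sqrt (real n) * sqrt (real n)" by simp
      then have "sqrt (real s * l / real n) * real n = (sqrt (real s * l / real n) * sqrt (real n)) * sqrt (real n)"
        by (metis mult.assoc)
      also have "\<dots> = sqrt (real n * l) * sqrt (real s)" unfolding snn by (simp add: real_sqrt_mult mult_ac)
      finally show ?thesis .
    qed
    have "b = t / 8 * (t * real n)" by (simp add: b_def power2_eq_square)
    also have "t * real n = 8 * (1 + c0) * A * K' * W * (sqrt (real s * l / real n) * real n) / (sf * K0)"
      by (simp add: t_def)
    also have "t / 8 * \<dots> = A * K' * W * sqrt (real n * l) * R"
      unfolding e R_def using sf kap by (simp add: field_simps)
    finally show ?thesis .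
  qed
  have nl: "1 \<le> real n * l" using n1 l mult_mono[of 1 "real n" 1 l] by simp
  have sqnl: "17/10 \<le> sqrt (real n * l)"
  proof -
    have "3 * 1 \<le> real n * l" using n3 l by (intro mult_mono) auto
    then have "(17/10)\<^sup>2 \<le> real n * l" by (simp add: power2_eq_square)
    then show ?thesis by (rule real_le_rsqrt)
  qed
  have AKW: "28/5 \<le> A * K' * W"
  proof -
    have "1 * (14/5) * 2 \<le> A * K' * W" using A K0' W by (intro mult_mono) auto
    then show ?thesis by simp
  qed
  \<comment> \<open>28/5 * 17/10 = 9.52, and 1 / 9.52 is slightly below 107/1000.\<close>
  have R_le: "R \<le> 107/1000 * b"
  proof -
    have "28/5 * (17/10) \<le> A * K' * W * sqrt (real n * l)" using AKW sqnl by (intro mult_mono) auto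
    then have "28/5 * (17/10) * R \<le> b" unfolding bR using R by (intro mult_right_mono) auto
    then show ?thesis using R by linarith
  qed
  \<comment> \<open>The scale-free size of t, in terms of which the lower-order terms are compared
    with b. The bound is 448 = 8 * 10 * 28/5.\<close>
  define tn where "tn = t * sqrt (real n) * sf"
  have tn: "448 \<le> tn"
  proof -
    have "tn = 8 * (1 + c0) * (A * K' * W) * (sqrt (real s * l / real n) * sqrt (real n)) / K0"
      unfolding tn_def t_def using sf by simp
    also have "\<dots> = 8 * (1 + c0) * (A * K' * W) * sqrt (real s * l) / K0" unfolding snn ..
    finally have e: "tn * K0 = 8 * (1 + c0) * (A * K' * W) * sqrt (real s * l)" using kap by simp
    have "1 * 1 \<le> real s * l" using s1 l by (intro mult_mono) auto
    then have sl: "1 \<le> sqrt (real s * l)" by simp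
    have "80 * (28/5) * 1 \<le> 8 * (1 + c0) * (A * K' * W) * sqrt (real s * l)"
      using c0 AKW sl by (intro mult_mono) auto
    then have "448 \<le> tn * K0" unfolding e by simp
    also have "tn * K0 \<le> tn * 1"
    proof (intro mult_left_mono K01)
      show "0 \<le> tn" unfolding tn_def using t sf by simp
    qed
    finally show ?thesis by simp
  qed
  have bt: "b * flow = tn\<^sup>2 / 8"
    unfolding b_def tn_def using sf by (simp add: power_mult_distrib)
  have flow_le: "8 / flow \<le> b / 1000"
  proof -
    have "448\<^sup>2 \<le> tn\<^sup>2" using tn by (intro power_mono) auto
    then have "8000 \<le> b * flow" unfolding bt by simp
    then show ?thesis using flow by (simp add: field_simps)
  qed
  \<comment> \<open>The smallest value that Chebyshev's inequality admits for the second moment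
    bound t^2 / flow.\<close>
  define a' where "a' = 2 * t * sqrt (real n) / sf"
  have a'0: "0 < a'" unfolding a'_def using t n1 sf by simp
  have a'_le: "a' \<le> b / 20"
  proof -
    have "a' * flow = 2 * tn" unfolding a'_def tn_def using sf by (simp add: power2_eq_square[symmetric] sf(2)[symmetric]) (simp add: power2_eq_square)
    moreover have "b / 20 * flow = tn\<^sup>2 / 160" using bt by simp
    moreover have "2 * tn \<le> tn\<^sup>2 / 160"
    proof -
      have "448 * tn \<le> tn * tn" using tn by (intro mult_right_mono) auto
      then show ?thesis using tn by (simp add: power2_eq_square)
    qed
    ultimately have "a' * flow \<le> b / 20 * flow" by linarith
    then show ?thesis using flow by (simp only: mult_le_cancel_right_pos)
  qed
  have a'v: "4 * (real n * (t\<^sup>2 / flow)) \<le> a'\<^sup>2"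
    unfolding a'_def using sf by (simp add: power_mult_distrib power_divide mult_ac)
  \<comment> \<open>8/5 leaves 2/5 b for the remaining terms and still brings the tail exponent
    above 5 A^2 log(n \<or> p).\<close>
  define a where "a = 8/5 * b"
  have b0: "0 < b" unfolding b_def using n1 t by simp
  have a0: "0 < a" using b0 by (simp add: a_def)
  \<comment> \<open>The growth condition makes q sqrt flow sqrt n larger than 112, and
    \<open>nonlin_q_le\<close> bounds q sqrt flow by 3/8 flow^2 / fbar'; together they put the mesh
    1/n below the scale required by \<open>quantile_lipschitz\<close>.\<close>
  have fine: "1 / real n < flow\<^sup>2 / (4 * fbar')"
  proof -
    have fb: "0 < fbar'" by (rule fbar'_pos)
    define z where "z = flow\<^sup>2 / fbar'"
    have z: "0 < z" using flow fb by (simp add: z_def)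
    have "q * sf \<le> 3/8 * (flow powr (3/2) / fbar') * sf"
      using nonlin_q_le sf unfolding q_def by (intro mult_right_mono) auto
    also have "\<dots> = 3/8 * z"
    proof -
      have "flow powr (3/2) * sf = flow powr (3/2) * flow powr (1/2)" using flow by (simp add: sf_def powr_half_sqrt)
      also have "\<dots> = flow powr 2" by (simp add: powr_add[symmetric])
      also have "\<dots> = flow\<^sup>2" using flow by simp
      finally show ?thesis by (simp add: z_def)
    qed
    finally have qz: "q * sf \<le> 3/8 * z" .
    have "1 * 1 \<le> real s * l" using s1 l by (intro mult_mono) auto
    then have sl: "1 \<le> sqrt (real s * l)" by simp
    have "2 * (10) * (28/5) * 1 \<le> 2 * (1 + c0) * (A * K' * W) * sqrt (real s * l)"
      using c0 AKW sl by (intro mult_mono) auto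
    also have "\<dots> < q * sf * K0 * sqrt (real n)"
      using growth unfolding q_def sf_def K0_def W_def l_def by (simp add: mult_ac)
    also have "\<dots> \<le> q * sf * 1 * sqrt (real n)" using q sf K01 by (intro mult_right_mono mult_left_mono) auto
    also have "\<dots> \<le> 3/8 * z * sqrt (real n)" using qz by (intro mult_right_mono) auto
    finally have "112 < 3/8 * z * sqrt (real n)" by simp
    also have "\<dots> \<le> 3/8 * z * real n"
    proof (intro mult_left_mono)
      have "sqrt (real n) * 1 \<le> sqrt (real n) * sqrt (real n)" using n1 by (intro mult_left_mono) auto
      then show "sqrt (real n) \<le> real n" by simp
    qed (use z in auto)
    finally have "4 < z * real n" by simp
    then have "1 / real n < z / 4" using n1 by (simp add: field_simps)
    then show ?thesis by (simp add: z_def)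
  qed
  obtain Edev where Edev: "Edev \<in> sets M"
    "1 - real n * (4 * real p * exp (- (64 * a\<^sup>2 / (243 * real n * (W_U U)\<^sup>2 * R\<^sup>2)))) \<le> measure M Edev"
    "\<And>\<omega>. \<omega> \<in> Edev \<Longrightarrow> \<omega> \<in> space M \<and> (\<forall>i<n. x i \<omega> \<in> good_cov)"
    "\<And>\<omega> u d. \<omega> \<in> Edev \<Longrightarrow> \<omega> \<in> scale_event \<Longrightarrow> u \<in> U \<Longrightarrow> (\<Sum>j<p. \<bar>d j\<bar>) \<le> R \<Longrightarrow> E2 d \<le> t\<^sup>2 / flow \<Longrightarrow>
      (\<Sum>i<n. (\<integral>w. qexcess u d w \<partial>PZ) - qexcess u d (y i \<omega>, x i \<omega>)) \<le> a + a' + 5/2 * R + 8 / flow"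
    by (rule deviation_event[OF R a0 a'0 a'v \<gamma> fine]) blast
  \<comment> \<open>The union bound costs 4 n p \<le> (n \<or> p)^4. Of the exponent 5 A^2 log(n
    \<or> p) at least A^2 log(n \<or> p) remains, because A > 1.\<close>
  have tail: "real n * (4 * real p * exp (- (64 * a\<^sup>2 / (243 * real n * (W_U U)\<^sup>2 * R\<^sup>2)))) \<le> \<pi>"
  proof -
    have A2: "1 \<le> A\<^sup>2" using A by (simp add: one_le_power)
    have "64 * a\<^sup>2 / (243 * real n * (W_U U)\<^sup>2 * R\<^sup>2) = 64 * 64 / (25 * 243) * (A\<^sup>2 * K'\<^sup>2 * l)"
    proof -
      have a2: "a\<^sup>2 = 64/25 * (A\<^sup>2 * K'\<^sup>2 * W\<^sup>2 * (real n * l) * R\<^sup>2)"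
      proof -
        have "(sqrt (real n * l))\<^sup>2 = real n * l" using nl by simp
        moreover have "(8/5 * b)\<^sup>2 = 64/25 * b\<^sup>2" by (simp add: power2_eq_square)
        ultimately show ?thesis unfolding a_def bR by (simp only: power_mult_distrib)
      qed
      show ?thesis unfolding a2 W_def[symmetric] using n1 W R by (simp add: field_simps)
    qed
    also have "\<dots> \<ge> 64 * 64 / (25 * 243) * (A\<^sup>2 * (14/5)\<^sup>2 * l)"
      using K0' l by (intro mult_left_mono mult_right_mono power_mono) auto
    finally have "64 * 64 / (25 * 243) * (A\<^sup>2 * (14/5)\<^sup>2 * l) \<le> 64 * a\<^sup>2 / (243 * real n * (W_U U)\<^sup>2 * R\<^sup>2)" .
    moreover have "64 * 64 / (25 * 243) * (A\<^sup>2 * (14/5)\<^sup>2 * l) = 802816/151875 * (A\<^sup>2 * l)"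
      by (simp add: power2_eq_square[of "14/5"])
    moreover have "0 \<le> A\<^sup>2 * l" using l by simp
    ultimately have "5 * (A\<^sup>2 * l) \<le> 64 * a\<^sup>2 / (243 * real n * (W_U U)\<^sup>2 * R\<^sup>2)" by linarith
    then have "exp (- (64 * a\<^sup>2 / (243 * real n * (W_U U)\<^sup>2 * R\<^sup>2))) \<le> exp (- (5 * (A\<^sup>2 * l)))" by simp
    then have "real n * (4 * real p * exp (- (64 * a\<^sup>2 / (243 * real n * (W_U U)\<^sup>2 * R\<^sup>2)))) \<le> real n * (4 * real p * exp (- (5 * (A\<^sup>2 * l))))"
      by (intro mult_left_mono) auto
    also have "\<dots> = 4 * (real n * real p) * exp (- (5 * (A\<^sup>2 * l)))" by simp
    also have "\<dots> \<le> exp (4 * l) * exp (- (5 * (A\<^sup>2 * l)))"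
    proof (intro mult_right_mono)
      define m0 where "m0 = real (max n p)"
      have m0: "3 \<le> m0" using n3 by (simp add: m0_def)
      have el: "exp l = m0" unfolding l_def lognp_def m0_def[symmetric] using m0 by simp
      have "4 * (real n * real p) \<le> (m0 * m0) * (m0 * m0)"
      proof (intro mult_mono)
        have "3 * 3 \<le> m0 * m0" using m0 by (intro mult_mono) auto
        then show "4 \<le> m0 * m0" by simp
      qed (auto simp: m0_def)
      also have "\<dots> = exp (4 * l)"
        unfolding el[symmetric] by (simp add: exp_add[symmetric])
      finally show "4 * (real n * real p) \<le> exp (4 * l)" .
    qed simp
    also have "\<dots> = exp (4 * l - 5 * (A\<^sup>2 * l))" by (simp add: exp_add[symmetric])
    also have "\<dots> \<le> exp (- (A\<^sup>2 * l))"
    proof -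
      have "1 * l \<le> A\<^sup>2 * l" using A2 l by (intro mult_right_mono) auto
      then show ?thesis unfolding exp_le_cancel_iff by linarith
    qed
    also have "\<dots> \<le> \<pi>"
    proof -
      have "ln (real p) \<le> l" unfolding l_def lognp_def using p_pos by simp
      then have "A\<^sup>2 * ln (real p) \<le> A\<^sup>2 * l" by (intro mult_left_mono) auto
      then show ?thesis unfolding \<pi>_def using p_pos by (simp add: powr_def)
    qed
    finally show ?thesis .
  qed
  obtain EL where EL: "EL \<in> sets M" "1 - \<alpha> \<le> measure M EL"
    "\<And>\<omega>. \<omega> \<in> EL \<Longrightarrow> Lam U n p (design Q \<omega>) (ranks \<omega>) \<le> Lam_quantile U n p (design Q \<omega>) (1 - \<alpha>)"
    by (rule pivotal_event[of "1 - \<alpha>"]) (use alpha in auto)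
  \<comment> \<open>A non-measurable set would be assigned measure 0, but this one has measure at
    least 1 - \<gamma> > 0.\<close>
  have Esc: "scale_event \<in> sets M"
    using scale_event_prob \<gamma> measure_notin_sets[of scale_event M] by (cases "scale_event \<in> sets M") auto
  define G where "G = (((Ephi \<inter> EK) \<inter> EL) \<inter> scale_event) \<inter> Edev"
  have G: "G \<in> sets M" unfolding G_def using Ephi EK EL Esc Edev by auto
  have EKp: "1 - (\<epsilon> + \<gamma>) \<le> measure M EK" using EK(3) by simp
  have Edevp: "1 - \<pi> \<le> measure M Edev" using Edev(2) tail by linarith
  have Gp: "1 - ((((\<epsilon> + (\<epsilon> + \<gamma>)) + \<alpha>) + \<gamma>) + \<pi>) \<le> measure M G"
    unfolding G_def
    by (intro measure_Int_lower sets.Int Ephi(1) EK(1) EL(1) Esc Edev(1) Ephi(3) EKp EL(2) scale_event_prob Edevp)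
  have main: "real (s_hat Q U (bhat \<omega>)) \<le> real s * (16 * mu Q flow fbar k * W / (sf * K0))\<^sup>2 * ((1 + c0) * A * K' / K)\<^sup>2"
    if w: "\<omega> \<in> G" for \<omega>
  proof -
    have wm: "\<omega> \<in> Ephi" "\<omega> \<in> EK" "\<omega> \<in> EL" "\<omega> \<in> scale_event" "\<omega> \<in> Edev" using w by (auto simp: G_def)
    have sp: "\<omega> \<in> space M" and gc: "\<forall>i<n. x i \<omega> \<in> good_cov" using Edev(3)[OF wm(5)] by auto
    define la where "la = lam (design Q \<omega>)"
    have la: "K * W * sqrt (real n * l) \<le> la" "la \<le> K' * W * sqrt (real n * l)"
      using lam_bounds[OF sp] by (simp_all add: la_def W_def l_def)
    have KW: "0 < K * W * sqrt (real n * l)" using K0' W nl by simp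
    then have la0: "0 < la" using la by linarith
    have act: "l0 p (bhat \<omega> u) \<le> nat \<lfloor>k\<rfloor>" if u: "u \<in> U" for u
    proof (rule active_le[OF min[OF sp u] u wm(4) k1 Ephi(2)[OF wm(1)]])
      have nk: "real n / k = l" using n1 l by (simp add: k_def)
      have "2 * sqrt 2 * sqrt phibar * W * sqrt (real n * l) \<le> K * W * sqrt (real n * l)"
        using K2 W nl by (intro mult_right_mono) auto
      then show "2 * sqrt 2 * sqrt phibar * W_U U * sqrt (real n * (real n / k)) \<le> lam (design Q \<omega>)"
        unfolding nk using la by (simp add: W_def la_def)
    qed
    have sh: "real (s_hat Q U (bhat \<omega>)) \<le> k"
    proof -
      have "s_hat Q U (bhat \<omega>) \<le> nat \<lfloor>k\<rfloor>" unfolding s_hat_def by (rule cSUP_least[OF U(2) act])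
      then have "real (s_hat Q U (bhat \<omega>)) \<le> real (nat \<lfloor>k\<rfloor>)" by simp
      also have "\<dots> \<le> k" using k1 by simp
      finally show ?thesis .
    qed
    have rate: "est_error Q U (bhat \<omega>) \<le> t"
      unfolding est_error_def
    proof (rule cSUP_least[OF U(2)])
      fix u assume u: "u \<in> U"
      show "L2_set (mat_vec p (mat_sqrt p (Jmat Q u)) (\<lambda>j. bhat \<omega> u j - \<beta> u j)) {..<p} \<le> t"
      proof (rule error_rate[OF min[OF sp u] u wm(4) gc EL(3)[OF wm(3)] lam_ge[OF sp]])
        show "0 < lam (design Q \<omega>)" using la0 by (simp add: la_def)
        have "real (l0 p (bhat \<omega> u)) \<le> real (nat \<lfloor>k\<rfloor>)" using act[OF u] by simp
        also have "\<dots> \<le> k" using k1 by simp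
        finally show "l0 p (bhat \<omega> u) \<le> n" using kn by linarith
        show "0 < t" "t \<le> 4 * nonlin_q Q U c0 flow fbar'" "0 < kappa Q U c0 0"
          using t t4q kap by (simp_all add: q_def K0_def)
        show "R = (1 + c0) * (sqrt (real s) * (t / (sqrt flow * kappa Q U c0 0)))"
          by (simp add: R_def sf_def K0_def)
        show "(\<Sum>i<n. (\<integral>w. qexcess u d w \<partial>PZ) - qexcess u d (y i \<omega>, x i \<omega>)) \<le> a + a' + 5/2 * R + 8 / flow"
          if "(\<Sum>j<p. \<bar>d j\<bar>) \<le> R" "E2 d \<le> t\<^sup>2 / flow" for d
          by (rule Edev(4)[OF wm(5,4) u that])
        \<comment> \<open>The penalty budget: la R \<le> b, and 1 + c0 \<ge> 10.\<close>
        have laR: "la * (R / (1 + c0)) \<le> b / 10"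
        proof -
          have "la * R \<le> (K' * W * sqrt (real n * l)) * R" using la R by (intro mult_right_mono) auto
          also have "\<dots> \<le> A * ((K' * W * sqrt (real n * l)) * R)"
          proof -
            have "0 \<le> (K' * W * sqrt (real n * l)) * R" using K0' W R nl by simp
            from mult_right_mono[OF _ this, of 1 A] A show ?thesis by simp
          qed
          also have "\<dots> = b" unfolding bR by simp
          finally have "la * R \<le> b" .
          then have "la * R / (1 + c0) \<le> b / (1 + c0)" using c0 by (intro divide_right_mono) auto
          also have "\<dots> \<le> b / 10" using c0 b0 by (intro divide_left_mono) auto
          finally show ?thesis by simp
        qed
        have tb: "real n * (t\<^sup>2 / 4) = 2 * b" by (simp add: b_def)
        show "3/4 * lam (design Q \<omega>) * (R / (1 + c0)) + (a + a' + 5/2 * R + 8 / flow) < real n * (t\<^sup>2 / 4)"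
        proof -
          \<comment> \<open>In units of b: 0.075 + 1.6 + 0.05 + 0.2675 + 0.001 = 1.9935 < 2.\<close>
          have arith: "3/4 * X + (8/5 * b + Y + 5/2 * V + F) < Z"
            if "X \<le> b / 10" "Z = 2 * b" "Y \<le> b / 20" "V \<le> 107/1000 * b" "F \<le> b / 1000" for X Y Z V F :: real
            using that b0 by linarith
          from arith[OF laR tb a'_le R_le flow_le]
          show ?thesis unfolding la_def[symmetric] a_def mult.assoc[of "3/4" la] .
        qed
      qed
    qed
    define S where "S = sqrt (real (s_hat Q U (bhat \<omega>)))"
    define m0 where "m0 = mu Q flow fbar k"
    have m0: "0 \<le> m0" unfolding m0_def by (rule mu_nonneg)
    have S0: "0 \<le> S" by (simp add: S_def)
    have "S / W \<le> mu Q flow fbar (real (s_hat Q U (bhat \<omega>))) * (real n / la) * min (est_error Q U (bhat \<omega>)) 1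
        + S * K_eps * (sqrt (real n * l * phi Q \<omega> (real (s_hat Q U (bhat \<omega>)))) / la)"
      using EK(2)[OF wm(2)] unfolding sparsity_ineq_def Let_def S_def W_def l_def la_def .
    \<comment> \<open>Here the preliminary bound \<open>sh\<close> is spent: \<open>mu\<close> and
      \<open>phi\<close> at \<open>s_hat\<close> give way to their bounds at k, and the minimum with
      1 to the rate t.\<close>
    also have "\<dots> \<le> m0 * (real n / la) * t + S * K_eps * (sqrt (real n * l * phibar) / la)"
    proof (intro add_mono)
      have "mu Q flow fbar (real (s_hat Q U (bhat \<omega>))) * (real n / la) * min (est_error Q U (bhat \<omega>)) 1
        \<le> mu Q flow fbar (real (s_hat Q U (bhat \<omega>))) * (real n / la) * t"
        using rate la0 mu_nonneg by (intro mult_left_mono) auto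
      also have "\<dots> \<le> m0 * (real n / la) * t"
        unfolding m0_def using mu_mono[OF sh] la0 t by (intro mult_right_mono) auto
      finally show "mu Q flow fbar (real (s_hat Q U (bhat \<omega>))) * (real n / la) * min (est_error Q U (bhat \<omega>)) 1 \<le> m0 * (real n / la) * t" .
      have "phi Q \<omega> (real (s_hat Q U (bhat \<omega>))) \<le> phibar" using phi_mono[OF sh, of \<omega>] Ephi(2)[OF wm(1)] by linarith
      then have "sqrt (real n * l * phi Q \<omega> (real (s_hat Q U (bhat \<omega>)))) \<le> sqrt (real n * l * phibar)"
        using l by (intro real_sqrt_le_mono mult_left_mono) auto
      then show "S * K_eps * (sqrt (real n * l * phi Q \<omega> (real (s_hat Q U (bhat \<omega>)))) / la) \<le> S * K_eps * (sqrt (real n * l * phibar) / la)"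
        using S0 Ke la0 by (intro mult_left_mono divide_right_mono) auto
    qed
    also have "\<dots> \<le> m0 * (real n / la) * t + S / (2 * W)"
    proof (intro add_left_mono)
      have "2 * W * (K_eps * sqrt (real n * l * phibar)) = (2 * K_eps * sqrt phibar) * W * sqrt (real n * l)"
        by (simp add: real_sqrt_mult mult_ac)
      also have "\<dots> \<le> K * W * sqrt (real n * l)" using K(2) W nl by (intro mult_right_mono) auto
      also have "\<dots> \<le> la" by (rule la)
      finally have "K_eps * sqrt (real n * l * phibar) / la \<le> 1 / (2 * W)" using la0 W by (simp add: field_simps)
      then have "S * (K_eps * sqrt (real n * l * phibar) / la) \<le> S * (1 / (2 * W))" using S0 by (intro mult_left_mono)
      then show "S * K_eps * (sqrt (real n * l * phibar) / la) \<le> S / (2 * W)" by simp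
    qed
    finally have "S / W \<le> m0 * (real n / la) * t + S / (2 * W)" .
    moreover have "S / W = S / (2 * W) + S / (2 * W)" by simp
    ultimately have "S / (2 * W) \<le> m0 * (real n / la) * t" by linarith
    then have "S \<le> 2 * W * (m0 * (real n / la) * t)" using W by (simp add: field_simps)
    also have "\<dots> = (2 * W * m0 * t * real n) / la" by simp
    also have "\<dots> \<le> (2 * W * m0 * t * real n) / (K * W * sqrt (real n * l))"
      using la(1) W m0 t by (intro divide_left_mono mult_pos_pos[OF la0 KW] mult_nonneg_nonneg) auto
    \<comment> \<open>Twice the 8 in t gives the 16, and sqrt (n log(n \<or> p)) cancels against the
      lower bound for the penalty level.\<close>
    also have "\<dots> = sqrt (real s) * (16 * m0 * W / (sf * K0)) * ((1 + c0) * A * K' / K)"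
    proof -
      have e: "sqrt (real s * l / real n) * real n = sqrt (real s) * sqrt (real n * l)"
      proof -
        have "sqrt (real s * l / real n) * real n = sqrt (real s * l / real n) * sqrt (real n * real n)" by simp
        also have "\<dots> = sqrt (real s * l / real n * (real n * real n))" by (simp only: real_sqrt_mult)
        also have "real s * l / real n * (real n * real n) = real s * (real n * l)" using n1 by simp
        finally show ?thesis by (simp only: real_sqrt_mult)
      qed
      have "2 * W * m0 * t * real n = 2 * W * m0 * (8 * (1 + c0) * A * K' * W * (sqrt (real s * l / real n) * real n) / (sf * K0))"
        by (simp add: t_def)
      also have "\<dots> = (K * W * sqrt (real n * l)) * (sqrt (real s) * (16 * m0 * W / (sf * K0)) * ((1 + c0) * A * K' / K))"
        unfolding e using K0' by simp
      finally have *: "2 * W * m0 * t * real n = (K * W * sqrt (real n * l)) * (sqrt (real s) * (16 * m0 * W / (sf * K0)) * ((1 + c0) * A * K' / K))" .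
      show ?thesis unfolding * by (rule nonzero_mult_div_cancel_left[OF less_imp_neq[OF KW, symmetric]])
    qed
    finally have "S\<^sup>2 \<le> (sqrt (real s) * (16 * m0 * W / (sf * K0)) * ((1 + c0) * A * K' / K))\<^sup>2"
      using S0 by (intro power_mono)
    then show ?thesis unfolding power_mult_distrib S_def m0_def by simp
  qed
  show ?thesis
    unfolding with_prob_at_least_def
  proof (intro bexI[of _ G] conjI ballI G)
    \<comment> \<open>The events account for 2 \<gamma>, which is within the 4 \<gamma> of the claim
      as \<gamma> \<ge> 0.\<close>
    show "1 - \<alpha> - 2 * \<epsilon> - 4 * \<gamma> - real p powr (- (A\<^sup>2)) \<le> measure M G"
      using Gp \<gamma>0 unfolding \<pi>_def by linarith
  qed (use main in \<open>simp only: k_def l_def W_def sf_def K0_def\<close>)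
qed

end

theorem theorem3:
  fixes Q :: "nat \<Rightarrow> 'w qr_model"
    and U :: "real set"
    and s :: "nat \<Rightarrow> nat"
    and flow L \<gamma> :: "nat \<Rightarrow> real"
    and lam :: "nat \<Rightarrow> (nat \<Rightarrow> nat \<Rightarrow> real) \<Rightarrow> real"
    and bhat :: "nat \<Rightarrow> 'w \<Rightarrow> real \<Rightarrow> nat \<Rightarrow> real"
    and m :: nat
    and fbar fbar' C_L C_f c0 \<epsilon> \<alpha> A K K' K_eps phibar :: real
  assumes U: "compact U" "U \<noteq> {}" "U \<subseteq> {0<..<1}"
    and n: "\<And>n. n \<ge> 3 \<Longrightarrow> nobs (Q n) = n"
    and s: "\<And>n. n \<ge> 3 \<Longrightarrow> real (s n) \<le> real n / lognp (Q n)"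
    and D1: "\<And>n. n \<ge> 3 \<Longrightarrow> cond_D1 (Q n) U (flow n) fbar fbar'"
    and D2: "\<And>n. n \<ge> 3 \<Longrightarrow> cond_D2 (Q n) U (s n) (L n) C_L"
    and D3: "\<And>n. n \<ge> 3 \<Longrightarrow> cond_D3 (Q n) (\<gamma> n)" "\<gamma> \<longlonglongrightarrow> 0"
    and D4: "\<And>n. n \<ge> 3 \<Longrightarrow> cond_D4 (Q n) U (flow n) fbar' m c0 C_f"
    and bhat: "\<And>n \<omega> u. n \<ge> 3 \<Longrightarrow> \<omega> \<in> space (pspace (Q n)) \<Longrightarrow> u \<in> U \<Longrightarrow>
      is_l1_qr n (dim (Q n)) (design (Q n) \<omega>) (\<lambda>i. resp (Q n) i \<omega>)
        (lam n (design (Q n) \<omega>)) u (bhat n \<omega> u)"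
    and eps: "\<epsilon> > 0"
    and alpha: "0 < \<alpha>" "\<alpha> < 1"
    and phibar: "\<And>n. n \<ge> 3 \<Longrightarrow> with_prob_at_least (pspace (Q n)) (1 - \<epsilon>)
      (\<lambda>\<omega>. phi (Q n) \<omega> (real n / lognp (Q n)) \<le> phibar)"
    and K_eps: "K_eps \<ge> sqrt 2"
      "\<And>n. n \<ge> 3 \<Longrightarrow> with_prob_at_least (pspace (Q n)) (1 - \<epsilon> - \<gamma> n)
        (\<lambda>\<omega>. sparsity_ineq (Q n) U (flow n) fbar K_eps
               (lam n (design (Q n) \<omega>)) (bhat n \<omega>) \<omega>)"
    and lam_ge: "\<And>n \<omega>. n \<ge> 3 \<Longrightarrow> \<omega> \<in> space (pspace (Q n)) \<Longrightarrow>
      lam n (design (Q n) \<omega>)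
        \<ge> (c0 + 3) / (c0 - 3) * Lam_quantile U n (dim (Q n)) (design (Q n) \<omega>) (1 - \<alpha>)"
    and lam_bounds: "\<And>n \<omega>. n \<ge> 3 \<Longrightarrow> \<omega> \<in> space (pspace (Q n)) \<Longrightarrow>
      K * W_U U * sqrt (real n * lognp (Q n)) \<le> lam n (design (Q n) \<omega>) \<and>
      lam n (design (Q n) \<omega>) \<le> K' * W_U U * sqrt (real n * lognp (Q n))"
    and K: "K' \<ge> K" "K \<ge> 2 * K_eps * sqrt phibar"
    and A: "A > 1"
  shows "\<forall>n\<ge>3.
    2 * K' * (1 + c0) * A * W_U U * sqrt (real (s n) * lognp (Q n))
      < nonlin_q (Q n) U c0 (flow n) fbar' * sqrt (flow n) * kappa (Q n) U c0 0 * sqrt (real n)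
    \<longrightarrow> with_prob_at_least (pspace (Q n))
          (1 - \<alpha> - 2 * \<epsilon> - 4 * \<gamma> n - real (dim (Q n)) powr (- (A\<^sup>2)))
          (\<lambda>\<omega>. real (s_hat (Q n) U (bhat n \<omega>))
             \<le> real (s n)
               * (16 * mu (Q n) (flow n) fbar (real n / lognp (Q n)) * W_U U
                    / (sqrt (flow n) * kappa (Q n) U c0 0))\<^sup>2
               * ((1 + c0) * A * K' / K)\<^sup>2)"
proof (intro allI impI)
  fix N :: nat
  assume N3: "3 \<le> N" and growth: "2 * K' * (1 + c0) * A * W_U U * sqrt (real (s N) * lognp (Q N))
      < nonlin_q (Q N) U c0 (flow N) fbar' * sqrt (flow N) * kappa (Q N) U c0 0 * sqrt (real N)"
  have nn: "nobs (Q N) = N" by (rule n[OF N3])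
  interpret qr_conditions "Q N" U "s N" "flow N" "L N" fbar fbar' C_L "\<gamma> N" c0 C_f m
    by unfold_locales (rule U D1[OF N3] D2[OF N3] D3(1)[OF N3] D4[OF N3])+
  show "with_prob_at_least (pspace (Q N))
          (1 - \<alpha> - 2 * \<epsilon> - 4 * \<gamma> N - real (dim (Q N)) powr (- (A\<^sup>2)))
          (\<lambda>\<omega>. real (s_hat (Q N) U (bhat N \<omega>))
             \<le> real (s N)
               * (16 * mu (Q N) (flow N) fbar (real N / lognp (Q N)) * W_U U
                    / (sqrt (flow N) * kappa (Q N) U c0 0))\<^sup>2
               * ((1 + c0) * A * K' / K)\<^sup>2)"
    using sparsity_bound[of "lam N" "bhat N" \<alpha> \<epsilon> phibar K_eps K K' A, unfolded nn,
        OF s[OF N3] bhat[OF N3, unfolded is_l1_qr_def, THEN conjunct1] alpha eps phibar[OF N3] K_eps(1) K_eps(2)[OF N3]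
          lam_ge[OF N3] lam_bounds[OF N3] K A growth] .
qed

end
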